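(* Let $q>0$. Consider the linear delay equation $x'(t)=L(t)x_t$ and the perturbed equation $x'(t)=L(t)x_t+g(t,x_t)$, with the standing assumptions and notation of the context. Assume: (1) The linear equation has a nonuniform $\mu$-dichotomy on $\mathbb{R}$ with constants $K\ge 1$, $\alpha,\beta>0$, $\theta,\nu\ge 0$, $\alpha>\theta$, $\beta>\nu$, where $\mu$ is a differentiable growth rate for which there is $N=N(r)>1$ with $\mu(s+r)/\mu(s)\le N$ for all $s\in\mathbb{R}$; the operators $T_0(t,s)$ have nonuniform $\mu$-bounded growth with constants $\tilde K\ge 1$, $a\ge 0$, $\varepsilon>0$; and $\theta\ge\varepsilon+\nu$, $\alpha>\theta+\varepsilon$, $\beta>\nu+\varepsilon$. (2) $g$ is a $C^1$ function with $D_2g(t,0)=0$ for all $t\in\mathbb{R}$. (3) There are constants $\delta>0$, $\gamma>\max\{\theta,\nu\}$, $\lambda>0$ and $\xi$ with $$\max\{\nu+\varepsilon,\ |a-\beta|+\varepsilon\}<\xi<\frac{\alpha+\beta}{2}$$ such that for every $t\in\mathbb{R}$ and $\phi,\psi\in C$, $$|g(t,\phi)-g(t,\psi)|\le \delta\min\{1,\|\phi-\psi\|_\mu\}\,\mu'(t)\,\mu(t)^{-\mathrm{sgn}(t)(\gamma+\varepsilon)-1},$$ $$|D_2g(t,\phi)-D_2g(t,\psi)|\le \lambda\min\{1,\|\phi-\psi\|_\mu\}\,\mu'(t)\,\mu(t)^{-\mathrm{sgn}(t)(\gamma+\varepsilon)-2\,\mathrm{sgn}(t)\xi-1},$$ where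 $\|\phi-\psi\|_\mu:=\|\phi-\psi\|\,\mu(t)^{-\mathrm{sgn}(t)(\xi+\varepsilon)}$. (4) With $D$ the constant described in the context, $$\delta\le\frac{q\alpha\beta}{D(\alpha+\beta)(1+q)^2},$$ $$\lambda\le\frac{q^2(\alpha+\beta-2\xi)\left[(\xi-\varepsilon)^2-(a-\beta)^2\right]}{D\left[D\left((\xi-\varepsilon)^2-(a-\beta)^2\right)+4\xi\tilde K(\alpha+\beta-2\xi)\right](1+q)^3}.$$ Then there exists a unique $\eta\in\mathcal{M}$ such that the maps $h^t=\mathrm{Id}_{U(t)}+\eta^t$, where $\eta^t=\eta(t,\cdot)$, satisfy $$h^t\circ T(t,s)=R(t,s)\circ h^s\quad\text{on }U(s)$$ for every $t,s\in\mathbb{R}$ with $t\ge s$. Moreover, each map $h^t$ is a $C^1$-diffeomorphism (from $U(t)$ onto its image in $C$).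
   Context: Phase space and linear equation. Fix $r>0$, and let $C=C([-r,0],\mathbb{R}^n)$ with the supremum norm $\|\cdot\|$. For a function $x$ put $x_t(\omega)=x(t+\omega)$, $\omega\in[-r,0]$. For each $t\in\mathbb{R}$, $L(t):C\to\mathbb{R}^n$ is a continuous linear operator, written as a Riemann–Stieltjes integral $L(t)\phi=\int_{-r}^0 d\zeta(t,\omega)\phi(\omega)$, where $\zeta$ is an $n\times n$ matrix function measurable in $(t,\omega)$, of bounded variation in $\omega\in[-r,0]$ for each $t$, with $\zeta(t,\omega)=0$ for $\omega\ge0$, $\zeta(t,\omega)=\zeta(t,-r)$ for $\omega\le -r$, left-continuous in $\omega\in(-r,0)$, and $\mathrm{Var}_{[-r,0]}\zeta(t,\cdot)\le m(t)$ for some $m\in L^1_{loc}(\mathbb{R})$. A solution of $x'(t)=L(t)x_t$, $x_s=\phi$, is a continuous function on $[s-r,\infty)$, absolutely continuous on $[s,\infty)$, satisfying the equation for almost every $t\ge s$; it exists and is unique for $\phi\in C$. For $t\ge s$, $T(t,s):C\to C$ is $T(t,s)\phi=x_t$. Let $C_0$ be the Banach space (supremum norm) of functions $\phi:[-r,0]\to\mathbb{R}^n$ that are continuous on $[-r,0)$ and have a limit as $\omega\to0^-$. $L(t)$ extends to $C_0$ by the same integral, and $T_0(t,s):C_0\to C_0$, $t\ge s$, is $T_0(t,s)\phi=x_t$ with $x$ the unique solution of the linear equation with $x_s=\phi\in C_0$. $X_0:\mathbb{R}^n\to C_0$ is given by $(X_0p)(\omega)=0$ for $\omega\in[-r,0)$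 and $(X_0p)(0)=p$. Growth rates. A growth rate is a strictly increasing $\mu:\mathbb{R}\to(0,\infty)$ with $\mu(0)=1$, $\mu(t)\to\infty$ as $t\to\infty$, $\mu(t)\to0$ as $t\to-\infty$; it is a differentiable growth rate if it is differentiable. Nonuniform $\mu$-dichotomy on an interval $J$ with constants $K\ge1$, $\alpha,\beta>0$, $\theta,\nu\ge0$, $\alpha>\theta$, $\beta>\nu$: there are strongly continuous projections $P(s)$, $Q(s)=I-P(s)$ on $C$, $s\in J$, such that (i) $T(t,s)P(s)=P(t)T(t,s)$ for $t\ge s$ in $J$; (ii) for $t\ge s$ in $J$, $\overline T(t,s):=T(t,s)|_{\mathcal{R}Q(s)}$ is an isomorphism of the range $\mathcal{R}Q(s)$ onto $\mathcal{R}Q(t)$, and $\overline T(s,t):\mathcal{R}Q(t)\to\mathcal{R}Q(s)$ denotes its inverse; (iii) $\|T(t,s)P(s)\|\le K(\mu(t)/\mu(s))^{-\alpha}\mu(s)^{\mathrm{sgn}(s)\theta}$ for $t\ge s$ in $J$; (iv) $\|\overline T(t,s)Q(s)\|\le K(\mu(t)/\mu(s))^{\beta}\mu(s)^{\mathrm{sgn}(s)\nu}$ for $t\le s$ in $J$. The unstable space at time $t$ is $U(t)=\mathcal{R}Q(t)$. Nonuniform $\mu$-bounded growth with constants $\tilde K\ge1$, $a\ge0$, $\varepsilon>0$: $\|T_0(t,s)\|\le\tilde K(\mu(t)/\mu(s))^{a}\mu(s)^{\mathrm{sgn}(s)\varepsilon}$ for all $t\ge s$. Extended projections. $Q_0(t)=\overline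 T(t,t+r)Q(t+r)T_0(t+r,t)X_0$ and $P_0(t)=X_0-Q_0(t)$, linear operators $\mathbb{R}^n\to C_0$. $D>0$ denotes a constant for which, on $\mathbb{R}$, $\|T_0(t,s)P_0(s)\|\le D(\mu(t)/\mu(s))^{-\alpha}\mu(s)^{\mathrm{sgn}(s)(\theta+\varepsilon)}$ for $t\ge s$ and $\|\overline T(t,s)Q_0(s)\|\le D(\mu(t)/\mu(s))^{\beta}\mu(s)^{\mathrm{sgn}(s)(\nu+\varepsilon)}$ for $t\le s$ (such a constant exists under hypothesis (1)). Perturbed equation. $g:\mathbb{R}\times C\to\mathbb{R}^n$ is continuous, $g(t,0)=0$ for all $t$, and $g$ is Lipschitz in the second variable. For $t\ge s$, $R(t,s):C\to C$ is defined by $R(t,s)(x_s)=x_t$ for solutions $x$ of $x'(t)=L(t)x_t+g(t,x_t)$. $D_2g$ is the derivative of $g$ in its second variable. Function space. $\mathcal{M}$ is the set of all bounded continuous functions $\eta:\{(t,b):t\in\mathbb{R},\,b\in U(t)\}\to C$, with norm $\|\eta\|_\infty=\sup\{\|\eta(t,b)\|:t\in\mathbb{R},\,b\in U(t)\}$. *)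

theory Defs
  imports "HOL-Analysis.Analysis"
begin

section \<open>Phase spaces\<close>

text \<open>
  A function on \<open>[-r, 0]\<close> is represented by its extension to the real line that is constant
  on \<open>(-\<infinity>, -r]\<close> and on \<open>[0, \<infinity>)\<close> (the library's \<^const>\<open>ext_cont\<close>). With this convention \<open>C([-r, 0], \<real>\<^sup>n)\<close>
  is a closed linear subspace of the Banach space of bounded continuous functions, the norm
  of the latter restricts to the supremum norm over \<open>[-r, 0]\<close>, and composition
  with \<^const>\<open>clamp\<close> is a bounded linear retraction onto the subspace. So a bounded linear map on the
  subspace always extends to the whole type, and \<^const>\<open>has_derivative\<close> relative to the filter
  \<open>at \<phi> within C r\<close> is exactly Frechet differentiability on \<open>C([-r, 0], \<real>\<^sup>n)\<close>; the derivative is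
  determined on the subspace only.
\<close>

type_synonym 'n curve = "real \<Rightarrow> real ^ 'n"
type_synonym 'n phase = "real \<Rightarrow>\<^sub>C (real ^ 'n)"

definition C :: "real \<Rightarrow> ('n::finite) phase set" where
  "C r = {\<phi>. ext_cont (apply_bcontfun \<phi>) (- r) 0 = apply_bcontfun \<phi>}"

definition C0 :: "real \<Rightarrow> ('n::finite) curve set" where
  "C0 r = {\<phi>. ext_cont \<phi> (- r) 0 = \<phi> \<and> continuous_on {- r..<0} \<phi> \<and>
              (\<exists>l. (\<phi> \<longlongrightarrow> l) (at_left 0))}"

definition sup_norm :: "real \<Rightarrow> ('n::finite) curve \<Rightarrow> real" where
  "sup_norm r \<phi> = (SUP \<omega>\<in>{- r..0}. norm (\<phi> \<omega>))"

definition segment :: "real \<Rightarrow> ('n::finite) curve \<Rightarrow> real \<Rightarrow> 'n curve" where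
  "segment r x t = ext_cont (\<lambda>\<omega>. x (t + \<omega>)) (- r) 0"


section \<open>The linear equation\<close>

text \<open>
  The Stieltjes integral is taken in the gauge (Kurzweil) sense. For continuous \<open>\<phi>\<close> and an
  integrator of bounded variation it is the Riemann-Stieltjes integral. The gauge version is
  needed for the extension to \<open>C0\<close>: \<open>\<phi>\<close> and the integrator may both jump from the left at \<open>0\<close>, and then
  Riemann-Stieltjes sums need not converge, whereas a gauge forces the tag \<open>0\<close> and gives the
  jump of the integrator at \<open>0\<close> the weight \<open>\<phi> 0\<close>, as for the Lebesgue-Stieltjes integral. It also
  covers segments of solutions started in \<open>C0\<close>, which may jump at one interior point.
\<close>

definition has_stieltjes_integral ::
    "(real \<Rightarrow> real ^ 'n ^ 'n) \<Rightarrow> ('n::finite) curve \<Rightarrow> real ^ 'n \<Rightarrow> real \<Rightarrow> real \<Rightarrow> bool" where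
  "has_stieltjes_integral Z \<phi> I a b \<longleftrightarrow>
     (\<forall>e>0. \<exists>\<gamma>. gauge \<gamma> \<and>
        (\<forall>p. p tagged_division_of {a..b} \<and> \<gamma> fine p \<longrightarrow>
           norm ((\<Sum>(\<omega>, k)\<in>p. (Z (Sup k) - Z (Inf k)) *v \<phi> \<omega>) - I) < e))"

definition L ::
    "real \<Rightarrow> (real \<Rightarrow> real \<Rightarrow> real ^ 'n ^ 'n) \<Rightarrow> real \<Rightarrow> ('n::finite) curve \<Rightarrow> real ^ 'n" where
  "L r \<zeta> t \<phi> = (THE I. has_stieltjes_integral (\<zeta> t) \<phi> I (- r) 0)"

definition variation_le :: "(real \<Rightarrow> 'a::real_normed_vector) \<Rightarrow> real \<Rightarrow> real \<Rightarrow> real \<Rightarrow> bool" where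
  "variation_le f a b V \<longleftrightarrow>
     (\<forall>d. d division_of {a..b} \<longrightarrow> (\<Sum>k\<in>d. norm (f (Sup k) - f (Inf k))) \<le> V)"

definition delay_kernel :: "real \<Rightarrow> (real \<Rightarrow> real \<Rightarrow> real ^ ('n::finite) ^ 'n) \<Rightarrow> bool" where
  "delay_kernel r \<zeta> \<longleftrightarrow>
     (\<lambda>(t, \<omega>). \<zeta> t \<omega>) \<in> borel_measurable lebesgue \<and>
     (\<forall>t. \<forall>\<omega>\<ge>0. \<zeta> t \<omega> = 0) \<and>
     (\<forall>t. \<forall>\<omega>\<le>- r. \<zeta> t \<omega> = \<zeta> t (- r)) \<and>
     (\<forall>t. \<forall>\<omega>\<in>{- r<..<0}. continuous (at_left \<omega>) (\<zeta> t)) \<and>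
     (\<exists>m. (\<forall>a b. m absolutely_integrable_on {a..b}) \<and>
          (\<forall>t. variation_le (\<zeta> t) (- r) 0 (m t)))"


section \<open>Solutions and evolution maps\<close>

definition abs_cont_on :: "real \<Rightarrow> real \<Rightarrow> (real \<Rightarrow> 'a::real_normed_vector) \<Rightarrow> bool" where
  "abs_cont_on a b x \<longleftrightarrow>
     (\<forall>e>0. \<exists>\<delta>>0. \<forall>d k. d division_of k \<and> k \<subseteq> {a..b} \<and> (\<Sum>i\<in>d. Sup i - Inf i) < \<delta> \<longrightarrow>
        (\<Sum>i\<in>d. norm (x (Sup i) - x (Inf i))) < e)"

text \<open>
  A solution of \<open>x'(t) = F t x\<^sub>t\<close>, \<open>x\<^sub>s = \<phi>\<close> on \<open>[s - r, \<infinity>)\<close>; its values to the left of \<open>s - r\<close> are irrelevant.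
  Absolute continuity on \<open>[s, \<infinity>)\<close> is meant on compact subintervals. For \<open>\<phi>\<close> in \<open>C\<close>, continuity
  on \<open>[s - r, \<infinity>)\<close> is a consequence.
\<close>

definition solution ::
    "real \<Rightarrow> (real \<Rightarrow> ('n::finite) curve \<Rightarrow> real ^ 'n) \<Rightarrow> real \<Rightarrow> 'n curve \<Rightarrow> 'n curve \<Rightarrow> bool" where
  "solution r F s \<phi> x \<longleftrightarrow>
     (\<forall>\<omega>\<in>{- r..0}. x (s + \<omega>) = \<phi> \<omega>) \<and>
     (\<forall>b. abs_cont_on s b x) \<and>
     (AE t in lborel. s \<le> t \<longrightarrow> (x has_vector_derivative F t (segment r x t)) (at t))"

definition evolution ::
    "real \<Rightarrow> (real \<Rightarrow> ('n::finite) curve \<Rightarrow> real ^ 'n) \<Rightarrow> real \<Rightarrow> real \<Rightarrow> 'n curve \<Rightarrow> 'n curve" where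
  "evolution r F t s \<phi> = (THE \<psi>. \<exists>x. solution r F s \<phi> x \<and> \<psi> = segment r x t)"

definition T0 ::
    "real \<Rightarrow> (real \<Rightarrow> real \<Rightarrow> real ^ 'n ^ 'n) \<Rightarrow> real \<Rightarrow> real \<Rightarrow> ('n::finite) curve \<Rightarrow> 'n curve" where
  "T0 r \<zeta> t s = evolution r (L r \<zeta>) t s"

definition T ::
    "real \<Rightarrow> (real \<Rightarrow> real \<Rightarrow> real ^ 'n ^ 'n) \<Rightarrow> real \<Rightarrow> real \<Rightarrow> ('n::finite) phase \<Rightarrow> 'n phase" where
  "T r \<zeta> t s \<phi> = Bcontfun (evolution r (L r \<zeta>) t s (apply_bcontfun \<phi>))"

definition R ::
    "real \<Rightarrow> (real \<Rightarrow> real \<Rightarrow> real ^ 'n ^ 'n) \<Rightarrow> (real \<Rightarrow> 'n phase \<Rightarrow> real ^ 'n) \<Rightarrow>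
     real \<Rightarrow> real \<Rightarrow> ('n::finite) phase \<Rightarrow> 'n phase" where
  "R r \<zeta> g t s \<phi> =
     Bcontfun (evolution r (\<lambda>\<tau> \<psi>. L r \<zeta> \<tau> \<psi> + g \<tau> (Bcontfun \<psi>)) t s (apply_bcontfun \<phi>))"

definition X0 :: "real ^ ('n::finite) \<Rightarrow> 'n curve" where
  "X0 p = (\<lambda>\<omega>. if \<omega> < 0 then 0 else p)"


section \<open>Growth rates and dichotomies\<close>

definition growth_rate :: "(real \<Rightarrow> real) \<Rightarrow> bool" where
  "growth_rate \<mu> \<longleftrightarrow>
     strict_mono \<mu> \<and> (\<forall>t. 0 < \<mu> t) \<and> \<mu> 0 = 1 \<and>
     filterlim \<mu> at_top at_top \<and> (\<mu> \<longlongrightarrow> 0) at_bot"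

definition differentiable_growth_rate :: "(real \<Rightarrow> real) \<Rightarrow> bool" where
  "differentiable_growth_rate \<mu> \<longleftrightarrow> growth_rate \<mu> \<and> (\<forall>t. \<mu> differentiable (at t))"

definition bounded_projection_on :: "'a::real_normed_vector set \<Rightarrow> ('a \<Rightarrow> 'a) \<Rightarrow> bool" where
  "bounded_projection_on E p \<longleftrightarrow>
     p ` E \<subseteq> E \<and>
     (\<forall>\<phi>\<in>E. \<forall>\<psi>\<in>E. p (\<phi> + \<psi>) = p \<phi> + p \<psi>) \<and>
     (\<forall>c. \<forall>\<phi>\<in>E. p (c *\<^sub>R \<phi>) = c *\<^sub>R p \<phi>) \<and>
     (\<forall>\<phi>\<in>E. p (p \<phi>) = p \<phi>) \<and>
     (\<exists>B. \<forall>\<phi>\<in>E. norm (p \<phi>) \<le> B * norm \<phi>)"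

definition Q :: "(real \<Rightarrow> 'n phase \<Rightarrow> 'n phase) \<Rightarrow> real \<Rightarrow> ('n::finite) phase \<Rightarrow> 'n phase" where
  "Q P s \<phi> = \<phi> - P s \<phi>"

definition U :: "real \<Rightarrow> (real \<Rightarrow> 'n phase \<Rightarrow> 'n phase) \<Rightarrow> real \<Rightarrow> ('n::finite) phase set" where
  "U r P s = Q P s ` C r"

definition Tbar ::
    "real \<Rightarrow> (real \<Rightarrow> real \<Rightarrow> real ^ 'n ^ 'n) \<Rightarrow> (real \<Rightarrow> 'n phase \<Rightarrow> 'n phase) \<Rightarrow>
     real \<Rightarrow> real \<Rightarrow> ('n::finite) phase \<Rightarrow> 'n phase" where
  "Tbar r \<zeta> P t s = (if s \<le> t then T r \<zeta> t s else inv_into (U r P t) (T r \<zeta> s t))"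

definition dichotomy ::
    "real \<Rightarrow> (real \<Rightarrow> real \<Rightarrow> real ^ 'n ^ 'n) \<Rightarrow> (real \<Rightarrow> real) \<Rightarrow>
     (real \<Rightarrow> ('n::finite) phase \<Rightarrow> 'n phase) \<Rightarrow> real set \<Rightarrow>
     real \<Rightarrow> real \<Rightarrow> real \<Rightarrow> real \<Rightarrow> real \<Rightarrow> bool" where
  "dichotomy r \<zeta> \<mu> P J K \<alpha> \<beta> \<theta> \<nu> \<longleftrightarrow>
     (\<forall>s\<in>J. bounded_projection_on (C r) (P s)) \<and>
     (\<forall>\<phi>\<in>C r. continuous_on J (\<lambda>s. P s \<phi>)) \<and>
     (\<forall>t\<in>J. \<forall>s\<in>J. s \<le> t \<longrightarrow>
        (\<forall>\<phi>\<in>C r. T r \<zeta> t s (P s \<phi>) = P t (T r \<zeta> t s \<phi>))) \<and>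
     (\<forall>t\<in>J. \<forall>s\<in>J. s \<le> t \<longrightarrow>
        bij_betw (T r \<zeta> t s) (U r P s) (U r P t) \<and>
        continuous_on (U r P s) (T r \<zeta> t s) \<and>
        continuous_on (U r P t) (inv_into (U r P s) (T r \<zeta> t s))) \<and>
     (\<forall>t\<in>J. \<forall>s\<in>J. s \<le> t \<longrightarrow>
        (\<forall>\<phi>\<in>C r. norm (T r \<zeta> t s (P s \<phi>)) \<le>
           K * (\<mu> t / \<mu> s) powr (- \<alpha>) * \<mu> s powr (sgn s * \<theta>) * norm \<phi>)) \<and>
     (\<forall>t\<in>J. \<forall>s\<in>J. t \<le> s \<longrightarrow>
        (\<forall>\<phi>\<in>C r. norm (Tbar r \<zeta> P t s (Q P s \<phi>)) \<le>
           K * (\<mu> t / \<mu> s) powr \<beta> * \<mu> s powr (sgn s * \<nu>) * norm \<phi>))"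

definition bounded_growth ::
    "real \<Rightarrow> (real \<Rightarrow> real \<Rightarrow> real ^ ('n::finite) ^ 'n) \<Rightarrow> (real \<Rightarrow> real) \<Rightarrow>
     real \<Rightarrow> real \<Rightarrow> real \<Rightarrow> bool" where
  "bounded_growth r \<zeta> \<mu> Kt a \<epsilon> \<longleftrightarrow>
     (\<forall>t s. s \<le> t \<longrightarrow>
        (\<forall>\<phi>\<in>C0 r. sup_norm r (T0 r \<zeta> t s \<phi>) \<le>
           Kt * (\<mu> t / \<mu> s) powr a * \<mu> s powr (sgn s * \<epsilon>) * sup_norm r \<phi>))"

definition Q0 ::
    "real \<Rightarrow> (real \<Rightarrow> real \<Rightarrow> real ^ 'n ^ 'n) \<Rightarrow> (real \<Rightarrow> 'n phase \<Rightarrow> 'n phase) \<Rightarrow>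
     real \<Rightarrow> real ^ ('n::finite) \<Rightarrow> 'n phase" where
  "Q0 r \<zeta> P t p = Tbar r \<zeta> P t (t + r) (Q P (t + r) (Bcontfun (T0 r \<zeta> (t + r) t (X0 p))))"

definition P0 ::
    "real \<Rightarrow> (real \<Rightarrow> real \<Rightarrow> real ^ 'n ^ 'n) \<Rightarrow> (real \<Rightarrow> 'n phase \<Rightarrow> 'n phase) \<Rightarrow>
     real \<Rightarrow> real ^ ('n::finite) \<Rightarrow> 'n curve" where
  "P0 r \<zeta> P t p = (\<lambda>\<omega>. X0 p \<omega> - apply_bcontfun (Q0 r \<zeta> P t p) \<omega>)"

definition extended_bounds ::
    "real \<Rightarrow> (real \<Rightarrow> real \<Rightarrow> real ^ 'n ^ 'n) \<Rightarrow> (real \<Rightarrow> real) \<Rightarrow>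
     (real \<Rightarrow> ('n::finite) phase \<Rightarrow> 'n phase) \<Rightarrow>
     real \<Rightarrow> real \<Rightarrow> real \<Rightarrow> real \<Rightarrow> real \<Rightarrow> real \<Rightarrow> bool" where
  "extended_bounds r \<zeta> \<mu> P D \<alpha> \<beta> \<theta> \<nu> \<epsilon> \<longleftrightarrow>
     (\<forall>t s. s \<le> t \<longrightarrow>
        (\<forall>p. sup_norm r (T0 r \<zeta> t s (P0 r \<zeta> P s p)) \<le>
           D * (\<mu> t / \<mu> s) powr (- \<alpha>) * \<mu> s powr (sgn s * (\<theta> + \<epsilon>)) * norm p)) \<and>
     (\<forall>t s. t \<le> s \<longrightarrow>
        (\<forall>p. norm (Tbar r \<zeta> P t s (Q0 r \<zeta> P s p)) \<le>
           D * (\<mu> t / \<mu> s) powr \<beta> * \<mu> s powr (sgn s * (\<nu> + \<epsilon>)) * norm p))"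


section \<open>Smooth maps\<close>

text \<open>
  \<open>E\<close> is a linear subspace (a Banach space in its own right) and \<open>V\<close> a relatively open subset.
  The last conjunct is continuity of the derivative in the operator norm over \<open>E\<close>.
\<close>

definition C1_on ::
    "'a::real_normed_vector set \<Rightarrow> 'a set \<Rightarrow> ('a \<Rightarrow> 'b::real_normed_vector) \<Rightarrow> bool" where
  "C1_on E V f \<longleftrightarrow>
     (\<exists>f'. (\<forall>x\<in>V. (f has_derivative f' x) (at x within E)) \<and>
           (\<forall>x\<in>V. \<forall>e>0. \<exists>d>0. \<forall>y\<in>V. dist y x < d \<longrightarrow>
              (\<forall>v\<in>E. norm (f' y v - f' x v) \<le> e * norm v)))"

text \<open>
  A \<open>C\<^sup>1\<close> diffeomorphism from the Banach space \<open>W\<close> onto its image in the Banach space \<open>E\<close>. As the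
  image is in general not open in \<open>E\<close>, the inverse being \<open>C\<^sup>1\<close> has the usual meaning: locally it is
  the restriction of a \<open>C\<^sup>1\<close> map defined on an open subset of \<open>E\<close>.
\<close>

definition C1_diffeo_onto_image ::
    "'a::real_normed_vector set \<Rightarrow> 'a set \<Rightarrow> ('a \<Rightarrow> 'a) \<Rightarrow> bool" where
  "C1_diffeo_onto_image E W h \<longleftrightarrow>
     h ` W \<subseteq> E \<and> inj_on h W \<and> C1_on W W h \<and>
     (\<forall>y\<in>h ` W. \<exists>V k. openin (top_of_set E) V \<and> y \<in> V \<and> k ` V \<subseteq> W \<and> C1_on E V k \<and>
        (\<forall>z\<in>V \<inter> h ` W. k z = the_inv_into W h z))"


section \<open>The function space of the conjugacies\<close>

text \<open>Maps are extensional, so that equality is equality on the domain.\<close>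

definition M :: "real \<Rightarrow> (real \<Rightarrow> 'n phase \<Rightarrow> 'n phase) \<Rightarrow> (real \<times> ('n::finite) phase \<Rightarrow> 'n phase) set" where
  "M r P = {\<eta> \<in> Sigma UNIV (U r P) \<rightarrow>\<^sub>E C r.
              continuous_on (Sigma UNIV (U r P)) \<eta> \<and> bounded (\<eta> ` Sigma UNIV (U r P))}"

definition conjugates ::
    "real \<Rightarrow> (real \<Rightarrow> real \<Rightarrow> real ^ 'n ^ 'n) \<Rightarrow> (real \<Rightarrow> 'n phase \<Rightarrow> real ^ 'n) \<Rightarrow>
     (real \<Rightarrow> 'n phase \<Rightarrow> 'n phase) \<Rightarrow> (real \<Rightarrow> ('n::finite) phase \<Rightarrow> 'n phase) \<Rightarrow> bool" where
  "conjugates r \<zeta> g P h \<longleftrightarrow>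
     (\<forall>t s. s \<le> t \<longrightarrow> (\<forall>b\<in>U r P s. h t (T r \<zeta> t s b) = R r \<zeta> g t s (h s b)))"

end

theory Submission
 imports Defs
begin

text \<open>
  The conjugacy is found orbit by orbit. A point \<open>b\<close> of the unstable space at time \<open>s\<close> lies on a full
  orbit \<open>X t = Tbar t s b\<close> of the linear equation. If \<open>h = Id + \<eta>\<close> is a conjugacy with bounded \<open>\<eta>\<close>, it
  carries \<open>X\<close> to a full orbit \<open>X + z\<close> of the perturbed equation with \<open>z\<close> bounded, and by the
  variation of constants formula \<open>z\<close> is a bounded solution of the linear equation forced by
  \<open>g t (X t + z t)\<close>. The dichotomy leaves exactly one bounded solution \<open>bsol f\<close> for a forcing term
  \<open>f\<close>: its stable part is driven by the past of \<open>f\<close>, its unstable part by the future. So \<open>z\<close> is a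
  fixed point of \<open>z \<mapsto> bsol (\<lambda>t. g t (X t + z t))\<close>. The fixed point is unique, and \<open>\<eta> (s, b) = z s\<close> is
  the only possible choice; as all points of an orbit share the same \<open>X\<close>, this choice is a conjugacy.

  The estimates of \<open>bsol\<close> come from the extended projections. An impulse \<open>p\<close> at time \<open>\<sigma>\<close> adds \<open>X0 p\<close> to
  the state, so the bounds on \<open>P0\<close> and \<open>Q0\<close> are bounds on responses to impulses. A continuous forcing
  term is approximated by impulses at the nodes of a fine grid (\<open>impulse_approximation\<close>), which
  yields \<open>stable_bound\<close> and \<open>unstable_bound\<close>. In the logarithmic time \<open>x = ln \<circ> \<mu>\<close> the kernels are
  exponentials, the Lipschitz constant of \<open>g t\<close> carries a factor \<open>x' t\<close>, and the integrals reduce to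
  the fundamental theorem of calculus. The bound on \<open>\<delta>\<close> enters as
  \<open>D * \<delta> * (1 / \<alpha> + 1 / \<beta>) \<le> q / (1 + q)\<^sup>2 \<le> 1 / 4\<close>.

  Orbits in the unstable spaces grow at most like \<open>\<mu> powr a\<close>. Hence the fixed point depends on \<open>b\<close> in a
  Lipschitz way only with respect to a weight \<open>1 + \<iota> * \<mu> powr e0\<close>, where \<open>a \<le> e0\<close> and a small \<open>\<iota>\<close> keeps
  the contraction constant below one. For the derivative, \<open>min 1 u \<le> u powr p\<close> turns the Lipschitz
  condition on \<open>D2g\<close> into a remainder of order \<open>1 + p\<close>, which is controlled by the weight with exponent
  \<open>e1 = e0 * (1 + p)\<close>. Both weights are admissible when \<open>e1 < \<beta> + \<xi> + \<epsilon>\<close>, and there is room for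
  that because \<open>a < \<beta> + \<xi> + \<epsilon>\<close>. The abstract form of this argument is \<open>observed_force_C1\<close>.

  The inverse of \<open>h\<close> at time \<open>t0\<close> is the restriction of a map defined on the whole phase space. Follow \<open>\<phi>\<close>
  forwards under the perturbed equation, let \<open>f\<close> be the force \<open>g t\<close> along this solution, and map \<open>\<phi>\<close> to
  \<open>Q P t0 \<phi> + unstable_sol f t0\<close>. If \<open>\<phi> = b + z t0\<close>, the solution is \<open>X + z\<close>; since the unstable part of
  \<open>z t0\<close> is \<open>- unstable_sol f t0\<close> and depends only on \<open>f\<close> after \<open>t0\<close>, the result is \<open>b\<close>. The same
  abstract theorem, now for the initial value problem on \<open>[t0, \<infinity>)\<close>, shows that this map is \<open>C\<^sup>1\<close>
  (\<open>smooth_left_inverse\<close>).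
\<close>

section \<open>Absolutely continuous functions and the Lebesgue integral\<close>

lemma division_of_real_interval:
 fixes k :: "real set"
 assumes "d division_of k" "k \<subseteq> {a..b}" "i \<in> d"
 shows "i = {Inf i..Sup i}" "Inf i \<le> Sup i" "a \<le> Inf i" "Sup i \<le> b"
proof -
 obtain u v where uv: "i = cbox u v" using division_ofD(4)[OF assms(1,3)] by blast
 moreover have "i \<noteq> {}" using division_ofD(3)[OF assms(1,3)] .
 ultimately have le: "u \<le> v" by auto
 then have "Inf i = u" "Sup i = v" using uv by auto
 moreover have "i \<subseteq> {a..b}" using division_ofD(2)[OF assms(1,3)] assms(2) by blast
 ultimately show "i = {Inf i..Sup i}" "Inf i \<le> Sup i" "a \<le> Inf i" "Sup i \<le> b"
  using uv le by auto
qed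

text \<open>
  Two tags can share an interval of a tagged division only if it is degenerate, and there \<open>h\<close> vanishes.
\<close>

lemma sum_tagged_division_snd:
 fixes h :: "real set => 'a::comm_monoid_add"
 assumes p: "p tagged_division_of S" and h: "!!u. h {u} = 0"
 shows "(\<Sum>(t, k)\<in>p. h k) = (\<Sum>k\<in>snd ` p. h k)"
proof -
 define h' where "h' k = (if k = {} then 0 else h k)" for k
 have ne: "k \<noteq> {}" if "(t, k) \<in> p" for t k using tagged_division_ofD(2)[OF p that] by auto
 have "(\<Sum>(t, k)\<in>p. h k) = (\<Sum>(t, k)\<in>p. h' k)"
  by (intro sum.cong) (auto simp: h'_def dest: ne)
 also have "\<dots> = (\<Sum>k\<in>snd ` p. h' k)"
 proof (rule sum.over_tagged_division_lemma[OF p])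
  fix u v :: real assume "box u v = {}"
  then have "cbox u v = {} \<or> cbox u v = {u}" by force
  then show "h' (cbox u v) = 0" using h by (auto simp: h'_def)
 qed
 also have "\<dots> = (\<Sum>k\<in>snd ` p. h k)"
  by (intro sum.cong) (auto simp: h'_def dest: ne)
 finally show ?thesis .
qed

lemma sum_integral_division_le:
 fixes h :: "real => real"
 assumes h: "h integrable_on {a..b}" "!!t. t \<in> {a..b} ==> 0 \<le> h t"
  and d: "d division_of k" "k \<subseteq> {a..b}"
 shows "(\<Sum>i\<in>d. integral i h) \<le> integral {a..b} h"
proof -
 have int: "h integrable_on i" if "i \<in> d" for i
  using integrable_on_subinterval[OF h(1)] division_of_real_interval[OF d that] by (metis atLeastatMost_subset_iff)
 have hk: "h integrable_on k" using integrable_combine_division[OF d(1)] int by blast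
 have "(\<Sum>i\<in>d. integral i h) = integral k h"
  using integral_combine_division_bottomup[OF d(1)] int by metis
 also have "\<dots> \<le> integral {a..b} h"
  by (rule integral_subset_le[OF d(2) hk h(1)]) (use h(2) in blast)
 finally show ?thesis .
qed

text \<open>
  Truncating \<open>norm f\<close> at a height \<open>n\<close> leaves an error with small integral, and below the height the integral
  over short intervals is at most \<open>n\<close> times their total length.
\<close>

lemma abs_cont_on_integral:
 fixes f :: "real => 'a::euclidean_space"
 assumes f: "f absolutely_integrable_on {a..b}"
 shows "abs_cont_on a b (\<lambda>t. integral {a..t} f)"
 unfolding abs_cont_on_def
proof (intro allI impI)
 fix e :: real assume e: "e > 0"
 define h where "h = (\<lambda>t. norm (f t))"
 have hai: "h absolutely_integrable_on {a..b}"
  using f unfolding h_def by (rule set_integrable_norm)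
 have hi: "h integrable_on {a..b}"
  using hai set_lebesgue_integral_eq_integral(1) by blast
 have fi: "f integrable_on {a..b}" using f set_lebesgue_integral_eq_integral(1) by blast
 define g where "g n t = min (h t) (real n)" for n t
 have gi: "g n integrable_on {a..b}" for n
 proof -
  have c: "(\<lambda>x. real n) absolutely_integrable_on {a..b}"
   by (intro nonnegative_absolutely_integrable_1) auto
  show ?thesis
   using absolutely_integrable_min_1[OF hai c]
   unfolding g_def using set_lebesgue_integral_eq_integral(1) by blast
 qed
 have lim: "(\<lambda>n. integral {a..b} (g n)) \<longlonglongrightarrow> integral {a..b} h"
 proof (rule dominated_convergence(2)[OF gi hi])
  show "norm (g n x) \<le> h x" for n x by (auto simp: g_def h_def)
  show "(\<lambda>n. g n x) \<longlonglongrightarrow> h x" for x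
  proof (rule tendsto_eventually)
   obtain m where "h x \<le> real m" using real_arch_simple by blast
   then show "\<forall>\<^sub>F n in sequentially. g n x = h x"
    unfolding eventually_sequentially g_def
    by (intro exI[of _ m]) (auto simp: min_def)
  qed
 qed
 obtain n where n: "\<bar>integral {a..b} (g n) - integral {a..b} h\<bar> < e / 2"
  using LIMSEQ_D[OF lim, of "e/2"] e by auto
 define \<delta> where "\<delta> = e / (2 * (real n + 1))"
 have "\<delta> > 0" using e by (simp add: \<delta>_def)
 moreover have "(\<Sum>i\<in>d. norm (integral {a..Sup i} f - integral {a..Inf i} f)) < e"
  if d: "d division_of k" "k \<subseteq> {a..b}" "(\<Sum>i\<in>d. Sup i - Inf i) < \<delta>" for d k
 proof -
  have *: "norm (integral {a..Sup i} f - integral {a..Inf i} f)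
    \<le> integral i (\<lambda>t. h t - g n t) + real n * (Sup i - Inf i)" if i: "i \<in> d" for i
  proof -
   note I = division_of_real_interval[OF d(1,2) i]
   have sub: "i \<subseteq> {a..b}" using division_ofD(2)[OF d(1) i] d(2) by blast
   have fi': "f integrable_on i" and hi': "h integrable_on i" and gi': "g n integrable_on i"
    using sub I(1) fi hi gi by (metis integrable_on_subinterval)+
   have "integral {a..Inf i} f + integral {Inf i..Sup i} f = integral {a..Sup i} f"
    using I integrable_on_subinterval[OF fi, of a "Sup i"] by (intro Henstock_Kurzweil_Integration.integral_combine) auto
   then have "norm (integral {a..Sup i} f - integral {a..Inf i} f) = norm (integral i f)"
    using I(1) by (metis add_diff_cancel_left')
   also have "\<dots> \<le> integral i h"
    unfolding h_def
    by (intro integral_norm_bound_integral fi' hi'[unfolded h_def]) simp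
   also have "\<dots> = integral i (\<lambda>t. (h t - g n t) + g n t)" by simp
   also have "\<dots> = integral i (\<lambda>t. h t - g n t) + integral i (g n)"
    using I(1) sub gi hi
    by (intro Henstock_Kurzweil_Integration.integral_add Henstock_Kurzweil_Integration.integrable_diff)
      (metis integrable_on_subinterval)+
   also have "integral i (g n) \<le> integral i (\<lambda>_. real n)"
    by (intro integral_le gi', subst I(1)) (auto simp: g_def)
   also have "integral i (\<lambda>_. real n) = real n * (Sup i - Inf i)"
    using I by (metis integral_const_real measure_lborel_Icc mult.commute real_scaleR_def)
   finally show ?thesis by simp
  qed
  have "(\<Sum>i\<in>d. norm (integral {a..Sup i} f - integral {a..Inf i} f))
    \<le> (\<Sum>i\<in>d. integral i (\<lambda>t. h t - g n t)) + real n * (\<Sum>i\<in>d. Sup i - Inf i)"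
   unfolding sum_distrib_left sum.distrib[symmetric] by (rule sum_mono[OF *])
  also have "(\<Sum>i\<in>d. integral i (\<lambda>t. h t - g n t)) \<le> integral {a..b} (\<lambda>t. h t - g n t)"
   by (rule sum_integral_division_le[OF _ _ d(1,2)])
     (auto simp: g_def intro: Henstock_Kurzweil_Integration.integrable_diff hi gi[unfolded g_def])
  also have "\<dots> = integral {a..b} h - integral {a..b} (g n)"
   using Henstock_Kurzweil_Integration.integral_diff[OF hi gi] .
  also have "\<dots> < e / 2" using n by linarith
  also have "real n * (\<Sum>i\<in>d. Sup i - Inf i) \<le> real n * \<delta>"
   using d(3) by (intro mult_left_mono) auto
  also have "\<dots> \<le> e / 2" using e by (auto simp: \<delta>_def field_simps)
  finally show ?thesis by simp
 qed
 ultimately show "\<exists>\<delta>>0. \<forall>d k. d division_of k \<and> k \<subseteq> {a..b} \<and> (\<Sum>i\<in>d. Sup i - Inf i) < \<delta> -->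
    (\<Sum>i\<in>d. norm (integral {a..Sup i} f - integral {a..Inf i} f)) < e" by blast
qed

lemma abs_cont_on_diff:
 assumes "abs_cont_on a b x" "abs_cont_on a b y"
 shows "abs_cont_on a b (\<lambda>t. x t - y t)"
 unfolding abs_cont_on_def
proof (intro allI impI)
 fix e :: real assume "e > 0"
 then have "e / 2 > 0" by simp
 obtain d1 where d1: "d1 > 0" "!!d k. d division_of k \<and> k \<subseteq> {a..b} \<and> (\<Sum>i\<in>d. Sup i - Inf i) < d1 ==>
    (\<Sum>i\<in>d. norm (x (Sup i) - x (Inf i))) < e/2"
  using assms(1) \<open>e / 2 > 0\<close> unfolding abs_cont_on_def by meson
 obtain d2 where d2: "d2 > 0" "!!d k. d division_of k \<and> k \<subseteq> {a..b} \<and> (\<Sum>i\<in>d. Sup i - Inf i) < d2 ==>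
    (\<Sum>i\<in>d. norm (y (Sup i) - y (Inf i))) < e/2"
  using assms(2) \<open>e / 2 > 0\<close> unfolding abs_cont_on_def by meson
 show "\<exists>\<delta>>0. \<forall>d k. d division_of k \<and> k \<subseteq> {a..b} \<and> (\<Sum>i\<in>d. Sup i - Inf i) < \<delta> -->
    (\<Sum>i\<in>d. norm (x (Sup i) - y (Sup i) - (x (Inf i) - y (Inf i)))) < e"
 proof (intro exI[of _ "min d1 d2"] conjI allI impI)
  show "min d1 d2 > 0" using d1(1) d2(1) by simp
  fix d k assume A: "d division_of k \<and> k \<subseteq> {a..b} \<and> (\<Sum>i\<in>d. Sup i - Inf i) < min d1 d2"
  have "(\<Sum>i\<in>d. norm (x (Sup i) - y (Sup i) - (x (Inf i) - y (Inf i))))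
    \<le> (\<Sum>i\<in>d. norm (x (Sup i) - x (Inf i)) + norm (y (Sup i) - y (Inf i)))"
  proof (intro sum_mono)
   fix i
   have "x (Sup i) - y (Sup i) - (x (Inf i) - y (Inf i)) = (x (Sup i) - x (Inf i)) - (y (Sup i) - y (Inf i))"
    by simp
   then show "norm (x (Sup i) - y (Sup i) - (x (Inf i) - y (Inf i)))
     \<le> norm (x (Sup i) - x (Inf i)) + norm (y (Sup i) - y (Inf i))"
    by (metis norm_triangle_ineq4)
  qed
  also have "\<dots> < e" unfolding sum.distrib using d1(2)[of d k] d2(2)[of d k] A by fastforce
  finally show "(\<Sum>i\<in>d. norm (x (Sup i) - y (Sup i) - (x (Inf i) - y (Inf i)))) < e" .
 qed
qed

text \<open>
  A gauge separates the points where the derivative vanishes, which contribute little because of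
  the derivative, from the exceptional null set, which contributes little because the intervals
  tagged there lie in an open set of small measure.
\<close>

lemma abs_cont_on_zero_derivative:
 fixes y :: "real => 'a::euclidean_space"
 assumes ac: "abs_cont_on a b y" and ab: "a \<le> b" and N: "negligible N"
  and der: "!!t. t \<in> {a..b} - N ==> (y has_vector_derivative 0) (at t within {a..b})"
 shows "y b = y a"
proof -
 have "norm (y b - y a) \<le> e" if e: "e > 0" for e :: real
 proof -
  define e' where "e' = e / (2 * (b - a + 1))"
  have e': "e' > 0" using e ab by (auto simp: e'_def)
  have e'2: "e' * (b - a) \<le> e / 2"
  proof -
   have "e' * (b - a) \<le> e' * (b - a + 1)" using e' by (intro mult_left_mono) auto
   also have "\<dots> = e / 2" using ab by (simp add: e'_def field_simps)
   finally show ?thesis .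
  qed
  obtain \<delta> where \<delta>: "\<delta> > 0" "!!d k. d division_of k \<and> k \<subseteq> {a..b} \<and> (\<Sum>i\<in>d. Sup i - Inf i) < \<delta> ==>
    (\<Sum>i\<in>d. norm (y (Sup i) - y (Inf i))) < e / 2"
   using ac e unfolding abs_cont_on_def by (meson half_gt_zero)
  have Nl: "N \<in> sets lebesgue" using N negligible_imp_sets by blast
  obtain W where W: "open W" "N \<subseteq> W" "W - N \<in> lmeasurable" "measure lebesgue (W - N) < \<delta>"
   using sets_lebesgue_outer_open[OF Nl \<delta>(1)] by (metis emeasure_eq_measure2 ennreal_less_iff measure_nonneg fmeasurableD2 emeasure_eq_ennreal_measure)
  have NW: "N \<in> lmeasurable" "measure lebesgue N = 0"
   using N negligible_iff_measure by auto
  have WW: "W = (W - N) \<union> N" using W(2) by auto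
  have Wm: "W \<in> lmeasurable" using WW W(3) NW(1) by (metis fmeasurable.Un)
  have Ws: "measure lebesgue W < \<delta>"
  proof -
   have "measure lebesgue ((W - N) \<union> N) \<le> measure lebesgue (W - N) + measure lebesgue N"
    using W(3) NW(1) by (intro measure_Un_le) (auto simp: fmeasurableD)
   then show ?thesis using WW W(4) NW(2) by simp
  qed
  have "\<exists>d>0. \<forall>u\<in>{a..b}. \<bar>u - t\<bar> < d --> norm (y u - y t) \<le> e' * \<bar>u - t\<bar>" if "t \<in> {a..b} - N" for t
   using der[OF that] e' unfolding has_vector_derivative_def has_derivative_within_alt by fastforce
  then obtain dd where dd: "!!t. t \<in> {a..b} - N ==> dd t > 0"
   "!!t u. t \<in> {a..b} - N ==> u \<in> {a..b} ==> \<bar>u - t\<bar> < dd t ==> norm (y u - y t) \<le> e' * \<bar>u - t\<bar>"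
   by metis
  define \<gamma> where "\<gamma> t = (if t \<in> N then W else if t \<in> {a..b} then ball t (dd t) else ball t 1)" for t
  have "gauge \<gamma>" unfolding gauge_def \<gamma>_def using W(1,2) dd(1) by auto
  then obtain p where p: "p tagged_division_of {a..b}" "\<gamma> fine p"
   using fine_division_exists_real by blast
  define p1 where "p1 = {x \<in> p. fst x \<in> N}"
  have p1p: "p1 \<subseteq> p" by (auto simp: p1_def)
  have fin: "finite p" using p(1) by blast
  have iv: "k = {Inf k..Sup k}" "Inf k \<le> Sup k" "a \<le> Inf k" "Sup k \<le> b" "t \<in> k" "k \<subseteq> \<gamma> t" "t \<in> {a..b}"
   if "(t, k) \<in> p" for t k
  proof -
   have kd: "k \<in> snd ` p" using that by force
   have dv: "snd ` p division_of {a..b}" using division_of_tagged_division[OF p(1)] .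
   show "k = {Inf k..Sup k}" "Inf k \<le> Sup k" "a \<le> Inf k" "Sup k \<le> b"
    by (fact division_of_real_interval[OF dv order_refl kd])+
   show "t \<in> k" using tagged_division_ofD(2)[OF p(1) that] .
   then show "t \<in> {a..b}" using tagged_division_ofD(3)[OF p(1) that] by auto
   show "k \<subseteq> \<gamma> t" using p(2) that unfolding fine_def by auto
  qed
  have 1: "(\<Sum>(t, k)\<in>p1. norm (y (Sup k) - y (Inf k))) < e / 2"
  proof -
   have "p1 tagged_partial_division_of {a..b}"
    using tagged_partial_division_subset[OF _ p1p] p(1) tagged_division_of_def by blast
   then have t1: "p1 tagged_division_of (\<Union>(snd ` p1))" using tagged_partial_division_of_Union_self by blast
   have d1: "snd ` p1 division_of (\<Union>(snd ` p1))" using division_of_tagged_division[OF t1] .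
   have sub: "\<Union>(snd ` p1) \<subseteq> {a..b}" using iv(6) iv(3,4) p1p tagged_division_ofD(3)[OF p(1)] by fastforce
   have subW: "\<Union>(snd ` p1) \<subseteq> W" using iv(6) p1p unfolding p1_def \<gamma>_def by fastforce
   have "(\<Sum>i\<in>snd ` p1. Sup i - Inf i) = (\<Sum>i\<in>snd ` p1. measure lebesgue i)"
   proof (rule sum.cong[OF refl])
    fix i assume "i \<in> snd ` p1"
    from division_of_real_interval[OF d1 sub this] show "Sup i - Inf i = measure lebesgue i"
     by (metis content_real measure_completion borel_closed closed_atLeastAtMost sets_lborel)
   qed
   also have "\<dots> = measure lebesgue (\<Union>(snd ` p1))" using content_division[OF d1] by simp
   also have "\<dots> \<le> measure lebesgue W"
    using subW Wm d1 by (intro measure_mono_fmeasurable) (auto simp: lmeasurable_division fmeasurableD)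
   also have "\<dots> < \<delta>" by (rule Ws)
   finally have "(\<Sum>i\<in>snd ` p1. norm (y (Sup i) - y (Inf i))) < e / 2"
    using \<delta>(2) d1 sub by blast
   moreover have "(\<Sum>(t, k)\<in>p1. norm (y (Sup k) - y (Inf k))) = (\<Sum>i\<in>snd ` p1. norm (y (Sup i) - y (Inf i)))"
    by (rule sum_tagged_division_snd[OF t1]) auto
   ultimately show ?thesis by simp
  qed
  have 2: "norm (y (Sup k) - y (Inf k)) \<le> e' * (Sup k - Inf k)" if "(t, k) \<in> p - p1" for t k
  proof -
   note I = iv[of t k]
   have tk: "(t, k) \<in> p" "t \<notin> N" using that by (auto simp: p1_def)
   then have tn: "t \<in> {a..b} - N" using I by auto
   have kb: "k \<subseteq> ball t (dd t)" using I(6) tk tn unfolding \<gamma>_def by auto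
   have mem: "Sup k \<in> k" "Inf k \<in> k" using I(1,2) tk by (metis atLeastAtMost_iff order.refl)+
   have "\<bar>Sup k - t\<bar> < dd t" "\<bar>Inf k - t\<bar> < dd t" using kb mem by (auto simp: dist_real_def abs_minus_commute)
   moreover have "Sup k \<in> {a..b}" "Inf k \<in> {a..b}" using I tk by auto
   ultimately have "norm (y (Sup k) - y t) \<le> e' * \<bar>Sup k - t\<bar>" "norm (y (Inf k) - y t) \<le> e' * \<bar>Inf k - t\<bar>"
    using dd(2)[OF tn] by auto
   moreover have "Inf k \<le> t" "t \<le> Sup k" using I(1,5) tk by auto
   ultimately have "norm (y (Sup k) - y t) + norm (y (Inf k) - y t) \<le> e' * (Sup k - Inf k)"
    by (auto simp: algebra_simps)
   moreover have "norm (y (Sup k) - y (Inf k)) \<le> norm (y (Sup k) - y t) + norm (y (Inf k) - y t)"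
    by (metis norm_triangle_ineq4 add_diff_cancel diff_add_cancel diff_diff_eq2)
   ultimately show ?thesis by linarith
  qed
  have "y b - y a = (\<Sum>(t, k)\<in>p. y (Sup k) - y (Inf k))"
   using additive_tagged_division_1[OF ab p(1), of y] by simp
  then have "norm (y b - y a) \<le> (\<Sum>(t, k)\<in>p. norm (y (Sup k) - y (Inf k)))"
   by (metis (no_types, lifting) norm_sum sum.cong case_prod_unfold)
  also have "\<dots> = (\<Sum>(t, k)\<in>p - p1. norm (y (Sup k) - y (Inf k))) + (\<Sum>(t, k)\<in>p1. norm (y (Sup k) - y (Inf k)))"
   using sum.subset_diff[OF p1p fin] .
  also have "(\<Sum>(t, k)\<in>p - p1. norm (y (Sup k) - y (Inf k))) \<le> (\<Sum>(t, k)\<in>p - p1. e' * (Sup k - Inf k))"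
   using 2 by (intro sum_mono) auto
  also have "\<dots> \<le> (\<Sum>(t, k)\<in>p. e' * (Sup k - Inf k))"
   using fin iv(2) e' by (intro sum_mono2) auto
  also have "\<dots> = e' * (b - a)"
   using additive_tagged_division_1[OF ab p(1), of "\<lambda>x. e' * x"] by (simp add: algebra_simps)
  finally show ?thesis using 1 e'2 by linarith
 qed
 then have "norm (y b - y a) \<le> 0" using field_le_epsilon[of "norm (y b - y a)" 0] by simp
 then show ?thesis by simp
qed

text \<open>
  Lebesgue differentiation gives the right derivative; the left derivative is the right derivative of the
  reflected function.
\<close>

lemma integral_has_derivative_ae:
 fixes f :: "real => 'a::euclidean_space"
 assumes f: "!!a b. f integrable_on {a..b}"
 obtains N where "negligible N"
  "!!s t. t \<notin> N ==> s < t ==> ((\<lambda>t. integral {s..t} f) has_vector_derivative f t) (at t)"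
proof -
 have f': "(\<lambda>x. f (- x)) integrable_on {a..b}" for a b
  using f[of "-b" "-a"] by (metis Henstock_Kurzweil_Integration.integrable_reflect_real minus_minus)
 obtain N1 where N1: "negligible N1" "!!x e. x \<notin> N1 ==> 0 < e ==>
   \<exists>d>0. \<forall>h. 0 < h \<and> h < d --> norm (integral (cbox x (x + h *\<^sub>R One)) f /\<^sub>R h ^ DIM(real) - f x) < e"
  using integrable_ccontinuous_explicit[of f] f by (metis cbox_interval)
 obtain N2 where N2: "negligible N2" "!!x e. x \<notin> N2 ==> 0 < e ==>
   \<exists>d>0. \<forall>h. 0 < h \<and> h < d --> norm (integral (cbox x (x + h *\<^sub>R One)) (\<lambda>x. f (- x)) /\<^sub>R h ^ DIM(real) - f (- x)) < e"
  using integrable_ccontinuous_explicit[of "\<lambda>x. f (- x)"] f' by (metis cbox_interval)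
 define N where "N = N1 \<union> uminus ` N2"
 have neg: "negligible N" unfolding N_def
  using N1(1) N2(1) by (intro negligible_Un negligible_differentiable_image_negligible) (auto intro!: derivative_intros)
 have "((\<lambda>t. integral {s..t} f) has_vector_derivative f t) (at t)" if tN: "t \<notin> N" and st: "s < t" for s t
  unfolding has_vector_derivative_def has_derivative_at_alt
 proof (intro conjI allI impI)
  show "bounded_linear (\<lambda>x. x *\<^sub>R f t)" by (rule bounded_linear_scaleR_left)
  fix e :: real assume e: "e > 0"
  have t1: "t \<notin> N1" and t2: "- t \<notin> N2" using tN unfolding N_def by (auto, metis image_eqI minus_minus)
  obtain d1 where d1: "d1 > 0" "!!h. 0 < h ==> h < d1 ==> norm (integral {t..t+h} f /\<^sub>R h - f t) < e"
   using N1(2)[OF t1 e] by auto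
  obtain d2 where d2: "d2 > 0" "!!h. 0 < h ==> h < d2 ==> norm (integral {-t..-t+h} (\<lambda>x. f (- x)) /\<^sub>R h - f t) < e"
   using N2(2)[OF t2 e] by auto
  have key: "norm (I - h *\<^sub>R f t) \<le> e * h" if "h > 0" "norm (I /\<^sub>R h - f t) < e" for I h
  proof -
   have "I - h *\<^sub>R f t = h *\<^sub>R (I /\<^sub>R h - f t)" using that(1) by (simp add: scaleR_diff_right)
   then have "norm (I - h *\<^sub>R f t) = h * norm (I /\<^sub>R h - f t)" using that(1) by (metis abs_of_pos norm_scaleR)
   then show ?thesis using that mult_left_mono[of "norm (I /\<^sub>R h - f t)" e h] by (simp add: mult.commute)
  qed
  show "\<exists>d>0. \<forall>y. norm (y - t) < d -->
    norm (integral {s..y} f - integral {s..t} f - (y - t) *\<^sub>R f t) \<le> e * norm (y - t)"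
  proof (intro exI[of _ "min (min d1 d2) (t - s)"] conjI allI impI)
   show "0 < min (min d1 d2) (t - s)" using d1(1) d2(1) st by simp
   fix y assume y: "norm (y - t) < min (min d1 d2) (t - s)"
   consider "y = t" | "y > t" | "y < t" by linarith
   then show "norm (integral {s..y} f - integral {s..t} f - (y - t) *\<^sub>R f t) \<le> e * norm (y - t)"
   proof cases
    case 2
    have "integral {s..t} f + integral {t..y} f = integral {s..y} f"
     using 2 st f by (intro Henstock_Kurzweil_Integration.integral_combine) auto
    moreover have "norm (integral {t..y} f - (y - t) *\<^sub>R f t) \<le> e * (y - t)"
     using key[of "y - t" "integral {t..y} f"] d1(2)[of "y - t"] 2 y by auto
    ultimately show ?thesis using 2 by (smt (verit) add_diff_cancel_left' real_norm_def)
   next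
    case 3
    have sy: "s < y" using y 3 by auto
    have "integral {s..y} f + integral {y..t} f = integral {s..t} f"
     using 3 sy f by (intro Henstock_Kurzweil_Integration.integral_combine) auto
    then have eq: "integral {s..y} f - integral {s..t} f - (y - t) *\<^sub>R f t = - (integral {y..t} f - (t - y) *\<^sub>R f t)"
     by (simp add: algebra_simps)
    have "integral {-t..-y} (\<lambda>x. f (- x)) = integral {y..t} f"
     using Henstock_Kurzweil_Integration.integral_reflect_real[of t y f] by simp
    then have "norm (integral {y..t} f - (t - y) *\<^sub>R f t) \<le> e * (t - y)"
     using key[of "t - y" "integral {y..t} f"] d2(2)[of "t - y"] 3 y by auto
    then show ?thesis unfolding eq norm_minus_cancel using 3 by simp
   qed simp
  qed
 qed
 then show ?thesis using that neg by blast
qed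

lemma AE_lborel_negligible:
 assumes "AE t in lborel. P (t::real)"
 obtains N where "negligible N" "!!t. t \<notin> N ==> P t"
proof -
 obtain N where N: "{t \<in> space lborel. \<not> P t} \<subseteq> N" "emeasure lborel N = 0" "N \<in> sets lborel"
  using AE_E[OF assms] by blast
 then have "negligible N" unfolding negligible_iff_null_sets
  by (metis null_setsI null_sets_completionI)
 then show ?thesis using that N(1) by auto
qed

lemma negligible_AE_lborel:
 assumes "negligible N" "!!t. t \<notin> N ==> P (t::real)"
 shows "AE t in lborel. P t"
proof -
 obtain N' where "N' \<in> null_sets lborel" "N \<subseteq> N'"
  using assms(1) unfolding negligible_iff_null_sets by (metis null_sets_completion_iff2)
 then show ?thesis using assms(2) by (intro AE_I'[of N']) auto
qed

text \<open>
  The difference from the indefinite integral is absolutely continuous with derivative zero almost everywhere.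
\<close>

lemma abs_cont_on_imp_integral:
 fixes x :: "real => 'a::euclidean_space"
 assumes ac: "abs_cont_on a b x" and ab: "a \<le> b"
  and f: "!!a b. f absolutely_integrable_on {a..b}"
  and N: "negligible N" and der: "!!t. t \<in> {a..b} - N ==> (x has_vector_derivative f t) (at t)"
 shows "x b = x a + integral {a..b} f"
proof -
 have fi: "f integrable_on {a..b}" for a b using f set_lebesgue_integral_eq_integral(1) by blast
 obtain N1 where N1: "negligible N1" "!!s t. t \<notin> N1 ==> s < t ==>
   ((\<lambda>t. integral {s..t} f) has_vector_derivative f t) (at t)"
  using integral_has_derivative_ae[of f] fi by blast
 define y where "y t = x t - integral {a..t} f" for t
 have "y b = y a"
 proof (rule abs_cont_on_zero_derivative[OF _ ab])
  show "abs_cont_on a b y" unfolding y_def by (intro abs_cont_on_diff ac abs_cont_on_integral f)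
  show "negligible (insert a (N \<union> N1))" using N N1(1) by simp
  fix t assume t: "t \<in> {a..b} - insert a (N \<union> N1)"
  then have "((\<lambda>t. x t - integral {a..t} f) has_vector_derivative f t - f t) (at t)"
   by (intro has_vector_derivative_diff der N1(2)) auto
  then show "(y has_vector_derivative 0) (at t within {a..b})"
   unfolding y_def using has_vector_derivative_at_within by fastforce
 qed
 then show ?thesis by (simp add: y_def algebra_simps)
qed

lemma abs_cont_on_exp:
 fixes x :: "real => real"
 assumes ac: "abs_cont_on a b x" and B: "!!t. t \<in> {a..b} ==> x t \<le> B"
 shows "abs_cont_on a b (\<lambda>t. exp (x t))"
 unfolding abs_cont_on_def
proof (intro allI impI)
 fix e :: real assume e: "e > 0"
 have lip: "\<bar>exp u - exp v\<bar> \<le> exp B * \<bar>u - v\<bar>" if "u \<le> B" "v \<le> B" for u v :: real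
  using field_differentiable_bound[of "{..B}" exp exp "exp B" u v] that
  by (auto intro: has_field_derivative_at_within DERIV_exp)
 obtain \<delta> where \<delta>: "\<delta> > 0" "!!d k. d division_of k \<and> k \<subseteq> {a..b} \<and> (\<Sum>i\<in>d. Sup i - Inf i) < \<delta> ==>
    (\<Sum>i\<in>d. norm (x (Sup i) - x (Inf i))) < e / exp B"
  using ac e divide_pos_pos[OF e exp_gt_zero[of B]] unfolding abs_cont_on_def by meson
 show "\<exists>\<delta>>0. \<forall>d k. d division_of k \<and> k \<subseteq> {a..b} \<and> (\<Sum>i\<in>d. Sup i - Inf i) < \<delta> -->
    (\<Sum>i\<in>d. norm (exp (x (Sup i)) - exp (x (Inf i)))) < e"
 proof (intro exI[of _ \<delta>] conjI allI impI \<delta>(1))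
  fix d k assume A: "d division_of k \<and> k \<subseteq> {a..b} \<and> (\<Sum>i\<in>d. Sup i - Inf i) < \<delta>"
  have "(\<Sum>i\<in>d. norm (exp (x (Sup i)) - exp (x (Inf i)))) \<le> (\<Sum>i\<in>d. exp B * norm (x (Sup i) - x (Inf i)))"
  proof (intro sum_mono)
   fix i assume "i \<in> d"
   from division_of_real_interval[OF conjunct1[OF A] _ this, of a b] A
   show "norm (exp (x (Sup i)) - exp (x (Inf i))) \<le> exp B * norm (x (Sup i) - x (Inf i))"
    unfolding real_norm_def by (intro lip B) auto
  qed
  also have "\<dots> < e" using \<delta>(2)[OF A] by (simp add: sum_distrib_left[symmetric] field_simps)
  finally show "(\<Sum>i\<in>d. norm (exp (x (Sup i)) - exp (x (Inf i)))) < e" .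
 qed
qed

text \<open>
  The chain rule for the absolutely continuous function \<open>exp (2 * integral {s..u} l)\<close>, whose derivative
  exists only almost everywhere.
\<close>

lemma integral_exp_integral:
 fixes l :: "real => real"
 assumes l: "!!a b. l absolutely_integrable_on {a..b}" "!!t. 0 \<le> l t" and st: "s \<le> t"
 shows "((\<lambda>u. l u * exp (2 * integral {s..u} l)) has_integral (exp (2 * integral {s..t} l) - 1) / 2) {s..t}"
  and "(\<lambda>u. l u * exp (2 * integral {s..u} l)) absolutely_integrable_on {s..t}"
proof -
 have l2: "(\<lambda>u. 2 * l u) absolutely_integrable_on {a..b}" for a b
  by (rule set_integrable_mult_right) (rule l(1))
 have li: "l integrable_on {a..b}" for a b using l(1) set_lebesgue_integral_eq_integral(1) by blast
 define x where "x u = integral {s..u} (\<lambda>u. 2 * l u)" for u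
 have xeq: "x u = 2 * integral {s..u} l" for u
  unfolding x_def by (rule Henstock_Kurzweil_Integration.integral_mult_right)
 define E where "E u = exp (x u)" for u
 define f where "f u = (if u \<in> {s..t} then 2 * l u * E u else 0)" for u
 have mono: "x u \<le> x v" if "s \<le> u" "u \<le> v" for u v
  unfolding xeq using integral_subset_le[of "{s..u}" "{s..v}" l] that li l(2) by auto
 have contx: "continuous_on {s..b} x" for b
  unfolding xeq by (intro continuous_intros indefinite_integral_continuous_1 li)
 have Em: "E \<in> borel_measurable (lebesgue_on {s..b})" for b
  unfolding E_def by (intro continuous_imp_measurable_on_sets_lebesgue continuous_intros contx) auto
 have fst: "(\<lambda>u. 2 * l u * E u) absolutely_integrable_on {s..t}"
 proof -
  have "(\<lambda>u. E u * (2 * l u)) absolutely_integrable_on {s..t}"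
  proof (rule absolutely_integrable_bounded_measurable_product_real)
   show "E \<in> borel_measurable (lebesgue_on {s..t})" by (rule Em)
   show "bounded (E ` {s..t})"
    unfolding bounded_iff E_def using mono by (intro exI[of _ "exp (x t)"]) auto
   show "(\<lambda>u. 2 * l u) absolutely_integrable_on {s..t}" by (rule l2)
  qed auto
  then show ?thesis by (simp add: mult.commute mult.left_commute)
 qed
 have fab: "f absolutely_integrable_on {a..b}" for a b
 proof -
  have "f absolutely_integrable_on UNIV"
   using fst unfolding f_def by (subst absolutely_integrable_restrict_UNIV)
  then show ?thesis by (rule set_integrable_subset) auto
 qed
 obtain N where N: "negligible N" "!!s t. t \<notin> N ==> s < t ==>
   ((\<lambda>t. integral {s..t} (\<lambda>u. 2 * l u)) has_vector_derivative 2 * l t) (at t)"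
  using integral_has_derivative_ae[of "\<lambda>u. 2 * l u"] l2 set_lebesgue_integral_eq_integral(1) by blast
 have "E t = E s + integral {s..t} f"
 proof (rule abs_cont_on_imp_integral[OF _ st fab])
  show "abs_cont_on s t E"
   unfolding E_def
  proof (rule abs_cont_on_exp[of _ _ _ "x t"])
   show "abs_cont_on s t x" unfolding x_def by (intro abs_cont_on_integral l2)
  qed (use mono in auto)
  show "negligible (insert s N)" using N(1) by simp
  fix u assume u: "u \<in> {s..t} - insert s N"
  have "(x has_real_derivative 2 * l u) (at u)"
   using N(2)[of u s] u unfolding x_def has_real_derivative_iff_has_vector_derivative by auto
  then have "(E has_real_derivative exp (x u) * (2 * l u)) (at u)"
   unfolding E_def by (rule DERIV_fun_exp)
  then show "(E has_vector_derivative f u) (at u)"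
   using u unfolding has_real_derivative_iff_has_vector_derivative f_def E_def by (simp add: mult.commute)
 qed
 moreover have "E s = 1" by (simp add: E_def xeq)
 moreover have "integral {s..t} f = integral {s..t} (\<lambda>u. 2 * l u * E u)"
  by (intro integral_cong) (simp add: f_def)
 ultimately have "integral {s..t} (\<lambda>u. 2 * l u * E u) = E t - 1" by simp
 moreover have "(\<lambda>u. 2 * l u * E u) integrable_on {s..t}" using fst set_lebesgue_integral_eq_integral(1) by blast
 ultimately have "((\<lambda>u. 2 * l u * E u) has_integral E t - 1) {s..t}" by (metis integrable_integral)
 from has_integral_mult_right[OF this, of "1/2"]
 show "((\<lambda>u. l u * exp (2 * integral {s..u} l)) has_integral (exp (2 * integral {s..t} l) - 1) / 2) {s..t}"
  by (simp add: E_def xeq)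
 show "(\<lambda>u. l u * exp (2 * integral {s..u} l)) absolutely_integrable_on {s..t}"
  using set_integrable_mult_right[of "1/2", OF fst] by (simp add: E_def xeq)
qed

section \<open>The Stieltjes integral of functions that are continuous up to one jump\<close>

lemma norm_matrix_vector_mult_le:
 fixes A :: "real ^ 'n ^ 'm"
 shows "norm (A *v x) \<le> norm A * norm x"
proof -
 have comp: "(A *v x) $ i = A $ i \<bullet> x" for i
  by (simp add: matrix_vector_mult_def inner_vec_def)
 have "norm (A *v x) = L2_set (\<lambda>i. norm (A $ i \<bullet> x)) UNIV"
  unfolding norm_vec_def comp ..
 also have "\<dots> \<le> L2_set (\<lambda>i. norm (A $ i) * norm x) UNIV"
  by (intro L2_set_mono) (auto simp: Cauchy_Schwarz_ineq2)
 also have "\<dots> = norm A * norm x"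
  by (simp add: norm_vec_def L2_set_left_distrib[symmetric])
 finally show ?thesis .
qed

lemma bounded_bilinear_matrix_vector_mult:
 "bounded_bilinear (\<lambda>(A :: real ^ 'n ^ 'm) x. A *v x)"
proof
 show "\<exists>K. \<forall>(A :: real ^ 'n ^ 'm) x. norm (A *v x) \<le> norm A * norm x * K"
  using norm_matrix_vector_mult_le by (intro exI[of _ 1]) auto
qed (auto simp: matrix_vector_mult_add_rdistrib matrix_vector_right_distrib matrix_vector_mult_scaleR scaleR_matrix_vector_assoc)

definition stieltjes_sum :: "(real => real ^ 'n ^ 'n) => ('n::finite) curve => (real \<times> real set) set => real ^ 'n" where
 "stieltjes_sum Z \<phi> p = (\<Sum>(\<omega>, k)\<in>p. (Z (Sup k) - Z (Inf k)) *v \<phi> \<omega>)"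

lemma has_stieltjes_integralD:
 assumes "has_stieltjes_integral Z \<phi> I a b" "e > 0"
 shows "\<exists>\<gamma>. gauge \<gamma> \<and>
  (\<forall>p. p tagged_division_of {a..b} --> \<gamma> fine p --> norm (stieltjes_sum Z \<phi> p - I) < e)"
 using assms unfolding has_stieltjes_integral_def stieltjes_sum_def by meson

lemma has_stieltjes_integralI:
 assumes "!!e. e > 0 ==> \<exists>\<gamma>. gauge \<gamma> \<and>
   (\<forall>p. p tagged_division_of {a..b} \<and> \<gamma> fine p --> norm (stieltjes_sum Z \<phi> p - I) < e)"
 shows "has_stieltjes_integral Z \<phi> I a b"
 using assms unfolding has_stieltjes_integral_def stieltjes_sum_def by blast

lemma stieltjes_sum_linear:
 "stieltjes_sum Z (\<lambda>\<omega>. \<phi> \<omega> + \<psi> \<omega>) p = stieltjes_sum Z \<phi> p + stieltjes_sum Z \<psi> p"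
 "stieltjes_sum Z (\<lambda>\<omega>. \<phi> \<omega> - \<psi> \<omega>) p = stieltjes_sum Z \<phi> p - stieltjes_sum Z \<psi> p"
 "stieltjes_sum Z (\<lambda>\<omega>. c *\<^sub>R \<phi> \<omega>) p = c *\<^sub>R stieltjes_sum Z \<phi> p"
 unfolding stieltjes_sum_def
 by (simp_all add: matrix_vector_right_distrib matrix_vector_mult_diff_distrib scaleR_sum_right case_prod_unfold
   sum.distrib sum_subtractf matrix_vector_mult_scaleR)

lemma has_stieltjes_integral_combine:
 assumes "has_stieltjes_integral Z \<phi> I a b" "has_stieltjes_integral Z \<psi> J a b"
 shows "has_stieltjes_integral Z (\<lambda>\<omega>. c *\<^sub>R \<phi> \<omega> + d *\<^sub>R \<psi> \<omega>) (c *\<^sub>R I + d *\<^sub>R J) a b"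
proof (rule has_stieltjes_integralI)
 fix e :: real assume e: "e > 0"
 define e' where "e' = e / (2 * (\<bar>c\<bar> + \<bar>d\<bar> + 1))"
 have e': "e' > 0" using e by (simp add: e'_def)
 obtain \<gamma>1 where 1: "gauge \<gamma>1"
  "!!p. p tagged_division_of {a..b} ==> \<gamma>1 fine p ==> norm (stieltjes_sum Z \<phi> p - I) < e'"
  using has_stieltjes_integralD[OF assms(1) e'] by blast
 obtain \<gamma>2 where 2: "gauge \<gamma>2"
  "!!p. p tagged_division_of {a..b} ==> \<gamma>2 fine p ==> norm (stieltjes_sum Z \<psi> p - J) < e'"
  using has_stieltjes_integralD[OF assms(2) e'] by blast
 show "\<exists>\<gamma>. gauge \<gamma> \<and> (\<forall>p. p tagged_division_of {a..b} \<and> \<gamma> fine p -->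
   norm (stieltjes_sum Z (\<lambda>\<omega>. c *\<^sub>R \<phi> \<omega> + d *\<^sub>R \<psi> \<omega>) p - (c *\<^sub>R I + d *\<^sub>R J)) < e)"
 proof (intro exI[of _ "\<lambda>x. \<gamma>1 x \<inter> \<gamma>2 x"] conjI allI impI)
  show "gauge (\<lambda>x. \<gamma>1 x \<inter> \<gamma>2 x)" using 1(1) 2(1) by (rule gauge_Int)
  fix p assume p: "p tagged_division_of {a..b} \<and> (\<lambda>x. \<gamma>1 x \<inter> \<gamma>2 x) fine p"
  then have A: "norm (stieltjes_sum Z \<phi> p - I) < e'" "norm (stieltjes_sum Z \<psi> p - J) < e'"
   using 1(2) 2(2) by (auto simp: fine_Int)
  have "stieltjes_sum Z (\<lambda>\<omega>. c *\<^sub>R \<phi> \<omega> + d *\<^sub>R \<psi> \<omega>) p - (c *\<^sub>R I + d *\<^sub>R J)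
   = c *\<^sub>R (stieltjes_sum Z \<phi> p - I) + d *\<^sub>R (stieltjes_sum Z \<psi> p - J)"
   unfolding stieltjes_sum_linear by (simp add: scaleR_diff_right)
  then have "norm (stieltjes_sum Z (\<lambda>\<omega>. c *\<^sub>R \<phi> \<omega> + d *\<^sub>R \<psi> \<omega>) p - (c *\<^sub>R I + d *\<^sub>R J))
   \<le> \<bar>c\<bar> * norm (stieltjes_sum Z \<phi> p - I) + \<bar>d\<bar> * norm (stieltjes_sum Z \<psi> p - J)"
   using norm_triangle_ineq[of "c *\<^sub>R (stieltjes_sum Z \<phi> p - I)" "d *\<^sub>R (stieltjes_sum Z \<psi> p - J)"]
   by (simp only: norm_scaleR)
  also have "\<dots> \<le> \<bar>c\<bar> * e' + \<bar>d\<bar> * e'" using A by (intro add_mono mult_left_mono) auto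
  also have "\<dots> \<le> (\<bar>c\<bar> + \<bar>d\<bar> + 1) * e'" using e' by (simp add: algebra_simps)
  also have "\<dots> = e / 2" by (simp add: e'_def field_simps add_nonneg_pos)
  also have "\<dots> < e" using e by simp
  finally show "norm (stieltjes_sum Z (\<lambda>\<omega>. c *\<^sub>R \<phi> \<omega> + d *\<^sub>R \<psi> \<omega>) p - (c *\<^sub>R I + d *\<^sub>R J)) < e" .
 qed
qed

lemma has_stieltjes_integral_add:
 assumes "has_stieltjes_integral Z \<phi> I a b" "has_stieltjes_integral Z \<psi> J a b"
 shows "has_stieltjes_integral Z (\<lambda>\<omega>. \<phi> \<omega> + \<psi> \<omega>) (I + J) a b"
 using has_stieltjes_integral_combine[OF assms, of 1 1] by simp

lemma has_stieltjes_integral_diff: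
 assumes "has_stieltjes_integral Z \<phi> I a b" "has_stieltjes_integral Z \<psi> J a b"
 shows "has_stieltjes_integral Z (\<lambda>\<omega>. \<phi> \<omega> - \<psi> \<omega>) (I - J) a b"
 using has_stieltjes_integral_combine[OF assms, of 1 "-1"] by simp

lemma has_stieltjes_integral_0: "has_stieltjes_integral Z (\<lambda>\<omega>. 0) 0 a b"
 by (rule has_stieltjes_integralI) (auto simp: stieltjes_sum_def intro!: exI[of _ "\<lambda>x. ball x 1"])

lemma has_stieltjes_integral_sum:
 assumes "finite A" "!!i. i \<in> A ==> has_stieltjes_integral Z (\<phi> i) (I i) a b"
 shows "has_stieltjes_integral Z (\<lambda>\<omega>. \<Sum>i\<in>A. \<phi> i \<omega>) (\<Sum>i\<in>A. I i) a b"
 using assms by (induction A rule: finite_induct) (auto intro: has_stieltjes_integral_0 has_stieltjes_integral_add)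

lemma stieltjes_sum_cong:
 assumes "p tagged_division_of {a..b}" "!!\<omega>. \<omega> \<in> {a..b} ==> \<phi> \<omega> = \<psi> \<omega>"
 shows "stieltjes_sum Z \<phi> p = stieltjes_sum Z \<psi> p"
 unfolding stieltjes_sum_def
proof (rule sum.cong[OF refl])
 fix x assume x: "x \<in> p"
 obtain \<omega> k where xk: "x = (\<omega>, k)" by (rule prod.exhaust)
 then have "\<omega> \<in> {a..b}" using tagged_division_ofD(2,3)[OF assms(1)] x by blast
 then show "(case x of (\<omega>, k) => (Z (Sup k) - Z (Inf k)) *v \<phi> \<omega>) = (case x of (\<omega>, k) => (Z (Sup k) - Z (Inf k)) *v \<psi> \<omega>)"
  using assms(2) xk by simp
qed

lemma has_stieltjes_integral_cong:
 assumes "has_stieltjes_integral Z \<phi> I a b" "!!\<omega>. \<omega> \<in> {a..b} ==> \<phi> \<omega> = \<psi> \<omega>"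
 shows "has_stieltjes_integral Z \<psi> I a b"
proof (rule has_stieltjes_integralI)
 fix e :: real assume e: "e > 0"
 obtain \<gamma> where g: "gauge \<gamma>"
  "!!p. p tagged_division_of {a..b} ==> \<gamma> fine p ==> norm (stieltjes_sum Z \<phi> p - I) < e"
  using has_stieltjes_integralD[OF assms(1) e] by blast
 then show "\<exists>\<gamma>. gauge \<gamma> \<and> (\<forall>p. p tagged_division_of {a..b} \<and> \<gamma> fine p --> norm (stieltjes_sum Z \<psi> p - I) < e)"
  using stieltjes_sum_cong[OF _ assms(2)] by (intro exI[of _ \<gamma>]) auto
qed

lemma stieltjes_sum_bound:
 assumes p: "p tagged_division_of {a..b}" and V: "variation_le Z a b V"
  and B: "!!\<omega>. \<omega> \<in> {a..b} ==> norm (\<phi> \<omega>) \<le> B" "0 \<le> B"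
 shows "norm (stieltjes_sum Z \<phi> p) \<le> V * B"
proof -
 have "norm (stieltjes_sum Z \<phi> p) \<le> (\<Sum>(\<omega>, k)\<in>p. norm ((Z (Sup k) - Z (Inf k)) *v \<phi> \<omega>))"
  unfolding stieltjes_sum_def case_prod_unfold by (rule norm_sum)
 also have "\<dots> \<le> (\<Sum>(\<omega>, k)\<in>p. norm (Z (Sup k) - Z (Inf k)) * B)"
 proof (rule sum_mono, clarify)
  fix \<omega> k assume "(\<omega>, k) \<in> p"
  then have "\<omega> \<in> {a..b}" using tagged_division_ofD(2,3)[OF p] by blast
  then show "norm ((Z (Sup k) - Z (Inf k)) *v \<phi> \<omega>) \<le> norm (Z (Sup k) - Z (Inf k)) * B"
   using norm_matrix_vector_mult_le[of "Z (Sup k) - Z (Inf k)" "\<phi> \<omega>"] B(1)[of \<omega>]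
   by (smt (verit) mult_left_mono norm_ge_zero)
 qed
 also have "\<dots> = (\<Sum>(\<omega>, k)\<in>p. norm (Z (Sup k) - Z (Inf k))) * B"
  unfolding sum_distrib_right case_prod_unfold ..
 also have "(\<Sum>(\<omega>, k)\<in>p. norm (Z (Sup k) - Z (Inf k))) = (\<Sum>k\<in>snd ` p. norm (Z (Sup k) - Z (Inf k)))"
  by (rule sum_tagged_division_snd[OF p]) simp
 also have "\<dots> * B \<le> V * B"
  using V division_of_tagged_division[OF p] B(2) unfolding variation_le_def by (intro mult_right_mono) auto
 finally show ?thesis .
qed

text \<open>
  Every Stieltjes sum satisfies the bound, and sums over fine tagged divisions approximate the integral.
\<close>

lemma stieltjes_integral_bound:
 assumes I: "has_stieltjes_integral Z \<phi> I a b" and V: "variation_le Z a b V"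
  and B: "!!\<omega>. \<omega> \<in> {a..b} ==> norm (\<phi> \<omega>) \<le> B" "0 \<le> B"
 shows "norm I \<le> V * B"
proof (rule field_le_epsilon)
 fix e :: real assume e: "e > 0"
 obtain \<gamma> where g: "gauge \<gamma>"
  "!!p. p tagged_division_of {a..b} ==> \<gamma> fine p ==> norm (stieltjes_sum Z \<phi> p - I) < e"
  using has_stieltjes_integralD[OF I e] by blast
 obtain p where p: "p tagged_division_of {a..b}" "\<gamma> fine p"
  using fine_division_exists_real[OF g(1)] by blast
 show "norm I \<le> V * B + e"
 proof -
  have "norm (stieltjes_sum Z \<phi> p) \<le> V * B" by (rule stieltjes_sum_bound[OF p(1) V B])
  moreover have "norm (I - stieltjes_sum Z \<phi> p) < e" using g(2)[OF p] by (simp add: norm_minus_commute)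
  ultimately show ?thesis using norm_triangle_sub[of I "stieltjes_sum Z \<phi> p"] by linarith
 qed
qed

text \<open>
  With uniqueness, the value of \<^const>\<open>L\<close> can be read off from any integral that has been computed.
\<close>

lemma has_stieltjes_integral_unique:
 assumes "has_stieltjes_integral Z \<phi> I a b" "has_stieltjes_integral Z \<phi> J a b"
 shows "I = J"
proof -
 have D: "has_stieltjes_integral Z (\<lambda>\<omega>. 0) (I - J) a b"
  using has_stieltjes_integral_diff[OF assms] by simp
 have "norm (I - J) \<le> 0 + e" if e: "e > 0" for e
 proof -
  obtain \<gamma> where g: "gauge \<gamma>"
   "!!p. p tagged_division_of {a..b} ==> \<gamma> fine p ==> norm (stieltjes_sum Z (\<lambda>_. 0) p - (I - J)) < e"
   using has_stieltjes_integralD[OF D e] by blast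
  obtain p where p: "p tagged_division_of {a..b}" "\<gamma> fine p"
   using fine_division_exists_real[OF g(1)] by blast
  show ?thesis using g(2)[OF p] norm_minus_commute[of I J] by (simp add: stieltjes_sum_def)
 qed
 then show ?thesis using field_le_epsilon[of "norm (I - J)" 0] by simp
qed

text \<open>Integrators of bounded variation make integration continuous for uniform convergence.\<close>

lemma has_stieltjes_integral_uniform_limit:
 fixes \<phi> :: "nat => real => real ^ 'n"
 assumes I: "!!k. has_stieltjes_integral Z (\<phi> k) (I k) a b" and V: "variation_le Z a b V" "0 \<le> V"
  and u: "!!e. e > 0 ==> \<forall>\<^sub>F k in sequentially. \<forall>\<omega>\<in>{a..b}. norm (\<phi> k \<omega> - \<psi> \<omega>) \<le> e"
 shows "\<exists>J. has_stieltjes_integral Z \<psi> J a b \<and> I \<longlonglongrightarrow> J"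
proof -
 have u': "\<exists>N. \<forall>k\<ge>N. \<forall>\<omega>\<in>{a..b}. norm (\<phi> k \<omega> - \<psi> \<omega>) \<le> e / (4 * (V + 1))" if "e > 0" for e
  using u[of "e / (4 * (V + 1))"] that V(2) unfolding eventually_sequentially by simp
 have Ve: "V * (e / (4 * (V + 1))) \<le> e / 4" if "e > 0" for e
  using that V(2) by (simp add: field_simps)
 have "Cauchy I"
 proof (rule CauchyI)
  fix e :: real assume e: "e > 0"
  obtain N where N: "!!k \<omega>. k \<ge> N ==> \<omega> \<in> {a..b} ==> norm (\<phi> k \<omega> - \<psi> \<omega>) \<le> e / (4 * (V + 1))"
   using u'[OF e] by blast
  have "norm (I m - I n) < e" if "m \<ge> N" "n \<ge> N" for m n
  proof -
   have "norm (\<phi> m \<omega> - \<phi> n \<omega>) \<le> 2 * (e / (4 * (V + 1)))" if "\<omega> \<in> {a..b}" for \<omega>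
    using N[OF \<open>m \<ge> N\<close> that] N[OF \<open>n \<ge> N\<close> that] norm_triangle_ineq4[of "\<phi> m \<omega> - \<psi> \<omega>" "\<phi> n \<omega> - \<psi> \<omega>"] by simp
   then have "norm (I m - I n) \<le> V * (2 * (e / (4 * (V + 1))))"
    using e V(2) by (intro stieltjes_integral_bound[OF has_stieltjes_integral_diff[OF I I] V(1)]) auto
   then have "norm (I m - I n) \<le> 2 * (V * (e / (4 * (V + 1))))" by (simp only: mult.left_commute)
   then show ?thesis using Ve[OF e] e by linarith
  qed
  then show "\<exists>M. \<forall>m\<ge>M. \<forall>n\<ge>M. norm (I m - I n) < e" by blast
 qed
 then obtain J where J: "I \<longlonglongrightarrow> J" using Cauchy_convergent convergentD by blast
 have "has_stieltjes_integral Z \<psi> J a b"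
 proof (rule has_stieltjes_integralI)
  fix e :: real assume e: "e > 0"
  obtain N where N: "!!k \<omega>. k \<ge> N ==> \<omega> \<in> {a..b} ==> norm (\<phi> k \<omega> - \<psi> \<omega>) \<le> e / (4 * (V + 1))"
   using u'[OF e] by blast
  obtain M where M: "!!k. k \<ge> M ==> norm (I k - J) < e / 4"
   using LIMSEQ_D[OF J, of "e/4"] e by auto
  define k where "k = max M N"
  obtain \<gamma> where g: "gauge \<gamma>"
   "!!p. p tagged_division_of {a..b} ==> \<gamma> fine p ==> norm (stieltjes_sum Z (\<phi> k) p - I k) < e / 4"
  proof -
   have e4: "e / 4 > 0" using e by simp
   show ?thesis using has_stieltjes_integralD[OF I e4, of k] that by blast
  qed
  have "norm (stieltjes_sum Z \<psi> p - J) < e" if p: "p tagged_division_of {a..b}" "\<gamma> fine p" for p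
  proof -
   have "norm (stieltjes_sum Z (\<lambda>\<omega>. \<phi> k \<omega> - \<psi> \<omega>) p) \<le> V * (e / (4 * (V + 1)))"
    using e V(2) N[of k] by (intro stieltjes_sum_bound[OF p(1) V(1)]) (auto simp: k_def)
   then have 1: "norm (stieltjes_sum Z (\<phi> k) p - stieltjes_sum Z \<psi> p) \<le> e / 4"
    using Ve[OF e] unfolding stieltjes_sum_linear by linarith
   have 2: "norm (stieltjes_sum Z (\<phi> k) p - I k) < e / 4" using g(2)[OF p] .
   have 3: "norm (I k - J) < e / 4" using M[of k] by (simp add: k_def)
   have "norm (stieltjes_sum Z \<psi> p - J) = norm (- (stieltjes_sum Z (\<phi> k) p - stieltjes_sum Z \<psi> p)
     + ((stieltjes_sum Z (\<phi> k) p - I k) + (I k - J)))" by simp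
   also have "\<dots> \<le> norm (stieltjes_sum Z (\<phi> k) p - stieltjes_sum Z \<psi> p) +
     (norm (stieltjes_sum Z (\<phi> k) p - I k) + norm (I k - J))"
    by (metis add_left_mono norm_minus_cancel norm_triangle_ineq norm_triangle_le)
   finally show ?thesis using 1 2 3 e by linarith
  qed
  then show "\<exists>\<gamma>. gauge \<gamma> \<and> (\<forall>p. p tagged_division_of {a..b} \<and> \<gamma> fine p --> norm (stieltjes_sum Z \<psi> p - J) < e)"
   using g(1) by blast
 qed
 then show ?thesis using J by blast
qed

lemma has_stieltjes_integral_const:
 assumes "a \<le> b"
 shows "has_stieltjes_integral Z (\<lambda>\<omega>. c) ((Z b - Z a) *v c) a b"
proof (rule has_stieltjes_integralI)
 fix e :: real assume e: "e > 0"
 have "stieltjes_sum Z (\<lambda>\<omega>. c) p = (Z b - Z a) *v c" if "p tagged_division_of {a..b}" for p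
 proof -
  have "stieltjes_sum Z (\<lambda>\<omega>. c) p = (\<Sum>(\<omega>, k)\<in>p. Z (Sup k) *v c - Z (Inf k) *v c)"
   unfolding stieltjes_sum_def by (simp add: matrix_vector_mult_diff_rdistrib)
  also have "\<dots> = Z b *v c - Z a *v c"
   using additive_tagged_division_1[OF assms that, of "\<lambda>t. Z t *v c"] .
  finally show ?thesis by (simp add: matrix_vector_mult_diff_rdistrib)
 qed
 then show "\<exists>\<gamma>. gauge \<gamma> \<and> (\<forall>p. p tagged_division_of {a..b} \<and> \<gamma> fine p -->
   norm (stieltjes_sum Z (\<lambda>\<omega>. c) p - (Z b - Z a) *v c) < e)"
  using e by (intro exI[of _ "\<lambda>x. ball x 1"]) auto
qed

text \<open>
  The gauge forces \<open>c\<close> to be the tag of every interval that contains it. Comparing with the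
  telescoping sum for the integrator stopped at \<open>c\<close>, only the interval that reaches from the left
  to \<open>c\<close> makes a difference, and there the integrator is left-continuous.
\<close>

lemma has_stieltjes_integral_step:
 fixes Z :: "real => real ^ 'n ^ 'n"
 assumes ab: "a \<le> b" "c \<le> b" and left: "continuous (at_left c) Z"
 shows "has_stieltjes_integral Z (\<lambda>\<omega>. if \<omega> < c then 0 else v) ((Z b - Z (max a c)) *v v) a b"
proof (rule has_stieltjes_integralI)
 fix e :: real assume e: "e > 0"
 define e' where "e' = e / 2 / (norm v + 1)"
 have e': "e' > 0" using e by (simp add: e'_def add_nonneg_pos)
 have "(Z \<longlongrightarrow> Z c) (at_left c)" using left by (simp add: continuous_within)
 then have "\<forall>\<^sub>F x in at_left c. dist (Z x) (Z c) < e'" using e' by (rule tendstoD)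
 then obtain d0 where d0: "d0 < c" "!!x. d0 < x ==> x < c ==> dist (Z x) (Z c) < e'"
  unfolding eventually_at_left_field by blast
 define d where "d = c - d0"
 have d: "d > 0" "!!x. c - d < x ==> x \<le> c ==> norm (Z x - Z c) < e'"
 proof -
  show "d > 0" using d0(1) by (simp add: d_def)
  show "norm (Z x - Z c) < e'" if "c - d < x" "x \<le> c" for x
   using d0(2)[of x] e' that by (cases "x = c") (auto simp: d_def dist_norm)
 qed
 define \<gamma> where "\<gamma> x = (if x = c then ball c d else ball x \<bar>x - c\<bar>)" for x
 have "gauge \<gamma>" unfolding gauge_def \<gamma>_def using d(1) by auto
 moreover have "norm (stieltjes_sum Z (\<lambda>\<omega>. if \<omega> < c then 0 else v) p - (Z b - Z (max a c)) *v v) < e"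
  if p: "p tagged_division_of {a..b}" "\<gamma> fine p" for p
 proof -
  have fin: "finite p" using p(1) by blast
  have iv: "k = {Inf k..Sup k}" "Inf k \<le> Sup k" "\<omega> \<in> k" "k \<subseteq> \<gamma> \<omega>" if "(\<omega>, k) \<in> p" for \<omega> k
  proof -
   have kd: "k \<in> snd ` p" using that by force
   have dv: "snd ` p division_of {a..b}" using division_of_tagged_division[OF p(1)] .
   show "k = {Inf k..Sup k}" "Inf k \<le> Sup k"
    by (fact division_of_real_interval[OF dv order_refl kd])+
   show "\<omega> \<in> k" using tagged_division_ofD(2)[OF p(1) that] .
   show "k \<subseteq> \<gamma> \<omega>" using p(2) that unfolding fine_def by auto
  qed
  define D where "D = (\<lambda>(\<omega>, k). (Z (Sup k) - Z (Inf k)) *v (if \<omega> < c then 0 else v)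
    - (Z (max (Sup k) c) - Z (max (Inf k) c)) *v v)"
  define p1 where "p1 = {x \<in> p. fst x = c \<and> Inf (snd x) < c}"
  have D0: "D x = 0" if "x \<in> p - p1" for x
  proof -
   obtain \<omega> k where x1: "x = (\<omega>, k)" by (rule prod.exhaust)
   have x: "x = (\<omega>, k)" "(\<omega>, k) \<in> p" using that x1 by auto
   note I = iv[OF x(2)]
   have I': "Inf k \<in> k" "Sup k \<in> k" "Inf k \<le> \<omega>" "\<omega> \<le> Sup k" using I(1,2,3) by (metis atLeastAtMost_iff order.refl)+
   have "\<not> (\<omega> = c \<and> Inf k < c)" using that x by (simp add: p1_def)
   then consider "\<omega> = c" "Inf k \<ge> c" | "\<omega> < c" | "\<omega> > c" by force
   then show ?thesis
   proof cases
    case 1 then show ?thesis using I' by (simp add: D_def x max_def)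
   next
    case 2
    then have "Sup k \<in> ball \<omega> (c - \<omega>)" using I(4) I'(2) by (auto simp: \<gamma>_def)
    then have "Sup k < c" by (auto simp: dist_real_def)
    then show ?thesis using 2 I' by (simp add: D_def x max_def)
   next
    case 3
    then have "Inf k \<in> ball \<omega> (\<omega> - c)" using I(4) I'(1) by (auto simp: \<gamma>_def)
    then have "Inf k > c" by (auto simp: dist_real_def)
    then show ?thesis using 3 I' by (simp add: D_def x max_def)
   qed
  qed
  have D1: "norm (D x) \<le> e' * norm v" if "x \<in> p1" for x
  proof -
   obtain \<omega> k where x1: "x = (\<omega>, k)" by (rule prod.exhaust)
   have x: "x = (c, k)" "(c, k) \<in> p" "Inf k < c" using that x1 by (auto simp: p1_def)
   note I = iv[OF x(2)]
   have I': "Inf k \<in> k" "c \<le> Sup k" using I(1,2,3) by (metis atLeastAtMost_iff order.refl)+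
   have "Inf k \<in> ball c d" using I(4) I'(1) by (auto simp: \<gamma>_def)
   then have "norm (Z (Inf k) - Z c) < e'" using d(2)[of "Inf k"] x(3) by (auto simp: dist_real_def)
   moreover have "D x = (Z c - Z (Inf k)) *v v"
    using x I' by (simp add: D_def max_def matrix_vector_mult_diff_rdistrib)
   ultimately show ?thesis
    using norm_matrix_vector_mult_le[of "Z c - Z (Inf k)" v]
    by (smt (verit) mult_right_mono norm_ge_zero norm_minus_commute)
  qed
  have "card p1 \<le> 1"
  proof (rule ccontr)
   assume "\<not> card p1 \<le> 1"
   then obtain x y where xy: "x \<in> p1" "y \<in> p1" "x \<noteq> y"
   proof -
    have "finite p1" using fin by (simp add: p1_def)
    then show ?thesis using \<open>\<not> card p1 \<le> 1\<close> card_le_Suc0_iff_eq[of p1] that unfolding One_nat_def by blast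
   qed
   obtain u k where x1: "x = (u, k)" by (rule prod.exhaust)
   obtain w l where y1: "y = (w, l)" by (rule prod.exhaust)
   have kl: "x = (c, k)" "y = (c, l)" "(c, k) \<in> p" "(c, l) \<in> p" "Inf k < c" "Inf l < c"
    using xy x1 y1 by (auto simp: p1_def)
   have "interior k \<inter> interior l = {}" using tagged_division_ofD(5)[OF p(1) kl(3,4)] xy(3) kl by auto
   moreover have "interior k = {Inf k<..<Sup k}" "interior l = {Inf l<..<Sup l}"
    using iv(1)[OF kl(3)] iv(1)[OF kl(4)] by (metis interior_atLeastAtMost_real)+
   moreover have "c \<le> Sup k" "c \<le> Sup l" using iv(1,3)[OF kl(3)] iv(1,3)[OF kl(4)] by (metis atLeastAtMost_iff)+
   ultimately have "{max (Inf k) (Inf l)<..<c} = {}" by fastforce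
   then show False using kl(5,6) by (metis greaterThanLessThan_empty_iff max_less_iff_conj not_le)
  qed
  have "stieltjes_sum Z (\<lambda>\<omega>. if \<omega> < c then 0 else v) p =
    (\<Sum>x\<in>p. D x) + (\<Sum>(\<omega>, k)\<in>p. Z (max (Sup k) c) *v v - Z (max (Inf k) c) *v v)"
   unfolding stieltjes_sum_def D_def sum.distrib[symmetric]
   by (intro sum.cong) (auto simp: matrix_vector_mult_diff_rdistrib)
  also have "(\<Sum>(\<omega>, k)\<in>p. Z (max (Sup k) c) *v v - Z (max (Inf k) c) *v v) = (Z b - Z (max a c)) *v v"
   using additive_tagged_division_1[OF ab(1) p(1), of "\<lambda>t. Z (max t c) *v v"] ab(2)
   by (simp add: matrix_vector_mult_diff_rdistrib max_def)
  also have "(\<Sum>x\<in>p. D x) = (\<Sum>x\<in>p1. D x)"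
   using fin D0 by (intro sum.mono_neutral_right) (auto simp: p1_def)
  finally have "norm (stieltjes_sum Z (\<lambda>\<omega>. if \<omega> < c then 0 else v) p - (Z b - Z (max a c)) *v v) = norm (\<Sum>x\<in>p1. D x)"
   by simp
  also have "\<dots> \<le> (\<Sum>x\<in>p1. e' * norm v)" by (intro order.trans[OF norm_sum] sum_mono D1)
  also have "\<dots> \<le> e' * norm v" using \<open>card p1 \<le> 1\<close> e' by (simp add: mult_left_le_one_le mult_nonneg_nonneg)
  also have "\<dots> \<le> e' * (norm v + 1)" using e' by (intro mult_left_mono) auto
  also have "\<dots> = e / 2"
  proof -
   have "e / 2 / m * m = e / 2" if "m \<noteq> 0" for m :: real using that by simp
   moreover have "norm v + 1 \<noteq> 0" using norm_ge_zero[of v] by linarith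
   ultimately show ?thesis unfolding e'_def by blast
  qed
  also have "\<dots> < e" using e by simp
  finally show ?thesis .
 qed
 ultimately show "\<exists>\<gamma>. gauge \<gamma> \<and> (\<forall>p. p tagged_division_of {a..b} \<and> \<gamma> fine p -->
   norm (stieltjes_sum Z (\<lambda>\<omega>. if \<omega> < c then 0 else v) p - (Z b - Z (max a c)) *v v) < e)"
  by (intro exI[of _ \<gamma>]) simp
qed

definition grid :: "real => nat => nat => real" where
 "grid r N i = - r + r * real i / real (Suc N)"

text \<open>
  The step function that takes the value of \<open>\<phi>\<close> at the last node, written as a sum of single steps so that
  \<open>has_stieltjes_integral_step\<close> applies to each summand.
\<close>

definition step_approx :: "real => (real => real ^ 'n) => nat => real => real ^ 'n" where
 "step_approx r \<phi> N \<omega> = \<phi> (- r) + (\<Sum>i\<in>{1..N}. if \<omega> < grid r N i then 0 else \<phi> (grid r N i) - \<phi> (grid r N (i - 1)))"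

lemma step_approx_uniform:
 fixes \<phi> :: "real => real ^ 'n"
 assumes r: "r > 0" and \<phi>: "continuous_on {- r..0} \<phi>" and e: "e > 0"
 shows "\<forall>\<^sub>F N in sequentially. \<forall>\<omega>\<in>{- r..0}. norm (step_approx r \<phi> N \<omega> - \<phi> \<omega>) \<le> e"
proof -
 have "uniformly_continuous_on {- r..0} \<phi>" using \<phi> by (intro compact_uniformly_continuous) auto
 then obtain d where d: "d > 0" "!!x y. x \<in> {- r..0} ==> y \<in> {- r..0} ==> dist y x < d ==> dist (\<phi> y) (\<phi> x) < e"
  using e unfolding uniformly_continuous_on_def by metis
 obtain M :: nat where M: "r / d < real M" using reals_Archimedean2 by blast
 have "norm (step_approx r \<phi> N \<omega> - \<phi> \<omega>) \<le> e" if N: "N \<ge> M" and w: "\<omega> \<in> {- r..0}" for N \<omega>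
 proof -
  define h where "h = r / real (Suc N)"
  have h: "h > 0" "h < d"
  proof -
   show "h > 0" using r by (simp add: h_def)
   have "r < d * real M" using M d(1) by (simp add: field_simps)
   also have "\<dots> < d * real (Suc N)" using N d(1) by simp
   finally show "h < d" by (simp add: h_def field_simps)
  qed
  have g: "grid r N i = - r + h * real i" for i by (simp add: grid_def h_def)
  define j where "j = min N (nat \<lfloor>(\<omega> + r) / h\<rfloor>)"
  have fl: "0 \<le> (\<omega> + r) / h" using w h(1) by simp
  have le: "grid r N i \<le> \<omega> \<longleftrightarrow> i \<le> nat \<lfloor>(\<omega> + r) / h\<rfloor>" for i
  proof -
   have "grid r N i \<le> \<omega> \<longleftrightarrow> real i \<le> (\<omega> + r) / h" unfolding g using h(1) by (simp add: field_simps)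
   also have "\<dots> \<longleftrightarrow> i \<le> nat \<lfloor>(\<omega> + r) / h\<rfloor>" using fl by (simp add: le_nat_iff le_floor_iff)
   finally show ?thesis .
  qed
  have "(\<Sum>i\<in>{1..N}. if \<omega> < grid r N i then 0 else \<phi> (grid r N i) - \<phi> (grid r N (i - 1)))
    = (\<Sum>i\<in>{1..j}. \<phi> (grid r N i) - \<phi> (grid r N (i - 1)))"
  proof (rule sum.mono_neutral_cong_right)
   show "{1..j} \<subseteq> {1..N}" by (auto simp: j_def)
   show "\<forall>i\<in>{1..N} - {1..j}. (if \<omega> < grid r N i then 0 else \<phi> (grid r N i) - \<phi> (grid r N (i - 1))) = 0"
    using le by (auto simp: j_def not_less)
   show "(if \<omega> < grid r N i then 0 else \<phi> (grid r N i) - \<phi> (grid r N (i - 1))) = \<phi> (grid r N i) - \<phi> (grid r N (i - 1))"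
    if "i \<in> {1..j}" for i using le[of i] that by (auto simp: j_def)
  qed simp
  also have "\<dots> = \<phi> (grid r N j) - \<phi> (grid r N 0)"
   using sum_telescope''[of 0 j "\<lambda>i. \<phi> (grid r N i)"] by (simp add: sum.atLeast1_atMost_eq atLeast0AtMost)
  finally have eq: "step_approx r \<phi> N \<omega> = \<phi> (grid r N j)" by (simp add: step_approx_def grid_def)
  have jw: "grid r N j \<le> \<omega>" using le[of j] by (simp add: j_def)
  have wj: "\<omega> \<le> grid r N j + h"
  proof (cases "nat \<lfloor>(\<omega> + r) / h\<rfloor> \<le> N")
   case True
   then have "\<not> grid r N (Suc j) \<le> \<omega>" using le[of "Suc j"] by (simp add: j_def)
   then show ?thesis unfolding g by (simp add: algebra_simps)
  next
   case False
   then have "grid r N j + h = - r + h * real (Suc N)" unfolding g j_def by (simp add: algebra_simps)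
   also have "\<dots> = 0" by (simp add: h_def)
   finally show ?thesis using w by simp
  qed
  have "- r \<le> grid r N j" unfolding g using h(1) by simp
  then have "dist (\<phi> (grid r N j)) (\<phi> \<omega>) < e"
   using jw wj w h by (intro d(2)) (auto simp: dist_real_def)
  then show ?thesis unfolding eq dist_norm by simp
 qed
 then show ?thesis unfolding eventually_sequentially by blast
qed

lemma has_stieltjes_integral_step_approx:
 fixes Z :: "real => real ^ 'n ^ 'n"
 assumes r: "r > 0" and left: "!!\<omega>. \<omega> \<in> {- r<..<0} ==> continuous (at_left \<omega>) Z"
 shows "has_stieltjes_integral Z (step_approx r \<phi> N)
  ((Z 0 - Z (- r)) *v \<phi> (- r) + (\<Sum>i\<in>{1..N}. (Z 0 - Z (grid r N i)) *v (\<phi> (grid r N i) - \<phi> (grid r N (i - 1))))) (- r) 0"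
 unfolding step_approx_def[abs_def]
proof (intro has_stieltjes_integral_add has_stieltjes_integral_sum)
 show "has_stieltjes_integral Z (\<lambda>\<omega>. \<phi> (- r)) ((Z 0 - Z (- r)) *v \<phi> (- r)) (- r) 0"
  using r by (intro has_stieltjes_integral_const) auto
 fix i assume i: "i \<in> {1..N}"
 have g: "- r < grid r N i" "grid r N i < 0"
 proof -
  have "r * real i > 0" using r i by auto
  then show "- r < grid r N i" by (simp add: grid_def)
  have "r * real i < r * real (Suc N)" using r i by (intro mult_strict_left_mono) auto
  then have "r * real i / real (Suc N) < r" by (simp add: pos_divide_less_eq del: of_nat_Suc)
  then show "grid r N i < 0" by (simp add: grid_def)
 qed
 have c: "continuous (at_left (grid r N i)) Z" by (rule left) (use g in auto)
 show "has_stieltjes_integral Z (\<lambda>\<omega>. if \<omega> < grid r N i then 0 else \<phi> (grid r N i) - \<phi> (grid r N (i - 1)))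
   ((Z 0 - Z (grid r N i)) *v (\<phi> (grid r N i) - \<phi> (grid r N (i - 1)))) (- r) 0"
 proof -
  have "max (- r) (grid r N i) = grid r N i" using g by simp
  then show ?thesis
   using has_stieltjes_integral_step[of "- r" 0 "grid r N i" Z "\<phi> (grid r N i) - \<phi> (grid r N (i - 1))", OF _ _ c] g r
   by simp
 qed
qed simp

section \<open>Measurability of the kernel and of the linear equation\<close>

lemma AE_lborel_ex_between:
 assumes "AE t in lborel. P (t::real)" "a < b"
 obtains t where "a < t" "t < b" "P t"
proof -
 obtain N where N: "negligible N" "!!t. t \<notin> N ==> P t" using AE_lborel_negligible[OF assms(1)] by blast
 have "\<not> {a<..<b} \<subseteq> N"
  using N(1) negligible_subset open_not_negligible[of "{a<..<b}"] assms(2) by auto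
 then obtain t where "t \<in> {a<..<b}" "t \<notin> N" by blast
 then show ?thesis using N(2) by (intro that[of t]) auto
qed

text \<open>
  A Lebesgue measurable function of two variables agrees with a Borel function off a null set. By
  Fubini almost all sections of that set are null, but nothing is said about an individual section.
\<close>

lemma delay_kernel_measurable_section_AE:
 fixes \<zeta> :: "real => real => real ^ ('n::finite) ^ 'n"
 assumes "(\<lambda>(t, \<omega>). \<zeta> t \<omega>) \<in> borel_measurable lebesgue"
 shows "AE \<omega> in lborel. (\<lambda>t. \<zeta> t \<omega>) \<in> borel_measurable lebesgue"
proof -
 have "AE \<omega> in lborel. (\<lambda>t. \<zeta> t \<omega> \<bullet> i) \<in> borel_measurable lebesgue" for i
 proof -
  have "(\<lambda>x. (\<lambda>(t, \<omega>). \<zeta> t \<omega>) x \<bullet> i) \<in> borel_measurable lebesgue"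
   using assms by (intro borel_measurable_inner) auto
  then obtain g where g: "g \<in> borel_measurable lborel" "AE x in lborel. (\<lambda>(t, \<omega>). \<zeta> t \<omega>) x \<bullet> i = g x"
   using completion_ex_borel_measurable_real by blast
  obtain N where N0: "{x \<in> space lborel. \<not> (\<lambda>(t, \<omega>). \<zeta> t \<omega>) x \<bullet> i = g x} \<subseteq> N"
   "emeasure lborel N = 0" "N \<in> sets lborel"
   by (rule AE_E[OF g(2)])
  then have N: "N \<in> null_sets lborel" by (auto intro: null_setsI)
  have gz: "g (t, \<omega>) = \<zeta> t \<omega> \<bullet> i" if "(t, \<omega>) \<notin> N" for t \<omega>
  proof -
   have "(t, \<omega>) \<notin> {x \<in> space lborel. \<not> (\<lambda>(t, \<omega>). \<zeta> t \<omega>) x \<bullet> i = g x}" using N0(1) that by blast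
   then show ?thesis by simp
  qed
  have Nl: "N \<in> null_sets (lborel \<Otimes>\<^sub>M lborel)" using N by (simp add: lborel_prod)
  then have "AE x in lborel \<Otimes>\<^sub>M lborel. x \<notin> N" by (rule AE_not_in)
  then have "AE t in lborel. AE \<omega> in lborel. (t, \<omega>) \<notin> N" by (rule lborel_pair.AE_pair)
  moreover have "{x \<in> space (lborel \<Otimes>\<^sub>M lborel). (fst x, snd x) \<notin> N} \<in> sets (lborel \<Otimes>\<^sub>M lborel)"
  proof -
   have "{x \<in> space (lborel \<Otimes>\<^sub>M lborel). (fst x, snd x) \<notin> N} = space (lborel \<Otimes>\<^sub>M lborel) - N" by auto
   then show ?thesis using Nl by (metis null_setsD2 sets.compl_sets)
  qed
  ultimately have "AE \<omega> in lborel. AE t in lborel. (t, \<omega>) \<notin> N"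
   using lborel_pair.AE_commute[of "\<lambda>t \<omega>. (t, \<omega>) \<notin> N"] by simp
  then show ?thesis
  proof (rule AE_mp[OF _ AE_I2], intro impI)
   fix \<omega> assume \<omega>: "AE t in lborel. (t, \<omega>) \<notin> N"
   then have ae: "AE t in lborel. g (t, \<omega>) = \<zeta> t \<omega> \<bullet> i"
    by (rule AE_mp[OF _ AE_I2]) (use gz in auto)
   have "(\<lambda>t. g (t, \<omega>)) \<in> borel_measurable lborel"
    using g(1) by (intro measurable_compose[OF _ g(1)]) (simp add: lborel_prod[symmetric])
   then have "(\<lambda>t. g (t, \<omega>)) \<in> borel_measurable lebesgue" by (rule measurable_completion)
   then show "(\<lambda>t. \<zeta> t \<omega> \<bullet> i) \<in> borel_measurable lebesgue"
    using AE_completion[OF ae] by (rule borel_measurable_AE)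
  qed
 qed
 then have "AE \<omega> in lborel. \<forall>i\<in>Basis. (\<lambda>t. \<zeta> t \<omega> \<bullet> i) \<in> borel_measurable lebesgue"
  by (intro AE_finite_allI) auto
 then show ?thesis by (rule AE_mp[OF _ AE_I2]) (auto simp: borel_measurable_euclidean_space[of "\<lambda>t. \<zeta> t _"])
qed

locale kernel =
 fixes r :: real and \<zeta> :: "real => real => real ^ ('n::finite) ^ 'n"
 assumes r: "r > 0" and kernel: "delay_kernel r \<zeta>"
begin

lemma zeta_right: "\<omega> \<ge> 0 ==> \<zeta> t \<omega> = 0"
 using kernel unfolding delay_kernel_def by blast

lemma zeta_left: "\<omega> \<le> - r ==> \<zeta> t \<omega> = \<zeta> t (- r)"
 using kernel unfolding delay_kernel_def by blast

lemma zeta_cont: "\<omega> \<in> {- r<..<0} ==> continuous (at_left \<omega>) (\<zeta> t)"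
 using kernel unfolding delay_kernel_def by blast

text \<open>
  Left continuity passes measurability from almost every \<open>\<omega>\<close> to every \<open>\<omega>\<close> inside the interval; outside, \<open>\<zeta>\<close> is
  constant in \<open>\<omega>\<close>.
\<close>

lemma zeta_measurable: "(\<lambda>t. \<zeta> t \<omega>) \<in> borel_measurable lebesgue"
proof -
 have ae: "AE \<omega> in lborel. (\<lambda>t. \<zeta> t \<omega>) \<in> borel_measurable lebesgue"
  by (rule delay_kernel_measurable_section_AE) (use kernel in \<open>unfold delay_kernel_def, blast\<close>)
 consider "\<omega> \<ge> 0" | "\<omega> \<le> - r" | "\<omega> \<in> {- r<..<0}" by force
 then show ?thesis
 proof cases
  case 1 then show ?thesis by (simp add: zeta_right)
 next
  case 2
  obtain \<omega>' where "\<omega>' < - r" "(\<lambda>t. \<zeta> t \<omega>') \<in> borel_measurable lebesgue"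
   using AE_lborel_ex_between[OF ae, of "- r - 1" "- r"] by auto
  moreover have "\<zeta> t \<omega> = \<zeta> t \<omega>'" for t using zeta_left[of \<omega> t] zeta_left[of \<omega>' t] 2 \<open>\<omega>' < - r\<close> by simp
  ultimately show ?thesis by simp
 next
  case 3
  have "\<exists>\<omega>'. \<omega> - 1 / real (Suc k) < \<omega>' \<and> \<omega>' < \<omega> \<and> (\<lambda>t. \<zeta> t \<omega>') \<in> borel_measurable lebesgue" for k
   using AE_lborel_ex_between[OF ae, of "\<omega> - 1 / real (Suc k)" \<omega>] by (metis diff_less_eq less_add_same_cancel1 of_nat_0_less_iff zero_less_Suc zero_less_divide_1_iff)
  then obtain w where w: "!!k. \<omega> - 1 / real (Suc k) < w k" "!!k. w k < \<omega>" "!!k. (\<lambda>t. \<zeta> t (w k)) \<in> borel_measurable lebesgue"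
   by metis
  have "w \<longlonglongrightarrow> \<omega>"
  proof (rule tendsto_sandwich[of "\<lambda>k. \<omega> - 1 / real (Suc k)" _ _ "\<lambda>k. \<omega>"])
   show "(\<lambda>k. \<omega> - 1 / real (Suc k)) \<longlonglongrightarrow> \<omega>"
    using tendsto_diff[OF tendsto_const LIMSEQ_inverse_real_of_nat] by (simp add: inverse_eq_divide)
  qed (use w in \<open>auto simp: less_imp_le\<close>)
  then have "filterlim w (at_left \<omega>) sequentially"
   using w(2) by (auto simp: filterlim_at less_imp_neq)
  then have "(\<lambda>k. \<zeta> t (w k)) \<longlonglongrightarrow> \<zeta> t \<omega>" for t
   using zeta_cont[OF 3, of t] unfolding continuous_within by (rule filterlim_compose[rotated])
  then show ?thesis by (rule borel_measurable_LIMSEQ_metric[OF w(3)])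
 qed
qed

text \<open>
  On a grid of \<open>\<omega>\<close> the claim is that of \<open>zeta_measurable\<close>; the grid points approach \<open>s - t\<close> from the left,
  where \<open>\<zeta> t\<close> is continuous.
\<close>

lemma zeta_diagonal_measurable: "(\<lambda>t. if t \<le> s then 0 else \<zeta> t (s - t)) \<in> borel_measurable lebesgue"
proof -
 define c :: "nat => real" where "c k = 2 ^ k" for k
 have cp: "c k > 0" for k by (simp add: c_def)
 define j where "j k t = \<lceil>(s - t) * c k\<rceil>" for k t
 define w where "w k t = (of_int (j k t) - 1) / c k" for k t
 have w: "w k t < s - t" "s - t - 1 / c k \<le> w k t" for k t
 proof -
  have j: "of_int (j k t) - 1 < (s - t) * c k" "(s - t) * c k \<le> of_int (j k t)"
   unfolding j_def using ceiling_correct[of "(s - t) * c k"] by auto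
  then show "w k t < s - t" unfolding w_def using cp[of k] by (simp add: pos_divide_less_eq)
  have "s - t - 1 / c k = ((s - t) * c k - 1) / c k" using cp[of k] by (simp add: field_simps)
  also have "\<dots> \<le> w k t" unfolding w_def using j cp[of k] by (intro divide_right_mono) auto
  finally show "s - t - 1 / c k \<le> w k t" .
 qed
 have meas: "(\<lambda>t. if t \<le> s then 0 else \<zeta> t (w k t)) \<in> borel_measurable lebesgue" for k
 proof -
  have "(\<lambda>t. \<zeta> t ((of_int (j k t) - 1) / c k)) \<in> borel_measurable lebesgue"
  proof (rule measurable_compose_countable[where f = "\<lambda>i t. \<zeta> t ((of_int i - 1) / c k)" and g = "j k"])
   show "(\<lambda>t. \<zeta> t ((of_int i - 1) / c k)) \<in> borel_measurable lebesgue" for i by (rule zeta_measurable)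
   show "j k \<in> lebesgue \<rightarrow>\<^sub>M count_space UNIV" unfolding j_def[abs_def]
    by (intro measurable_completion) measurable
  qed
  then show ?thesis unfolding w_def by (intro measurable_If) auto
 qed
 have "(\<lambda>k. 1 / c k) \<longlonglongrightarrow> 0" unfolding c_def
  using LIMSEQ_power_zero[of "1/2::real"] by (simp add: power_divide)
 then have c0: "(\<lambda>k. s - t - 1 / c k) \<longlonglongrightarrow> s - t" for t
  using tendsto_diff[OF tendsto_const, of "\<lambda>k. 1 / c k" 0 sequentially "s - t"] by simp
 have wl: "filterlim (\<lambda>k. w k t) (at_left (s - t)) sequentially" for t
 proof -
  have "(\<lambda>k. w k t) \<longlonglongrightarrow> s - t"
   using w by (intro tendsto_sandwich[OF _ _ c0 tendsto_const]) (auto simp: less_imp_le)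
  then show ?thesis using w(1) by (auto simp: filterlim_at less_imp_neq)
 qed
 have "(\<lambda>k. if t \<le> s then 0 else \<zeta> t (w k t)) \<longlonglongrightarrow> (if t \<le> s then 0 else \<zeta> t (s - t))" for t
 proof -
  consider "t \<le> s" | "s - t \<le> - r" | "s - t \<in> {- r<..<0}" by force
  then show ?thesis
  proof cases
   case 2
   then have "\<zeta> t (w k t) = \<zeta> t (s - t)" for k using w(1)[of k t] zeta_left by (metis less_imp_le order.trans)
   then show ?thesis by simp
  next
   case 3
   have "(\<zeta> t \<longlongrightarrow> \<zeta> t (s - t)) (at_left (s - t))"
    using zeta_cont[OF 3, of t] by (simp add: continuous_within)
   then have "(\<lambda>k. \<zeta> t (w k t)) \<longlonglongrightarrow> \<zeta> t (s - t)" by (rule filterlim_compose[OF _ wl])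
   then show ?thesis by simp
  qed simp
 qed
 then show ?thesis by (rule borel_measurable_LIMSEQ_metric[OF meas])
qed

lemma variation_bound:
 "\<exists>m. (\<forall>a b. m absolutely_integrable_on {a..b}) \<and> (\<forall>t. 0 \<le> m t) \<and>
  (\<forall>t. variation_le (\<zeta> t) (- r) 0 (m t))"
proof -
 obtain m where m: "!!a b. m absolutely_integrable_on {a..b}" "!!t. variation_le (\<zeta> t) (- r) 0 (m t)"
  using kernel unfolding delay_kernel_def by blast
 have "0 \<le> m t" for t
 proof -
  have "{{- r..0}} division_of {- r..0}" using division_of_self[of "- r" "0::real"] r by simp
  then have "(\<Sum>k\<in>{{- r..0}}. norm (\<zeta> t (Sup k) - \<zeta> t (Inf k))) \<le> m t"
   using m(2)[of t] unfolding variation_le_def by blast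
  then show ?thesis by (smt (verit) norm_ge_zero sum_nonneg)
 qed
 then show ?thesis using m by blast
qed

lemma L_eq: "has_stieltjes_integral (\<zeta> t) \<phi> I (- r) 0 ==> L r \<zeta> t \<phi> = I"
 unfolding L_def by (rule the_equality) (auto dest: has_stieltjes_integral_unique)

text \<open>
  The explicit sums exhibit \<open>L r \<zeta> t \<phi>\<close> as a pointwise limit in \<open>t\<close>, which is what its measurability along
  a curve rests on.
\<close>

lemma L_continuous:
 assumes "continuous_on {- r..0} \<phi>"
 shows "has_stieltjes_integral (\<zeta> t) \<phi> (L r \<zeta> t \<phi>) (- r) 0"
  and "(\<lambda>N. (\<zeta> t 0 - \<zeta> t (- r)) *v \<phi> (- r) +
   (\<Sum>i\<in>{1..N}. (\<zeta> t 0 - \<zeta> t (grid r N i)) *v (\<phi> (grid r N i) - \<phi> (grid r N (i - 1))))) \<longlonglongrightarrow> L r \<zeta> t \<phi>"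
proof -
 obtain m where m0: "!!a b. m absolutely_integrable_on {a..b}" "!!t. 0 \<le> m t"
  "!!t. variation_le (\<zeta> t) (- r) 0 (m t)"
  using variation_bound by blast
 note m = m0(2,3)
 obtain J where "has_stieltjes_integral (\<zeta> t) \<phi> J (- r) 0"
  "(\<lambda>N. (\<zeta> t 0 - \<zeta> t (- r)) *v \<phi> (- r) +
   (\<Sum>i\<in>{1..N}. (\<zeta> t 0 - \<zeta> t (grid r N i)) *v (\<phi> (grid r N i) - \<phi> (grid r N (i - 1))))) \<longlonglongrightarrow> J"
  using has_stieltjes_integral_uniform_limit[OF has_stieltjes_integral_step_approx m(2,1) step_approx_uniform[OF r assms]]
   r zeta_cont by blast
 moreover from this L_eq have "L r \<zeta> t \<phi> = J" by blast
 ultimately show "has_stieltjes_integral (\<zeta> t) \<phi> (L r \<zeta> t \<phi>) (- r) 0"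
  and "(\<lambda>N. (\<zeta> t 0 - \<zeta> t (- r)) *v \<phi> (- r) +
   (\<Sum>i\<in>{1..N}. (\<zeta> t 0 - \<zeta> t (grid r N i)) *v (\<phi> (grid r N i) - \<phi> (grid r N (i - 1))))) \<longlonglongrightarrow> L r \<zeta> t \<phi>"
  by simp_all
qed

lemma segment_apply: "\<omega> \<in> {- r..0} ==> segment r x t \<omega> = x (t + \<omega>)"
 unfolding segment_def by (subst ext_cont_cancel_cbox) auto

lemma segment_continuous_on:
 assumes "continuous_on {t - r..t} x"
 shows "continuous_on {- r..0} (segment r x t)"
proof -
 have "continuous_on {- r..0} (\<lambda>\<omega>. x (t + \<omega>))"
  by (rule continuous_on_compose2[OF assms]) (auto intro!: continuous_intros)
 then show ?thesis by (rule continuous_on_eq) (simp add: segment_apply)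
qed

lemma L_segment_measurable:
 assumes x: "continuous_on UNIV x"
 shows "(\<lambda>t. L r \<zeta> t (segment r x t)) \<in> borel_measurable lebesgue"
proof (rule borel_measurable_LIMSEQ_metric)
 fix t
 have "continuous_on {- r..0} (segment r x t)"
  by (intro segment_continuous_on continuous_on_subset[OF x]) auto
 from L_continuous(2)[OF this, of t]
 show "(\<lambda>N. (\<zeta> t 0 - \<zeta> t (- r)) *v segment r x t (- r) +
   (\<Sum>i\<in>{1..N}. (\<zeta> t 0 - \<zeta> t (grid r N i)) *v (segment r x t (grid r N i) - segment r x t (grid r N (i - 1)))))
   \<longlonglongrightarrow> L r \<zeta> t (segment r x t)" .
next
 fix N
 have mv: "(\<lambda>t. (\<zeta> t u - \<zeta> t w) *v y t) \<in> borel_measurable lebesgue"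
  if "y \<in> borel_measurable lebesgue" for u w and y :: "real => real ^ 'n"
 proof -
  have "continuous_on UNIV (\<lambda>p :: (real ^ 'n ^ 'n) \<times> (real ^ 'n). fst p *v snd p)"
   by (intro bounded_bilinear.continuous_on[OF bounded_bilinear_matrix_vector_mult] continuous_intros)
  then have "(\<lambda>t. (\<lambda>p. fst p *v snd p) ((\<lambda>t. (\<zeta> t u - \<zeta> t w, y t)) t)) \<in> borel_measurable lebesgue"
   by (rule borel_measurable_continuous_on) (intro borel_measurable_Pair borel_measurable_diff zeta_measurable that)
  then show ?thesis by simp
 qed
 have sm: "(\<lambda>t. segment r x t \<omega>) \<in> borel_measurable lebesgue" for \<omega>
 proof -
  have "(\<lambda>t. x (t + clamp (- r) 0 \<omega>)) \<in> borel_measurable borel"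
   by (intro borel_measurable_continuous_onI continuous_on_compose2[OF x] continuous_intros) auto
  then have "(\<lambda>t. x (t + clamp (- r) 0 \<omega>)) \<in> borel_measurable lebesgue"
   by (intro measurable_completion) simp
  then show ?thesis by (simp add: segment_def ext_cont_def)
 qed
 show "(\<lambda>t. (\<zeta> t 0 - \<zeta> t (- r)) *v segment r x t (- r) +
   (\<Sum>i\<in>{1..N}. (\<zeta> t 0 - \<zeta> t (grid r N i)) *v (segment r x t (grid r N i) - segment r x t (grid r N (i - 1)))))
   \<in> borel_measurable lebesgue"
  by (intro borel_measurable_add borel_measurable_sum mv borel_measurable_diff sm)
qed

text \<open>
  The response of the linear equation to the discontinuous part of a solution started from \<^const>\<open>X0\<close>.
\<close>

lemma has_stieltjes_integral_jump:
 assumes "\<sigma> < t"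
 shows "has_stieltjes_integral (\<zeta> t) (segment r (\<lambda>u. if u < \<sigma> then 0 else p) t) (- (\<zeta> t (\<sigma> - t) *v p)) (- r) 0"
proof -
 have "has_stieltjes_integral (\<zeta> t) (\<lambda>\<omega>. if \<omega> < \<sigma> - t then 0 else p) (- (\<zeta> t (\<sigma> - t) *v p)) (- r) 0"
 proof (cases "\<sigma> - t \<le> - r")
  case True
  have "has_stieltjes_integral (\<zeta> t) (\<lambda>\<omega>. p) ((\<zeta> t 0 - \<zeta> t (- r)) *v p) (- r) 0"
   using r by (intro has_stieltjes_integral_const) auto
  then have "has_stieltjes_integral (\<zeta> t) (\<lambda>\<omega>. if \<omega> < \<sigma> - t then 0 else p) ((\<zeta> t 0 - \<zeta> t (- r)) *v p) (- r) 0"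
   by (rule has_stieltjes_integral_cong) (use True in auto)
  then show ?thesis using zeta_left[OF True, of t] zeta_right[of 0 t]
   unfolding matrix_vector_mult_diff_rdistrib by simp
 next
  case False
  then have "continuous (at_left (\<sigma> - t)) (\<zeta> t)" using assms by (intro zeta_cont) auto
  from has_stieltjes_integral_step[of "- r" 0 "\<sigma> - t" "\<zeta> t" p, OF _ _ this]
  show ?thesis using False assms r zeta_right[of 0 t]
   unfolding matrix_vector_mult_diff_rdistrib by (simp add: max_def)
 qed
 then show ?thesis
  by (rule has_stieltjes_integral_cong) (auto simp: segment_apply)
qed

end

section \<open>Volterra equations with a causal Lipschitz right-hand side\<close>

lemma continuous_on_integral_from:
 fixes f :: "real => 'a::euclidean_space"
 assumes f: "!!a b. f integrable_on {a..b}"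
 shows "continuous_on UNIV (\<lambda>t. integral {s..t} f)"
proof -
 have eq: "integral {s..t} f = integral {s..max s t} f" for t by (cases "s \<le> t") auto
 have "continuous (at t) (\<lambda>t. integral {s..t} f)" for t
 proof -
  define b where "b = max s t + 1"
  have "continuous_on {s..b} (\<lambda>t. integral {s..t} f)" by (rule indefinite_integral_continuous_1[OF f])
  then have "continuous_on {..<b} (\<lambda>t. integral {s..max s t} f)"
   by (rule continuous_on_compose2) (auto intro!: continuous_intros simp: b_def)
  then have "continuous_on {..<b} (\<lambda>t. integral {s..t} f)" using eq by simp
  moreover have "t \<in> {..<b}" by (auto simp: b_def)
  ultimately show ?thesis using continuous_on_eq_continuous_at[OF open_lessThan] by blast
 qed
 then show ?thesis by (simp add: continuous_on_eq_continuous_at)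
qed

lemma continuous_on_interval_bounded:
 fixes f :: "real => 'a::real_normed_vector"
 assumes "continuous_on {a..b} f"
 shows "\<exists>W. \<forall>v\<in>{a..b}. norm (f v) \<le> W"
 using compact_imp_bounded[OF compact_continuous_image[OF assms compact_Icc]] unfolding bounded_iff by blast

text \<open>
  Twice the integral makes integration against \<open>l\<close> a contraction with constant \<open>1 / 2\<close> in the weighted norm.
\<close>

definition growth :: "(real => real) => real => real => real" where
 "growth l s t = exp (2 * integral {s..t} l)"

locale rate =
 fixes l :: "real => real"
 assumes rate_integrable: "!!a b. l absolutely_integrable_on {a..b}" and rate_nonneg: "!!t. 0 \<le> l t"
begin

lemma rate_int: "l integrable_on {a..b}"
 using rate_integrable set_lebesgue_integral_eq_integral(1) by blast

lemma growth_pos: "0 < growth l s t" by (simp add: growth_def)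

lemma growth_mono: "t \<le> u ==> growth l s t \<le> growth l s u"
proof -
 assume "t \<le> u"
 then have "integral {s..t} l \<le> integral {s..u} l"
  by (intro integral_subset_le rate_int) (auto simp: rate_nonneg)
 then show ?thesis by (simp add: growth_def)
qed

lemma growth_ge_1: "1 \<le> growth l s t"
 using Henstock_Kurzweil_Integration.integral_nonneg[OF rate_int, of s t] rate_nonneg by (simp add: growth_def)

lemma growth_before: "t \<le> s ==> growth l s t = 1"
 unfolding growth_def by (cases "t = s") auto

lemma continuous_growth: "continuous_on A (growth l s)"
 unfolding growth_def[abs_def]
 by (intro continuous_intros continuous_on_subset[OF continuous_on_integral_from[OF rate_int]]) auto

lemma integral_growth:
 assumes "s \<le> t"
 shows "((\<lambda>u. l u * growth l s u) has_integral (growth l s t - 1) / 2) {s..t}"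
 unfolding growth_def using integral_exp_integral(1)[of l s t] rate_integrable rate_nonneg assms by blast

lemma norm_integral_le_growth:
 fixes \<psi> :: "real => 'a::euclidean_space"
 assumes st: "s \<le> t" and \<psi>: "\<psi> integrable_on {s..t}" and N: "negligible N"
  and b: "!!u. u \<in> {s..t} - N ==> norm (\<psi> u) \<le> l u * (B * growth l s u)" and B: "0 \<le> B"
 shows "norm (integral {s..t} \<psi>) \<le> B * (growth l s t - 1) / 2"
proof -
 define \<psi>' where "\<psi>' u = (if u \<in> N then 0 else \<psi> u)" for u
 have eq: "integral {s..t} \<psi> = integral {s..t} \<psi>'"
  by (rule integral_spike[OF N]) (auto simp: \<psi>'_def)
 have "\<psi>' integrable_on {s..t}" by (rule integrable_spike[OF \<psi> N]) (auto simp: \<psi>'_def)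
 moreover have I: "((\<lambda>u. B * (l u * growth l s u)) has_integral B * ((growth l s t - 1) / 2)) {s..t}"
  by (rule has_integral_mult_right[OF integral_growth[OF st]])
 moreover have "norm (\<psi>' u) \<le> B * (l u * growth l s u)" if "u \<in> {s..t}" for u
  using b[of u] that B rate_nonneg[of u] growth_pos[of s u] by (auto simp: \<psi>'_def mult_ac)
 ultimately have "norm (integral {s..t} \<psi>') \<le> integral {s..t} (\<lambda>u. B * (l u * growth l s u))"
  by (intro integral_norm_bound_integral) auto
 also have "\<dots> = B * ((growth l s t - 1) / 2)" using I by blast
 finally show ?thesis unfolding eq by simp
qed

text \<open>
  A form of Gronwall's lemma in which \<open>w\<close> need not be continuous. The weight \<open>growth l s\<close> turns
  integration against \<open>l\<close> into a map of norm at most \<open>1 / 2\<close>.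
\<close>

lemma gronwall_causal:
 fixes w :: "real => 'a::euclidean_space"
 assumes sb: "s \<le> b" and w: "!!v. v \<in> {s..b} ==> norm (w v) \<le> W" and before: "!!v. v \<le> s ==> norm (w v) \<le> \<eta>"
  and \<psi>: "!!t. t \<in> {s..b} ==> \<psi> integrable_on {s..t}" and N: "negligible N"
  and eq: "!!t. t \<in> {s..b} ==> norm (w t - integral {s..t} \<psi>) \<le> \<eta>"
  and lip: "!!u B. u \<in> {s..b} - N ==> 0 \<le> B ==> (!!v. v \<le> u ==> norm (w v) \<le> B) ==> norm (\<psi> u) \<le> l u * B"
  and t: "t \<in> {s..b}"
 shows "norm (w t) \<le> 2 * \<eta> * growth l s t"
proof -
 have eta: "0 \<le> \<eta>" using before[OF order_refl] norm_ge_zero[of "w s"] by linarith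
 define S where "S = (SUP v\<in>{s..b}. norm (w v) / growth l s v)"
 have bdd: "bdd_above ((\<lambda>v. norm (w v) / growth l s v) ` {s..b})"
 proof (rule bdd_aboveI2)
  fix v assume v: "v \<in> {s..b}"
  show "norm (w v) / growth l s v \<le> W"
   using w[OF v] growth_ge_1[of s v] growth_pos[of s v] norm_ge_zero[of "w v"]
   by (smt (verit) divide_le_eq mult_le_cancel_left1)
 qed
 have S: "norm (w v) \<le> S * growth l s v" if "v \<in> {s..b}" for v
  using cSUP_upper[OF that bdd] growth_pos[of s v] by (simp add: S_def pos_divide_le_eq)
 define M where "M = max S \<eta>"
 have M0: "0 \<le> M" using eta by (simp add: M_def)
 have wM: "norm (w v) \<le> M * growth l s u" if "v \<le> u" "u \<in> {s..b}" for u v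
 proof (cases "v \<le> s")
  case True
  have "norm (w v) \<le> M * 1" using before[OF True] by (simp add: M_def)
  also have "\<dots> \<le> M * growth l s u" using M0 growth_ge_1 by (intro mult_left_mono) auto
  finally show ?thesis .
 next
  case False
  then have "norm (w v) \<le> S * growth l s v" using S that by auto
  also have "\<dots> \<le> M * growth l s v" using growth_pos[of s v] by (intro mult_right_mono) (auto simp: M_def)
  also have "\<dots> \<le> M * growth l s u" using M0 growth_mono[OF that(1)] by (intro mult_left_mono) auto
  finally show ?thesis .
 qed
 have est: "norm (w t) \<le> \<eta> + M * (growth l s t - 1) / 2" if t: "t \<in> {s..b}" for t
 proof -
  have "norm (integral {s..t} \<psi>) \<le> M * (growth l s t - 1) / 2"
  proof (rule norm_integral_le_growth[OF _ \<psi>[OF t] N _ M0])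
   show "s \<le> t" using t by simp
   fix u assume u: "u \<in> {s..t} - N"
   show "norm (\<psi> u) \<le> l u * (M * growth l s u)"
    using u t M0 growth_pos[of s u] by (intro lip wM) auto
  qed
  then show ?thesis using eq[OF t] norm_triangle_sub[of "w t" "integral {s..t} \<psi>"] by linarith
 qed
 have "S \<le> \<eta> + M / 2" unfolding S_def
 proof (rule cSUP_least)
  show "{s..b} \<noteq> {}" using sb by simp
  fix v assume v: "v \<in> {s..b}"
  have "\<eta> + M * (growth l s v - 1) / 2 \<le> \<eta> * growth l s v + M / 2 * growth l s v"
  proof -
   have "M * (growth l s v - 1) / 2 = M / 2 * growth l s v - M / 2" by (simp add: algebra_simps diff_divide_distrib)
   then show ?thesis using mult_left_mono[OF growth_ge_1[of s v] eta] M0 by linarith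
  qed
  then have "norm (w v) \<le> (\<eta> + M / 2) * growth l s v" using est[OF v] by (simp add: algebra_simps)
  then show "norm (w v) / growth l s v \<le> \<eta> + M / 2" using growth_pos[of s v] by (simp add: pos_divide_le_eq)
 qed
 then have "S \<le> 2 * \<eta>" using eta unfolding M_def by (auto simp: max_def split: if_splits)
 then show ?thesis using S[OF t] growth_pos[of s t] by (meson mult_right_mono less_imp_le order_trans)
qed

end

lemma (in rate) rate_double: "rate (\<lambda>t. 2 * l t)"
proof
 show "(\<lambda>t. 2 * l t) absolutely_integrable_on {a..b}" for a b
  by (rule set_integrable_mult_right) (rule rate_integrable)
qed (simp add: rate_nonneg)

text \<open>
  The right-hand side is an operator on whole curves that depends on the curve up to time \<open>t\<close> only. The
  linear, the forced and the perturbed delay equation are all of this form.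
\<close>

locale volterra = rate l for l +
 fixes F :: "(real => 'a::euclidean_space) => real => 'a"
 assumes F_meas: "!!x. continuous_on UNIV x ==> F x \<in> borel_measurable lebesgue"
  and F_lip: "!!x y t B. continuous_on UNIV x ==> continuous_on UNIV y ==> 0 \<le> B ==>
   (!!v. v \<le> t ==> norm (x v - y v) \<le> B) ==> norm (F x t - F y t) \<le> l t * B"
  and F_zero: "!!t. norm (F (\<lambda>_. 0) t) \<le> l t"
begin

lemma F_bound:
 assumes "continuous_on UNIV x" "0 \<le> B" "!!v. v \<le> t ==> norm (x v) \<le> B"
 shows "norm (F x t) \<le> l t * (1 + B)"
proof -
 have "norm (F x t - F (\<lambda>_. 0) t) \<le> l t * B" using assms by (intro F_lip) auto
 then show ?thesis using F_zero[of t] norm_triangle_sub[of "F x t" "F (\<lambda>_. 0) t"]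
  by (simp add: algebra_simps)
qed

lemma F_integrable:
 assumes x: "continuous_on UNIV x" and before: "!!v. v \<le> s ==> norm (x v) \<le> W"
 shows "F x absolutely_integrable_on {a..b}"
proof -
 obtain W' where W': "!!v. v \<in> {s..b} ==> norm (x v) \<le> W'"
  using continuous_on_interval_bounded[OF continuous_on_subset[OF x subset_UNIV], of s b] by blast
 define B where "B = max 0 (max W W')"
 have B: "norm (x v) \<le> B" if "v \<le> b" for v
  using before[of v] W'[of v] that by (cases "v \<le> s") (auto simp: B_def)
 show ?thesis
 proof (rule measurable_bounded_by_integrable_imp_absolutely_integrable[where g = "\<lambda>t. (1 + B) * l t"])
  show "F x \<in> borel_measurable (lebesgue_on {a..b})"
   using F_meas[OF x] by (rule measurable_restrict_space1)
  show "(\<lambda>t. (1 + B) * l t) integrable_on {a..b}"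
   using rate_int by (rule integrable_on_mult_right)
  show "norm (F x t) \<le> (1 + B) * l t" if "t \<in> {a..b}" for t
   using F_bound[OF x, of B t] B that by (simp add: B_def mult.commute)
 qed simp
qed

lemma F_int:
 assumes x: "continuous_on UNIV x" and before: "!!v. v \<le> s ==> norm (x v) \<le> W"
 shows "F x integrable_on {a..b}"
 using F_integrable[OF assms] set_lebesgue_integral_eq_integral(1) by blast

definition is_sol :: "real => (real => 'a) => (real => 'a) => bool" where
 "is_sol s \<phi> x \<longleftrightarrow> continuous_on UNIV x \<and> (\<forall>t\<le>s. x t = \<phi> t) \<and> (\<forall>t\<ge>s. x t = \<phi> s + integral {s..t} (F x))"

text \<open>
  The equation is required up to \<open>b\<close> only, so the same argument gives uniqueness and causality.
\<close>

lemma agree_upto: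
 assumes cx: "continuous_on UNIV x" and cy: "continuous_on UNIV y"
  and before: "!!v. v \<le> s ==> x v = y v" "!!v. v \<le> s ==> norm (x v) \<le> W"
  and eq: "!!t. t \<in> {s..b} ==> x t - y t = integral {s..t} (\<lambda>u. F x u - F y u)"
  and t: "t \<le> b"
 shows "x t = y t"
proof (cases "t \<le> s")
 case False
 have Fi: "F x integrable_on {a..b}" "F y integrable_on {a..b}" for a b
  using before by (auto intro!: F_int[of _ s W] cx cy)
 obtain W' where W': "!!v. v \<in> {s..t} ==> norm (x v - y v) \<le> W'"
  using continuous_on_interval_bounded[OF continuous_on_subset[OF continuous_on_diff[OF cx cy] subset_UNIV], of s t] by blast
 have "norm (x t - y t) \<le> 2 * 0 * growth l s t"
 proof (rule gronwall_causal[where b = t and W = W' and \<psi> = "\<lambda>u. F x u - F y u" and N = "{}"])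
  show "norm (x v - y v) \<le> 0" if "v \<le> s" for v using before that by simp
  show "norm (x u - y u - integral {s..u} (\<lambda>u. F x u - F y u)) \<le> 0" if "u \<in> {s..t}" for u
   using eq[of u] that t by simp
  show "norm (F x u - F y u) \<le> l u * B" if "u \<in> {s..t} - {}" "0 \<le> B" "!!v. v \<le> u ==> norm (x v - y v) \<le> B" for u B
   using that by (intro F_lip cx cy) auto
 qed (use False W' Fi in \<open>auto intro: Henstock_Kurzweil_Integration.integrable_diff\<close>)
 then show ?thesis by simp
qed (rule before(1))

lemma is_sol_unique:
 assumes x: "is_sol s \<phi> x" and y: "is_sol s \<phi> y" and W: "!!v. v \<le> s ==> norm (\<phi> v) \<le> W"
 shows "x = y"
proof (rule ext)
 fix t
 have cx: "continuous_on UNIV x" and cy: "continuous_on UNIV y" using x y by (auto simp: is_sol_def)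
 have bx: "!!v. v \<le> s ==> norm (x v) \<le> W" and byy: "!!v. v \<le> s ==> norm (y v) \<le> W"
  using x y W by (auto simp: is_sol_def)
 show "x t = y t"
 proof (rule agree_upto[OF cx cy _ bx, of s t t])
  show "x t - y t = integral {s..t} (\<lambda>u. F x u - F y u)" if "t \<in> {s..u}" for t u
   using x y that Henstock_Kurzweil_Integration.integral_diff[OF F_int[OF cx bx] F_int[OF cy byy]]
   by (simp add: is_sol_def)
 qed (use x y in \<open>auto simp: is_sol_def\<close>)
qed

text \<open>
  A contraction on bounded continuous functions: dividing the unknown by a weight that grows with the rate
  \<open>2 * l\<close> makes the integral operator contract on the whole half-line at once.
\<close>

lemma is_sol_exists:
 assumes \<phi>: "continuous_on UNIV \<phi>" and W: "!!v. v \<le> s ==> norm (\<phi> v) \<le> W"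
 shows "\<exists>x. is_sol s \<phi> x"
proof -
 interpret two: rate "\<lambda>t. 2 * l t" by (rule rate_double)
 define G where "G = growth (\<lambda>t. 2 * l t) s"
 have G: "0 < G t" "1 \<le> G t" "continuous_on UNIV G" "!!u. t \<le> u ==> G t \<le> G u" for t
  unfolding G_def by (auto intro: two.growth_pos two.growth_ge_1 two.continuous_growth two.growth_mono)
 have G1: "t \<le> s ==> G t = 1" for t unfolding G_def by (rule two.growth_before)
 have W0: "0 \<le> W" using W[of s] norm_ge_zero[of "\<phi> s"] by linarith
 \<comment> \<open>The unknown is the integral part of the solution, divided by the weight.\<close>
 define ex where "ex y t = \<phi> (min t s) + (G t *\<^sub>R apply_bcontfun y (max s t) - apply_bcontfun y s)" for y :: "real \<Rightarrow>\<^sub>C 'a" and t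
 have ex_cont: "continuous_on UNIV (ex y)" for y
  unfolding ex_def[abs_def]
  by (intro continuous_intros G(3) continuous_on_compose2[OF \<phi>] continuous_on_compose2[OF continuous_on_apply_bcontfun[of UNIV]]) auto
 have ex_before: "ex y t = \<phi> t" if "t \<le> s" for y t using that by (simp add: ex_def G1 min_def max_def)
 have ex_diff: "norm (ex y v - ex z v) \<le> 2 * (dist y z * G u)" if "v \<le> u" for y z u v
 proof -
  have "ex y v - ex z v = G v *\<^sub>R (apply_bcontfun y (max s v) - apply_bcontfun z (max s v)) - (apply_bcontfun y s - apply_bcontfun z s)"
   by (simp add: ex_def scaleR_diff_right)
  then have "norm (ex y v - ex z v) \<le> norm (G v *\<^sub>R (apply_bcontfun y (max s v) - apply_bcontfun z (max s v))) + norm (apply_bcontfun y s - apply_bcontfun z s)"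
   by (metis norm_triangle_ineq4)
  also have "\<dots> \<le> G v * dist y z + 1 * dist y z"
   using dist_bounded[of y "max s v" z] dist_bounded[of y s z] G(1)[of v] by (auto simp: dist_norm intro!: add_mono mult_left_mono)
  also have "\<dots> \<le> G u * dist y z + G u * dist y z"
   using G(2)[of u] G(4)[OF that] by (intro add_mono mult_right_mono) auto
  finally show ?thesis by (simp add: algebra_simps)
 qed
 have ex_bound: "norm (ex y v) \<le> (2 * norm y + W) * G u" if "v \<le> u" for y u v
 proof -
  have "norm (ex y v) \<le> norm (\<phi> (min v s)) + (norm (G v *\<^sub>R apply_bcontfun y (max s v)) + norm (apply_bcontfun y s))"
   unfolding ex_def by (rule norm_triangle_le) (rule add_left_mono, rule norm_triangle_ineq4)
  also have "\<dots> \<le> W * G u + (G u * norm y + norm y * G u)"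
  proof (intro add_mono)
   show "norm (G v *\<^sub>R apply_bcontfun y (max s v)) \<le> G u * norm y"
    using norm_bounded[of y "max s v"] G(1)[of v] G(4)[OF that] by (auto intro!: mult_mono)
   show "norm (\<phi> (min v s)) \<le> W * G u"
    using W[of "min v s"] mult_left_mono[OF G(2)[of u] W0] by simp
   show "norm (apply_bcontfun y s) \<le> norm y * G u"
    using norm_bounded[of y s] mult_left_mono[OF G(2)[of u] norm_ge_zero[of y]] by simp
  qed
  finally show ?thesis by (simp add: algebra_simps)
 qed
 have Fi: "F (ex y) integrable_on {a..b}" for y a b
  by (rule F_int[OF ex_cont, of s y W]) (simp add: ex_before W)
 define H where "H y t = integral {s..t} (F (ex y)) /\<^sub>R G t" for y t
 have H_le: "norm (integral {s..t} \<psi> /\<^sub>R G t) \<le> C / 2"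
  if "\<psi> integrable_on {s..t}" "0 \<le> C" "!!u. norm (\<psi> u) \<le> 2 * l u * (C * G u)" for \<psi> :: "real => 'a" and C t
 proof (cases "s \<le> t")
  case True
  have "norm (integral {s..t} \<psi>) \<le> C * (G t - 1) / 2"
   unfolding G_def by (rule two.norm_integral_le_growth[OF True that(1) negligible_empty]) (use that in \<open>auto simp: G_def\<close>)
  also have "\<dots> \<le> C / 2 * G t" using that(2) by (simp add: algebra_simps)
  finally show ?thesis using G(1)[of t] by (simp add: field_simps)
 qed (use that(2) in simp)
 have H_bc: "H y \<in> bcontfun" for y
 proof (rule bcontfun_normI)
  show "continuous_on UNIV (H y)"
   unfolding H_def[abs_def] using G(1)
   by (intro continuous_intros G(3) continuous_on_integral_from Fi) (simp add: less_imp_neq[symmetric])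
  show "norm (H y t) \<le> (1 + (2 * norm y + W)) / 2" for t
   unfolding H_def
  proof (rule H_le[OF Fi])
   fix u
   have nn: "0 \<le> (2 * norm y + W) * G u" using W0 G(1)[of u] by simp
   have "norm (F (ex y) u) \<le> l u * (1 + (2 * norm y + W) * G u)"
    by (rule F_bound[OF ex_cont nn ex_bound])
   also have "\<dots> \<le> l u * ((1 + (2 * norm y + W)) * G u)"
    using rate_nonneg[of u] G(2)[of u] by (intro mult_left_mono) (auto simp: algebra_simps)
   also have "\<dots> \<le> 2 * l u * ((1 + (2 * norm y + W)) * G u)"
    using rate_nonneg[of u] G(1)[of u] W0 by (intro mult_right_mono) auto
   finally show "norm (F (ex y) u) \<le> 2 * l u * ((1 + (2 * norm y + W)) * G u)" .
  qed (use W0 in simp)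
 qed
 define \<Phi> where "\<Phi> y = Bcontfun (H y)" for y
 have \<Phi>: "apply_bcontfun (\<Phi> y) = H y" for y unfolding \<Phi>_def using H_bc by (simp add: Bcontfun_inverse)
 have "dist (\<Phi> y) (\<Phi> z) \<le> (1/2) * dist y z" for y z
 proof (rule dist_bound)
  fix t
  have "H y t - H z t = integral {s..t} (\<lambda>u. F (ex y) u - F (ex z) u) /\<^sub>R G t"
   unfolding H_def using Henstock_Kurzweil_Integration.integral_diff[OF Fi Fi] by (simp add: scaleR_diff_right)
  also have "norm \<dots> \<le> dist y z / 2"
  proof (rule H_le)
   fix u
   have nn: "0 \<le> 2 * (dist y z * G u)" using G(1)[of u] by simp
   show "norm (F (ex y) u - F (ex z) u) \<le> 2 * l u * (dist y z * G u)"
    using F_lip[OF ex_cont ex_cont nn ex_diff] by (simp add: mult.assoc mult.left_commute)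
  qed (auto intro: Henstock_Kurzweil_Integration.integrable_diff Fi)
  finally show "dist (apply_bcontfun (\<Phi> y) t) (apply_bcontfun (\<Phi> z) t) \<le> 1/2 * dist y z"
   by (simp add: \<Phi> dist_norm)
 qed
 then have "\<exists>!y. \<Phi> y = y" by (intro banach_fix_type[of "1/2"]) auto
 then obtain y where y: "\<Phi> y = y" by blast
 have yH: "apply_bcontfun y t = H y t" for t using \<Phi>[of y] y by simp
 have ys: "apply_bcontfun y s = 0" by (simp add: yH H_def)
 have "ex y t = \<phi> s + integral {s..t} (F (ex y))" if "t \<ge> s" for t
 proof -
  have "G t *\<^sub>R H y t = integral {s..t} (F (ex y))" using G(1)[of t] by (simp add: H_def)
  then show ?thesis using that unfolding ex_def[of y t] ys by (simp add: yH min_def max_def)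
 qed
 then have "is_sol s \<phi> (ex y)" unfolding is_sol_def using ex_cont ex_before by blast
 then show ?thesis by (rule exI[of "is_sol s \<phi>" "ex y"])
qed

end

section \<open>Segments and histories\<close>

lemma abs_cont_on_imp_continuous:
 assumes ac: "abs_cont_on a b x"
 shows "continuous_on {a..b} x"
 unfolding continuous_on_iff
proof (intro ballI allI impI)
 fix t e :: real assume t: "t \<in> {a..b}" and e: "0 < e"
 obtain \<delta> where \<delta>: "\<delta> > 0" "!!d k. d division_of k \<and> k \<subseteq> {a..b} \<and> (\<Sum>i\<in>d. Sup i - Inf i) < \<delta> ==>
    (\<Sum>i\<in>d. norm (x (Sup i) - x (Inf i))) < e"
  using ac e unfolding abs_cont_on_def by meson
 have key: "norm (x v - x u) < e" if "u \<in> {a..b}" "v \<in> {a..b}" "u \<le> v" "v - u < \<delta>" for u v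
 proof -
  have "{{u..v}} division_of {u..v}" using division_of_self[of u v] that(3) by simp
  then have "(\<Sum>i\<in>{{u..v}}. norm (x (Sup i) - x (Inf i))) < e"
   using that by (intro \<delta>(2)[of "{{u..v}}" "{u..v}"]) auto
  then show ?thesis using that(3) by simp
 qed
 show "\<exists>d>0. \<forall>u\<in>{a..b}. dist u t < d --> dist (x u) (x t) < e"
 proof (intro exI[of _ \<delta>] conjI ballI impI \<delta>(1))
  fix u assume u: "u \<in> {a..b}" "dist u t < \<delta>"
  show "dist (x u) (x t) < e"
   using key[of u t] key[of t u] u t by (cases "u \<le> t") (auto simp: dist_norm norm_minus_commute)
 qed
qed

lemma clamp_real: "a \<le> b ==> clamp a b (x::real) = max a (min b x)"
 unfolding clamp_def Basis_real_def by (auto simp: max_def min_def)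

definition seg :: "real => ('n::finite) curve => real => 'n phase" where
 "seg r x t = Bcontfun (segment r x t)"

text \<open>
  The history is continued by constants to the whole line, which keeps all curves continuous on \<open>UNIV\<close>.
\<close>

definition hist :: "('n::finite) phase => real => 'n curve" where
 "hist \<phi> s t = apply_bcontfun \<phi> (t - s)"

lemma hist_continuous: "continuous_on UNIV (hist \<phi> s)"
 unfolding hist_def[abs_def] by (intro continuous_on_compose2[OF continuous_on_apply_bcontfun[of UNIV]] continuous_intros) auto

lemma hist_bound: "norm (hist \<phi> s t) \<le> norm \<phi>"
 unfolding hist_def by (rule norm_bounded)

context kernel
begin

lemma segment_eq: "segment r x t \<omega> = x (t + max (- r) (min 0 \<omega>))"
proof -
 have "clamp (- r) 0 \<omega> = max (- r) (min 0 \<omega>)"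
  using r by (simp add: clamp_real)
 then show ?thesis by (simp add: segment_def ext_cont_def)
qed

lemma C_iff: "\<phi> \<in> C r \<longleftrightarrow> (\<forall>\<omega>. apply_bcontfun \<phi> (max (- r) (min 0 \<omega>)) = apply_bcontfun \<phi> \<omega>)"
proof -
 have "clamp (- r) 0 \<omega> = max (- r) (min 0 \<omega>)" for \<omega> :: real
  using r by (simp add: clamp_real)
 then show ?thesis by (simp add: C_def ext_cont_def fun_eq_iff)
qed

lemma C_apply: "\<phi> \<in> C r ==> apply_bcontfun \<phi> \<omega> = apply_bcontfun \<phi> (max (- r) (min 0 \<omega>))"
 unfolding C_iff by metis

lemma C_norm_le:
 assumes "\<phi> \<in> C r" "!!\<omega>. \<omega> \<in> {- r..0} ==> norm (apply_bcontfun \<phi> \<omega>) \<le> B"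
 shows "norm \<phi> \<le> B"
proof (rule norm_bound)
 fix \<omega> show "norm (apply_bcontfun \<phi> \<omega>) \<le> B"
  using C_apply[OF assms(1), of \<omega>] assms(2)[of "max (- r) (min 0 \<omega>)"] r by auto
qed

lemma subspace_C: "subspace (C r)"
 by (auto simp: subspace_def C_iff)

lemma C_add: "\<phi> \<in> C r ==> \<psi> \<in> C r ==> \<phi> + \<psi> \<in> C r"
 and C_diff: "\<phi> \<in> C r ==> \<psi> \<in> C r ==> \<phi> - \<psi> \<in> C r"
 and C_scale: "\<phi> \<in> C r ==> c *\<^sub>R \<phi> \<in> C r"
 and C_0: "0 \<in> C r"
 using subspace_C by (auto intro: subspace_add subspace_diff subspace_scale subspace_0)

lemma closed_C: "closed (C r :: 'n phase set)"
 unfolding closed_sequential_limits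
proof (intro allI impI, elim conjE)
 fix f :: "nat => 'n phase" and l assume f: "\<forall>n. f n \<in> C r" and l: "f \<longlonglongrightarrow> l"
 have lim: "(\<lambda>n. apply_bcontfun (f n) \<omega>) \<longlonglongrightarrow> apply_bcontfun l \<omega>" for \<omega>
  by (rule tendsto_uniform_limitI[OF tendsto_bcontfun_uniform_limit[OF l]]) simp
 show "l \<in> C r" unfolding C_iff
 proof
  fix \<omega>
  have "(\<lambda>n. apply_bcontfun (f n) \<omega>) \<longlonglongrightarrow> apply_bcontfun l (max (- r) (min 0 \<omega>))"
   using lim[of "max (- r) (min 0 \<omega>)"] f unfolding C_iff by simp
  then show "apply_bcontfun l (max (- r) (min 0 \<omega>)) = apply_bcontfun l \<omega>"
   using lim[of \<omega>] LIMSEQ_unique by blast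
 qed
qed

text \<open>Composition with this retraction extends a linear map from the phase space to the ambient space.\<close>

definition retr :: "'n phase => 'n phase" where
 "retr \<phi> = seg r (apply_bcontfun \<phi>) 0"

lemma seg_apply_gen:
 assumes "continuous_on {t - r..t} x"
 shows "apply_bcontfun (seg r x t) = segment r x t"
proof -
 have c: "continuous_on UNIV (segment r x t)"
  unfolding segment_eq[abs_def] using r
  by (intro continuous_on_compose2[OF assms] continuous_intros) auto
 obtain W where W: "!!v. v \<in> {t - r..t} ==> norm (x v) \<le> W"
  using continuous_on_interval_bounded[OF assms] by blast
 have "norm (segment r x t \<omega>) \<le> W" for \<omega> unfolding segment_eq using r by (intro W) auto
 then have "segment r x t \<in> bcontfun" by (intro bcontfun_normI c)
 then show ?thesis unfolding seg_def by (rule Bcontfun_inverse)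
qed

lemma seg_C_gen:
 assumes "continuous_on {t - r..t} x"
 shows "seg r x t \<in> C r"
proof -
 have "max (- r) (min 0 (max (- r) (min 0 \<omega>))) = max (- r) (min 0 \<omega>)" for \<omega> using r by auto
 then show ?thesis unfolding C_iff seg_apply_gen[OF assms] segment_eq by simp
qed

lemma seg_apply: "continuous_on UNIV x ==> apply_bcontfun (seg r x t) = segment r x t"
 by (rule seg_apply_gen) (rule continuous_on_subset, auto)

lemma seg_C: "continuous_on UNIV x ==> seg r x t \<in> C r"
 by (rule seg_C_gen) (rule continuous_on_subset, auto)

lemma segment_cong: "(!!v. v \<in> {t - r..t} ==> x v = y v) ==> segment r x t = segment r y t"
 unfolding segment_eq[abs_def] using r by auto

lemma seg_cong: "(!!v. v \<in> {t - r..t} ==> x v = y v) ==> seg r x t = seg r y t"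
 unfolding seg_def by (metis segment_cong)

lemma seg_norm_le:
 assumes "continuous_on UNIV x" "!!v. v \<in> {t - r..t} ==> norm (x v) \<le> B"
 shows "norm (seg r x t) \<le> B"
 by (rule norm_bound) (use assms r in \<open>auto simp: seg_apply segment_eq\<close>)

lemma seg_value: "continuous_on UNIV x ==> v \<in> {t - r..t} ==> x v = apply_bcontfun (seg r x t) (v - t)"
proof -
 assume x: "continuous_on UNIV x" and v: "v \<in> {t - r..t}"
 have "max (- r) (min 0 (v - t)) = v - t" using v by auto
 then show ?thesis using x by (simp add: seg_apply segment_eq)
qed

lemma seg_combine:
 assumes "continuous_on UNIV x" "continuous_on UNIV y"
 shows "seg r (\<lambda>u. c *\<^sub>R x u + d *\<^sub>R y u) t = c *\<^sub>R seg r x t + d *\<^sub>R seg r y t"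
proof (rule bcontfun_eqI)
 have "continuous_on UNIV (\<lambda>u. c *\<^sub>R x u + d *\<^sub>R y u)" using assms by (intro continuous_intros)
 then show "apply_bcontfun (seg r (\<lambda>u. c *\<^sub>R x u + d *\<^sub>R y u) t) \<omega> = apply_bcontfun (c *\<^sub>R seg r x t + d *\<^sub>R seg r y t) \<omega>" for \<omega>
  using assms by (simp add: seg_apply segment_eq)
qed

lemma seg_diff:
 assumes "continuous_on UNIV x" "continuous_on UNIV y"
 shows "seg r (\<lambda>u. x u - y u) t = seg r x t - seg r y t"
 using seg_combine[OF assms, of 1 "-1"] by simp

lemma seg_continuous:
 assumes x: "continuous_on UNIV x"
 shows "continuous_on UNIV (seg r x)"
 unfolding continuous_on_iff
proof (intro ballI allI impI)
 fix t e :: real assume e: "0 < e"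
 have "uniformly_continuous_on {t - r - 1..t + 1} x"
  by (intro compact_uniformly_continuous continuous_on_subset[OF x]) auto
 then obtain d where d: "d > 0" "!!u v. u \<in> {t - r - 1..t + 1} ==> v \<in> {t - r - 1..t + 1} ==> dist v u < d ==> dist (x v) (x u) < e / 2"
  using e unfolding uniformly_continuous_on_def by (metis half_gt_zero)
 show "\<exists>d>0. \<forall>t'\<in>UNIV. dist t' t < d --> dist (seg r x t') (seg r x t) < e"
 proof (intro exI[of _ "min d 1"] conjI ballI impI)
  show "0 < min d 1" using d(1) by simp
  fix t' assume t': "dist t' t < min d 1"
  have "dist (seg r x t') (seg r x t) \<le> e / 2"
  proof (rule dist_bound)
   fix \<omega>
   define w where "w = max (- r) (min 0 \<omega>)"
   have w: "- r \<le> w" "w \<le> 0" using r by (auto simp: w_def)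
   have "dist (x (t' + w)) (x (t + w)) < e / 2"
    using w t' by (intro d(2)) (auto simp: dist_real_def)
   then show "dist (apply_bcontfun (seg r x t') \<omega>) (apply_bcontfun (seg r x t) \<omega>) \<le> e / 2"
    by (simp add: seg_apply[OF x] segment_eq w_def)
  qed
  then show "dist (seg r x t') (seg r x t) < e" using e by simp
 qed
qed

lemma retr_C: "retr \<phi> \<in> C r" unfolding retr_def by (rule seg_C) simp

lemma retr_apply: "apply_bcontfun (retr \<phi>) \<omega> = apply_bcontfun \<phi> (max (- r) (min 0 \<omega>))"
 by (simp add: retr_def seg_apply segment_eq)

lemma retr_id: "\<phi> \<in> C r ==> retr \<phi> = \<phi>"
 by (rule bcontfun_eqI) (simp add: retr_def seg_apply segment_eq C_iff)

lemma bounded_linear_retr: "bounded_linear retr"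
proof (rule bounded_linear_intro[where K = 1])
 show "retr (\<phi> + \<psi>) = retr \<phi> + retr \<psi>" for \<phi> \<psi>
  by (rule bcontfun_eqI) (simp add: retr_apply)
 show "retr (c *\<^sub>R \<phi>) = c *\<^sub>R retr \<phi>" for c \<phi>
  by (rule bcontfun_eqI) (simp add: retr_apply)
 show "norm (retr \<phi>) \<le> norm \<phi> * 1" for \<phi>
  unfolding retr_def by (simp add: seg_norm_le norm_bounded)
qed

lemma seg_hist: "\<phi> \<in> C r ==> seg r (hist \<phi> s) s = \<phi>"
 by (rule bcontfun_eqI) (simp add: seg_apply[OF hist_continuous] segment_eq hist_def C_iff)

section \<open>The linear equation with a forcing term\<close>

definition m :: "real => real" where
 "m = (SOME m. (\<forall>a b. m absolutely_integrable_on {a..b}) \<and> (\<forall>t. 0 \<le> m t) \<and>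
  (\<forall>t. variation_le (\<zeta> t) (- r) 0 (m t)))"

lemma m: "m absolutely_integrable_on {a..b}" "0 \<le> m t" "variation_le (\<zeta> t) (- r) 0 (m t)"
proof -
 have "(\<forall>a b. m absolutely_integrable_on {a..b}) \<and> (\<forall>t. 0 \<le> m t) \<and> (\<forall>t. variation_le (\<zeta> t) (- r) 0 (m t))"
  unfolding m_def by (rule someI_ex[OF variation_bound])
 then show "m absolutely_integrable_on {a..b}" "0 \<le> m t" "variation_le (\<zeta> t) (- r) 0 (m t)" by blast+
qed

sublocale m: rate m by standard (rule m)+

lemma L_bound:
 assumes "has_stieltjes_integral (\<zeta> t) (segment r x t) I (- r) 0" "0 \<le> B" "!!v. v \<le> t ==> norm (x v) \<le> B"
 shows "norm I \<le> m t * B"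
 by (rule stieltjes_integral_bound[OF assms(1) m(3)]) (use assms(2,3) in \<open>auto simp: segment_apply\<close>)

lemma L_integral:
 assumes "continuous_on UNIV x"
 shows "has_stieltjes_integral (\<zeta> t) (segment r x t) (L r \<zeta> t (segment r x t)) (- r) 0"
 by (intro L_continuous segment_continuous_on continuous_on_subset[OF assms]) auto

lemma L_combine:
 assumes "continuous_on UNIV x" "continuous_on UNIV y"
 shows "L r \<zeta> t (segment r (\<lambda>u. c *\<^sub>R x u + d *\<^sub>R y u) t) = c *\<^sub>R L r \<zeta> t (segment r x t) + d *\<^sub>R L r \<zeta> t (segment r y t)"
proof (rule L_eq)
 have "segment r (\<lambda>u. c *\<^sub>R x u + d *\<^sub>R y u) t = (\<lambda>\<omega>. c *\<^sub>R segment r x t \<omega> + d *\<^sub>R segment r y t \<omega>)"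
  by (simp add: segment_eq fun_eq_iff)
 then show "has_stieltjes_integral (\<zeta> t) (segment r (\<lambda>u. c *\<^sub>R x u + d *\<^sub>R y u) t)
   (c *\<^sub>R L r \<zeta> t (segment r x t) + d *\<^sub>R L r \<zeta> t (segment r y t)) (- r) 0"
  using has_stieltjes_integral_combine[OF L_integral[OF assms(1)] L_integral[OF assms(2)]] by simp
qed

lemma L_diff:
 assumes "continuous_on UNIV x" "continuous_on UNIV y"
 shows "L r \<zeta> t (segment r (\<lambda>u. x u - y u) t) = L r \<zeta> t (segment r x t) - L r \<zeta> t (segment r y t)"
 using L_combine[OF assms, of t 1 "-1"] by simp

lemma L_zero: "L r \<zeta> t (segment r (\<lambda>_. 0) t) = 0"
 using L_diff[of "\<lambda>_. 0" "\<lambda>_. 0" t] by simp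

lemma L_lip:
 assumes "continuous_on UNIV x" "continuous_on UNIV y" "0 \<le> B" "!!v. v \<le> t ==> norm (x v - y v) \<le> B"
 shows "norm (L r \<zeta> t (segment r x t) - L r \<zeta> t (segment r y t)) \<le> m t * B"
 unfolding L_diff[OF assms(1,2), symmetric]
 by (intro L_bound[OF L_integral[OF continuous_on_diff[OF assms(1,2)]] assms(3,4)])

definition forcing :: "(real => real ^ 'n) => bool" where
 "forcing f \<longleftrightarrow> f \<in> borel_measurable lebesgue \<and> (\<forall>a b. f absolutely_integrable_on {a..b})"

lemma forcing_int: "forcing f ==> f integrable_on {a..b}"
 unfolding forcing_def using set_lebesgue_integral_eq_integral(1) by blast

lemma forcing_continuous: "continuous_on UNIV f ==> forcing f"
 unfolding forcing_def
 by (auto intro!: absolutely_integrable_continuous_real measurable_completion borel_measurable_continuous_onI intro: continuous_on_subset)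

lemma forcing_0: "forcing (\<lambda>_. 0)" by (rule forcing_continuous) simp

lemma forcing_combine: "forcing f ==> forcing h ==> forcing (\<lambda>t. c *\<^sub>R f t + d *\<^sub>R h t)"
 unfolding forcing_def by (auto intro!: set_integral_add absolutely_integrable_scaleR_left borel_measurable_add borel_measurable_scaleR)

lemma forcing_restrict: "forcing f ==> forcing (\<lambda>t. if t \<in> {a..b} then f t else 0)"
proof -
 assume f: "forcing f"
 have "(\<lambda>t. if t \<in> {a..b} then f t else 0) absolutely_integrable_on UNIV"
  using f unfolding forcing_def by (subst absolutely_integrable_restrict_UNIV) blast
 then have "(\<lambda>t. if t \<in> {a..b} then f t else 0) absolutely_integrable_on {c..d}" for c d
  by (rule set_integrable_subset) auto
 moreover have "(\<lambda>t. if t \<in> {a..b} then f t else 0) \<in> borel_measurable lebesgue"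
  using f unfolding forcing_def by (intro measurable_If) auto
 ultimately show ?thesis unfolding forcing_def by blast
qed

definition rhs :: "(real => real ^ 'n) => 'n curve => 'n curve" where
 "rhs f x t = L r \<zeta> t (segment r x t) + f t"

lemma volterra_rhs:
 assumes f: "forcing f"
 shows "volterra (\<lambda>t. m t + norm (f t)) (rhs f)"
proof
 show "(\<lambda>t. m t + norm (f t)) absolutely_integrable_on {a..b}" for a b
  using f m(1) unfolding forcing_def by (intro set_integral_add set_integrable_norm) auto
 show "0 \<le> m t + norm (f t)" for t using m(2) by simp
 show "rhs f x \<in> borel_measurable lebesgue" if "continuous_on UNIV x" for x
  unfolding rhs_def[abs_def] using f that L_segment_measurable
  by (intro borel_measurable_add) (auto simp: forcing_def)
 show "norm (rhs f x t - rhs f y t) \<le> (m t + norm (f t)) * B"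
  if "continuous_on UNIV x" "continuous_on UNIV y" "0 \<le> B" "!!v. v \<le> t ==> norm (x v - y v) \<le> B" for x y t B
 proof -
  have "norm (rhs f x t - rhs f y t) \<le> m t * B" using L_lip[OF that] by (simp add: rhs_def)
  also have "\<dots> \<le> (m t + norm (f t)) * B" using that(3) by (intro mult_right_mono) auto
  finally show ?thesis .
 qed
 show "norm (rhs f (\<lambda>_. 0) t) \<le> m t + norm (f t)" for t
  using m(2)[of t] by (simp add: rhs_def L_zero)
qed

text \<open>
  The equation in integrated form. The forcing term is merely integrable, since splitting off a jump
  leaves a discontinuous one.
\<close>

definition sol :: "real => 'n phase => (real => real ^ 'n) => 'n curve => bool" where
 "sol s \<phi> f x \<longleftrightarrow> continuous_on UNIV x \<and> (\<forall>t\<le>s. x t = hist \<phi> s t) \<and>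
   (\<forall>t\<ge>s. x t = hist \<phi> s s + integral {s..t} (rhs f x))"

definition traj :: "real => 'n phase => (real => real ^ 'n) => 'n curve" where
 "traj s \<phi> f = (SOME x. sol s \<phi> f x)"

lemma sol_is_sol: "forcing f ==> sol s \<phi> f x \<longleftrightarrow> volterra.is_sol (rhs f) s (hist \<phi> s) x"
 unfolding sol_def volterra.is_sol_def[OF volterra_rhs] ..

lemma sol_traj:
 assumes f: "forcing f"
 shows "sol s \<phi> f (traj s \<phi> f)"
proof -
 have "\<exists>x. sol s \<phi> f x"
  unfolding sol_is_sol[OF f] by (rule volterra.is_sol_exists[OF volterra_rhs[OF f] hist_continuous hist_bound])
 then show ?thesis unfolding traj_def by (rule someI_ex)
qed

lemma sol_unique:
 assumes f: "forcing f" and x: "sol s \<phi> f x"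
 shows "x = traj s \<phi> f"
 by (rule volterra.is_sol_unique[OF volterra_rhs[OF f] _ _ hist_bound])
   (use x sol_traj[OF f, of s \<phi>] in \<open>simp_all add: sol_is_sol[OF f]\<close>)

lemma traj_continuous: "forcing f ==> continuous_on UNIV (traj s \<phi> f)"
 and traj_before: "forcing f ==> t \<le> s ==> traj s \<phi> f t = hist \<phi> s t"
 and traj_after: "forcing f ==> s \<le> t ==> traj s \<phi> f t = hist \<phi> s s + integral {s..t} (rhs f (traj s \<phi> f))"
 using sol_traj[of f s \<phi>] unfolding sol_def by auto

lemma rhs_int: "forcing f ==> continuous_on UNIV x ==> (!!v. v \<le> s ==> norm (x v) \<le> W) ==> rhs f x integrable_on {a..b}"
 by (rule volterra.F_int[OF volterra_rhs])

lemma rhs_traj_int: "forcing f ==> rhs f (traj s \<phi> f) integrable_on {a..b}"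
 by (rule rhs_int[where s = s and W = "norm \<phi>"]) (auto simp: traj_continuous traj_before hist_bound)

lemma traj_combine:
 assumes f: "forcing f" and h: "forcing h"
 shows "traj s (c *\<^sub>R \<phi> + d *\<^sub>R \<psi>) (\<lambda>t. c *\<^sub>R f t + d *\<^sub>R h t) = (\<lambda>t. c *\<^sub>R traj s \<phi> f t + d *\<^sub>R traj s \<psi> h t)"
proof (rule sol_unique[symmetric, OF forcing_combine[OF f h]])
 have eq: "rhs (\<lambda>t. c *\<^sub>R f t + d *\<^sub>R h t) (\<lambda>t. c *\<^sub>R traj s \<phi> f t + d *\<^sub>R traj s \<psi> h t)
   = (\<lambda>t. c *\<^sub>R rhs f (traj s \<phi> f) t + d *\<^sub>R rhs h (traj s \<psi> h) t)"
  unfolding rhs_def by (simp add: L_combine traj_continuous f h fun_eq_iff algebra_simps)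
 have I: "integral {s..t} (\<lambda>t. c *\<^sub>R rhs f (traj s \<phi> f) t + d *\<^sub>R rhs h (traj s \<psi> h) t)
   = c *\<^sub>R integral {s..t} (rhs f (traj s \<phi> f)) + d *\<^sub>R integral {s..t} (rhs h (traj s \<psi> h))" for t
  using rhs_traj_int[OF f] rhs_traj_int[OF h]
  by (subst Henstock_Kurzweil_Integration.integral_add) (auto intro: integrable_cmul)
 show "sol s (c *\<^sub>R \<phi> + d *\<^sub>R \<psi>) (\<lambda>t. c *\<^sub>R f t + d *\<^sub>R h t) (\<lambda>t. c *\<^sub>R traj s \<phi> f t + d *\<^sub>R traj s \<psi> h t)"
  unfolding sol_def eq I
  using traj_continuous[OF f] traj_continuous[OF h]
  by (auto intro!: continuous_intros simp: traj_before[OF f] traj_before[OF h] traj_after[OF f, of s] traj_after[OF h, of s]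
    hist_def algebra_simps)
qed

definition W :: "real => real => 'n phase => (real => real ^ 'n) => 'n phase" where
 "W t s \<phi> f = seg r (traj s \<phi> f) t"

lemma W_C: "forcing f ==> W t s \<phi> f \<in> C r"
 unfolding W_def by (intro seg_C traj_continuous)

lemma W_continuous: "forcing f ==> continuous_on UNIV (\<lambda>t. W t s \<phi> f)"
 unfolding W_def by (intro seg_continuous traj_continuous)

lemma W_start: "forcing f ==> \<phi> \<in> C r ==> W s s \<phi> f = \<phi>"
 unfolding W_def using seg_cong[of s "traj s \<phi> f" "hist \<phi> s"] by (simp add: traj_before seg_hist)

lemma W_combine:
 "forcing f ==> forcing h ==> W t s (c *\<^sub>R \<phi> + d *\<^sub>R \<psi>) (\<lambda>t. c *\<^sub>R f t + d *\<^sub>R h t) = c *\<^sub>R W t s \<phi> f + d *\<^sub>R W t s \<psi> h"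
 unfolding W_def by (simp add: traj_combine seg_combine traj_continuous)

lemma integral_combine': "s \<le> u ==> u \<le> t ==> (f :: real => real ^ 'n) integrable_on {s..t} ==>
  integral {s..u} f + integral {u..t} f = integral {s..t} f"
 by (rule Henstock_Kurzweil_Integration.integral_combine)

text \<open>
  The two curves agree from \<open>u - r\<close> on but not before, since \<^const>\<open>hist\<close> freezes the values left of \<open>u - r\<close>.
\<close>

lemma traj_cocycle:
 assumes f: "forcing f" and su: "s \<le> u" and t: "u - r \<le> t"
 shows "traj u (W u s \<phi> f) f t = traj s \<phi> f t"
proof -
 define x where "x = traj s \<phi> f"
 have cx: "continuous_on UNIV x" unfolding x_def by (rule traj_continuous[OF f])
 define y where "y t = (if t \<le> u then hist (W u s \<phi> f) u t else x t)" for t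
 have hx: "hist (W u s \<phi> f) u t = x t" if "u - r \<le> t" "t \<le> u" for t
  using seg_value[OF cx, of t u] that by (simp add: hist_def W_def x_def)
 have cy: "continuous_on UNIV y"
 proof -
  have "continuous_on ({..u} \<union> {u..}) (\<lambda>t. if t \<in> {..u} then hist (W u s \<phi> f) u t else x t)"
   using hx[of u] r by (intro continuous_on_cases continuous_on_subset[OF hist_continuous] continuous_on_subset[OF cx]) auto
  moreover have "{..u} \<union> {u..} = UNIV" by auto
  ultimately show ?thesis by (simp add: y_def[abs_def])
 qed
 have yx: "y t = x t" if "u - r \<le> t" for t using hx that by (simp add: y_def)
 have rhs_eq: "rhs f y t = rhs f x t" if "u \<le> t" for t
  unfolding rhs_def using segment_cong[of t y x] yx that by simp
 have "sol u (W u s \<phi> f) f y"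
  unfolding sol_def
 proof (intro conjI allI impI cy)
  show "y t = hist (W u s \<phi> f) u t" if "t \<le> u" for t using that by (simp add: y_def)
  fix t assume ut: "u \<le> t"
  have "x t = x u + integral {u..t} (rhs f x)"
   using traj_after[OF f, of s t \<phi>] traj_after[OF f, of s u \<phi>] su ut
    integral_combine'[OF su ut rhs_traj_int[OF f, of s \<phi>]]
   by (simp add: x_def algebra_simps)
  also have "integral {u..t} (rhs f x) = integral {u..t} (rhs f y)"
   by (intro integral_cong) (auto simp: rhs_eq)
  finally show "y t = hist (W u s \<phi> f) u u + integral {u..t} (rhs f y)"
   using yx[of t] hx[of u] ut r by simp
 qed
 then have "y = traj u (W u s \<phi> f) f" by (rule sol_unique[OF f])
 then show ?thesis using yx[OF t] by (simp add: x_def)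
qed

lemma W_cocycle:
 assumes "forcing f" "s \<le> u" "u \<le> t"
 shows "W t u (W u s \<phi> f) f = W t s \<phi> f"
 unfolding W_def[of t] using traj_cocycle[OF assms(1,2)] assms(3) by (intro seg_cong) auto

text \<open>
  The value of the forcing at the initial time does not enter; this is what allows forcing terms that are cut off
  at an endpoint of an interval.
\<close>

lemma traj_forcing_cong:
 assumes f: "forcing f" and h: "forcing h" and eq: "!!u. u \<in> {s<..b} ==> f u = h u" and t: "t \<le> b"
 shows "traj s \<phi> f t = traj s \<phi> h t"
proof (rule volterra.agree_upto[OF volterra_rhs[OF forcing_0], of _ _ s "norm \<phi>" b])
 fix t assume t: "t \<in> {s..b}"
 have "integral {s..t} (rhs f (traj s \<phi> f)) - integral {s..t} (rhs h (traj s \<phi> h))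
   = integral {s..t} (\<lambda>u. rhs f (traj s \<phi> f) u - rhs h (traj s \<phi> h) u)"
  by (rule Henstock_Kurzweil_Integration.integral_diff[symmetric, OF rhs_traj_int[OF f] rhs_traj_int[OF h]])
 also have "\<dots> = integral {s..t} (\<lambda>u. rhs (\<lambda>_. 0) (traj s \<phi> f) u - rhs (\<lambda>_. 0) (traj s \<phi> h) u)"
  by (rule integral_spike[of "{s}"]) (use eq t in \<open>auto simp: rhs_def\<close>)
 finally show "traj s \<phi> f t - traj s \<phi> h t = integral {s..t} (\<lambda>u. rhs (\<lambda>_. 0) (traj s \<phi> f) u - rhs (\<lambda>_. 0) (traj s \<phi> h) u)"
  using t by (simp add: traj_after[OF f] traj_after[OF h])
qed (use t in \<open>auto simp: traj_continuous f h traj_before hist_bound\<close>)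

lemma W_forcing_cong:
 assumes "forcing f" "forcing h" "!!u. u \<in> {s<..t} ==> f u = h u"
 shows "W t s \<phi> f = W t s \<phi> h"
 unfolding W_def using traj_forcing_cong[OF assms] by (intro seg_cong) auto

section \<open>Solutions of the initial value problem and the evolution maps\<close>

text \<open>
  For a right-hand side that depends on a continuous curve in a causal way, the solutions in the
  sense of absolutely continuous functions are the solutions of the Volterra equation.
\<close>

lemma is_sol_imp_solution:
 assumes v: "volterra l G" and G: "!!x t. G x t = Fn t (segment r x t)"
  and x: "volterra.is_sol G s (hist \<phi> s) x"
 shows "solution r Fn s (apply_bcontfun \<phi>) x"
 unfolding solution_def
proof (intro conjI ballI allI)
 interpret volterra l G by (rule v)
 have cx: "continuous_on UNIV x" and xb: "!!t. t \<le> s ==> x t = hist \<phi> s t"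
  and xa: "!!t. t \<ge> s ==> x t = hist \<phi> s s + integral {s..t} (G x)" using x by (auto simp: is_sol_def)
 have Gai: "G x absolutely_integrable_on {a..b}" for a b
  by (rule F_integrable[OF cx, of s "norm \<phi>"]) (simp add: xb hist_bound)
 show "x (s + \<omega>) = apply_bcontfun \<phi> \<omega>" if "\<omega> \<in> {- r..0}" for \<omega> using xb[of "s + \<omega>"] that by (simp add: hist_def)
 show "abs_cont_on s b x" for b
 proof -
  have "abs_cont_on s b (\<lambda>t. integral {s..t} (G x))" by (intro abs_cont_on_integral Gai)
  moreover have "norm (x (Sup i) - x (Inf i)) = norm (integral {s..Sup i} (G x) - integral {s..Inf i} (G x))"
   if "d division_of k" "k \<subseteq> {s..b}" "i \<in> d" for d k i
   using division_of_real_interval[OF that] by (simp add: xa)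
  ultimately show ?thesis unfolding abs_cont_on_def by (metis (no_types, lifting) sum.cong)
 qed
 obtain N where N: "negligible N" "!!s t. t \<notin> N ==> s < t ==> ((\<lambda>t. integral {s..t} (G x)) has_vector_derivative G x t) (at t)"
  using integral_has_derivative_ae[of "G x"] Gai set_lebesgue_integral_eq_integral(1) by blast
 show "AE t in lborel. s \<le> t --> (x has_vector_derivative Fn t (segment r x t)) (at t)"
 proof (rule negligible_AE_lborel)
  show "negligible (insert s N)" using N(1) by simp
  show "s \<le> t --> (x has_vector_derivative Fn t (segment r x t)) (at t)" if t: "t \<notin> insert s N" for t
  proof
   assume "s \<le> t"
   then have st: "s < t" using t by auto
   have "((\<lambda>t. hist \<phi> s s + integral {s..t} (G x)) has_vector_derivative G x t) (at t)"
    using has_vector_derivative_add[OF has_vector_derivative_const N(2)[OF _ st]] t by simp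
   then have "(x has_vector_derivative G x t) (at t)"
    by (rule has_vector_derivative_transform_within_open[where S = "{s<..}"]) (use st in \<open>auto simp: xa\<close>)
   then show "(x has_vector_derivative Fn t (segment r x t)) (at t)" by (simp add: G)
  qed
 qed
qed

text \<open>
  Left of \<open>s - r\<close> a solution is arbitrary, hence the redefinition before \<open>s\<close>.
\<close>

lemma solution_imp_is_sol:
 assumes v: "volterra l G" and G: "!!x t. G x t = Fn t (segment r x t)"
  and x: "solution r Fn s (apply_bcontfun \<phi>) x" and \<phi>: "\<phi> \<in> C r"
 shows "volterra.is_sol G s (hist \<phi> s) (\<lambda>t. if t \<le> s then hist \<phi> s t else x t)"
proof -
 interpret volterra l G by (rule v)
 define y where "y t = (if t \<le> s then hist \<phi> s t else x t)" for t
 have x1: "x (s + \<omega>) = apply_bcontfun \<phi> \<omega>" if "\<omega> \<in> {- r..0}" for \<omega> using x that by (simp add: solution_def)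
 have ac: "abs_cont_on s b x" for b using x by (simp add: solution_def)
 obtain N where N: "negligible N" "!!t. t \<notin> N ==> s \<le> t ==> (x has_vector_derivative Fn t (segment r x t)) (at t)"
  using AE_lborel_negligible[of "\<lambda>t. s \<le> t --> (x has_vector_derivative Fn t (segment r x t)) (at t)"] x
  unfolding solution_def by blast
 have yx: "y t = x t" if "s - r \<le> t" for t
  using x1[of "t - s"] that by (auto simp: y_def hist_def)
 have cxs: "continuous_on {s..} x"
 proof -
  have "continuous_on {s..<b} x" for b
   using abs_cont_on_imp_continuous[OF ac[of b]] by (rule continuous_on_subset) auto
  then have "continuous (at t within {s..}) x" if "t \<ge> s" for t
  proof -
   have "continuous (at t within {s..<t + 1}) x"
    using \<open>continuous_on {s..<t + 1} x\<close> that by (simp add: continuous_on_eq_continuous_within)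
   moreover have "at t within {s..} = at t within {s..<t + 1}"
    by (rule at_within_nhd[of _ "{..<t + 1}"]) auto
   ultimately show ?thesis by simp
  qed
  then show ?thesis by (simp add: continuous_on_eq_continuous_within)
 qed
 have cy: "continuous_on UNIV y"
 proof -
  have "continuous_on ({..s} \<union> {s..}) (\<lambda>t. if t \<in> {..s} then hist \<phi> s t else x t)"
   using x1[of 0] r by (intro continuous_on_cases continuous_on_subset[OF hist_continuous] cxs) (auto simp: hist_def)
  moreover have "{..s} \<union> {s..} = UNIV" by auto
  ultimately show ?thesis by (simp add: y_def[abs_def])
 qed
 have Gai: "G y absolutely_integrable_on {a..b}" for a b
  by (rule F_integrable[OF cy, of s "norm \<phi>"]) (simp add: y_def hist_bound)
 have "x t = x s + integral {s..t} (G y)" if "s \<le> t" for t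
 proof (rule abs_cont_on_imp_integral[OF ac that Gai N(1)])
  fix u assume u: "u \<in> {s..t} - N"
  then have "segment r x u = segment r y u" by (intro segment_cong) (simp add: yx)
  then show "(x has_vector_derivative G y u) (at u)" using N(2)[of u] u by (simp add: G)
 qed
 moreover have "x s = hist \<phi> s s" using x1[of 0] r by (simp add: hist_def)
 moreover have "y t = x t" if "s \<le> t" for t using yx[of t] that r by simp
 moreover have "y t = hist \<phi> s t" if "t \<le> s" for t using that by (simp add: y_def)
 ultimately have "is_sol s (hist \<phi> s) y"
  unfolding is_sol_def using cy by simp
 then show ?thesis by (simp add: y_def[abs_def])
qed

text \<open>
  The description operator in \<^const>\<open>evolution\<close> is resolved by existence and uniqueness for the Volterra equation.
\<close>

lemma evolution_eq_segment:
 assumes v: "volterra l G" and G: "!!x t. G x t = Fn t (segment r x t)"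
  and x: "volterra.is_sol G s (hist \<phi> s) x" and \<phi>: "\<phi> \<in> C r" and st: "s \<le> t"
 shows "evolution r Fn t s (apply_bcontfun \<phi>) = segment r x t"
 unfolding evolution_def
proof (rule the_equality)
 show "\<exists>y. solution r Fn s (apply_bcontfun \<phi>) y \<and> segment r x t = segment r y t"
  using is_sol_imp_solution[OF v G x] by blast
 fix \<psi> assume "\<exists>y. solution r Fn s (apply_bcontfun \<phi>) y \<and> \<psi> = segment r y t"
 then obtain y where y: "solution r Fn s (apply_bcontfun \<phi>) y" "\<psi> = segment r y t" by blast
 have E: "(\<lambda>t. if t \<le> s then hist \<phi> s t else y t) = x"
  by (rule volterra.is_sol_unique[OF v solution_imp_is_sol[OF v G y(1) \<phi>] x hist_bound])
 have "y u = (if u \<le> s then hist \<phi> s u else y u)" if "s - r \<le> u" for u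
  using y(1) that unfolding solution_def hist_def by (auto dest!: bspec[where x = "u - s"])
 then have "y u = x u" if "s - r \<le> u" for u using fun_cong[OF E, of u] that by simp
 then show "\<psi> = segment r x t" unfolding y(2) using st by (intro segment_cong) auto
qed

lemma T_eq:
 assumes "\<phi> \<in> C r" "s \<le> t"
 shows "T r \<zeta> t s \<phi> = W t s \<phi> (\<lambda>_. 0)"
proof -
 have "evolution r (L r \<zeta>) t s (apply_bcontfun \<phi>) = segment r (traj s \<phi> (\<lambda>_. 0)) t"
  by (rule evolution_eq_segment[OF volterra_rhs[OF forcing_0] _ _ assms])
    (use sol_traj[OF forcing_0, of s \<phi>] in \<open>simp_all add: rhs_def[symmetric] sol_is_sol[OF forcing_0, symmetric]\<close>, simp add: rhs_def)
 then show ?thesis by (simp add: T_def W_def seg_def)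
qed

end

section \<open>The perturbed equation in mild form\<close>

locale perturbation = kernel r \<zeta> for r and \<zeta> :: "real => real => real ^ ('n::finite) ^ 'n" +
 fixes g :: "real => 'n phase => real ^ 'n" and k :: "real => real"
 assumes g_cont: "continuous_on (UNIV \<times> C r) (\<lambda>(t, \<phi>). g t \<phi>)"
  and g_zero: "g t 0 = 0"
  and k_rate: "rate k"
  and g_lip: "\<phi> \<in> C r ==> \<psi> \<in> C r ==> norm (g t \<phi> - g t \<psi>) \<le> k t * norm (\<phi> - \<psi>)"
begin

lemma g_path_continuous:
 assumes "continuous_on A y" "!!t. t \<in> A ==> y t \<in> C r"
 shows "continuous_on A (\<lambda>t. g t (y t))"
proof -
 have "continuous_on A (\<lambda>t. (\<lambda>(t, \<phi>). g t \<phi>) (t, y t))"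
  by (rule continuous_on_compose2[OF g_cont]) (use assms in \<open>auto intro!: continuous_intros\<close>)
 then show ?thesis by simp
qed

definition G :: "'n curve => 'n curve" where
 "G x t = L r \<zeta> t (segment r x t) + g t (seg r x t)"

lemma volterra_G: "volterra (\<lambda>t. m t + k t) G"
proof
 interpret k: rate k by (rule k_rate)
 show "(\<lambda>t. m t + k t) absolutely_integrable_on {a..b}" for a b
  by (intro set_integral_add m(1) k.rate_integrable)
 show "0 \<le> m t + k t" for t using m(2) k.rate_nonneg by simp
 show "G x \<in> borel_measurable lebesgue" if x: "continuous_on UNIV x" for x
 proof -
  have "continuous_on UNIV (\<lambda>t. g t (seg r x t))"
   by (intro g_path_continuous seg_continuous seg_C x)
  then show ?thesis
   unfolding G_def[abs_def] using L_segment_measurable[OF x]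
   by (intro borel_measurable_add) (auto intro!: measurable_completion borel_measurable_continuous_onI)
 qed
 show "norm (G x t - G y t) \<le> (m t + k t) * B"
  if x: "continuous_on UNIV x" and y: "continuous_on UNIV y" and B: "0 \<le> B" "!!v. v \<le> t ==> norm (x v - y v) \<le> B" for x y t B
 proof -
  have "norm (seg r x t - seg r y t) \<le> B"
   unfolding seg_diff[OF x y, symmetric] by (rule seg_norm_le) (use x y B in \<open>auto intro!: continuous_intros\<close>)
  then have "norm (g t (seg r x t) - g t (seg r y t)) \<le> k t * B"
   using g_lip[OF seg_C[OF x, of t] seg_C[OF y, of t], of t] k.rate_nonneg[of t] by (meson mult_left_mono order_trans)
  moreover have "norm (L r \<zeta> t (segment r x t) - L r \<zeta> t (segment r y t)) \<le> m t * B" by (rule L_lip[OF x y B])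
  ultimately show ?thesis
   unfolding G_def distrib_right add_diff_add by (intro norm_triangle_le) linarith
 qed
 show "norm (G (\<lambda>_. 0) t) \<le> m t + k t" for t
 proof -
  have "seg r (\<lambda>_. 0 :: real ^ 'n) t = 0" by (rule bcontfun_eqI) (simp add: seg_apply segment_eq)
  then have "G (\<lambda>_. 0) t = 0" by (simp add: G_def L_zero g_zero)
  then show ?thesis using add_nonneg_nonneg[OF m(2)[of t] k.rate_nonneg[of t]] by simp
 qed
qed

lemma R_eq_seg:
 assumes x: "volterra.is_sol G s (hist \<phi> s) x" and \<phi>: "\<phi> \<in> C r" and st: "s \<le> t"
 shows "R r \<zeta> g t s \<phi> = seg r x t"
proof -
 have "evolution r (\<lambda>\<tau> \<psi>. L r \<zeta> \<tau> \<psi> + g \<tau> (Bcontfun \<psi>)) t s (apply_bcontfun \<phi>) = segment r x t"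
  by (rule evolution_eq_segment[OF volterra_G _ x \<phi> st]) (simp add: G_def seg_def)
 then show ?thesis by (simp add: R_def seg_def)
qed

text \<open>
  The mild form: the perturbed solution is a solution of the linear equation forced by \<open>g\<close> along the solution
  itself.
\<close>

lemma R_mild:
 assumes \<phi>: "\<phi> \<in> C r"
 shows "\<exists>y. continuous_on UNIV y \<and> (\<forall>t. y t \<in> C r) \<and> y s = \<phi> \<and> (\<forall>t\<ge>s. R r \<zeta> g t s \<phi> = y t) \<and>
  (\<forall>t\<ge>s. y t = W t s \<phi> (\<lambda>u. g u (y u)))"
proof -
 interpret volterra "\<lambda>t. m t + k t" G by (rule volterra_G)
 obtain x where x: "is_sol s (hist \<phi> s) x" using is_sol_exists[OF hist_continuous hist_bound] by blast
 have cx: "continuous_on UNIV x" using x by (simp add: is_sol_def)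
 define f where "f u = g u (seg r x u)" for u
 have cf: "continuous_on UNIV f" unfolding f_def by (intro g_path_continuous seg_continuous seg_C cx)
 note ff = forcing_continuous[OF cf]
 have "rhs f x = G x" by (simp add: rhs_def G_def f_def fun_eq_iff)
 then have "sol s \<phi> f x" using x unfolding sol_def is_sol_def by simp
 then have xt: "x = traj s \<phi> f" by (rule sol_unique[OF ff])
 have "seg r x s = \<phi>" using W_start[OF ff \<phi>, of s] by (simp add: W_def xt)
 moreover have "R r \<zeta> g t s \<phi> = seg r x t" if "s \<le> t" for t by (rule R_eq_seg[OF x \<phi> that])
 moreover have "seg r x t = W t s \<phi> (\<lambda>u. g u (seg r x u))" for t
  using xt unfolding W_def f_def by simp
 ultimately show ?thesis using seg_continuous[OF cx] seg_C[OF cx] by blast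
qed

text \<open>
  Conversely a curve in the phase space that satisfies the mild equation is the perturbed solution. The
  forcing term is a separate function because it need not be \<open>g\<close> along \<open>y\<close> before \<open>s\<close>.
\<close>

lemma R_unique:
 assumes \<phi>: "\<phi> \<in> C r" and f: "forcing f" and fg: "!!u. s \<le> u ==> f u = g u (y u)"
  and y: "!!t. s \<le> t ==> y t = W t s \<phi> f" and st: "s \<le> t"
 shows "R r \<zeta> g t s \<phi> = y t"
proof -
 interpret volterra "\<lambda>t. m t + k t" G by (rule volterra_G)
 define x where "x = traj s \<phi> f"
 have cx: "continuous_on UNIV x" unfolding x_def by (rule traj_continuous[OF f])
 have "rhs f x u = G x u" if "s \<le> u" for u
  using fg[OF that] y[OF that] by (simp add: rhs_def G_def x_def W_def)
 then have "integral {s..t} (rhs f x) = integral {s..t} (G x)" for t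
  by (intro integral_cong) auto
 then have "is_sol s (hist \<phi> s) x"
  using sol_traj[OF f, of s \<phi>] unfolding sol_def is_sol_def x_def[symmetric] by simp
 then show ?thesis using R_eq_seg[OF _ \<phi> st] y[OF st] by (simp add: W_def x_def)
qed

end

section \<open>Solutions with a jump in the initial function\<close>

context kernel
begin

lemma traj_zero: "traj s 0 (\<lambda>_. 0) t = 0"
 using traj_combine[OF forcing_0 forcing_0, of s 0 0 0 0] by (simp add: fun_eq_iff)

definition jump_force :: "real => real ^ 'n => real => real ^ 'n" where
 "jump_force \<sigma> p u = (if u \<le> \<sigma> then 0 else - (\<zeta> u (\<sigma> - u) *v p))"

lemma forcing_jump: "forcing (jump_force \<sigma> p)"
proof -
 have meas: "jump_force \<sigma> p \<in> borel_measurable lebesgue"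
 proof -
  have "continuous_on UNIV (\<lambda>A :: real ^ 'n ^ 'n. - (A *v p))"
   by (intro continuous_intros bounded_bilinear.continuous_on[OF bounded_bilinear_matrix_vector_mult])
  then have "(\<lambda>u. - ((if u \<le> \<sigma> then 0 else \<zeta> u (\<sigma> - u)) *v p)) \<in> borel_measurable lebesgue"
   by (rule borel_measurable_continuous_on[OF _ zeta_diagonal_measurable])
  moreover have "(\<lambda>u. - ((if u \<le> \<sigma> then 0 else \<zeta> u (\<sigma> - u)) *v p)) = jump_force \<sigma> p"
   by (auto simp: jump_force_def fun_eq_iff)
  ultimately show ?thesis by simp
 qed
 have bound: "norm (jump_force \<sigma> p u) \<le> norm p * m u" for u
 proof (cases "u \<le> \<sigma>")
  case False
  then have "norm (- (\<zeta> u (\<sigma> - u) *v p)) \<le> m u * norm p"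
   by (intro L_bound[OF has_stieltjes_integral_jump]) auto
  then show ?thesis using False by (simp add: jump_force_def mult.commute)
 qed (use m(2) in \<open>simp add: jump_force_def\<close>)
 have "jump_force \<sigma> p absolutely_integrable_on {a..b}" for a b
 proof (rule measurable_bounded_by_integrable_imp_absolutely_integrable[where g = "\<lambda>u. norm p * m u"])
  show "jump_force \<sigma> p \<in> borel_measurable (lebesgue_on {a..b})" using meas by (rule measurable_restrict_space1)
  show "(\<lambda>u. norm p * m u) integrable_on {a..b}" using m.rate_int by (rule integrable_on_mult_right)
 qed (use bound in auto)
 then show ?thesis unfolding forcing_def using meas by blast
qed

text \<open>
  A solution whose initial function is \<open>X0 p\<close> splits into the jump itself and a continuous part; the
  latter sees the jump through the forcing term \<open>jump_force \<sigma> p\<close>.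
\<close>

definition jump_cont :: "real => real ^ 'n => 'n curve" where
 "jump_cont \<sigma> p = traj \<sigma> 0 (jump_force \<sigma> p)"

definition jump_sol :: "real => real ^ 'n => 'n curve" where
 "jump_sol \<sigma> p t = (if t < \<sigma> then 0 else p) + jump_cont \<sigma> p t"

definition jump_rhs :: "real => real ^ 'n => 'n curve" where
 "jump_rhs \<sigma> p u = rhs (jump_force \<sigma> p) (jump_cont \<sigma> p) u"

lemma jump_cont_continuous: "continuous_on UNIV (jump_cont \<sigma> p)"
 unfolding jump_cont_def by (rule traj_continuous[OF forcing_jump])

lemma jump_cont_before: "t \<le> \<sigma> ==> jump_cont \<sigma> p t = 0"
 unfolding jump_cont_def by (simp add: traj_before[OF forcing_jump] hist_def)

lemma jump_rhs_before: "u \<le> \<sigma> ==> jump_rhs \<sigma> p u = 0"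
proof -
 assume "u \<le> \<sigma>"
 then have "segment r (jump_cont \<sigma> p) u = segment r (\<lambda>_. 0) u"
  by (intro segment_cong) (simp add: jump_cont_before)
 then show ?thesis using \<open>u \<le> \<sigma>\<close> by (simp add: jump_rhs_def rhs_def jump_force_def L_zero)
qed

lemma jump_rhs_int: "jump_rhs \<sigma> p integrable_on {a..b}"
 unfolding jump_rhs_def[abs_def] jump_cont_def using rhs_traj_int[OF forcing_jump] by simp

lemma jump_rhs_abs_int: "jump_rhs \<sigma> p absolutely_integrable_on {a..b}"
 unfolding jump_rhs_def[abs_def] jump_cont_def
 by (rule volterra.F_integrable[OF volterra_rhs[OF forcing_jump] traj_continuous[OF forcing_jump], where s = \<sigma> and W = 0])
   (simp add: traj_before[OF forcing_jump] hist_def)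

lemma jump_sol_eq:
 assumes "s \<le> \<sigma>"
 shows "jump_sol \<sigma> p t = (if t < \<sigma> then 0 else p) + integral {s..t} (jump_rhs \<sigma> p)"
proof (cases "t < \<sigma>")
 case True
 have "integral {s..t} (jump_rhs \<sigma> p) = integral {s..t} (\<lambda>_. 0)"
  by (rule integral_cong) (use True in \<open>simp add: jump_rhs_before\<close>)
 then show ?thesis using True by (simp add: jump_sol_def jump_cont_before)
next
 case False
 have "integral {s..\<sigma>} (jump_rhs \<sigma> p) = integral {s..\<sigma>} (\<lambda>_. 0)"
  by (rule integral_cong) (simp add: jump_rhs_before)
 then have "integral {s..t} (jump_rhs \<sigma> p) = integral {\<sigma>..t} (jump_rhs \<sigma> p)"
  using integral_combine'[OF assms, of t "jump_rhs \<sigma> p"] jump_rhs_int False by simp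
 then show ?thesis
  using False traj_after[OF forcing_jump, of \<sigma> t 0 \<sigma> p]
  by (simp add: jump_sol_def jump_cont_def jump_rhs_def[abs_def] hist_def)
qed

text \<open>
  At the time of the jump itself the segment jumps at \<open>0\<close>; this single time is irrelevant.
\<close>

lemma jump_sol_stieltjes:
 assumes "u \<noteq> \<sigma>"
 shows "has_stieltjes_integral (\<zeta> u) (segment r (jump_sol \<sigma> p) u) (jump_rhs \<sigma> p u) (- r) 0"
proof -
 have jump: "has_stieltjes_integral (\<zeta> u) (segment r (\<lambda>t. if t < \<sigma> then 0 else p) u) (jump_force \<sigma> p u) (- r) 0"
 proof (cases "u < \<sigma>")
  case True
  then have "segment r (\<lambda>t. if t < \<sigma> then 0 else p) u = (\<lambda>_. 0)"
   using r by (auto simp: segment_eq fun_eq_iff)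
  then show ?thesis using True has_stieltjes_integral_0 by (simp add: jump_force_def)
 next
  case False
  then show ?thesis using has_stieltjes_integral_jump[of \<sigma> u p] assms by (simp add: jump_force_def)
 qed
 have "segment r (jump_sol \<sigma> p) u = (\<lambda>\<omega>. segment r (jump_cont \<sigma> p) u \<omega> + segment r (\<lambda>t. if t < \<sigma> then 0 else p) u \<omega>)"
  by (simp add: segment_eq jump_sol_def fun_eq_iff)
 then show ?thesis
  using has_stieltjes_integral_add[OF L_integral[OF jump_cont_continuous] jump]
  by (simp add: jump_rhs_def rhs_def)
qed

text \<open>
  Only one of the two solutions is assumed to have Stieltjes integrable segments: the difference of the
  solutions is continuous, so integrability carries over.
\<close>

lemma linear_solution_unique:
 assumes x1: "solution r (L r \<zeta>) s \<phi> x1" and x2: "solution r (L r \<zeta>) s \<phi> x2"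
  and int: "!!u. s < u ==> \<exists>I. has_stieltjes_integral (\<zeta> u) (segment r x1 u) I (- r) 0"
  and t: "s - r \<le> t"
 shows "x2 t = x1 t"
proof -
 define d where "d t = (if t \<le> s then 0 else x2 t - x1 t)" for t
 have same: "x2 t = x1 t" if "s - r \<le> t" "t \<le> s" for t
  using x1 x2 that unfolding solution_def by (auto dest!: bspec[where x = "t - s"])
 have dx: "d t = x2 t - x1 t" if "s - r \<le> t" for t using same that by (simp add: d_def)
 have ac: "abs_cont_on s b (\<lambda>t. x2 t - x1 t)" for b
  using x1 x2 unfolding solution_def by (blast intro: abs_cont_on_diff)
 have acd: "abs_cont_on s b d" for b
 proof -
  have "norm (d (Sup i) - d (Inf i)) = norm (x2 (Sup i) - x1 (Sup i) - (x2 (Inf i) - x1 (Inf i)))"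
   if "dd division_of k" "k \<subseteq> {s..b}" "i \<in> dd" for dd k i
   using division_of_real_interval[OF that] r by (simp add: dx)
  then show ?thesis using ac[of b] unfolding abs_cont_on_def by (metis (no_types, lifting) sum.cong)
 qed
 have cd: "continuous_on UNIV d"
 proof -
  have "continuous (at t) d" for t
  proof -
   have "continuous_on {s..max s t + 1} d" by (rule abs_cont_on_imp_continuous[OF acd])
   then have "continuous_on ({..s} \<union> {s..max s t + 1}) (\<lambda>t. if t \<in> {..s} then 0 else d t)"
    by (intro continuous_on_cases) (auto simp: d_def)
   moreover have "(\<lambda>t. if t \<in> {..s} then 0 else d t) = d" by (auto simp: d_def)
   ultimately have "continuous_on ({..s} \<union> {s..max s t + 1}) d" by (simp only:)
   then have "continuous_on {..<max s t + 1} d" by (rule continuous_on_subset) auto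
   then show ?thesis using continuous_on_eq_continuous_at[OF open_lessThan, of "max s t + 1" d] by force
  qed
  then show ?thesis by (simp add: continuous_on_eq_continuous_at)
 qed
 obtain N1 where N1: "negligible N1" "!!t. t \<notin> N1 ==> s \<le> t ==> (x1 has_vector_derivative L r \<zeta> t (segment r x1 t)) (at t)"
  using AE_lborel_negligible[of "\<lambda>t. s \<le> t --> (x1 has_vector_derivative L r \<zeta> t (segment r x1 t)) (at t)"] x1
  unfolding solution_def by blast
 obtain N2 where N2: "negligible N2" "!!t. t \<notin> N2 ==> s \<le> t ==> (x2 has_vector_derivative L r \<zeta> t (segment r x2 t)) (at t)"
  using AE_lborel_negligible[of "\<lambda>t. s \<le> t --> (x2 has_vector_derivative L r \<zeta> t (segment r x2 t)) (at t)"] x2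
  unfolding solution_def by blast
 have ai: "rhs (\<lambda>_. 0) d absolutely_integrable_on {a..b}" for a b
  by (rule volterra.F_integrable[OF volterra_rhs[OF forcing_0] cd, of s 0]) (simp add: d_def)
 have "d t = d s + integral {s..t} (rhs (\<lambda>_. 0) d)" if "s \<le> t" for t
 proof (rule abs_cont_on_imp_integral[OF acd that ai])
  show "negligible (insert s (N1 \<union> N2))" using N1(1) N2(1) by simp
  fix u assume u: "u \<in> {s..t} - insert s (N1 \<union> N2)"
  obtain I where I: "has_stieltjes_integral (\<zeta> u) (segment r x1 u) I (- r) 0" using int[of u] u by auto
  have "segment r x2 u = (\<lambda>\<omega>. segment r x1 u \<omega> + segment r d u \<omega>)"
  proof
   fix \<omega>
   have "s - r \<le> u + max (- r) (min 0 \<omega>)" using u by auto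
   then show "segment r x2 u \<omega> = segment r x1 u \<omega> + segment r d u \<omega>" by (simp add: segment_eq dx)
  qed
  then have "has_stieltjes_integral (\<zeta> u) (segment r x2 u) (I + L r \<zeta> u (segment r d u)) (- r) 0"
   using has_stieltjes_integral_add[OF I L_integral[OF cd]] by simp
  then have "L r \<zeta> u (segment r x2 u) - L r \<zeta> u (segment r x1 u) = rhs (\<lambda>_. 0) d u"
   using L_eq[OF I] by (simp add: L_eq rhs_def)
  moreover have "((\<lambda>t. x2 t - x1 t) has_vector_derivative L r \<zeta> u (segment r x2 u) - L r \<zeta> u (segment r x1 u)) (at u)"
   using N1(2)[of u] N2(2)[of u] u by (intro has_vector_derivative_diff) auto
  ultimately have "((\<lambda>t. x2 t - x1 t) has_vector_derivative rhs (\<lambda>_. 0) d u) (at u)" by simp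
  then show "(d has_vector_derivative rhs (\<lambda>_. 0) d u) (at u)"
   by (rule has_vector_derivative_transform_within_open[where S = "{s<..}"]) (use u r in \<open>auto simp: dx\<close>)
 qed
 then have "sol s 0 (\<lambda>_. 0) d" unfolding sol_def using cd by (auto simp: d_def hist_def)
 then have "d = traj s 0 (\<lambda>_. 0)" by (rule sol_unique[OF forcing_0])
 then have "d t = 0" by (simp add: traj_zero)
 then show ?thesis using dx[OF t] by simp
qed

text \<open>
  The initial functions \<open>X0 p - q\<close> include \<open>P0 r \<zeta> P \<sigma> p\<close>, for which \<open>q = Q0 r \<zeta> P \<sigma> p\<close>.
\<close>

lemma T0_jump:
 assumes q: "q \<in> C r" and t: "\<sigma> \<le> t"
 shows "T0 r \<zeta> t \<sigma> (\<lambda>\<omega>. X0 p \<omega> - apply_bcontfun q \<omega>) = segment r (\<lambda>u. jump_sol \<sigma> p u - traj \<sigma> q (\<lambda>_. 0) u) t"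
proof -
 define x where "x u = jump_sol \<sigma> p u - traj \<sigma> q (\<lambda>_. 0) u" for u
 define \<psi> where "\<psi> u = jump_rhs \<sigma> p u - rhs (\<lambda>_. 0) (traj \<sigma> q (\<lambda>_. 0)) u" for u
 have \<psi>i: "\<psi> absolutely_integrable_on {a..b}" for a b
  unfolding \<psi>_def
  by (intro set_integral_diff jump_rhs_abs_int
    volterra.F_integrable[OF volterra_rhs[OF forcing_0] traj_continuous[OF forcing_0], where s = \<sigma> and W = "norm q"])
    (simp add: traj_before[OF forcing_0] hist_bound)
 have st: "has_stieltjes_integral (\<zeta> u) (segment r x u) (\<psi> u) (- r) 0" if "\<sigma> < u" for u
 proof -
  have "segment r x u = (\<lambda>\<omega>. segment r (jump_sol \<sigma> p) u \<omega> - segment r (traj \<sigma> q (\<lambda>_. 0)) u \<omega>)"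
   by (simp add: segment_eq x_def fun_eq_iff)
  then show ?thesis
   using has_stieltjes_integral_diff[OF jump_sol_stieltjes L_integral[OF traj_continuous[OF forcing_0]], of u \<sigma> p \<sigma> q] that
   by (simp add: \<psi>_def rhs_def)
 qed
 have xeq: "x u = p - apply_bcontfun q 0 + integral {\<sigma>..u} \<psi>" if "\<sigma> \<le> u" for u
 proof -
  have "integral {\<sigma>..u} \<psi> = integral {\<sigma>..u} (jump_rhs \<sigma> p) - integral {\<sigma>..u} (rhs (\<lambda>_. 0) (traj \<sigma> q (\<lambda>_. 0)))"
   unfolding \<psi>_def by (rule Henstock_Kurzweil_Integration.integral_diff[OF jump_rhs_int rhs_traj_int[OF forcing_0]])
  then show ?thesis using that
   by (simp add: x_def jump_sol_eq[of \<sigma> \<sigma>] traj_after[OF forcing_0] hist_def)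
 qed
 have sx: "solution r (L r \<zeta>) \<sigma> (\<lambda>\<omega>. X0 p \<omega> - apply_bcontfun q \<omega>) x"
  unfolding solution_def
 proof (intro conjI ballI allI)
  show "x (\<sigma> + \<omega>) = X0 p \<omega> - apply_bcontfun q \<omega>" if "\<omega> \<in> {- r..0}" for \<omega>
   using that by (simp add: x_def jump_sol_def X0_def jump_cont_before traj_before[OF forcing_0] hist_def)
  show "abs_cont_on \<sigma> b x" for b
  proof -
   have "abs_cont_on \<sigma> b (\<lambda>t. integral {\<sigma>..t} \<psi>)" by (intro abs_cont_on_integral \<psi>i)
   moreover have "norm (x (Sup i) - x (Inf i)) = norm (integral {\<sigma>..Sup i} \<psi> - integral {\<sigma>..Inf i} \<psi>)"
    if "d division_of k" "k \<subseteq> {\<sigma>..b}" "i \<in> d" for d k i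
    using division_of_real_interval[OF that] by (simp add: xeq)
   ultimately show ?thesis unfolding abs_cont_on_def by (metis (no_types, lifting) sum.cong)
  qed
  obtain N where N: "negligible N" "!!s t. t \<notin> N ==> s < t ==> ((\<lambda>t. integral {s..t} \<psi>) has_vector_derivative \<psi> t) (at t)"
   using integral_has_derivative_ae[of \<psi>] \<psi>i set_lebesgue_integral_eq_integral(1) by blast
  show "AE t in lborel. \<sigma> \<le> t --> (x has_vector_derivative L r \<zeta> t (segment r x t)) (at t)"
  proof (rule negligible_AE_lborel)
   show "negligible (insert \<sigma> N)" using N(1) by simp
   show "\<sigma> \<le> t --> (x has_vector_derivative L r \<zeta> t (segment r x t)) (at t)" if t: "t \<notin> insert \<sigma> N" for t
   proof
    assume "\<sigma> \<le> t"
    then have lt: "\<sigma> < t" using t by auto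
    have "((\<lambda>t. (p - apply_bcontfun q 0) + integral {\<sigma>..t} \<psi>) has_vector_derivative \<psi> t) (at t)"
     using has_vector_derivative_add[OF has_vector_derivative_const N(2)[OF _ lt]] t by simp
    then have "(x has_vector_derivative \<psi> t) (at t)"
     by (rule has_vector_derivative_transform_within_open[where S = "{\<sigma><..}"]) (use lt in \<open>auto simp: xeq\<close>)
    then show "(x has_vector_derivative L r \<zeta> t (segment r x t)) (at t)" by (simp add: L_eq[OF st[OF lt]])
   qed
  qed
 qed
 show ?thesis
  unfolding T0_def evolution_def x_def[symmetric]
 proof (rule the_equality)
  show "\<exists>y. solution r (L r \<zeta>) \<sigma> (\<lambda>\<omega>. X0 p \<omega> - apply_bcontfun q \<omega>) y \<and> segment r x t = segment r y t"
   using sx by blast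
  fix \<psi>' assume "\<exists>y. solution r (L r \<zeta>) \<sigma> (\<lambda>\<omega>. X0 p \<omega> - apply_bcontfun q \<omega>) y \<and> \<psi>' = segment r y t"
  then obtain y where y: "solution r (L r \<zeta>) \<sigma> (\<lambda>\<omega>. X0 p \<omega> - apply_bcontfun q \<omega>) y" "\<psi>' = segment r y t" by blast
  show "\<psi>' = segment r x t" unfolding y(2)
  proof (rule segment_cong)
   show "y v = x v" if "v \<in> {t - r..t}" for v
    by (rule linear_solution_unique[OF sx y(1)]) (use st t that in auto)
  qed
 qed
qed

lemma T0_X0: "\<sigma> \<le> t ==> T0 r \<zeta> t \<sigma> (X0 p) = segment r (jump_sol \<sigma> p) t"
 using T0_jump[OF C_0, of \<sigma> t p] by (simp add: traj_zero)

lemma segment_le_sup_norm: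
 assumes "!!v. v \<in> {t - r..t} ==> norm (x v) \<le> B" "\<omega> \<in> {- r..0}"
 shows "norm (x (t + \<omega>)) \<le> sup_norm r (segment r x t)"
proof -
 have "bdd_above ((\<lambda>\<omega>. norm (segment r x t \<omega>)) ` {- r..0})"
  by (rule bdd_aboveI2[where M = B]) (use assms(1) in \<open>auto simp: segment_apply\<close>)
 from cSUP_upper[OF assms(2) this] show ?thesis using assms(2) by (simp add: sup_norm_def segment_apply)
qed

lemma jump_sol_bounded: "\<exists>B. \<forall>v\<in>{a..b}. norm (jump_sol \<sigma> p v) \<le> B"
proof -
 obtain B where B: "\<forall>v\<in>{a..b}. norm (jump_cont \<sigma> p v) \<le> B"
  using continuous_on_interval_bounded[OF continuous_on_subset[OF jump_cont_continuous subset_UNIV]] by blast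
 have "norm (jump_sol \<sigma> p v) \<le> norm p + B" if "v \<in> {a..b}" for v
 proof -
  have "norm (jump_sol \<sigma> p v) \<le> norm (if v < \<sigma> then 0 else p) + norm (jump_cont \<sigma> p v)"
   unfolding jump_sol_def by (rule norm_triangle_ineq)
  also have "\<dots> \<le> norm p + B" using B that by (intro add_mono) auto
  finally show ?thesis .
 qed
 then show ?thesis by blast
qed

lemma X0_C0: "X0 p \<in> C0 r"
proof -
 have "ext_cont (X0 p) (- r) 0 = X0 p" using r by (auto simp: ext_cont_def clamp_real X0_def fun_eq_iff)
 moreover have "continuous_on {- r..<0} (X0 p)"
  by (rule continuous_on_eq[of _ "\<lambda>_. 0"]) (auto simp: X0_def)
 moreover have "(X0 p \<longlongrightarrow> 0) (at_left 0)"
  by (rule tendsto_eventually) (auto simp: eventually_at_left_field X0_def intro!: exI[of _ "-1"])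
 ultimately show ?thesis unfolding C0_def by blast
qed

lemma sup_norm_X0: "sup_norm r (X0 p) = norm p"
proof -
 have "(SUP \<omega>\<in>{- r..0}. norm (X0 p \<omega>)) = norm p"
 proof (rule cSup_eq_maximum)
  show "norm p \<in> (\<lambda>\<omega>. norm (X0 p \<omega>)) ` {- r..0}" using r by (auto simp: X0_def intro!: image_eqI[of _ _ 0])
  show "y \<le> norm p" if "y \<in> (\<lambda>\<omega>. norm (X0 p \<omega>)) ` {- r..0}" for y using that by (auto simp: X0_def)
 qed
 then show ?thesis by (simp add: sup_norm_def)
qed

lemma C_imp_C0: "\<phi> \<in> C r ==> apply_bcontfun \<phi> \<in> C0 r"
proof -
 assume \<phi>: "\<phi> \<in> C r"
 have "continuous_on UNIV (apply_bcontfun \<phi>)" by simp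
 then have "(apply_bcontfun \<phi> \<longlongrightarrow> apply_bcontfun \<phi> 0) (at_left 0)"
  unfolding continuous_on_eq_continuous_at[OF open_UNIV] isCont_def
  using tendsto_within_subset[of _ _ 0 UNIV "{..<0}"] by blast
 then show ?thesis using \<phi> by (auto simp: C0_def C_def)
qed

lemma sup_norm_C: "\<phi> \<in> C r ==> sup_norm r (apply_bcontfun \<phi>) = norm \<phi>"
proof (rule antisym)
 assume \<phi>: "\<phi> \<in> C r"
 show "sup_norm r (apply_bcontfun \<phi>) \<le> norm \<phi>"
  unfolding sup_norm_def by (rule cSUP_least) (use r in \<open>auto simp: norm_bounded\<close>)
 show "norm \<phi> \<le> sup_norm r (apply_bcontfun \<phi>)"
 proof (rule C_norm_le[OF \<phi>])
  fix \<omega> assume "\<omega> \<in> {- r..0}"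
  then show "norm (apply_bcontfun \<phi> \<omega>) \<le> sup_norm r (apply_bcontfun \<phi>)"
   unfolding sup_norm_def by (intro cSUP_upper bdd_aboveI2[where M = "norm \<phi>"]) (auto simp: norm_bounded)
 qed
qed

lemma T0_C:
 assumes "\<phi> \<in> C r" "s \<le> t"
 shows "T0 r \<zeta> t s (apply_bcontfun \<phi>) = apply_bcontfun (W t s \<phi> (\<lambda>_. 0))"
proof -
 have "evolution r (L r \<zeta>) t s (apply_bcontfun \<phi>) = segment r (traj s \<phi> (\<lambda>_. 0)) t"
  by (rule evolution_eq_segment[OF volterra_rhs[OF forcing_0] _ _ assms])
    (use sol_traj[OF forcing_0, of s \<phi>] in \<open>simp_all add: rhs_def[symmetric] sol_is_sol[OF forcing_0, symmetric]\<close>, simp add: rhs_def)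
 then show ?thesis by (simp add: T0_def W_def seg_apply[OF traj_continuous[OF forcing_0]])
qed

end

section \<open>Riemann sums\<close>

definition node :: "real => real => nat => nat => real" where
 "node s b N i = s + (b - s) / real (Suc N) * real i"

text \<open>
  On each cell the integrand differs from its value at the left node by at most \<open>e\<close>.
\<close>

lemma riemann_sum_upto_nodes:
 fixes f :: "real => 'a::euclidean_space"
 assumes sb: "s < b" and f: "continuous_on UNIV f"
  and osc: "!!u v. u \<in> {s..b} ==> v \<in> {s..b} ==> \<bar>v - u\<bar> \<le> (b - s) / real (Suc N) ==> norm (f v - f u) \<le> e"
  and j: "j \<le> Suc N"
 shows "norm ((\<Sum>i<j. ((b - s) / real (Suc N)) *\<^sub>R f (node s b N i)) - integral {s..node s b N j} f) \<le> e * (node s b N j - s)"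
 using j
proof (induction j)
 case 0 then show ?case by (simp add: node_def)
next
 case (Suc j)
 define h where "h = (b - s) / real (Suc N)"
 have h: "h > 0" using sb by (simp add: h_def)
 have nd: "node s b N i = s + h * real i" for i by (simp add: node_def h_def)
 have le: "s \<le> node s b N j" "node s b N (Suc j) = node s b N j + h" "node s b N (Suc j) \<le> b"
 proof -
  show "s \<le> node s b N j" "node s b N (Suc j) = node s b N j + h" using h by (auto simp: nd algebra_simps)
  have "h * real (Suc j) \<le> h * real (Suc N)" using Suc.prems h by (intro mult_left_mono) auto
  also have "\<dots> = b - s" by (simp add: h_def)
  finally show "node s b N (Suc j) \<le> b" by (simp add: nd)
 qed
 have fi: "f integrable_on {u..v}" for u v
  by (intro integrable_continuous_real continuous_on_subset[OF f]) auto
 have comb: "integral {s..node s b N (Suc j)} f = integral {s..node s b N j} f + integral {node s b N j..node s b N (Suc j)} f"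
  using le h fi by (intro Henstock_Kurzweil_Integration.integral_combine[symmetric]) auto
 have "h *\<^sub>R f (node s b N j) - integral {node s b N j..node s b N (Suc j)} f
   = integral {node s b N j..node s b N (Suc j)} (\<lambda>u. f (node s b N j) - f u)"
  using le h by (subst Henstock_Kurzweil_Integration.integral_diff) (auto simp: fi)
 also have "norm \<dots> \<le> integral {node s b N j..node s b N (Suc j)} (\<lambda>u. e)"
 proof (rule integral_norm_bound_integral)
  show "(\<lambda>u. f (node s b N j) - f u) integrable_on {node s b N j..node s b N (Suc j)}"
   by (intro Henstock_Kurzweil_Integration.integrable_diff fi integrable_const_ivl)
  show "norm (f (node s b N j) - f u) \<le> e" if "u \<in> {node s b N j..node s b N (Suc j)}" for u
   using that le h by (intro osc) (auto simp: h_def)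
 qed auto
 also have "\<dots> = e * h" using le(2) h by simp
 finally have 1: "norm (h *\<^sub>R f (node s b N j) - integral {node s b N j..node s b N (Suc j)} f) \<le> e * h" .
 have "norm ((\<Sum>i<Suc j. h *\<^sub>R f (node s b N i)) - integral {s..node s b N (Suc j)} f)
   = norm (((\<Sum>i<j. h *\<^sub>R f (node s b N i)) - integral {s..node s b N j} f)
    + (h *\<^sub>R f (node s b N j) - integral {node s b N j..node s b N (Suc j)} f))"
  unfolding comb by (simp add: algebra_simps)
 also have "\<dots> \<le> e * (node s b N j - s) + e * h"
  using Suc.IH Suc.prems 1 unfolding h_def[symmetric] by (intro norm_triangle_mono) auto
 also have "\<dots> = e * (node s b N (Suc j) - s)" using le(2) by (simp add: algebra_simps)
 finally show ?case unfolding h_def .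
qed

text \<open>The nodes up to \<open>t\<close> are an initial segment of all nodes, and rounding \<open>t\<close> to a node costs at most one cell.\<close>

lemma riemann_sum_uniform:
 fixes f :: "real => 'a::euclidean_space"
 assumes sb: "s < b" and f: "continuous_on UNIV f" and e: "e > 0"
 shows "\<forall>\<^sub>F N in sequentially. \<forall>t. norm ((\<Sum>i<Suc N. if t < node s b N i then 0 else ((b - s) / real (Suc N)) *\<^sub>R f (node s b N i))
   - integral {s..min t b} f) \<le> e"
proof -
 obtain M where M: "\<forall>v\<in>{s..b}. norm (f v) \<le> M"
  using continuous_on_interval_bounded[OF continuous_on_subset[OF f subset_UNIV]] by blast
 have M0: "0 \<le> M" using M sb norm_ge_zero[of "f s"] by (metis atLeastAtMost_iff less_imp_le order.trans order_refl)
 define e' where "e' = e / 2 / (b - s)"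
 have "b - s > 0" using sb by simp
 moreover have "x / c * c = x" if "c > 0" for x c :: real using that by simp
 ultimately have e': "e' > 0" "e' * (b - s) = e / 2" using e unfolding e'_def by (blast intro: divide_pos_pos half_gt_zero)+
 have "uniformly_continuous_on {s..b} f"
  by (intro compact_uniformly_continuous continuous_on_subset[OF f]) auto
 then obtain d where d: "d > 0" "!!u v. u \<in> {s..b} ==> v \<in> {s..b} ==> dist v u < d ==> dist (f v) (f u) < e'"
  using e'(1) unfolding uniformly_continuous_on_def by metis
 define c where "c = min d (e / (2 * (M + 1)))"
 have c: "c > 0" using d(1) e M0 by (simp add: c_def)
 obtain N0 :: nat where N0: "(b - s) / c < real N0" using reals_Archimedean2 by blast
 have "norm ((\<Sum>i<Suc N. if t < node s b N i then 0 else ((b - s) / real (Suc N)) *\<^sub>R f (node s b N i))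
   - integral {s..min t b} f) \<le> e" if N: "N \<ge> N0" for N t
 proof -
  define h where "h = (b - s) / real (Suc N)"
  have h: "h > 0" using sb by (simp add: h_def)
  have hc: "h < c"
  proof -
   have "b - s < c * real N0" using N0 c by (simp add: field_simps)
   also have "\<dots> < c * real (Suc N)" using N c by simp
   finally show ?thesis by (simp add: h_def field_simps)
  qed
  have nd: "node s b N i = s + h * real i" for i by (simp add: node_def h_def)
  have last: "node s b N (Suc N) = b" by (simp add: node_def)
  have osc: "norm (f v - f u) \<le> e'" if "u \<in> {s..b}" "v \<in> {s..b}" "\<bar>v - u\<bar> \<le> (b - s) / real (Suc N)" for u v
  proof -
   have "\<bar>v - u\<bar> \<le> h" using that(3) by (simp only: h_def)
   then have "dist v u < d" using hc by (simp add: dist_real_def c_def)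
   then show ?thesis using d(2)[OF that(1,2)] by (simp add: dist_norm less_imp_le)
  qed
  have hM: "h * M \<le> e / 2"
  proof -
   have "h * M \<le> c * (M + 1)" using hc h M0 by (intro mult_mono) auto
   also have "\<dots> \<le> e / (2 * (M + 1)) * (M + 1)" using M0 by (intro mult_right_mono) (auto simp: c_def)
   also have "\<dots> = e / 2"
   proof -
    have "e / (2 * k) * k = e / 2" if "k \<noteq> 0" for k :: real using that by simp
    moreover have "M + 1 \<noteq> 0" using M0 by linarith
    ultimately show ?thesis by blast
   qed
   finally show ?thesis .
  qed
  note up = riemann_sum_upto_nodes[OF sb f osc]
  have mono: "node s b N i \<le> node s b N j" if "i \<le> j" for i j
   unfolding nd using that h by simp
  show ?thesis
  proof (cases "t < s")
   case True
   have "s \<le> node s b N i" for i using h by (simp add: nd)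
   then have "(\<Sum>i<Suc N. if t < node s b N i then 0 else h *\<^sub>R f (node s b N i)) = 0"
    using True by (intro sum.neutral) (auto intro: order.strict_trans2)
   moreover have "integral {s..min t b} f = 0" using True by simp
   ultimately show ?thesis using e unfolding h_def[symmetric] by (metis diff_zero norm_zero less_imp_le)
  next
   case ts: False
   define j where "j = (if b \<le> t then Suc N else Suc (nat \<lfloor>(t - s) / h\<rfloor>))"
   have jN: "j \<le> Suc N" and lt: "!!i. i < j ==> node s b N i \<le> t" and ge: "!!i. j \<le> i ==> i < Suc N ==> t < node s b N i"
    and close: "min t b \<le> node s b N j" "node s b N j \<le> min t b + h"
   proof -
    have main: "j \<le> Suc N \<and> (\<forall>i<j. node s b N i \<le> t) \<and> (\<forall>i\<ge>j. i < Suc N --> t < node s b N i)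
      \<and> min t b \<le> node s b N j \<and> node s b N j \<le> min t b + h"
    proof (cases "b \<le> t")
     case True
     then have j: "j = Suc N" by (simp add: j_def)
     have "node s b N i \<le> t" if "i < Suc N" for i using mono[of i "Suc N"] that last True by simp
     then show ?thesis using True h unfolding j last by auto
    next
     case False
     define n where "n = nat \<lfloor>(t - s) / h\<rfloor>"
     have j: "j = Suc n" using False by (simp add: j_def n_def)
     have "0 \<le> (t - s) / h" using ts h by simp
     then have "real n \<le> (t - s) / h" "(t - s) / h < real n + 1"
      unfolding n_def by (auto simp: le_nat_floor of_nat_floor)
     then have n: "node s b N n \<le> t" "t < node s b N (Suc n)"
      unfolding nd using h by (auto simp: field_simps)
     have "n < Suc N"
     proof (rule ccontr)
      assume "\<not> n < Suc N"
      then have "b \<le> node s b N n" using mono[of "Suc N" n] last by simp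
      then show False using n(1) False by simp
     qed
     moreover have "node s b N (Suc n) = node s b N n + h" by (simp add: nd algebra_simps)
     moreover have "node s b N i \<le> t" if "i < Suc n" for i using mono[of i n] that n(1) by simp
     moreover have "t < node s b N i" if "Suc n \<le> i" for i using mono[OF that] n(2) by simp
     ultimately show ?thesis using n False h unfolding j by auto
    qed
    then show "j \<le> Suc N" "!!i. i < j ==> node s b N i \<le> t" "!!i. j \<le> i ==> i < Suc N ==> t < node s b N i"
     "min t b \<le> node s b N j" "node s b N j \<le> min t b + h" by auto
   qed
   have jb: "node s b N j \<le> b" using mono[OF jN] last by simp
   have "(\<Sum>i<Suc N. if t < node s b N i then 0 else h *\<^sub>R f (node s b N i)) = (\<Sum>i<j. h *\<^sub>R f (node s b N i))"
   proof (rule sum.mono_neutral_cong_right)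
    show "{..<j} \<subseteq> {..<Suc N}" using jN by auto
    show "\<forall>i\<in>{..<Suc N} - {..<j}. (if t < node s b N i then 0 else h *\<^sub>R f (node s b N i)) = 0"
     using ge by auto
    show "(if t < node s b N i then 0 else h *\<^sub>R f (node s b N i)) = h *\<^sub>R f (node s b N i)" if "i \<in> {..<j}" for i
     using lt[of i] that by auto
   qed simp
   moreover have "integral {s..node s b N j} f = integral {s..min t b} f + integral {min t b..node s b N j} f"
    using ts sb close(1)
    by (intro Henstock_Kurzweil_Integration.integral_combine[symmetric] integrable_continuous_real continuous_on_subset[OF f]) auto
   moreover have "norm (integral {min t b..node s b N j} f) \<le> e / 2"
   proof -
    have "norm (integral {min t b..node s b N j} f) \<le> M * (node s b N j - min t b)"
     using close M jb ts sb by (intro integral_bound continuous_on_subset[OF f]) auto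
    also have "\<dots> \<le> M * h" using close M0 by (intro mult_left_mono) auto
    finally show ?thesis using hM by (simp add: mult.commute)
   qed
   moreover have "norm ((\<Sum>i<j. h *\<^sub>R f (node s b N i)) - integral {s..node s b N j} f) \<le> e / 2"
   proof -
    have "norm ((\<Sum>i<j. h *\<^sub>R f (node s b N i)) - integral {s..node s b N j} f) \<le> e' * (node s b N j - s)"
     using up[OF _ _ _ jN] by (simp add: h_def)
    also have "\<dots> \<le> e' * (b - s)" using jb e'(1) by (intro mult_left_mono) auto
    finally show ?thesis using e'(2) by simp
   qed
   ultimately show ?thesis unfolding h_def[symmetric]
    using norm_triangle_mono[of "(\<Sum>i<j. h *\<^sub>R f (node s b N i)) - integral {s..node s b N j} f" "e/2" "integral {min t b..node s b N j} f" "e/2"]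
    by (simp add: algebra_simps)
  qed
 qed
 then show ?thesis unfolding eventually_sequentially by blast
qed

lemma riemann_sum_tendsto:
 fixes f :: "real => 'a::euclidean_space"
 assumes sb: "s < b" and f: "continuous_on UNIV f"
 shows "(\<lambda>N. \<Sum>i<Suc N. ((b - s) / real (Suc N)) *\<^sub>R f (node s b N i)) \<longlonglongrightarrow> integral {s..b} f"
proof (rule tendstoI)
 fix e :: real assume e: "e > 0"
 have nb: "\<not> b < node s b N i" if "i < Suc N" for N i
 proof -
  have "(b - s) / real (Suc N) * real i \<le> (b - s) / real (Suc N) * real (Suc N)"
   using that sb by (intro mult_left_mono) auto
  then show ?thesis by (simp add: node_def)
 qed
 show "\<forall>\<^sub>F N in sequentially. dist (\<Sum>i<Suc N. ((b - s) / real (Suc N)) *\<^sub>R f (node s b N i)) (integral {s..b} f) < e"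
  using riemann_sum_uniform[OF sb f half_gt_zero[OF e]]
 proof (eventually_elim)
  case (elim N)
  have "(\<Sum>i<Suc N. if b < node s b N i then 0 else ((b - s) / real (Suc N)) *\<^sub>R f (node s b N i))
    = (\<Sum>i<Suc N. ((b - s) / real (Suc N)) *\<^sub>R f (node s b N i))"
   by (rule sum.cong) (auto simp: nb simp del: of_nat_Suc)
  then have "norm ((\<Sum>i<Suc N. ((b - s) / real (Suc N)) *\<^sub>R f (node s b N i)) - integral {s..b} f) \<le> e / 2"
   using spec[OF elim, of b] by (simp del: sum.lessThan_Suc of_nat_Suc)
  then show ?case using e by (simp add: dist_norm del: sum.lessThan_Suc of_nat_Suc)
 qed
qed

lemma node_bounds:
 assumes "s < b" "i < Suc N"
 shows "s \<le> node s b N i" "node s b N i < b"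
proof -
 show "s \<le> node s b N i" using assms(1) by (simp add: node_def)
 have "(b - s) / real (Suc N) * real i < (b - s) / real (Suc N) * real (Suc N)"
  using assms by (intro mult_strict_left_mono) auto
 then show "node s b N i < b" by (simp add: node_def)
qed

text \<open>Bounds for finite sums of impulse responses become integral bounds for their limit.\<close>

lemma norm_limit_le_integral:
 fixes S :: "nat => 'a::real_normed_vector" and q :: "real => real"
 assumes sb: "s < b" and S: "S \<longlonglongrightarrow> Z" and q: "continuous_on UNIV q"
  and le: "!!N. norm (S N) \<le> (\<Sum>i<Suc N. (b - s) / real (Suc N) * q (node s b N i))"
 shows "norm Z \<le> integral {s..b} q"
 using tendsto_norm[OF S] riemann_sum_tendsto[OF sb q] le by (intro LIMSEQ_le) auto

section \<open>Variation of constants through impulses\<close>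

context kernel
begin

text \<open>
  Replacing the forcing term by impulses at the nodes of a fine grid changes the solution little:
  by Gronwall's lemma it suffices that the accumulated impulses are uniformly close to the integral of
  the forcing. This is the variation of constants formula in the form of a limit of finite sums.
\<close>

lemma impulse_approximation:
 assumes sb: "s < t0" and f: "continuous_on UNIV f" and e: "e > 0" and b: "t0 \<le> b"
 shows "\<forall>\<^sub>F N in sequentially. \<forall>t\<le>b. norm ((\<Sum>i<Suc N. jump_sol (node s t0 N i) (((t0 - s) / real (Suc N)) *\<^sub>R f (node s t0 N i)) t)
   - traj s 0 (\<lambda>u. if u \<in> {s..t0} then f u else 0) t) \<le> e"
proof -
 define f1 where "f1 u = (if u \<in> {s..t0} then f u else 0)" for u
 have ff: "forcing f1" unfolding f1_def by (intro forcing_restrict forcing_continuous f)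
 define x where "x = traj s 0 f1"
 have cx: "continuous_on UNIV x" unfolding x_def by (rule traj_continuous[OF ff])
 have xb: "x t = 0" if "t \<le> s" for t using that by (simp add: x_def traj_before[OF ff] hist_def)
 define \<eta> where "\<eta> = e / (2 * growth m s b)"
 have gb: "growth m s b > 0" by (rule m.growth_pos)
 have eta: "\<eta> > 0" using e gb by (simp add: \<eta>_def)
 show ?thesis
  using riemann_sum_uniform[OF sb f eta]
 proof (eventually_elim, intro allI impI)
  fix N t
  define h where "h = (t0 - s) / real (Suc N)"
  define \<sigma> where "\<sigma> = node s t0 N"
  define p where "p i = h *\<^sub>R f (\<sigma> i)" for i
  assume "\<forall>t. norm ((\<Sum>i<Suc N. if t < node s t0 N i then 0 else ((t0 - s) / real (Suc N)) *\<^sub>R f (node s t0 N i)) - integral {s..min t t0} f) \<le> \<eta>"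
  then have R: "norm ((\<Sum>i<Suc N. if t < \<sigma> i then 0 else p i) - integral {s..min t t0} f) \<le> \<eta>" for t
   unfolding p_def \<sigma>_def h_def by blast
  assume tb: "t \<le> b"
  have \<sigma>s: "s \<le> \<sigma> i" if "i < Suc N" for i using node_bounds[OF sb that] by (simp add: \<sigma>_def)
  define w where "w t = (\<Sum>i<Suc N. jump_sol (\<sigma> i) (p i) t) - x t" for t
  define \<psi> where "\<psi> u = (\<Sum>i<Suc N. jump_rhs (\<sigma> i) (p i) u) - rhs (\<lambda>_. 0) x u" for u
  have rx: "rhs (\<lambda>_. 0) x integrable_on {a..b}" for a b
   by (rule rhs_int[OF forcing_0 cx, of s 0]) (simp add: xb)
  have \<psi>i: "\<psi> integrable_on {a..b}" for a b
   unfolding \<psi>_def by (intro Henstock_Kurzweil_Integration.integrable_diff integrable_sum jump_rhs_int rx) auto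
  have weq: "w t - integral {s..t} \<psi> = (\<Sum>i<Suc N. if t < \<sigma> i then 0 else p i) - integral {s..min t t0} f" if "s \<le> t" for t
  proof -
   have I1: "integral {s..t} \<psi> = (\<Sum>i<Suc N. integral {s..t} (jump_rhs (\<sigma> i) (p i))) - integral {s..t} (rhs (\<lambda>_. 0) x)"
    unfolding \<psi>_def
    by (subst Henstock_Kurzweil_Integration.integral_diff)
      (auto intro!: integrable_sum jump_rhs_int rx simp: Henstock_Kurzweil_Integration.integral_sum jump_rhs_int simp del: sum.lessThan_Suc)
   have I2: "x t = integral {s..t} (rhs (\<lambda>_. 0) x) + integral {s..t} f1"
   proof -
    have "x t = integral {s..t} (rhs f1 x)" using traj_after[OF ff that, of 0] by (simp add: x_def hist_def)
    also have "rhs f1 x = (\<lambda>u. rhs (\<lambda>_. 0) x u + f1 u)" by (simp add: rhs_def fun_eq_iff)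
    finally show ?thesis using Henstock_Kurzweil_Integration.integral_add[OF rx forcing_int[OF ff]] by simp
   qed
   have I3: "integral {s..t} f1 = integral {s..min t t0} f"
   proof -
    have "integral {s..t} f1 = integral ({s..t0} \<inter> {s..t}) f"
     unfolding f1_def by (simp only: Henstock_Kurzweil_Integration.integral_restrict_Int)
    also have "{s..t0} \<inter> {s..t} = {s..min t t0}" by auto
    finally show ?thesis .
   qed
   have "(\<Sum>i<Suc N. jump_sol (\<sigma> i) (p i) t) = (\<Sum>i<Suc N. (if t < \<sigma> i then 0 else p i) + integral {s..t} (jump_rhs (\<sigma> i) (p i)))"
    by (intro sum.cong refl jump_sol_eq \<sigma>s) auto
   then show ?thesis unfolding w_def I1 I2 I3 sum.distrib by simp
  qed
  have before: "norm (w v) \<le> \<eta>" if "v \<le> s" for v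
  proof (cases "v = s")
   case True then show ?thesis using weq[of s] R[of s] by simp
  next
   case False
   then have "jump_sol (\<sigma> i) (p i) v = 0" if "i < Suc N" for i
    using \<sigma>s[OF that] \<open>v \<le> s\<close> by (simp add: jump_sol_def jump_cont_before)
   then have "w v = 0" using xb[OF that] by (simp add: w_def del: sum.lessThan_Suc)
   then show ?thesis using eta by simp
  qed
  have st: "has_stieltjes_integral (\<zeta> u) (segment r w u) (\<psi> u) (- r) 0" if "u \<notin> \<sigma> ` {..<Suc N}" for u
  proof -
   have "segment r w u = (\<lambda>\<omega>. (\<Sum>i<Suc N. segment r (jump_sol (\<sigma> i) (p i)) u \<omega>) - segment r x u \<omega>)"
    by (simp add: segment_eq w_def fun_eq_iff del: sum.lessThan_Suc)
   moreover have "has_stieltjes_integral (\<zeta> u) (\<lambda>\<omega>. (\<Sum>i<Suc N. segment r (jump_sol (\<sigma> i) (p i)) u \<omega>) - segment r x u \<omega>) (\<psi> u) (- r) 0"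
    unfolding \<psi>_def rhs_def add_0_right
    by (intro has_stieltjes_integral_diff has_stieltjes_integral_sum jump_sol_stieltjes L_integral cx) (use that in auto)
   ultimately show ?thesis by simp
  qed
  have "\<exists>W. \<forall>v\<in>{s..b}. norm (w v) \<le> W"
  proof -
   have "\<forall>i. \<exists>B. \<forall>v\<in>{s..b}. norm (jump_sol (\<sigma> i) (p i) v) \<le> B" using jump_sol_bounded by blast
   then obtain B1 where B1: "\<forall>i. \<forall>v\<in>{s..b}. norm (jump_sol (\<sigma> i) (p i) v) \<le> B1 i" by (rule choice[THEN exE])
   obtain B2 where B2: "\<forall>v\<in>{s..b}. norm (x v) \<le> B2"
    using continuous_on_interval_bounded[OF continuous_on_subset[OF cx subset_UNIV]] by blast
   have "norm (w v) \<le> (\<Sum>i<Suc N. B1 i) + B2" if "v \<in> {s..b}" for v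
   proof -
    have "norm (w v) \<le> norm (\<Sum>i<Suc N. jump_sol (\<sigma> i) (p i) v) + norm (x v)" unfolding w_def by (rule norm_triangle_ineq4)
    also have "norm (\<Sum>i<Suc N. jump_sol (\<sigma> i) (p i) v) \<le> (\<Sum>i<Suc N. B1 i)"
     by (intro order.trans[OF norm_sum] sum_mono) (use B1 that in blast)
    finally show ?thesis using B2 that by fastforce
   qed
   then show ?thesis by blast
  qed
  then obtain W where W: "\<forall>v\<in>{s..b}. norm (w v) \<le> W" by blast
  have "norm (w t) \<le> e"
  proof (cases "t \<le> s")
   case True
   have "\<eta> \<le> e" using e m.growth_ge_1[of s b] by (auto simp: \<eta>_def divide_le_eq mult_le_cancel_left1)
   then show ?thesis using before[OF True] by simp
  next
   case False
   have "norm (w t) \<le> 2 * \<eta> * growth m s t"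
   proof (rule m.gronwall_causal[where b = b and W = W and \<psi> = \<psi> and N = "\<sigma> ` {..<Suc N}"])
    show "norm (w v - integral {s..v} \<psi>) \<le> \<eta>" if "v \<in> {s..b}" for v using weq[of v] R[of v] that by simp
    show "norm (\<psi> u) \<le> m u * B" if "u \<in> {s..b} - \<sigma> ` {..<Suc N}" "0 \<le> B" "!!v. v \<le> u ==> norm (w v) \<le> B" for u B
     by (rule L_bound[OF st]) (use that in auto)
   qed (use sb b W before \<psi>i False tb in auto)
   also have "\<dots> \<le> 2 * \<eta> * growth m s b" using eta m.growth_mono[OF tb] by (intro mult_left_mono) auto
   also have "\<dots> = e" using gb by (simp add: \<eta>_def)
   finally show ?thesis .
  qed
  then show "norm ((\<Sum>i<Suc N. jump_sol (node s t0 N i) (((t0 - s) / real (Suc N)) *\<^sub>R f (node s t0 N i)) t)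
    - traj s 0 (\<lambda>u. if u \<in> {s..t0} then f u else 0) t) \<le> e"
   unfolding w_def x_def f1_def p_def \<sigma>_def h_def .
 qed
qed

end

section \<open>Dichotomies and responses to a forcing term\<close>

context kernel
begin

abbreviation TT :: "real => real => 'n phase => 'n phase" where
 "TT t s \<phi> \<equiv> W t s \<phi> (\<lambda>_. 0)"

lemma TT_C: "TT t s \<phi> \<in> C r" by (rule W_C[OF forcing_0])

lemma TT_combine: "TT t s (c *\<^sub>R \<phi> + d *\<^sub>R \<psi>) = c *\<^sub>R TT t s \<phi> + d *\<^sub>R TT t s \<psi>"
 using W_combine[OF forcing_0 forcing_0, of t s c \<phi> d \<psi>] by simp

lemma TT_add: "TT t s (\<phi> + \<psi>) = TT t s \<phi> + TT t s \<psi>"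
 and TT_diff: "TT t s (\<phi> - \<psi>) = TT t s \<phi> - TT t s \<psi>"
 using TT_combine[of t s 1 \<phi> 1 \<psi>] TT_combine[of t s 1 \<phi> "-1" \<psi>] by simp_all

lemma TT_start: "\<phi> \<in> C r ==> TT s s \<phi> = \<phi>" by (rule W_start[OF forcing_0])

lemma TT_cocycle: "s \<le> u ==> u \<le> t ==> TT t u (TT u s \<phi>) = TT t s \<phi>" by (rule W_cocycle[OF forcing_0])

lemma W_split: "forcing f ==> W t s \<phi> f = TT t s \<phi> + W t s 0 f"
 using W_combine[OF forcing_0, of f t s 1 \<phi> 1 0] by simp

lemma W_forced_combine:
 "forcing f ==> forcing h ==> W t s 0 (\<lambda>t. c *\<^sub>R f t + d *\<^sub>R h t) = c *\<^sub>R W t s 0 f + d *\<^sub>R W t s 0 h"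
 using W_combine[of f h t s c 0 d 0] by simp

lemma W_forced_cocycle: "forcing f ==> s \<le> u ==> u \<le> t ==> W t s 0 f = TT t u (W u s 0 f) + W t u 0 f"
 using W_cocycle[of f s u t 0] W_split[of f t u "W u s 0 f"] by simp

text \<open>The response at time \<open>u\<close>, at least one delay after \<open>\<sigma>\<close>, to an impulse \<open>p\<close> at time \<open>\<sigma>\<close>.\<close>

definition impulse :: "real => real => real ^ 'n => 'n phase" where
 "impulse u \<sigma> p = seg r (jump_sol \<sigma> p) u"

lemma jump_sol_continuous_on: "continuous_on {\<sigma>..} (jump_sol \<sigma> p)"
proof -
 have "continuous_on {\<sigma>..} (\<lambda>t. p + jump_cont \<sigma> p t)"
  by (intro continuous_intros continuous_on_subset[OF jump_cont_continuous]) auto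
 then show ?thesis by (rule continuous_on_eq) (simp add: jump_sol_def)
qed

lemma impulse_apply: "\<sigma> + r \<le> u ==> apply_bcontfun (impulse u \<sigma> p) = segment r (jump_sol \<sigma> p) u"
 and impulse_C: "\<sigma> + r \<le> u ==> impulse u \<sigma> p \<in> C r"
 unfolding impulse_def
 by (intro seg_apply_gen seg_C_gen continuous_on_subset[OF jump_sol_continuous_on], auto)+

text \<open>
  One delay after the jump the segment is continuous, and from then on the impulse response is an ordinary
  solution.
\<close>

lemma impulse_evolves:
 assumes u: "\<sigma> + r \<le> u" and t: "u \<le> t"
 shows "TT t u (impulse u \<sigma> p) = impulse t \<sigma> p"
proof -
 define y where "y t = (if t \<le> u then hist (impulse u \<sigma> p) u t else jump_sol \<sigma> p t)" for t
 have hx: "hist (impulse u \<sigma> p) u t = jump_sol \<sigma> p t" if "u - r \<le> t" "t \<le> u" for t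
 proof -
  have "max (- r) (min 0 (t - u)) = t - u" using that by auto
  then show ?thesis by (simp add: hist_def impulse_apply[OF u] segment_eq)
 qed
 have cy: "continuous_on UNIV y"
 proof -
  have "continuous_on ({..u} \<union> {u..}) (\<lambda>t. if t \<in> {..u} then hist (impulse u \<sigma> p) u t else jump_sol \<sigma> p t)"
   using hx[of u] r u
   by (intro continuous_on_cases continuous_on_subset[OF hist_continuous] continuous_on_subset[OF jump_sol_continuous_on]) auto
  moreover have "{..u} \<union> {u..} = UNIV" by auto
  ultimately show ?thesis by (simp add: y_def[abs_def])
 qed
 have yx: "y t = jump_sol \<sigma> p t" if "u - r \<le> t" for t using hx that by (simp add: y_def)
 have rhs_eq: "rhs (\<lambda>_. 0) y t = jump_rhs \<sigma> p t" if "u \<le> t" for t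
 proof -
  have "segment r y t = segment r (jump_sol \<sigma> p) t" using yx that by (intro segment_cong) auto
  then show ?thesis using L_eq[OF jump_sol_stieltjes, of t \<sigma> p] that u r by (simp add: rhs_def)
 qed
 have "sol u (impulse u \<sigma> p) (\<lambda>_. 0) y"
  unfolding sol_def
 proof (intro conjI allI impI cy)
  show "y t = hist (impulse u \<sigma> p) u t" if "t \<le> u" for t using that by (simp add: y_def)
  fix t assume ut: "u \<le> t"
  have "\<sigma> \<le> u" using u r by simp
  have "jump_sol \<sigma> p t = jump_sol \<sigma> p u + integral {u..t} (jump_rhs \<sigma> p)"
   using jump_sol_eq[OF order_refl, of \<sigma> p t] jump_sol_eq[OF order_refl, of \<sigma> p u] \<open>\<sigma> \<le> u\<close> ut
    integral_combine'[OF \<open>\<sigma> \<le> u\<close> ut jump_rhs_int]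
   by (simp add: algebra_simps)
  also have "integral {u..t} (jump_rhs \<sigma> p) = integral {u..t} (rhs (\<lambda>_. 0) y)"
   by (intro integral_cong) (auto simp: rhs_eq)
  finally show "y t = hist (impulse u \<sigma> p) u u + integral {u..t} (rhs (\<lambda>_. 0) y)"
   using yx[of t] hx[of u] ut r by simp
 qed
 then have "y = traj u (impulse u \<sigma> p) (\<lambda>_. 0)" by (rule sol_unique[OF forcing_0])
 then show ?thesis unfolding W_def impulse_def[of t] using yx t by (intro seg_cong) auto
qed

lemma impulse_sum_tendsto:
 assumes sb: "s < t0" and f: "continuous_on UNIV f" and t: "t0 + r \<le> t"
 shows "(\<lambda>N. \<Sum>i<Suc N. impulse t (node s t0 N i) (((t0 - s) / real (Suc N)) *\<^sub>R f (node s t0 N i)))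
   \<longlonglongrightarrow> W t s 0 (\<lambda>u. if u \<in> {s..t0} then f u else 0)"
proof (rule tendstoI)
 fix e :: real assume e: "e > 0"
 have ff: "forcing (\<lambda>u. if u \<in> {s..t0} then f u else 0)" by (intro forcing_restrict forcing_continuous f)
 have t0t: "t0 \<le> t" using t r by simp
 show "\<forall>\<^sub>F N in sequentially. dist (\<Sum>i<Suc N. impulse t (node s t0 N i) (((t0 - s) / real (Suc N)) *\<^sub>R f (node s t0 N i)))
   (W t s 0 (\<lambda>u. if u \<in> {s..t0} then f u else 0)) < e"
  using impulse_approximation[OF sb f half_gt_zero[OF e] t0t]
 proof eventually_elim
  case (elim N)
  let ?S = "\<Sum>i<Suc N. impulse t (node s t0 N i) (((t0 - s) / real (Suc N)) *\<^sub>R f (node s t0 N i))"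
  have app: "apply_bcontfun ?S \<omega> = (\<Sum>i<Suc N. jump_sol (node s t0 N i) (((t0 - s) / real (Suc N)) *\<^sub>R f (node s t0 N i)) (t + max (- r) (min 0 \<omega>)))" for \<omega>
  proof -
   have gen: "apply_bcontfun (\<Sum>i\<in>A. h i) \<omega> = (\<Sum>i\<in>A. apply_bcontfun (h i) \<omega>)" if "finite A" for A and h :: "nat => 'n phase"
    using that by (induction A rule: finite_induct) auto
   have "node s t0 N i + r \<le> t" if "i < Suc N" for i using node_bounds(2)[OF sb that] t by simp
   then show ?thesis unfolding gen[OF finite_lessThan]
    by (intro sum.cong refl) (auto simp: impulse_apply segment_eq simp del: of_nat_Suc)
  qed
  have "dist ?S (W t s 0 (\<lambda>u. if u \<in> {s..t0} then f u else 0)) \<le> e / 2"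
  proof (rule dist_bound)
   fix \<omega>
   have "t + max (- r) (min 0 \<omega>) \<le> t" using r by simp
   from elim[rule_format, OF this]
   show "dist (apply_bcontfun ?S \<omega>) (apply_bcontfun (W t s 0 (\<lambda>u. if u \<in> {s..t0} then f u else 0)) \<omega>) \<le> e / 2"
    unfolding app dist_norm W_def seg_apply[OF traj_continuous[OF ff]] segment_eq .
  qed
  then show ?case using e by simp
 qed
qed

end

text \<open>
  Time is measured logarithmically by \<open>x = ln \<circ> \<mu>\<close>, so that powers of \<open>\<mu>\<close> become exponentials of \<open>x\<close> and
  \<open>\<mu> s powr (sgn s * \<theta>)\<close> becomes \<open>exp (\<theta> * \<bar>x s\<bar>)\<close>.
\<close>

locale exponential_dichotomy = kernel r \<zeta> for r and \<zeta> :: "real => real => real ^ ('n::finite) ^ 'n" +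
 fixes x :: "real => real" and P :: "real => 'n phase => 'n phase" and K \<alpha> \<beta> \<theta> \<nu> Kt a \<epsilon> D :: real
 assumes x_cont: "continuous_on UNIV x"
  and x_top: "filterlim x at_top at_top" and x_bot: "filterlim x at_bot at_bot"
  and signs: "0 \<le> \<theta>" "0 \<le> \<nu>" "\<theta> < \<alpha>" "\<nu> < \<beta>" "0 \<le> K" "0 \<le> Kt" "0 \<le> D"
  and P: "bounded_projection_on (C r) (P s)"
  and P_T: "s \<le> t ==> \<phi> \<in> C r ==> T r \<zeta> t s (P s \<phi>) = P t (T r \<zeta> t s \<phi>)"
  and T_bij: "s \<le> t ==> bij_betw (T r \<zeta> t s) (U r P s) (U r P t)"
  and P_bound: "s \<le> t ==> \<phi> \<in> C r ==> norm (T r \<zeta> t s (P s \<phi>)) \<le> K * exp (- \<alpha> * (x t - x s) + \<theta> * \<bar>x s\<bar>) * norm \<phi>"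
  and Q_bound: "t \<le> s ==> \<phi> \<in> C r ==> norm (Tbar r \<zeta> P t s (Q P s \<phi>)) \<le> K * exp (\<beta> * (x t - x s) + \<nu> * \<bar>x s\<bar>) * norm \<phi>"
  and T0_growth: "s \<le> t ==> \<psi> \<in> C0 r ==> sup_norm r (T0 r \<zeta> t s \<psi>) \<le> Kt * exp (a * (x t - x s) + \<epsilon> * \<bar>x s\<bar>) * sup_norm r \<psi>"
  and P0_bound: "s \<le> t ==> sup_norm r (T0 r \<zeta> t s (P0 r \<zeta> P s p)) \<le> D * exp (- \<alpha> * (x t - x s) + (\<theta> + \<epsilon>) * \<bar>x s\<bar>) * norm p"
  and Q0_bound: "t \<le> s ==> norm (Tbar r \<zeta> P t s (Q0 r \<zeta> P s p)) \<le> D * exp (\<beta> * (x t - x s) + (\<nu> + \<epsilon>) * \<bar>x s\<bar>) * norm p"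
begin

lemma P_C: "\<phi> \<in> C r ==> P s \<phi> \<in> C r"
 and P_add: "\<phi> \<in> C r ==> \<psi> \<in> C r ==> P s (\<phi> + \<psi>) = P s \<phi> + P s \<psi>"
 and P_scale: "\<phi> \<in> C r ==> P s (c *\<^sub>R \<phi>) = c *\<^sub>R P s \<phi>"
 and P_idem: "\<phi> \<in> C r ==> P s (P s \<phi>) = P s \<phi>"
 using P[of s] unfolding bounded_projection_on_def by blast+

lemma P_combine: "\<phi> \<in> C r ==> \<psi> \<in> C r ==> P s (c *\<^sub>R \<phi> + d *\<^sub>R \<psi>) = c *\<^sub>R P s \<phi> + d *\<^sub>R P s \<psi>"
 by (simp add: P_add P_scale C_scale)

lemma P_diff: "\<phi> \<in> C r ==> \<psi> \<in> C r ==> P s (\<phi> - \<psi>) = P s \<phi> - P s \<psi>"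
 using P_combine[of \<phi> \<psi> s 1 "-1"] by simp

lemma P_0: "P s 0 = 0" using P_scale[OF C_0, of s 0] by simp

abbreviation QQ :: "real => 'n phase => 'n phase" where "QQ \<equiv> Q P"

lemma QQ_C: "\<phi> \<in> C r ==> QQ s \<phi> \<in> C r" by (simp add: Q_def P_C C_diff)

lemma QQ_combine: "\<phi> \<in> C r ==> \<psi> \<in> C r ==> QQ s (c *\<^sub>R \<phi> + d *\<^sub>R \<psi>) = c *\<^sub>R QQ s \<phi> + d *\<^sub>R QQ s \<psi>"
 by (simp add: Q_def P_combine algebra_simps)

lemma QQ_add: "\<phi> \<in> C r ==> \<psi> \<in> C r ==> QQ s (\<phi> + \<psi>) = QQ s \<phi> + QQ s \<psi>"
 and QQ_diff: "\<phi> \<in> C r ==> \<psi> \<in> C r ==> QQ s (\<phi> - \<psi>) = QQ s \<phi> - QQ s \<psi>"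
 using QQ_combine[of \<phi> \<psi> s 1 1] QQ_combine[of \<phi> \<psi> s 1 "-1"] by simp_all

abbreviation UU :: "real => 'n phase set" where "UU \<equiv> U r P"

lemma UU_iff: "b \<in> UU s \<longleftrightarrow> b \<in> C r \<and> QQ s b = b"
proof
 assume "b \<in> UU s"
 then obtain \<phi> where \<phi>: "\<phi> \<in> C r" "b = QQ s \<phi>" unfolding U_def by blast
 then show "b \<in> C r \<and> QQ s b = b" by (simp add: QQ_C) (simp add: Q_def P_diff P_C P_idem)
next
 assume "b \<in> C r \<and> QQ s b = b"
 then show "b \<in> UU s" unfolding U_def by (metis imageI)
qed

lemma UU_C: "b \<in> UU s ==> b \<in> C r" and QQ_UU: "b \<in> UU s ==> QQ s b = b" by (auto simp: UU_iff)

lemma QQ_in_UU: "\<phi> \<in> C r ==> QQ s \<phi> \<in> UU s" unfolding U_def by blast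

lemma UU_combine: "b \<in> UU s ==> c \<in> UU s ==> u *\<^sub>R b + v *\<^sub>R c \<in> UU s"
 by (simp add: UU_iff QQ_combine C_add C_scale)

lemma UU_add: "b \<in> UU s ==> c \<in> UU s ==> b + c \<in> UU s"
 and UU_diff: "b \<in> UU s ==> c \<in> UU s ==> b - c \<in> UU s"
 using UU_combine[of b s c 1 1] UU_combine[of b s c 1 "-1"] by simp_all

lemma UU_scale: "b \<in> UU s ==> v *\<^sub>R b \<in> UU s" using UU_combine[of b s b v 0] by simp

lemma UU_0: "0 \<in> UU s" by (simp add: UU_iff C_0 Q_def P_0)

lemma TT_P: "s \<le> t ==> \<phi> \<in> C r ==> TT t s (P s \<phi>) = P t (TT t s \<phi>)"
 using P_T[of s t \<phi>] by (simp add: T_eq P_C)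

lemma TT_Q: "s \<le> t ==> \<phi> \<in> C r ==> TT t s (QQ s \<phi>) = QQ t (TT t s \<phi>)"
 unfolding Q_def by (simp add: TT_diff TT_P)

lemma TT_UU: "s \<le> t ==> b \<in> UU s ==> TT t s b \<in> UU t"
 unfolding UU_iff by (metis TT_C TT_Q)

lemma TT_inj: "s \<le> t ==> b \<in> UU s ==> c \<in> UU s ==> TT t s b = TT t s c ==> b = c"
 using T_bij[of s t] unfolding bij_betw_def inj_on_def by (metis T_eq UU_C)

abbreviation orb :: "real => real => 'n phase => 'n phase" where "orb \<equiv> Tbar r \<zeta> P"

lemma orb_forward: "s \<le> t ==> b \<in> C r ==> orb t s b = TT t s b"
 by (simp add: Tbar_def T_eq)

lemma orb_UU: "b \<in> UU s ==> orb t s b \<in> UU t"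
proof (cases "s \<le> t")
 case False
 assume b: "b \<in> UU s"
 have "b \<in> T r \<zeta> s t ` UU t" using T_bij[of t s] b False by (simp add: bij_betw_def)
 then show ?thesis using False by (simp add: Tbar_def inv_into_into)
qed (simp add: orb_forward UU_C TT_UU)

text \<open>
  Orbits in the unstable spaces are compared at a common later time, where \<^const>\<open>T\<close> is injective on them. All
  rules for \<open>orb\<close> follow from this without distinguishing the order of the times.
\<close>

lemma orb_eq_iff:
 assumes b: "b \<in> UU s" and c: "c \<in> UU t" and w: "s \<le> w" "t \<le> w"
 shows "c = orb t s b \<longleftrightarrow> TT w t c = TT w s b"
proof -
 have "TT w t (orb t s b) = TT w s b"
 proof (cases "s \<le> t")
  case True then show ?thesis using b w by (simp add: orb_forward UU_C TT_cocycle)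
 next
  case False
  have "b \<in> T r \<zeta> s t ` UU t" using T_bij[of t s] b False by (simp add: bij_betw_def)
  then have "T r \<zeta> s t (orb t s b) = b" using False by (simp add: Tbar_def f_inv_into_f)
  then have "TT s t (orb t s b) = b" using False orb_UU[OF b, of t] by (simp add: T_eq UU_C)
  then show ?thesis using TT_cocycle[of t s w "orb t s b"] False w by simp
 qed
 then show ?thesis using TT_inj[OF w(2) c orb_UU[OF b]] by metis
qed

lemma TT_orb: "b \<in> UU s ==> s \<le> w ==> t \<le> w ==> TT w t (orb t s b) = TT w s b"
 using orb_eq_iff[of b s "orb t s b" t w] orb_UU by blast

lemma orb_self: "b \<in> UU s ==> orb s s b = b" using orb_eq_iff[of b s b s s] by simp

lemma orb_cocycle: "b \<in> UU s ==> orb t u (orb u s b) = orb t s b"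
proof -
 assume b: "b \<in> UU s"
 define w where "w = max t (max u s)"
 have "TT w t (orb t s b) = TT w s b" by (rule TT_orb[OF b]) (auto simp: w_def)
 moreover have "TT w u (orb u s b) = TT w s b" by (rule TT_orb[OF b]) (auto simp: w_def)
 ultimately show ?thesis
  using orb_eq_iff[OF orb_UU[OF b], of "orb t s b" t u w] orb_UU[OF b] by (simp add: w_def)
qed

lemma orb_combine:
 assumes b: "b \<in> UU s" and c: "c \<in> UU s"
 shows "orb t s (u *\<^sub>R b + v *\<^sub>R c) = u *\<^sub>R orb t s b + v *\<^sub>R orb t s c"
proof -
 define w where "w = max t s"
 have "TT w t (u *\<^sub>R orb t s b + v *\<^sub>R orb t s c) = TT w s (u *\<^sub>R b + v *\<^sub>R c)"
  unfolding TT_combine using TT_orb[OF b, of w t] TT_orb[OF c, of w t] by (simp add: w_def)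
 then show ?thesis
  using orb_eq_iff[OF UU_combine[OF b c, of u v] UU_combine[OF orb_UU[OF b] orb_UU[OF c], of u t v], of w]
  by (simp add: w_def)
qed

lemma orb_diff: "b \<in> UU s ==> c \<in> UU s ==> orb t s (b - c) = orb t s b - orb t s c"
 and orb_add: "b \<in> UU s ==> c \<in> UU s ==> orb t s (b + c) = orb t s b + orb t s c"
 using orb_combine[of b s c t 1 "-1"] orb_combine[of b s c t 1 1] by simp_all

lemma orb_scale: "b \<in> UU s ==> orb t s (v *\<^sub>R b) = v *\<^sub>R orb t s b"
 using orb_combine[of b s b t v 0] by simp

lemma orb_0: "orb t s 0 = 0" using orb_scale[OF UU_0, of t s 0] by simp

lemma orb_evolves:
 assumes b: "b \<in> UU s" and t: "t \<le> w"
 shows "TT w t (orb t s b) = orb w s b"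
 using orb_cocycle[OF b, of w t] orb_forward[OF t UU_C[OF orb_UU[OF b]]] by simp

lemma orb_continuous: "b \<in> UU s ==> continuous_on UNIV (\<lambda>t. orb t s b)"
proof -
 assume b: "b \<in> UU s"
 have "isCont (\<lambda>t. orb t s b) t" for t
 proof -
  have "continuous_on {t - 1<..} (\<lambda>w. TT w (t - 1) (orb (t - 1) s b))"
   by (rule continuous_on_subset[OF W_continuous[OF forcing_0]]) auto
  then have "continuous_on {t - 1<..} (\<lambda>w. orb w s b)"
   by (rule continuous_on_eq) (simp add: orb_evolves[OF b])
  then show ?thesis using continuous_on_eq_continuous_at[OF open_greaterThan, of "t - 1" "\<lambda>w. orb w s b"] by simp
 qed
 then show ?thesis by (simp add: continuous_on_eq_continuous_at)
qed

lemma orb_bound: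
 "t \<le> s ==> b \<in> UU s ==> norm (orb t s b) \<le> K * exp (\<beta> * (x t - x s) + \<nu> * \<bar>x s\<bar>) * norm b"
 using Q_bound[of t s b] by (simp add: UU_C QQ_UU)

lemma TT_growth:
 assumes "s \<le> t" "\<phi> \<in> C r"
 shows "norm (TT t s \<phi>) \<le> Kt * exp (a * (x t - x s) + \<epsilon> * \<bar>x s\<bar>) * norm \<phi>"
 using T0_growth[OF assms(1) C_imp_C0[OF assms(2)]]
 by (simp add: T0_C assms sup_norm_C TT_C)

lemma TT_P_bound: "s \<le> t ==> \<phi> \<in> C r ==> norm (TT t s (P s \<phi>)) \<le> K * exp (- \<alpha> * (x t - x s) + \<theta> * \<bar>x s\<bar>) * norm \<phi>"
 using P_bound[of s t \<phi>] by (simp add: T_eq P_C)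

lemma P_norm: "\<phi> \<in> C r ==> norm (P s \<phi>) \<le> K * exp (\<theta> * \<bar>x s\<bar>) * norm \<phi>"
 using TT_P_bound[of s s \<phi>] by (simp add: TT_start P_C)

lemma QQ_norm: "\<phi> \<in> C r ==> norm (QQ s \<phi>) \<le> K * exp (\<nu> * \<bar>x s\<bar>) * norm \<phi>"
 using Q_bound[of s s \<phi>] by (simp add: orb_self QQ_in_UU)

lemma Q0_eq: "Q0 r \<zeta> P \<sigma> p = orb \<sigma> (\<sigma> + r) (QQ (\<sigma> + r) (impulse (\<sigma> + r) \<sigma> p))"
 unfolding Q0_def impulse_def seg_def using r by (simp add: T0_X0)

lemma Q0_UU: "Q0 r \<zeta> P \<sigma> p \<in> UU \<sigma>"
 unfolding Q0_eq by (intro orb_UU QQ_in_UU impulse_C) simp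

text \<open>
  The definition of \<^const>\<open>Q0\<close> waits one delay for the impulse response to become continuous; by the cocycle
  property any longer waiting time gives the same unstable orbit.
\<close>

lemma QQ_impulse:
 assumes "\<sigma> + r \<le> u"
 shows "QQ u (impulse u \<sigma> p) = orb u \<sigma> (Q0 r \<zeta> P \<sigma> p)"
proof -
 have i: "impulse (\<sigma> + r) \<sigma> p \<in> C r" by (rule impulse_C) simp
 have "QQ u (impulse u \<sigma> p) = QQ u (TT u (\<sigma> + r) (impulse (\<sigma> + r) \<sigma> p))"
  using impulse_evolves[of \<sigma> "\<sigma> + r" u p] assms by simp
 also have "\<dots> = TT u (\<sigma> + r) (QQ (\<sigma> + r) (impulse (\<sigma> + r) \<sigma> p))" using TT_Q[OF assms i] by simp
 also have "\<dots> = orb u (\<sigma> + r) (QQ (\<sigma> + r) (impulse (\<sigma> + r) \<sigma> p))" using orb_forward[OF assms] QQ_C[OF i] by simp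
 also have "\<dots> = orb u \<sigma> (Q0 r \<zeta> P \<sigma> p)" unfolding Q0_eq using orb_cocycle[OF QQ_in_UU[OF i]] by metis
 finally show ?thesis .
qed

text \<open>
  The unstable component followed back to time \<open>u\<close> is a bounded linear operation, so it passes to the limit of
  the impulse sums.
\<close>

lemma unstable_sum_tendsto:
 assumes sb: "s < t0" and f: "continuous_on UNIV f" and t: "t0 + r \<le> t" and ut: "u \<le> t"
 shows "(\<lambda>N. \<Sum>i<Suc N. orb u (node s t0 N i) (Q0 r \<zeta> P (node s t0 N i) (((t0 - s) / real (Suc N)) *\<^sub>R f (node s t0 N i))))
   \<longlonglongrightarrow> orb u t (QQ t (W t s 0 (\<lambda>u. if u \<in> {s..t0} then f u else 0)))"
proof -
 define Z where "Z = W t s 0 (\<lambda>u. if u \<in> {s..t0} then f u else 0)"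
 have ff: "forcing (\<lambda>u. if u \<in> {s..t0} then f u else 0)" by (intro forcing_restrict forcing_continuous f)
 have ZC: "Z \<in> C r" unfolding Z_def by (rule W_C[OF ff])
 define H where "H \<phi> = orb u t (QQ t \<phi>)" for \<phi>
 have H_diff: "H (\<phi> - \<psi>) = H \<phi> - H \<psi>" if "\<phi> \<in> C r" "\<psi> \<in> C r" for \<phi> \<psi>
  using that by (simp add: H_def QQ_diff orb_diff QQ_in_UU)
 have H_bound: "norm (H \<phi>) \<le> K * exp (\<beta> * (x u - x t) + \<nu> * \<bar>x t\<bar>) * norm \<phi>" if "\<phi> \<in> C r" for \<phi>
  using Q_bound[OF ut that] by (simp add: H_def)
 have H_sum: "(\<Sum>i\<in>A. h i) \<in> C r \<and> H (\<Sum>i\<in>A. h i) = (\<Sum>i\<in>A. H (h i))" if "finite A" "!!i. i \<in> A ==> h i \<in> C r" for A and h :: "nat => 'n phase"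
  using that
 proof (induction A rule: finite_induct)
  case empty then show ?case using H_diff[OF C_0 C_0] by (simp add: C_0)
 next
  case (insert i A)
  then have A: "(\<Sum>i\<in>A. h i) \<in> C r" "H (\<Sum>i\<in>A. h i) = (\<Sum>i\<in>A. H (h i))" by auto
  have "H (h i + (\<Sum>i\<in>A. h i)) = H (h i) + H (\<Sum>i\<in>A. h i)"
   using insert.prems A(1) by (simp add: H_def QQ_add orb_add QQ_in_UU)
  then show ?case using insert A by (simp add: C_add)
 qed
 define I where "I N i = impulse t (node s t0 N i) (((t0 - s) / real (Suc N)) *\<^sub>R f (node s t0 N i))" for N i
 have nt: "node s t0 N i + r \<le> t" if "i < Suc N" for N i using node_bounds(2)[OF sb that] t by simp
 have IC: "I N i \<in> C r" if "i < Suc N" for N i unfolding I_def by (rule impulse_C[OF nt[OF that]])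
 have lim: "(\<lambda>N. \<Sum>i<Suc N. I N i) \<longlonglongrightarrow> Z" unfolding I_def Z_def by (rule impulse_sum_tendsto[OF sb f t])
 have "(\<lambda>N. H (\<Sum>i<Suc N. I N i)) \<longlonglongrightarrow> H Z"
 proof (rule Lim_null[THEN iffD2])
  show "(\<lambda>N. H (\<Sum>i<Suc N. I N i) - H Z) \<longlonglongrightarrow> 0"
  proof (rule Lim_null_comparison[OF always_eventually])
   show "(\<lambda>N. K * exp (\<beta> * (x u - x t) + \<nu> * \<bar>x t\<bar>) * norm ((\<Sum>i<Suc N. I N i) - Z)) \<longlonglongrightarrow> 0"
    using tendsto_mult_right_zero[OF tendsto_norm_zero[OF Lim_null[THEN iffD1, OF lim]]] .
   show "\<forall>N. norm (H (\<Sum>i<Suc N. I N i) - H Z) \<le> K * exp (\<beta> * (x u - x t) + \<nu> * \<bar>x t\<bar>) * norm ((\<Sum>i<Suc N. I N i) - Z)"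
   proof
    fix N
    have S: "(\<Sum>i<Suc N. I N i) \<in> C r" using H_sum[of "{..<Suc N}" "I N"] IC by blast
    show "norm (H (\<Sum>i<Suc N. I N i) - H Z) \<le> K * exp (\<beta> * (x u - x t) + \<nu> * \<bar>x t\<bar>) * norm ((\<Sum>i<Suc N. I N i) - Z)"
     using H_bound[OF C_diff[OF S ZC]] unfolding H_diff[OF S ZC] .
   qed
  qed
 qed
 moreover have "H (\<Sum>i<Suc N. I N i) = (\<Sum>i<Suc N. orb u (node s t0 N i) (Q0 r \<zeta> P (node s t0 N i) (((t0 - s) / real (Suc N)) *\<^sub>R f (node s t0 N i))))" for N
 proof -
  have "H (\<Sum>i<Suc N. I N i) = (\<Sum>i<Suc N. H (I N i))" using H_sum[of "{..<Suc N}" "I N"] IC by blast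
  also have "\<dots> = (\<Sum>i<Suc N. orb u (node s t0 N i) (Q0 r \<zeta> P (node s t0 N i) (((t0 - s) / real (Suc N)) *\<^sub>R f (node s t0 N i))))"
   by (intro sum.cong refl) (use nt in \<open>simp add: H_def I_def QQ_impulse orb_cocycle[OF Q0_UU] del: of_nat_Suc\<close>)
  finally show ?thesis .
 qed
 ultimately show ?thesis by (simp only: H_def Z_def)
qed

definition growth_kernel :: "real => real => real" where
 "growth_kernel t \<sigma> = Kt * exp (a * (x t - x \<sigma>) + \<epsilon> * \<bar>x \<sigma>\<bar>)"

definition stable_kernel :: "real => real => real" where
 "stable_kernel t \<sigma> = D * exp (- \<alpha> * (x t - x \<sigma>) + (\<theta> + \<epsilon>) * \<bar>x \<sigma>\<bar>)"

definition unstable_kernel :: "real => real => real" where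
 "unstable_kernel t \<sigma> = D * exp (\<beta> * (x t - x \<sigma>) + (\<nu> + \<epsilon>) * \<bar>x \<sigma>\<bar>)"

lemma kernels_continuous: "continuous_on A (growth_kernel t)" "continuous_on A (stable_kernel t)" "continuous_on A (unstable_kernel t)"
 unfolding growth_kernel_def[abs_def] stable_kernel_def[abs_def] unstable_kernel_def[abs_def]
 by (intro continuous_intros continuous_on_subset[OF x_cont]; simp)+

lemma kernels_nonneg: "0 \<le> growth_kernel t \<sigma>" "0 \<le> stable_kernel t \<sigma>" "0 \<le> unstable_kernel t \<sigma>"
 using signs by (auto simp: growth_kernel_def stable_kernel_def unstable_kernel_def)

text \<open>
  The three estimates of the response to a forcing that acts on \<open>[s, t0]\<close> only. Each passes the
  corresponding bound for a single impulse to the limit of Riemann sums.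
\<close>

lemma forced_growth_bound:
 assumes sb: "s < t0" and f: "continuous_on UNIV f" and t: "t0 \<le> t"
 shows "norm (W t s 0 (\<lambda>u. if u \<in> {s..t0} then f u else 0)) \<le> integral {s..t0} (\<lambda>\<sigma>. growth_kernel t \<sigma> * norm (f \<sigma>))"
proof (rule C_norm_le)
 have ff: "forcing (\<lambda>u. if u \<in> {s..t0} then f u else 0)" by (intro forcing_restrict forcing_continuous f)
 show "W t s 0 (\<lambda>u. if u \<in> {s..t0} then f u else 0) \<in> C r" by (rule W_C[OF ff])
 fix \<omega> assume \<omega>: "\<omega> \<in> {- r..0}"
 define S where "S N = (\<Sum>i<Suc N. jump_sol (node s t0 N i) (((t0 - s) / real (Suc N)) *\<^sub>R f (node s t0 N i)) (t + \<omega>))" for N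
 have lim: "S \<longlonglongrightarrow> traj s 0 (\<lambda>u. if u \<in> {s..t0} then f u else 0) (t + \<omega>)"
 proof (rule tendstoI)
  fix e :: real assume e: "e > 0"
  show "\<forall>\<^sub>F N in sequentially. dist (S N) (traj s 0 (\<lambda>u. if u \<in> {s..t0} then f u else 0) (t + \<omega>)) < e"
   using impulse_approximation[OF sb f half_gt_zero[OF e] t]
  proof eventually_elim
   case (elim N)
   have "t + \<omega> \<le> t" using \<omega> by simp
   from elim[rule_format, OF this] show ?case using e unfolding S_def dist_norm by linarith
  qed
 qed
 have "norm (traj s 0 (\<lambda>u. if u \<in> {s..t0} then f u else 0) (t + \<omega>)) \<le> integral {s..t0} (\<lambda>\<sigma>. growth_kernel t \<sigma> * norm (f \<sigma>))"
 proof (rule norm_limit_le_integral[OF sb lim])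
  show "continuous_on UNIV (\<lambda>\<sigma>. growth_kernel t \<sigma> * norm (f \<sigma>))" by (intro continuous_intros kernels_continuous f)
  show "norm (S N) \<le> (\<Sum>i<Suc N. (t0 - s) / real (Suc N) * (growth_kernel t (node s t0 N i) * norm (f (node s t0 N i))))" for N
   unfolding S_def
  proof (rule order.trans[OF norm_sum sum_mono])
   fix i assume "i \<in> {..<Suc N}"
   define \<sigma> where "\<sigma> = node s t0 N i"
   define p where "p = ((t0 - s) / real (Suc N)) *\<^sub>R f \<sigma>"
   have \<sigma>t: "\<sigma> \<le> t" using node_bounds(2)[OF sb, of i N] \<open>i \<in> {..<Suc N}\<close> t by (simp add: \<sigma>_def)
   obtain B where B: "\<forall>v\<in>{t - r..t}. norm (jump_sol \<sigma> p v) \<le> B" using jump_sol_bounded by blast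
   have "norm (jump_sol \<sigma> p (t + \<omega>)) \<le> sup_norm r (segment r (jump_sol \<sigma> p) t)"
    using segment_le_sup_norm[OF _ \<omega>, of t "jump_sol \<sigma> p" B] B by simp
   also have "\<dots> = sup_norm r (T0 r \<zeta> t \<sigma> (X0 p))" by (simp add: T0_X0[OF \<sigma>t])
   also have "\<dots> \<le> growth_kernel t \<sigma> * norm p"
    using T0_growth[OF \<sigma>t X0_C0, of p] by (simp add: sup_norm_X0 growth_kernel_def)
   also have "\<dots> = (t0 - s) / real (Suc N) * (growth_kernel t \<sigma> * norm (f \<sigma>))" using sb by (simp add: p_def)
   finally show "norm (jump_sol (node s t0 N i) (((t0 - s) / real (Suc N)) *\<^sub>R f (node s t0 N i)) (t + \<omega>))
     \<le> (t0 - s) / real (Suc N) * (growth_kernel t (node s t0 N i) * norm (f (node s t0 N i)))"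
    unfolding \<sigma>_def p_def .
  qed
 qed
 then show "norm (apply_bcontfun (W t s 0 (\<lambda>u. if u \<in> {s..t0} then f u else 0)) \<omega>) \<le> integral {s..t0} (\<lambda>\<sigma>. growth_kernel t \<sigma> * norm (f \<sigma>))"
  unfolding W_def seg_apply[OF traj_continuous[OF ff]] segment_apply[OF \<omega>] .
qed

lemma orb_QQ_TT: "t \<le> t' ==> \<phi> \<in> C r ==> orb u t' (QQ t' (TT t' t \<phi>)) = orb u t (QQ t \<phi>)"
proof -
 assume t: "t \<le> t'" and \<phi>: "\<phi> \<in> C r"
 have "QQ t' (TT t' t \<phi>) = orb t' t (QQ t \<phi>)" using TT_Q[OF t \<phi>] orb_forward[OF t QQ_C[OF \<phi>]] by simp
 then show ?thesis using orb_cocycle[OF QQ_in_UU[OF \<phi>]] by simp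
qed

lemma restricted_forcing_free:
 assumes f: "continuous_on UNIV f" and t: "t0 \<le> t" "t \<le> t'" and "s \<le> t"
 shows "W t' s 0 (\<lambda>u. if u \<in> {s..t0} then f u else 0) = TT t' t (W t s 0 (\<lambda>u. if u \<in> {s..t0} then f u else 0))"
proof -
 have ff: "forcing (\<lambda>u. if u \<in> {s..t0} then f u else 0)" by (intro forcing_restrict forcing_continuous f)
 have "W t' t (W t s 0 (\<lambda>u. if u \<in> {s..t0} then f u else 0)) (\<lambda>u. if u \<in> {s..t0} then f u else 0)
   = TT t' t (W t s 0 (\<lambda>u. if u \<in> {s..t0} then f u else 0))"
  by (rule W_forcing_cong[OF ff forcing_0]) (use t in auto)
 then show ?thesis using W_cocycle[OF ff \<open>s \<le> t\<close> t(2), of 0] by simp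
qed

text \<open>
  The limit of impulse sums is taken at \<open>t0 + r\<close>, when all impulse responses have become continuous; evolving
  further does not change the unstable orbit.
\<close>

lemma unstable_bound:
 assumes sb: "s < t0" and f: "continuous_on UNIV f" and t: "t0 \<le> t" and u: "u \<le> s"
 shows "norm (orb u t (QQ t (W t s 0 (\<lambda>u. if u \<in> {s..t0} then f u else 0)))) \<le> integral {s..t0} (\<lambda>\<sigma>. unstable_kernel u \<sigma> * norm (f \<sigma>))"
proof -
 have ff: "forcing (\<lambda>u. if u \<in> {s..t0} then f u else 0)" by (intro forcing_restrict forcing_continuous f)
 have eq: "orb u (t + r) (QQ (t + r) (W (t + r) s 0 (\<lambda>u. if u \<in> {s..t0} then f u else 0))) = orb u t (QQ t (W t s 0 (\<lambda>u. if u \<in> {s..t0} then f u else 0)))"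
  using restricted_forcing_free[OF f t, of "t + r" s] r sb t orb_QQ_TT[of t "t + r" _ u] W_C[OF ff] by simp
 have tr: "t0 + r \<le> t + r" "u \<le> t + r" using t u sb r by auto
 show ?thesis unfolding eq[symmetric]
 proof (rule norm_limit_le_integral[OF sb unstable_sum_tendsto[OF sb f tr]])
  show "continuous_on UNIV (\<lambda>\<sigma>. unstable_kernel u \<sigma> * norm (f \<sigma>))" by (intro continuous_intros kernels_continuous f)
  show "norm (\<Sum>i<Suc N. orb u (node s t0 N i) (Q0 r \<zeta> P (node s t0 N i) (((t0 - s) / real (Suc N)) *\<^sub>R f (node s t0 N i))))
   \<le> (\<Sum>i<Suc N. (t0 - s) / real (Suc N) * (unstable_kernel u (node s t0 N i) * norm (f (node s t0 N i))))" for N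
  proof (rule order.trans[OF norm_sum sum_mono])
   fix i assume "i \<in> {..<Suc N}"
   then have "u \<le> node s t0 N i" using node_bounds(1)[OF sb, of i N] u by simp
   from Q0_bound[OF this, of "((t0 - s) / real (Suc N)) *\<^sub>R f (node s t0 N i)"]
   show "norm (orb u (node s t0 N i) (Q0 r \<zeta> P (node s t0 N i) (((t0 - s) / real (Suc N)) *\<^sub>R f (node s t0 N i))))
    \<le> (t0 - s) / real (Suc N) * (unstable_kernel u (node s t0 N i) * norm (f (node s t0 N i)))"
    using sb by (simp add: unstable_kernel_def mult_ac)
  qed
 qed
qed

text \<open>
  At time \<open>t\<close> the most recent impulse responses may still jump, so the limit is taken for each \<open>\<omega>\<close> separately:
  the full response minus its unstable component, which is known from time \<open>t + r\<close>.
\<close>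

lemma stable_bound:
 assumes sb: "s < t0" and f: "continuous_on UNIV f" and t: "t0 \<le> t"
 shows "norm (P t (W t s 0 (\<lambda>u. if u \<in> {s..t0} then f u else 0))) \<le> integral {s..t0} (\<lambda>\<sigma>. stable_kernel t \<sigma> * norm (f \<sigma>))"
proof (rule C_norm_le)
 define Z where "Z t = W t s 0 (\<lambda>u. if u \<in> {s..t0} then f u else 0)" for t
 have ff: "forcing (\<lambda>u. if u \<in> {s..t0} then f u else 0)" by (intro forcing_restrict forcing_continuous f)
 have ZC: "Z t \<in> C r" for t unfolding Z_def by (rule W_C[OF ff])
 then show "P t (W t s 0 (\<lambda>u. if u \<in> {s..t0} then f u else 0)) \<in> C r" unfolding Z_def[symmetric] by (rule P_C)
 fix \<omega> assume \<omega>: "\<omega> \<in> {- r..0}"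
 have eq: "orb t (t + r) (QQ (t + r) (Z (t + r))) = QQ t (Z t)"
  using restricted_forcing_free[OF f t, of "t + r" s] r sb t orb_QQ_TT[of t "t + r" "Z t" t] ZC
  by (simp add: orb_self QQ_in_UU Z_def)
 have tr: "t0 + r \<le> t + r" "t \<le> t + r" using t r by auto
 define S1 where "S1 N = (\<Sum>i<Suc N. jump_sol (node s t0 N i) (((t0 - s) / real (Suc N)) *\<^sub>R f (node s t0 N i)) (t + \<omega>))" for N
 have lim1: "S1 \<longlonglongrightarrow> apply_bcontfun (Z t) \<omega>"
 proof (rule tendstoI)
  fix e :: real assume e: "e > 0"
  show "\<forall>\<^sub>F N in sequentially. dist (S1 N) (apply_bcontfun (Z t) \<omega>) < e"
   using impulse_approximation[OF sb f half_gt_zero[OF e] t]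
  proof eventually_elim
   case (elim N)
   have "t + \<omega> \<le> t" using \<omega> by simp
   from elim[rule_format, OF this] show ?case
    using e \<omega> unfolding S1_def dist_norm Z_def W_def seg_apply[OF traj_continuous[OF ff]] segment_apply[OF \<omega>] by linarith
  qed
 qed
 define S2 where "S2 N = (\<Sum>i<Suc N. orb t (node s t0 N i) (Q0 r \<zeta> P (node s t0 N i) (((t0 - s) / real (Suc N)) *\<^sub>R f (node s t0 N i))))" for N
 have "S2 \<longlonglongrightarrow> QQ t (Z t)"
  using unstable_sum_tendsto[OF sb f tr, folded Z_def] unfolding S2_def[abs_def] eq .
 then have lim2: "(\<lambda>N. apply_bcontfun (S2 N) \<omega>) \<longlonglongrightarrow> apply_bcontfun (QQ t (Z t)) \<omega>"
  by (intro tendsto_uniform_limitI[OF tendsto_bcontfun_uniform_limit]) auto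
 have "norm (apply_bcontfun (Z t) \<omega> - apply_bcontfun (QQ t (Z t)) \<omega>) \<le> integral {s..t0} (\<lambda>\<sigma>. stable_kernel t \<sigma> * norm (f \<sigma>))"
 proof (rule norm_limit_le_integral[OF sb tendsto_diff[OF lim1 lim2]])
  show "continuous_on UNIV (\<lambda>\<sigma>. stable_kernel t \<sigma> * norm (f \<sigma>))" by (intro continuous_intros kernels_continuous f)
  fix N
  have gen: "apply_bcontfun (\<Sum>i\<in>A. h i) \<omega> = (\<Sum>i\<in>A. apply_bcontfun (h i) \<omega>)" if "finite A" for A and h :: "nat => 'n phase"
   using that by (induction A rule: finite_induct) auto
  have diff: "S1 N - apply_bcontfun (S2 N) \<omega> = (\<Sum>i<Suc N. jump_sol (node s t0 N i) (((t0 - s) / real (Suc N)) *\<^sub>R f (node s t0 N i)) (t + \<omega>)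
    - apply_bcontfun (orb t (node s t0 N i) (Q0 r \<zeta> P (node s t0 N i) (((t0 - s) / real (Suc N)) *\<^sub>R f (node s t0 N i)))) \<omega>)"
   unfolding S1_def S2_def gen[OF finite_lessThan] by (rule sum_subtractf[symmetric])
  show "norm (S1 N - apply_bcontfun (S2 N) \<omega>) \<le> (\<Sum>i<Suc N. (t0 - s) / real (Suc N) * (stable_kernel t (node s t0 N i) * norm (f (node s t0 N i))))"
   unfolding diff
  proof (rule order.trans[OF norm_sum sum_mono])
   fix i assume "i \<in> {..<Suc N}"
   define \<sigma> where "\<sigma> = node s t0 N i"
   define p where "p = ((t0 - s) / real (Suc N)) *\<^sub>R f \<sigma>"
   define q where "q = Q0 r \<zeta> P \<sigma> p"
   have q: "q \<in> C r" unfolding q_def by (rule UU_C[OF Q0_UU])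
   have \<sigma>t: "\<sigma> \<le> t" using node_bounds(2)[OF sb, of i N] \<open>i \<in> {..<Suc N}\<close> t by (simp add: \<sigma>_def)
   obtain B1 where B1: "\<forall>v\<in>{t - r..t}. norm (jump_sol \<sigma> p v) \<le> B1" using jump_sol_bounded by blast
   obtain B2 where B2: "\<forall>v\<in>{t - r..t}. norm (traj \<sigma> q (\<lambda>_. 0) v) \<le> B2"
    using continuous_on_interval_bounded[OF continuous_on_subset[OF traj_continuous[OF forcing_0] subset_UNIV]] by blast
   have B: "norm (jump_sol \<sigma> p v - traj \<sigma> q (\<lambda>_. 0) v) \<le> B1 + B2" if "v \<in> {t - r..t}" for v
    using B1 B2 that norm_triangle_ineq4[of "jump_sol \<sigma> p v" "traj \<sigma> q (\<lambda>_. 0) v"] by fastforce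
   have "apply_bcontfun (orb t \<sigma> q) \<omega> = traj \<sigma> q (\<lambda>_. 0) (t + \<omega>)"
    using orb_forward[OF \<sigma>t q] \<omega> by (simp add: W_def seg_apply[OF traj_continuous[OF forcing_0]] segment_apply)
   then have "norm (jump_sol \<sigma> p (t + \<omega>) - apply_bcontfun (orb t \<sigma> q) \<omega>)
     \<le> sup_norm r (segment r (\<lambda>v. jump_sol \<sigma> p v - traj \<sigma> q (\<lambda>_. 0) v) t)"
    using segment_le_sup_norm[OF B \<omega>] by simp
   also have "\<dots> = sup_norm r (T0 r \<zeta> t \<sigma> (P0 r \<zeta> P \<sigma> p))"
    unfolding P0_def using T0_jump[OF q \<sigma>t, of p] by (simp add: q_def)
   also have "\<dots> \<le> stable_kernel t \<sigma> * norm p" using P0_bound[OF \<sigma>t] by (simp add: stable_kernel_def)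
   also have "\<dots> = (t0 - s) / real (Suc N) * (stable_kernel t \<sigma> * norm (f \<sigma>))" using sb by (simp add: p_def)
   finally show "norm (jump_sol (node s t0 N i) (((t0 - s) / real (Suc N)) *\<^sub>R f (node s t0 N i)) (t + \<omega>)
    - apply_bcontfun (orb t (node s t0 N i) (Q0 r \<zeta> P (node s t0 N i) (((t0 - s) / real (Suc N)) *\<^sub>R f (node s t0 N i)))) \<omega>)
    \<le> (t0 - s) / real (Suc N) * (stable_kernel t (node s t0 N i) * norm (f (node s t0 N i)))"
    unfolding q_def p_def \<sigma>_def .
  qed
 qed
 then show "norm (apply_bcontfun (P t (W t s 0 (\<lambda>u. if u \<in> {s..t0} then f u else 0))) \<omega>) \<le> integral {s..t0} (\<lambda>\<sigma>. stable_kernel t \<sigma> * norm (f \<sigma>))"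
  unfolding Z_def[symmetric] by (simp add: Q_def)
qed

end

section \<open>Bounded solutions of the forced linear equation\<close>

lemma convergent_by_increments:
 fixes c :: "nat => 'a::{real_normed_vector, complete_space}" and I :: "nat => real"
 assumes inc: "!!m n. n \<le> m ==> norm (c m - c n) \<le> I m - I n" and I: "!!n. I n \<le> Mb"
 shows "convergent c"
proof -
 have "incseq I" unfolding incseq_def using inc norm_ge_zero by (metis diff_ge_0_iff_ge order_trans)
 moreover have "Bseq I"
 proof (rule BseqI')
  fix n
  have "I 0 \<le> I n" using \<open>incseq I\<close> unfolding incseq_def by simp
  then show "norm (I n) \<le> \<bar>Mb\<bar> + \<bar>I 0\<bar>" using I[of n] by simp
 qed
 ultimately have "convergent I" by (intro Bseq_monoseq_convergent) (auto simp: monoseq_def incseq_def)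
 then have "Cauchy I" by (rule convergent_Cauchy)
 have "Cauchy c"
 proof (rule CauchyI)
  fix e :: real assume "e > 0"
  then obtain N where N: "\<forall>m\<ge>N. \<forall>n\<ge>N. norm (I m - I n) < e" using CauchyD[OF \<open>Cauchy I\<close>] by blast
  have "norm (c m - c n) < e" if "m \<ge> N" "n \<ge> N" for m n
  proof (cases "n \<le> m")
   case True then show ?thesis using inc[OF True] N that by fastforce
  next
   case False
   then have "norm (c n - c m) \<le> I n - I m" using inc[of m n] by simp
   then show ?thesis using N that by (metis abs_le_D1 norm_minus_commute order_le_less_trans real_norm_def abs_ge_self order_trans)
  qed
  then show "\<exists>N. \<forall>m\<ge>N. \<forall>n\<ge>N. norm (c m - c n) < e" by blast
 qed
 then show ?thesis by (rule Cauchy_convergent)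
qed

context exponential_dichotomy
begin

text \<open>
  The improper integrals against the kernels are only used through bounds of their partial integrals.
\<close>

definition stable_adm :: "(real => real ^ 'n) => real => real => bool" where
 "stable_adm f t Mb \<longleftrightarrow> (\<forall>s\<le>t. integral {s..t} (\<lambda>\<sigma>. stable_kernel t \<sigma> * norm (f \<sigma>)) \<le> Mb)"

definition unstable_adm :: "(real => real ^ 'n) => real => real => bool" where
 "unstable_adm f t Mb \<longleftrightarrow> (\<forall>u\<ge>t. integral {t..u} (\<lambda>\<sigma>. unstable_kernel t \<sigma> * norm (f \<sigma>)) \<le> Mb)"

text \<open>
  The stable component at time \<open>t\<close> of the solution that starts from zero at a remote past time.
\<close>

definition stable_part :: "(real => real ^ 'n) => real => nat => 'n phase" where
 "stable_part f t n = P t (W t (min t (- real n)) 0 f)"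

text \<open>
  The unstable component at a remote future time of the solution that starts from zero at time \<open>t\<close>,
  followed back to time \<open>t\<close>.
\<close>

definition unstable_part :: "(real => real ^ 'n) => real => nat => 'n phase" where
 "unstable_part f t n = orb t (max t (real n)) (QQ (max t (real n)) (W (max t (real n)) t 0 f))"

definition stable_sol :: "(real => real ^ 'n) => real => 'n phase" where
 "stable_sol f t = lim (stable_part f t)"

definition unstable_sol :: "(real => real ^ 'n) => real => 'n phase" where
 "unstable_sol f t = lim (unstable_part f t)"

text \<open>
  The Green operator of the dichotomy: \<open>stable_sol\<close> is the integral of the stable responses over \<open>(-\<infinity>, t]\<close>,
  \<open>unstable_sol\<close> that of the unstable responses over \<open>[t, \<infinity>)\<close>.
\<close>

definition bsol :: "(real => real ^ 'n) => real => 'n phase" where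
 "bsol f t = stable_sol f t - unstable_sol f t"

lemma W_zero_time: "forcing f ==> W t t 0 f = 0"
 using W_start[of f 0 t] C_0 by simp

lemma W_restrict:
 assumes f: "continuous_on UNIV f"
 shows "W t s 0 (\<lambda>u. if u \<in> {s..t} then f u else 0) = W t s 0 f"
 by (rule W_forcing_cong[OF forcing_restrict[OF forcing_continuous[OF f]] forcing_continuous[OF f]]) simp

lemma stable_increment:
 assumes f: "continuous_on UNIV f" and s: "s' \<le> s" "s \<le> t"
 shows "norm (P t (W t s' 0 f) - P t (W t s 0 f)) \<le> integral {s'..s} (\<lambda>\<sigma>. stable_kernel t \<sigma> * norm (f \<sigma>))"
proof (cases "s' = s")
 case False
 note ff = forcing_continuous[OF f]
 have eq: "W t s' 0 (\<lambda>u. if u \<in> {s'..s} then f u else 0) = TT t s (W s s' 0 f)"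
  using restricted_forcing_free[OF f order_refl s(2,1)] W_restrict[OF f] by simp
 have "P t (W t s' 0 f) - P t (W t s 0 f) = P t (W t s' 0 f - W t s 0 f)" by (simp add: P_diff W_C ff)
 also have "W t s' 0 f - W t s 0 f = TT t s (W s s' 0 f)" using W_forced_cocycle[OF ff s] by simp
 finally show ?thesis using stable_bound[OF _ f s(2), of s'] False s(1) unfolding eq by simp
qed simp

lemma unstable_increment:
 assumes f: "continuous_on UNIV f" and u: "t \<le> u" "u \<le> u'"
 shows "norm (orb t u' (QQ u' (W u' t 0 f)) - orb t u (QQ u (W u t 0 f))) \<le> integral {u..u'} (\<lambda>\<sigma>. unstable_kernel t \<sigma> * norm (f \<sigma>))"
proof (cases "u' = u")
 case False
 note ff = forcing_continuous[OF f]
 have "QQ u' (W u' t 0 f) = QQ u' (TT u' u (W u t 0 f)) + QQ u' (W u' u 0 f)"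
  using W_forced_cocycle[OF ff u] by (simp add: QQ_add TT_C W_C ff)
 then have "orb t u' (QQ u' (W u' t 0 f)) = orb t u (QQ u (W u t 0 f)) + orb t u' (QQ u' (W u' u 0 f))"
  using orb_QQ_TT[OF u(2) W_C[OF ff], of t] by (simp add: orb_add QQ_in_UU TT_C W_C ff)
 then show ?thesis using unstable_bound[OF _ f order_refl, of u u' t] False u W_restrict[OF f, of u' u] by simp
qed (use u in simp)

lemma kernel_int: "continuous_on UNIV f ==> (\<lambda>\<sigma>. stable_kernel t \<sigma> * norm (f \<sigma>)) integrable_on {u..v}"
 "continuous_on UNIV f ==> (\<lambda>\<sigma>. unstable_kernel t \<sigma> * norm (f \<sigma>)) integrable_on {u..v}"
 by (auto intro!: integrable_continuous_real continuous_intros kernels_continuous intro: continuous_on_subset)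

lemma stable_sol_lim:
 assumes f: "continuous_on UNIV f" and Mb: "stable_adm f t Mb"
 shows "stable_part f t \<longlonglongrightarrow> stable_sol f t" "norm (stable_sol f t) \<le> Mb"
  "stable_sol f t \<in> C r" "P t (stable_sol f t) = stable_sol f t"
proof -
 note ff = forcing_continuous[OF f]
 define q where "q = (\<lambda>\<sigma>. stable_kernel t \<sigma> * norm (f \<sigma>))"
 define s where "s n = min t (- real n)" for n
 have s: "s n \<le> t" "n \<le> m ==> s m \<le> s n" for n m by (auto simp: s_def)
 have "convergent (stable_part f t)"
 proof (rule convergent_by_increments[where I = "\<lambda>n. integral {s n..t} q" and Mb = Mb])
  show "integral {s n..t} q \<le> Mb" for n using Mb s(1) unfolding stable_adm_def q_def by blast
  show "norm (stable_part f t m - stable_part f t n) \<le> integral {s m..t} q - integral {s n..t} q" if "n \<le> m" for m n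
  proof -
   have "integral {s m..s n} q + integral {s n..t} q = integral {s m..t} q"
    unfolding q_def by (intro Henstock_Kurzweil_Integration.integral_combine s kernel_int f that)
   then show ?thesis
    using stable_increment[OF f s(2)[OF that] s(1)] by (simp add: stable_part_def s_def q_def)
  qed
 qed
 then show lim: "stable_part f t \<longlonglongrightarrow> stable_sol f t" unfolding stable_sol_def by (simp add: convergent_LIMSEQ_iff)
 have PC: "stable_part f t n \<in> C r" for n by (simp add: stable_part_def P_C W_C ff)
 have "norm (stable_part f t n) \<le> Mb" for n
 proof -
  have "norm (stable_part f t n) \<le> integral {s n..t} q"
   using stable_increment[OF f s(1) order_refl, of n] by (simp add: stable_part_def s_def q_def W_zero_time[OF ff] P_0)
  then show ?thesis using Mb s(1)[of n] unfolding stable_adm_def q_def by force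
 qed
 then show "norm (stable_sol f t) \<le> Mb" by (intro LIMSEQ_le_const2[OF tendsto_norm[OF lim]]) auto
 show SC: "stable_sol f t \<in> C r" using closed_sequentially[OF closed_C PC lim] .
 have "(\<lambda>n. P t (stable_part f t n)) \<longlonglongrightarrow> P t (stable_sol f t)"
 proof (rule Lim_null[THEN iffD2], rule Lim_null_comparison[OF always_eventually])
  show "\<forall>n. norm (P t (stable_part f t n) - P t (stable_sol f t)) \<le> K * exp (\<theta> * \<bar>x t\<bar>) * norm (stable_part f t n - stable_sol f t)"
   using P_norm[OF C_diff[OF PC SC], of t] by (simp add: P_diff PC SC)
  show "(\<lambda>n. K * exp (\<theta> * \<bar>x t\<bar>) * norm (stable_part f t n - stable_sol f t)) \<longlonglongrightarrow> 0"
   using tendsto_mult_right_zero[OF tendsto_norm_zero[OF Lim_null[THEN iffD1, OF lim]]] .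
 qed
 moreover have "(\<lambda>n. P t (stable_part f t n)) = stable_part f t" by (simp add: stable_part_def fun_eq_iff P_idem W_C ff)
 ultimately show "P t (stable_sol f t) = stable_sol f t" using LIMSEQ_unique[OF _ lim] by metis
qed

lemma unstable_sol_lim:
 assumes f: "continuous_on UNIV f" and Mb: "unstable_adm f t Mb"
 shows "unstable_part f t \<longlonglongrightarrow> unstable_sol f t" "norm (unstable_sol f t) \<le> Mb" "unstable_sol f t \<in> UU t"
proof -
 note ff = forcing_continuous[OF f]
 define q where "q = (\<lambda>\<sigma>. unstable_kernel t \<sigma> * norm (f \<sigma>))"
 define s where "s n = max t (real n)" for n
 have s: "t \<le> s n" "n \<le> m ==> s n \<le> s m" for n m by (auto simp: s_def)
 have "convergent (unstable_part f t)"
 proof (rule convergent_by_increments[where I = "\<lambda>n. integral {t..s n} q" and Mb = Mb])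
  show "integral {t..s n} q \<le> Mb" for n using Mb s(1) unfolding unstable_adm_def q_def by blast
  show "norm (unstable_part f t m - unstable_part f t n) \<le> integral {t..s m} q - integral {t..s n} q" if "n \<le> m" for m n
  proof -
   have "integral {t..s n} q + integral {s n..s m} q = integral {t..s m} q"
    unfolding q_def by (intro Henstock_Kurzweil_Integration.integral_combine s kernel_int f that)
   then show ?thesis
    using unstable_increment[OF f s(1) s(2)[OF that]] by (simp add: unstable_part_def s_def q_def)
  qed
 qed
 then show lim: "unstable_part f t \<longlonglongrightarrow> unstable_sol f t" unfolding unstable_sol_def by (simp add: convergent_LIMSEQ_iff)
 have PU: "unstable_part f t n \<in> UU t" for n by (simp add: unstable_part_def orb_UU QQ_in_UU W_C ff)
 note PC = UU_C[OF PU]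
 have "norm (unstable_part f t n) \<le> Mb" for n
 proof -
  have "QQ t (W t t 0 f) = 0" by (simp add: W_zero_time[OF ff] Q_def P_0)
  then have "norm (unstable_part f t n) \<le> integral {t..s n} q"
   using unstable_increment[OF f order_refl s(1), of n] by (simp add: unstable_part_def s_def q_def orb_0)
  then show ?thesis using Mb s(1)[of n] unfolding unstable_adm_def q_def by force
 qed
 then show "norm (unstable_sol f t) \<le> Mb" by (intro LIMSEQ_le_const2[OF tendsto_norm[OF lim]]) auto
 have SC: "unstable_sol f t \<in> C r" using closed_sequentially[OF closed_C PC lim] .
 have "(\<lambda>n. QQ t (unstable_part f t n)) \<longlonglongrightarrow> QQ t (unstable_sol f t)"
 proof (rule Lim_null[THEN iffD2], rule Lim_null_comparison[OF always_eventually])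
  show "\<forall>n. norm (QQ t (unstable_part f t n) - QQ t (unstable_sol f t)) \<le> K * exp (\<nu> * \<bar>x t\<bar>) * norm (unstable_part f t n - unstable_sol f t)"
   using QQ_norm[OF C_diff[OF PC SC], of t] by (simp add: QQ_diff PC SC)
  show "(\<lambda>n. K * exp (\<nu> * \<bar>x t\<bar>) * norm (unstable_part f t n - unstable_sol f t)) \<longlonglongrightarrow> 0"
   using tendsto_mult_right_zero[OF tendsto_norm_zero[OF Lim_null[THEN iffD1, OF lim]]] .
 qed
 moreover have "(\<lambda>n. QQ t (unstable_part f t n)) = unstable_part f t" by (simp add: fun_eq_iff QQ_UU[OF PU])
 ultimately have "QQ t (unstable_sol f t) = unstable_sol f t" using LIMSEQ_unique[OF _ lim] by metis
 then show "unstable_sol f t \<in> UU t" using SC by (simp add: UU_iff)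
qed

definition adm :: "(real => real ^ 'n) => bool" where
 "adm f \<longleftrightarrow> continuous_on UNIV f \<and> (\<forall>t. (\<exists>Mb. stable_adm f t Mb) \<and> (\<exists>Mb. unstable_adm f t Mb))"

lemma admD:
 assumes "adm f"
 shows "continuous_on UNIV f" "stable_part f t \<longlonglongrightarrow> stable_sol f t" "stable_sol f t \<in> C r" "P t (stable_sol f t) = stable_sol f t"
  "unstable_part f t \<longlonglongrightarrow> unstable_sol f t" "unstable_sol f t \<in> UU t" "bsol f t \<in> C r"
proof -
 show f: "continuous_on UNIV f" using assms by (simp add: adm_def)
 obtain M1 M2 where Mb: "stable_adm f t M1" "unstable_adm f t M2" using assms unfolding adm_def by blast
 show "stable_part f t \<longlonglongrightarrow> stable_sol f t" "stable_sol f t \<in> C r" "P t (stable_sol f t) = stable_sol f t"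
  using stable_sol_lim[OF f Mb(1)] by blast+
 moreover show "unstable_part f t \<longlonglongrightarrow> unstable_sol f t" "unstable_sol f t \<in> UU t"
  using unstable_sol_lim[OF f Mb(2)] by blast+
 ultimately show "bsol f t \<in> C r" unfolding bsol_def using C_diff[OF _ UU_C] by blast
qed

lemma TT_tendsto:
 assumes "c \<longlonglongrightarrow> l" "!!n. c n \<in> C r" "l \<in> C r" "s \<le> t"
 shows "(\<lambda>n. TT t s (c n)) \<longlonglongrightarrow> TT t s l"
proof (rule Lim_null[THEN iffD2], rule Lim_null_comparison[OF always_eventually])
 show "\<forall>n. norm (TT t s (c n) - TT t s l) \<le> Kt * exp (a * (x t - x s) + \<epsilon> * \<bar>x s\<bar>) * norm (c n - l)"
  using TT_growth[OF assms(4) C_diff[OF assms(2,3)]] by (simp add: TT_diff)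
 show "(\<lambda>n. Kt * exp (a * (x t - x s) + \<epsilon> * \<bar>x s\<bar>) * norm (c n - l)) \<longlonglongrightarrow> 0"
  using tendsto_mult_right_zero[OF tendsto_norm_zero[OF Lim_null[THEN iffD1, OF assms(1)]]] .
qed

text \<open>
  Both parts are limits of quantities that satisfy the same identity from some index on, because the starting
  time and the observation time have then left the interval between \<open>s\<close> and \<open>t\<close>.
\<close>

lemma bsol_mild:
 assumes f: "adm f" and st: "s \<le> t"
 shows "bsol f t = W t s (bsol f s) f"
proof -
 note ff = forcing_continuous[OF admD(1)[OF f]]
 have "stable_sol f t = P t (W t s 0 f) + TT t s (stable_sol f s)"
 proof -
  have "(\<lambda>n. TT t s (stable_part f s n)) \<longlonglongrightarrow> TT t s (stable_sol f s)"
   by (rule TT_tendsto[OF admD(2)[OF f] _ admD(3)[OF f] st]) (simp add: stable_part_def P_C W_C ff)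
  then have l: "(\<lambda>n. P t (W t s 0 f) + TT t s (stable_part f s n)) \<longlonglongrightarrow> P t (W t s 0 f) + TT t s (stable_sol f s)"
   by (intro tendsto_intros)
  obtain N :: nat where N: "- s \<le> real N" using real_arch_simple by blast
  have "\<forall>\<^sub>F n in sequentially. P t (W t s 0 f) + TT t s (stable_part f s n) = stable_part f t n"
   using eventually_ge_at_top[of N]
  proof eventually_elim
   case (elim n)
   then have n: "- real n \<le> s" "min t (- real n) = - real n" "min s (- real n) = - real n" using N st by auto
   show ?case
    unfolding stable_part_def n TT_P[OF st W_C[OF ff]]
    using W_forced_cocycle[OF ff n(1) st] by (simp add: P_add TT_C W_C ff)
  qed
  from Lim_transform_eventually[OF l this] show ?thesis using LIMSEQ_unique[OF admD(2)[OF f, of t]] by simp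
 qed
 moreover have "TT t s (unstable_sol f s) = unstable_sol f t + QQ t (W t s 0 f)"
 proof -
  have l1: "(\<lambda>n. TT t s (unstable_part f s n)) \<longlonglongrightarrow> TT t s (unstable_sol f s)"
   by (rule TT_tendsto[OF admD(5)[OF f] _ UU_C[OF admD(6)[OF f]] st])
     (unfold unstable_part_def, rule UU_C[OF orb_UU[OF QQ_in_UU[OF W_C[OF ff]]]])
  have l: "(\<lambda>n. unstable_part f t n + QQ t (W t s 0 f)) \<longlonglongrightarrow> unstable_sol f t + QQ t (W t s 0 f)"
   by (intro tendsto_intros admD(5)[OF f])
  obtain N :: nat where N: "t \<le> real N" using real_arch_simple by blast
  have "\<forall>\<^sub>F n in sequentially. unstable_part f t n + QQ t (W t s 0 f) = TT t s (unstable_part f s n)"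
   using eventually_ge_at_top[of N]
  proof eventually_elim
   case (elim n)
   then have n: "t \<le> real n" "max t (real n) = real n" "max s (real n) = real n" using N st by auto
   have U: "QQ (real n) (W (real n) s 0 f) \<in> UU (real n)" by (intro QQ_in_UU W_C ff)
   have "TT t s (unstable_part f s n) = orb t (real n) (QQ (real n) (W (real n) s 0 f))"
    unfolding unstable_part_def n by (rule orb_evolves[OF U st])
   also have "QQ (real n) (W (real n) s 0 f) = QQ (real n) (TT (real n) t (W t s 0 f)) + QQ (real n) (W (real n) t 0 f)"
    using W_forced_cocycle[OF ff st n(1)] by (simp add: QQ_add TT_C W_C ff)
   also have "orb t (real n) \<dots> = orb t t (QQ t (W t s 0 f)) + unstable_part f t n"
    unfolding unstable_part_def n using orb_QQ_TT[OF n(1) W_C[OF ff], of t t s 0]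
    by (simp add: orb_add QQ_in_UU TT_C W_C ff)
   finally show ?case by (simp add: orb_self QQ_in_UU W_C ff)
  qed
  from Lim_transform_eventually[OF l this] show ?thesis using LIMSEQ_unique[OF l1] by simp
 qed
 moreover have "W t s (bsol f s) f = TT t s (stable_sol f s) - TT t s (unstable_sol f s) + W t s 0 f"
  using W_split[OF ff, of t s "bsol f s"] by (simp add: bsol_def TT_diff)
 ultimately show ?thesis by (simp add: bsol_def Q_def)
qed

lemma mild_continuous:
 assumes f: "forcing f" and z: "!!s t. s \<le> t ==> z t = W t s (z s) f"
 shows "continuous_on UNIV z"
proof -
 have "isCont z t" for t
 proof -
  have "continuous_on {t - 1<..} (\<lambda>w. W w (t - 1) (z (t - 1)) f)"
   by (rule continuous_on_subset[OF W_continuous[OF f]]) auto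
  moreover have "W w (t - 1) (z (t - 1)) f = z w" if "w \<in> {t - 1<..}" for w
   using z[of "t - 1" w] that by auto
  ultimately have "continuous_on {t - 1<..} z" by (rule continuous_on_eq)
  then show ?thesis using continuous_on_eq_continuous_at[OF open_greaterThan, of "t - 1" z] by simp
 qed
 then show ?thesis by (simp add: continuous_on_eq_continuous_at)
qed

lemma bsol_continuous: "adm f ==> continuous_on UNIV (bsol f)"
 by (rule mild_continuous[of f]) (auto intro: forcing_continuous admD bsol_mild)

lemma stable_part_combine:
 "forcing f ==> forcing h ==> stable_part (\<lambda>t. c *\<^sub>R f t + d *\<^sub>R h t) t n = c *\<^sub>R stable_part f t n + d *\<^sub>R stable_part h t n"
 by (simp add: stable_part_def W_forced_combine P_combine W_C)

lemma unstable_part_combine: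
 "forcing f ==> forcing h ==> unstable_part (\<lambda>t. c *\<^sub>R f t + d *\<^sub>R h t) t n = c *\<^sub>R unstable_part f t n + d *\<^sub>R unstable_part h t n"
 by (simp add: unstable_part_def W_forced_combine QQ_combine W_C orb_combine QQ_in_UU)

lemma unstable_sol_combine:
 assumes "continuous_on UNIV f" "continuous_on UNIV h" "unstable_adm f t M1" "unstable_adm h t M2"
 shows "unstable_sol (\<lambda>t. c *\<^sub>R f t + d *\<^sub>R h t) t = c *\<^sub>R unstable_sol f t + d *\<^sub>R unstable_sol h t"
proof -
 have "unstable_part (\<lambda>t. c *\<^sub>R f t + d *\<^sub>R h t) t = (\<lambda>n. c *\<^sub>R unstable_part f t n + d *\<^sub>R unstable_part h t n)"
  using unstable_part_combine[OF forcing_continuous[OF assms(1)] forcing_continuous[OF assms(2)]] by auto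
 then show ?thesis
  unfolding unstable_sol_def[of "\<lambda>t. c *\<^sub>R f t + d *\<^sub>R h t"]
  using tendsto_add[OF tendsto_scaleR[OF tendsto_const unstable_sol_lim(1)[OF assms(1,3)]]
    tendsto_scaleR[OF tendsto_const unstable_sol_lim(1)[OF assms(2,4)]], of c d] by (simp add: limI)
qed

lemma bsol_combine:
 assumes f: "adm f" and h: "adm h"
 shows "bsol (\<lambda>t. c *\<^sub>R f t + d *\<^sub>R h t) t = c *\<^sub>R bsol f t + d *\<^sub>R bsol h t"
proof -
 note ff = forcing_continuous[OF admD(1)[OF f]] and fh = forcing_continuous[OF admD(1)[OF h]]
 have "stable_sol (\<lambda>t. c *\<^sub>R f t + d *\<^sub>R h t) t = c *\<^sub>R stable_sol f t + d *\<^sub>R stable_sol h t"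
 proof -
  have "stable_part (\<lambda>t. c *\<^sub>R f t + d *\<^sub>R h t) t = (\<lambda>n. c *\<^sub>R stable_part f t n + d *\<^sub>R stable_part h t n)"
   using stable_part_combine[OF ff fh] by auto
  then show ?thesis
   unfolding stable_sol_def[of "\<lambda>t. c *\<^sub>R f t + d *\<^sub>R h t"]
   using tendsto_add[OF tendsto_scaleR[OF tendsto_const admD(2)[OF f, of t]]
     tendsto_scaleR[OF tendsto_const admD(2)[OF h, of t]], of c d] by (simp add: limI)
 qed
 moreover have "unstable_sol (\<lambda>t. c *\<^sub>R f t + d *\<^sub>R h t) t = c *\<^sub>R unstable_sol f t + d *\<^sub>R unstable_sol h t"
 proof -
  obtain M1 M2 where "unstable_adm f t M1" "unstable_adm h t M2" using f h unfolding adm_def by blast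
  then show ?thesis by (rule unstable_sol_combine[OF admD(1)[OF f] admD(1)[OF h]])
 qed
 ultimately show ?thesis by (simp add: bsol_def algebra_simps)
qed

text \<open>
  The unstable part looks into the future only. This is what links a full orbit to the problem on a half-line.
\<close>

lemma unstable_sol_cong:
 assumes f: "continuous_on UNIV f" and h: "continuous_on UNIV h" and eq: "!!u. t \<le> u ==> f u = h u"
 shows "unstable_sol f t = unstable_sol h t"
proof -
 have "W u t 0 f = W u t 0 h" for u
  by (rule W_forcing_cong[OF forcing_continuous[OF f] forcing_continuous[OF h]]) (simp add: eq)
 then have "unstable_part f t = unstable_part h t" by (simp add: unstable_part_def fun_eq_iff)
 then show ?thesis by (simp add: unstable_sol_def)
qed

lemma QQ_bsol: "adm f ==> QQ t (bsol f t) = - unstable_sol f t"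
proof -
 assume f: "adm f"
 have "QQ t (stable_sol f t) = 0" using admD(4)[OF f, of t] by (simp add: Q_def)
 then show ?thesis
  unfolding bsol_def using admD(3)[OF f] admD(6)[OF f, of t] by (simp add: QQ_diff UU_C QQ_UU)
qed

text \<open>
  The stable component of a bounded solution is controlled from the remote past, the unstable component from
  the remote future, and both bounds tend to zero.
\<close>

lemma bounded_orbit_zero:
 assumes d: "!!s t. s \<le> t ==> d t = TT t s (d s)" and C: "!!t. d t \<in> C r" and B: "!!t. norm (d t) \<le> B"
 shows "d t = 0"
proof -
 have B0: "0 \<le> B" using B[of 0] norm_ge_zero[of "d 0"] by linarith
 have c1: "((\<lambda>s. K * exp (- \<alpha> * x t + (\<alpha> - \<theta>) * x s) * B) \<longlongrightarrow> 0) at_bot"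
 proof -
  have "filterlim (\<lambda>s. (\<alpha> - \<theta>) * x s) at_bot at_bot"
   using signs x_bot by (intro filterlim_tendsto_pos_mult_at_bot[OF tendsto_const]) auto
  then have "filterlim (\<lambda>s. - \<alpha> * x t + (\<alpha> - \<theta>) * x s) at_bot at_bot"
   by (simp only: filterlim_tendsto_add_at_bot_iff[OF tendsto_const])
  then have "((\<lambda>s. exp (- \<alpha> * x t + (\<alpha> - \<theta>) * x s)) \<longlongrightarrow> 0) at_bot"
   by (rule filterlim_compose[OF exp_at_bot])
  then show ?thesis using tendsto_mult_left_zero[OF tendsto_mult_right_zero] by blast
 qed
 have c2: "((\<lambda>u. K * exp (\<beta> * x t - (\<beta> - \<nu>) * x u) * B) \<longlongrightarrow> 0) at_top"
 proof -
  have "filterlim (\<lambda>u. (\<beta> - \<nu>) * x u) at_top at_top"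
   using signs x_top by (intro filterlim_tendsto_pos_mult_at_top[OF tendsto_const]) auto
  then have "filterlim (\<lambda>u. - ((\<beta> - \<nu>) * x u)) at_bot at_top"
   by (simp add: filterlim_uminus_at_bot)
  then have "filterlim (\<lambda>u. \<beta> * x t + - ((\<beta> - \<nu>) * x u)) at_bot at_top"
   by (simp only: filterlim_tendsto_add_at_bot_iff[OF tendsto_const])
  then have "((\<lambda>u. exp (\<beta> * x t + - ((\<beta> - \<nu>) * x u))) \<longlongrightarrow> 0) at_top"
   by (rule filterlim_compose[OF exp_at_bot])
  then show ?thesis using tendsto_mult_left_zero[OF tendsto_mult_right_zero] by fastforce
 qed
 have "norm (P t (d t)) \<le> 0"
 proof (rule tendsto_lowerbound[OF c1])
  have "\<forall>\<^sub>F s in at_bot. x s \<le> 0" using x_bot by (simp add: filterlim_at_bot)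
  then show "\<forall>\<^sub>F s in at_bot. norm (P t (d t)) \<le> K * exp (- \<alpha> * x t + (\<alpha> - \<theta>) * x s) * B"
   using eventually_le_at_bot[of t]
  proof eventually_elim
   case (elim s)
   have "P t (d t) = TT t s (P s (d s))" using d[OF elim(2)] TT_P[OF elim(2) C] by simp
   then have "norm (P t (d t)) \<le> K * exp (- \<alpha> * (x t - x s) + \<theta> * \<bar>x s\<bar>) * norm (d s)"
    using TT_P_bound[OF elim(2) C[of s]] by simp
   also have "\<dots> \<le> K * exp (- \<alpha> * (x t - x s) + \<theta> * \<bar>x s\<bar>) * B" using signs B by (intro mult_left_mono) auto
   also have "- \<alpha> * (x t - x s) + \<theta> * \<bar>x s\<bar> = - \<alpha> * x t + (\<alpha> - \<theta>) * x s" using elim(1) by (simp add: algebra_simps)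
   finally show ?case .
  qed
 qed simp
 moreover have "norm (QQ t (d t)) \<le> 0"
 proof (rule tendsto_lowerbound[OF c2])
  have "\<forall>\<^sub>F u in at_top. 0 \<le> x u" using x_top by (simp add: filterlim_at_top)
  then show "\<forall>\<^sub>F u in at_top. norm (QQ t (d t)) \<le> K * exp (\<beta> * x t - (\<beta> - \<nu>) * x u) * B"
   using eventually_ge_at_top[of t]
  proof eventually_elim
   case (elim u)
   have "QQ t (d t) = orb t u (QQ u (d u))" using d[OF elim(2)] orb_QQ_TT[OF elim(2) C, of t t] by (simp add: orb_self QQ_in_UU C)
   then have "norm (QQ t (d t)) \<le> K * exp (\<beta> * (x t - x u) + \<nu> * \<bar>x u\<bar>) * norm (d u)"
    using Q_bound[OF elim(2) C[of u]] by simp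
   also have "\<dots> \<le> K * exp (\<beta> * (x t - x u) + \<nu> * \<bar>x u\<bar>) * B" using signs B by (intro mult_left_mono) auto
   also have "\<beta> * (x t - x u) + \<nu> * \<bar>x u\<bar> = \<beta> * x t - (\<beta> - \<nu>) * x u" using elim(1) by (simp add: algebra_simps)
   finally show ?case .
  qed
 qed simp
 ultimately show ?thesis by (simp add: Q_def)
qed

lemma bsol_unique:
 assumes f: "adm f" and z: "!!s t. s \<le> t ==> z t = W t s (z s) f" and C: "!!t. z t \<in> C r"
  and B: "!!t. norm (z t) \<le> B1" "!!t. norm (bsol f t) \<le> B2"
 shows "z t = bsol f t"
proof -
 note ff = forcing_continuous[OF admD(1)[OF f]]
 have "z t - bsol f t = 0"
 proof (rule bounded_orbit_zero[where B = "B1 + B2" and d = "\<lambda>t. z t - bsol f t"])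
  show "z t - bsol f t = TT t s (z s - bsol f s)" if "s \<le> t" for s t
   using z[OF that] bsol_mild[OF f that] W_split[OF ff, of t s "z s"] W_split[OF ff, of t s "bsol f s"]
   by (simp add: TT_diff)
  show "z t - bsol f t \<in> C r" for t by (intro C_diff C admD(7) f)
  show "norm (z t - bsol f t) \<le> B1 + B2" for t
   using norm_triangle_ineq4[of "z t" "bsol f t"] B(1)[of t] B(2)[of t] by linarith
 qed
 then show ?thesis by simp
qed

end

section \<open>Contractions in weighted spaces of paths\<close>

text \<open>
  The best constant \<open>S\<close> in \<open>u \<le> S * \<rho>\<close> improves itself to \<open>\<kappa> * (S + c)\<close>. An a priori finite constant is needed for \<open>S\<close>
  to exist.
\<close>

lemma weighted_self_improvement:
 fixes u \<rho> :: "real => real"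
 assumes \<rho>: "!!t. 0 < \<rho> t" and u: "!!t. 0 \<le> u t" "!!t. u t \<le> B * \<rho> t"
  and \<kappa>: "0 \<le> \<kappa>" "\<kappa> < 1" and c: "0 \<le> c"
  and improve: "!!B t. 0 \<le> B ==> \<forall>t. u t \<le> B * \<rho> t ==> u t \<le> \<kappa> * (B + c) * \<rho> t"
 shows "u t \<le> \<kappa> * c / (1 - \<kappa>) * \<rho> t"
proof -
 define S where "S = (SUP t. u t / \<rho> t)"
 have bdd: "bdd_above (range (\<lambda>t. u t / \<rho> t))"
  using u(2) \<rho> by (intro bdd_aboveI2[where M = B]) (simp add: divide_le_eq)
 have upper: "u t / \<rho> t \<le> S" for t unfolding S_def by (rule cSUP_upper[OF UNIV_I bdd])
 then have le: "\<forall>t. u t \<le> S * \<rho> t" using \<rho> by (simp add: divide_le_eq)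
 have "0 \<le> u 0 / \<rho> 0" using u(1) \<rho>[of 0] by simp
 then have "0 \<le> S" using upper[of 0] by linarith
 then have "u t / \<rho> t \<le> \<kappa> * (S + c)" for t using improve[OF _ le] \<rho>[of t] by (simp add: divide_le_eq)
 then have "S \<le> \<kappa> * (S + c)" unfolding S_def by (intro cSUP_least) auto
 then have "S \<le> \<kappa> * c / (1 - \<kappa>)" using \<kappa> by (simp add: field_simps)
 then have "S * \<rho> t \<le> \<kappa> * c / (1 - \<kappa>) * \<rho> t" using \<rho>[of t] by (intro mult_right_mono) auto
 then show ?thesis using le by (meson order_trans)
qed

lemma min_one_le_powr:
 fixes u p :: real
 assumes "0 \<le> u" "0 < p" "p \<le> 1"
 shows "min 1 u \<le> u powr p"
proof (cases "u \<le> 1")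
 case True
 show ?thesis
 proof (cases "u = 0")
  case False
  then have "u powr 1 \<le> u powr p" using True assms powr_mono'[of p 1 u] by simp
  then show ?thesis using True assms False by simp
 qed simp
next
 case False
 then show ?thesis using assms ge_one_powr_ge_zero[of u p] by simp
qed

lemma small_powr_ball:
 fixes B p e :: real
 assumes "0 < p" "0 < e"
 shows "\<exists>d>0. \<forall>u. 0 \<le> u --> u < d --> B * u powr p \<le> e"
proof (intro exI conjI allI impI)
 let ?q = "e / (\<bar>B\<bar> + 1)"
 have q: "0 < ?q" using assms by (simp add: add_nonneg_pos)
 show "0 < ?q powr (1 / p)" using q by (metis powr_gt_zero less_irrefl)
 fix u :: real assume u: "0 \<le> u" "u < ?q powr (1 / p)"
 have "u powr p \<le> (?q powr (1 / p)) powr p" using u assms by (intro powr_mono2) auto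
 also have "\<dots> = ?q" using q assms by (simp add: powr_powr)
 finally have "(\<bar>B\<bar> + 1) * u powr p \<le> e" by (simp add: field_simps add_nonneg_pos)
 moreover have "B * u powr p \<le> (\<bar>B\<bar> + 1) * u powr p" by (intro mult_right_mono) auto
 ultimately show "B * u powr p \<le> e" by linarith
qed

text \<open>
  A bounded linear map on \<open>W\<close> is extended to the whole space by the retraction \<open>pr\<close>, as \<^const>\<open>has_derivative\<close> requires.
\<close>

lemma C1_on_of_holder_expansion:
 fixes N :: "'a::real_normed_vector => 'b::real_normed_vector"
 assumes W: "subspace W" and pr: "bounded_linear pr" "!!w. pr w \<in> W" "!!w. w \<in> W ==> pr w = w"
  and A: "bounded_linear A" and f: "!!b. b \<in> W ==> f b = A b + N b" and p: "0 < p"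
  and linear: "!!b c d u v. b \<in> W ==> c \<in> W ==> d \<in> W ==> N' b (u *\<^sub>R c + v *\<^sub>R d) = u *\<^sub>R N' b c + v *\<^sub>R N' b d"
  and bound: "!!b c. b \<in> W ==> c \<in> W ==> norm (N' b c) \<le> B * norm c"
  and remainder: "!!b c. b \<in> W ==> c \<in> W ==> norm (N (b + c) - N b - N' b c) \<le> B * (norm c powr p * norm c)"
  and holder: "!!b b' c. b \<in> W ==> b' \<in> W ==> c \<in> W ==> norm (N' b c - N' b' c) \<le> B * (norm (b - b') powr p * norm c)"
 shows "C1_on W W f"
 unfolding C1_on_def
proof (intro exI[of _ "\<lambda>b v. A v + N' b (pr v)"] conjI ballI allI impI)
 let ?f' = "\<lambda>b v. A v + N' b (pr v)"
 fix b e assume b: "b \<in> W" and e: "(0::real) < e"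
 obtain d where d: "0 < d" "!!u. 0 \<le> u ==> u < d ==> B * u powr p \<le> e" using small_powr_ball[OF p e] by blast
 show "\<exists>d>0. \<forall>y\<in>W. dist y b < d --> (\<forall>v\<in>W. norm (?f' y v - ?f' b v) \<le> e * norm v)"
 proof (intro exI conjI ballI impI)
  fix y v assume y: "y \<in> W" "dist y b < d" and v: "v \<in> W"
  have "norm (N' y v - N' b v) \<le> (B * norm (y - b) powr p) * norm v" using holder[OF y(1) b v] by (simp add: mult_ac)
  also have "\<dots> \<le> e * norm v" using d(2)[of "norm (y - b)"] y(2) by (intro mult_right_mono) (auto simp: dist_norm)
  finally show "norm (?f' y v - ?f' b v) \<le> e * norm v" by (simp add: pr(3)[OF v])
 qed (rule d(1))
next
 let ?f' = "\<lambda>b v. A v + N' b (pr v)"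
 fix b assume b: "b \<in> W"
 interpret A: bounded_linear A by (rule A)
 interpret pr: bounded_linear pr by (rule pr)
 obtain k where k: "!!v. norm (pr v) \<le> norm v * k" using pr.bounded by blast
 have "bounded_linear (\<lambda>v. N' b (pr v))"
 proof (rule bounded_linear_intro)
  show "N' b (pr (u + v)) = N' b (pr u) + N' b (pr v)" for u v
   using linear[OF b pr(2,2), of 1 u 1 v] by (simp add: pr.add)
  show "N' b (pr (c *\<^sub>R u)) = c *\<^sub>R N' b (pr u)" for c u
   using linear[OF b pr(2,2), of c u 0 u] by (simp add: pr.scaleR)
  show "norm (N' b (pr v)) \<le> norm v * (\<bar>B\<bar> * k)" for v
  proof -
   have "norm (N' b (pr v)) \<le> \<bar>B\<bar> * norm (pr v)"
    using bound[OF b pr(2), of v] mult_right_mono[OF abs_ge_self[of B] norm_ge_zero[of "pr v"]] by linarith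
   also have "\<dots> \<le> \<bar>B\<bar> * (norm v * k)" using k by (intro mult_left_mono) auto
   finally show ?thesis by (simp add: mult_ac)
  qed
 qed
 then have bl: "bounded_linear (?f' b)" by (intro bounded_linear_add A)
 show "(f has_derivative ?f' b) (at b within W)"
  unfolding has_derivative_within_alt
 proof (intro conjI bl allI impI)
  fix e :: real assume e: "0 < e"
  obtain d where d: "0 < d" "!!u. 0 \<le> u ==> u < d ==> B * u powr p \<le> e" using small_powr_ball[OF p e] by blast
  show "\<exists>d>0. \<forall>y\<in>W. norm (y - b) < d --> norm (f y - f b - ?f' b (y - b)) \<le> e * norm (y - b)"
  proof (intro exI conjI ballI impI)
   fix y assume y: "y \<in> W" "norm (y - b) < d"
   have c: "y - b \<in> W" using subspace_diff[OF W y(1) b] .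
   have "norm (N (b + (y - b)) - N b - N' b (y - b)) \<le> (B * norm (y - b) powr p) * norm (y - b)"
    using remainder[OF b c] by (simp add: mult_ac)
   also have "\<dots> \<le> e * norm (y - b)" using d(2)[of "norm (y - b)"] y(2) by (intro mult_right_mono) auto
   finally show "norm (f y - f b - ?f' b (y - b)) \<le> e * norm (y - b)"
    by (simp add: f y(1) b pr(3)[OF c] A.diff algebra_simps)
  qed (rule d(1))
 qed
qed

text \<open>
  \<open>G\<close> stands for the solution operator of the forced linear equation. It contracts in the weighted supremum norm
  of every admissible weight, relative to forcing terms bounded by \<open>k\<close> times the weight. Working with several
  weights at once is the point: a map into one weighted space is differentiable only into a larger one.
\<close>

locale weighted_problem =
 fixes E :: "'e::{real_normed_vector, complete_space} set"
  and g :: "real => 'e => 'f::real_normed_vector" and Dg :: "real => 'e => 'e => 'f"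
  and k :: "real => real" and \<Lambda> \<kappa> :: real
  and G :: "(real => 'f) => real => 'e" and weights :: "(real => real) set"
 assumes subspace_E: "subspace E" and closed_E: "closed E"
  and g_path: "continuous_on UNIV y ==> (!!t. y t \<in> E) ==> continuous_on UNIV (\<lambda>t. g t (y t))"
  and Dg_path: "continuous_on UNIV y ==> (!!t. y t \<in> E) ==> continuous_on UNIV w ==> (!!t. w t \<in> E) ==>
   continuous_on UNIV (\<lambda>t. Dg t (y t) (w t))"
  and g_lip: "\<phi> \<in> E ==> \<psi> \<in> E ==> norm (g t \<phi> - g t \<psi>) \<le> k t * norm (\<phi> - \<psi>)"
  and g_zero: "g t 0 = 0"
  and g_deriv: "\<phi> \<in> E ==> (g t has_derivative Dg t \<phi>) (at \<phi> within E)"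
  and Dg_bound: "\<phi> \<in> E ==> v \<in> E ==> norm (Dg t \<phi> v) \<le> k t * norm v"
  and Dg_lip: "\<phi> \<in> E ==> \<psi> \<in> E ==> v \<in> E ==>
   norm (Dg t \<phi> v - Dg t \<psi> v) \<le> \<Lambda> * k t * (min 1 (norm (\<phi> - \<psi>)) * norm v)"
  and k_nonneg: "0 \<le> k t" and \<Lambda>_nonneg: "0 \<le> \<Lambda>"
  and \<kappa>: "0 \<le> \<kappa>" "\<kappa> < 1"
  and weight_cont: "\<rho> \<in> weights ==> continuous_on UNIV \<rho>" and weight_pos: "\<rho> \<in> weights ==> 0 < \<rho> t"
  and G_maps: "\<rho> \<in> weights ==> continuous_on UNIV f ==> 0 \<le> c ==> (!!t. norm (f t) \<le> c * (k t * \<rho> t)) ==>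
   continuous_on UNIV (G f) \<and> (\<forall>t. G f t \<in> E \<and> norm (G f t) \<le> \<kappa> * c * \<rho> t)"
  and G_combine: "\<rho> \<in> weights ==> continuous_on UNIV f ==> continuous_on UNIV h ==> 0 \<le> c ==>
   (!!t. norm (f t) \<le> c * (k t * \<rho> t)) ==> (!!t. norm (h t) \<le> c * (k t * \<rho> t)) ==>
   G (\<lambda>t. c1 *\<^sub>R f t + c2 *\<^sub>R h t) t = c1 *\<^sub>R G f t + c2 *\<^sub>R G h t"
begin

definition wpath :: "(real => real) => (real => 'e) => bool" where
 "wpath \<rho> X \<longleftrightarrow> continuous_on UNIV X \<and> (\<forall>t. X t \<in> E) \<and> (\<exists>B\<ge>0. \<forall>t. norm (X t) \<le> B * \<rho> t)"

definition tame :: "(real => real) => (real => 'f) => bool" where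
 "tame \<rho> f \<longleftrightarrow> continuous_on UNIV f \<and> (\<exists>c\<ge>0. \<forall>t. norm (f t) \<le> c * (k t * \<rho> t))"

lemma wpathD: "wpath \<rho> X ==> continuous_on UNIV X" "wpath \<rho> X ==> X t \<in> E"
 by (auto simp: wpath_def)

lemma wpath_combine:
 assumes "wpath \<rho> X" "wpath \<rho> Y"
 shows "wpath \<rho> (\<lambda>t. u *\<^sub>R X t + v *\<^sub>R Y t)"
proof -
 obtain A B where AB: "0 \<le> A" "0 \<le> B" "!!t. norm (X t) \<le> A * \<rho> t" "!!t. norm (Y t) \<le> B * \<rho> t" using assms unfolding wpath_def by blast
 have "norm (u *\<^sub>R X t + v *\<^sub>R Y t) \<le> (\<bar>u\<bar> * A + \<bar>v\<bar> * B) * \<rho> t" for t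
 proof -
  have "norm (u *\<^sub>R X t + v *\<^sub>R Y t) \<le> \<bar>u\<bar> * norm (X t) + \<bar>v\<bar> * norm (Y t)" by (rule order_trans[OF norm_triangle_ineq]) simp
  also have "\<dots> \<le> \<bar>u\<bar> * (A * \<rho> t) + \<bar>v\<bar> * (B * \<rho> t)" by (intro add_mono mult_left_mono AB) auto
  finally show ?thesis by (simp add: algebra_simps)
 qed
 moreover have "0 \<le> \<bar>u\<bar> * A + \<bar>v\<bar> * B" using AB by simp
 moreover have "continuous_on UNIV (\<lambda>t. u *\<^sub>R X t + v *\<^sub>R Y t)" by (intro continuous_intros wpathD(1)[OF assms(1)] wpathD(1)[OF assms(2)])
 moreover have "u *\<^sub>R X t + v *\<^sub>R Y t \<in> E" for t
  by (intro subspace_add[OF subspace_E] subspace_scale[OF subspace_E] wpathD(2)[OF assms(1)] wpathD(2)[OF assms(2)])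
 ultimately show ?thesis unfolding wpath_def by blast
qed

lemma wpath_add: "wpath \<rho> X ==> wpath \<rho> Y ==> wpath \<rho> (\<lambda>t. X t + Y t)"
 using wpath_combine[of \<rho> X Y 1 1] by simp

lemma wpath_diff_bound:
 assumes "wpath \<rho> X" "wpath \<rho> Y"
 shows "\<exists>B. \<forall>t. norm (X t - Y t) \<le> B * \<rho> t"
 using wpath_combine[OF assms, of 1 "-1"] unfolding wpath_def by auto

lemma k\<rho>_nonneg: "\<rho> \<in> weights ==> 0 \<le> k t * \<rho> t" using k_nonneg weight_pos[of \<rho> t] by simp

lemma tame_G:
 assumes "\<rho> \<in> weights" "tame \<rho> f"
 shows "wpath \<rho> (G f)"
proof -
 obtain c where c: "0 \<le> c" "!!t. norm (f t) \<le> c * (k t * \<rho> t)" "continuous_on UNIV f" using assms unfolding tame_def by blast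
 then show ?thesis using G_maps[OF assms(1) c(3,1,2)] \<kappa> unfolding wpath_def by (meson mult_nonneg_nonneg)
qed

lemma tame_common:
 assumes \<rho>: "\<rho> \<in> weights" and "tame \<rho> f" "tame \<rho> h"
 shows "\<exists>c\<ge>0. (\<forall>t. norm (f t) \<le> c * (k t * \<rho> t)) \<and> (\<forall>t. norm (h t) \<le> c * (k t * \<rho> t))"
proof -
 obtain c d where c: "0 \<le> c" "0 \<le> d" "!!t. norm (f t) \<le> c * (k t * \<rho> t)" "!!t. norm (h t) \<le> d * (k t * \<rho> t)"
  using assms unfolding tame_def by blast
 have "c * (k t * \<rho> t) \<le> (c + d) * (k t * \<rho> t)" "d * (k t * \<rho> t) \<le> (c + d) * (k t * \<rho> t)" for t
  using c k\<rho>_nonneg[OF \<rho>] by (intro mult_right_mono; simp)+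
 then show ?thesis using c by (intro exI[of _ "c + d"]) (meson add_nonneg_nonneg order_trans)
qed

lemma tame_combine:
 assumes \<rho>: "\<rho> \<in> weights" and f: "tame \<rho> f" and h: "tame \<rho> h"
 shows "tame \<rho> (\<lambda>t. u *\<^sub>R f t + v *\<^sub>R h t)" "G (\<lambda>t. u *\<^sub>R f t + v *\<^sub>R h t) t = u *\<^sub>R G f t + v *\<^sub>R G h t"
proof -
 obtain c where c: "0 \<le> c" "!!t. norm (f t) \<le> c * (k t * \<rho> t)" "!!t. norm (h t) \<le> c * (k t * \<rho> t)"
  using tame_common[OF assms] by blast
 have cf: "continuous_on UNIV f" "continuous_on UNIV h" using f h by (auto simp: tame_def)
 show "G (\<lambda>t. u *\<^sub>R f t + v *\<^sub>R h t) t = u *\<^sub>R G f t + v *\<^sub>R G h t" by (rule G_combine[OF \<rho> cf c])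
 have "norm (u *\<^sub>R f t + v *\<^sub>R h t) \<le> (\<bar>u\<bar> * c + \<bar>v\<bar> * c) * (k t * \<rho> t)" for t
 proof -
  have "norm (u *\<^sub>R f t + v *\<^sub>R h t) \<le> \<bar>u\<bar> * norm (f t) + \<bar>v\<bar> * norm (h t)" by (rule order_trans[OF norm_triangle_ineq]) simp
  also have "\<dots> \<le> \<bar>u\<bar> * (c * (k t * \<rho> t)) + \<bar>v\<bar> * (c * (k t * \<rho> t))" by (intro add_mono mult_left_mono c) auto
  finally show ?thesis by (simp add: algebra_simps)
 qed
 moreover have "0 \<le> \<bar>u\<bar> * c + \<bar>v\<bar> * c" using c by simp
 moreover have "continuous_on UNIV (\<lambda>t. u *\<^sub>R f t + v *\<^sub>R h t)" by (intro continuous_intros cf)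
 ultimately show "tame \<rho> (\<lambda>t. u *\<^sub>R f t + v *\<^sub>R h t)" unfolding tame_def by blast
qed

lemma G_diff_bound:
 assumes \<rho>: "\<rho> \<in> weights" and f: "tame \<rho> f" and h: "tame \<rho> h" and "0 \<le> c"
  and d: "!!t. norm (f t - h t) \<le> c * (k t * \<rho> t)"
 shows "norm (G f t - G h t) \<le> \<kappa> * c * \<rho> t"
proof -
 have "continuous_on UNIV (\<lambda>t. 1 *\<^sub>R f t + (-1) *\<^sub>R h t)" using f h by (intro continuous_intros) (auto simp: tame_def)
 moreover have "norm (1 *\<^sub>R f t + (-1) *\<^sub>R h t) \<le> c * (k t * \<rho> t)" for t using d[of t] by simp
 ultimately have "norm (G (\<lambda>t. 1 *\<^sub>R f t + (-1) *\<^sub>R h t) t) \<le> \<kappa> * c * \<rho> t" using G_maps[OF \<rho> _ \<open>0 \<le> c\<close>] by blast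
 then show ?thesis unfolding tame_combine(2)[OF \<rho> f h] by simp
qed

text \<open>
  All later estimates are instances: Lipschitz dependence (\<open>c\<close> is the distance of the data), uniqueness and linearity
  (\<open>c = 0\<close>), remainders and continuity of derivatives (with the larger weight).
\<close>

lemma comparison:
 assumes \<rho>: "\<rho> \<in> weights" and f: "tame \<rho> f" "tame \<rho> f'" and z: "!!t. z t = G f t" "!!t. z' t = G f' t" and c: "0 \<le> c"
  and d: "!!t. norm (f t - f' t) \<le> k t * (norm (z t - z' t) + c * \<rho> t)"
 shows "norm (z t - z' t) \<le> \<kappa> * c / (1 - \<kappa>) * \<rho> t"
proof -
 have zG: "z = G f" "z' = G f'" using z by auto
 obtain B where B: "!!t. norm (z t - z' t) \<le> B * \<rho> t"
  using wpath_diff_bound[OF tame_G[OF \<rho> f(1)] tame_G[OF \<rho> f(2)]] unfolding zG by blast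
 show ?thesis
 proof (rule weighted_self_improvement[where u = "\<lambda>t. norm (z t - z' t)" and B = B, OF weight_pos[OF \<rho>] norm_ge_zero B \<kappa> c])
  fix B t assume B: "0 \<le> B" "\<forall>t. norm (z t - z' t) \<le> B * \<rho> t"
  have "norm (f t - f' t) \<le> (B + c) * (k t * \<rho> t)" for t
  proof -
   have "k t * (norm (z t - z' t) + c * \<rho> t) \<le> k t * (B * \<rho> t + c * \<rho> t)" using B k_nonneg by (intro mult_left_mono) auto
   then show ?thesis using d[of t] by (simp add: algebra_simps)
  qed
  then show "norm (z t - z' t) \<le> \<kappa> * (B + c) * \<rho> t" unfolding z using B(1) c by (intro G_diff_bound[OF \<rho> f]) auto
 qed
qed

text \<open>
  The contraction principle for \<open>z = G (\<lambda>t. h t (z t))\<close>, applied to \<open>z / \<rho>\<close> in the space of bounded continuous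
  functions.
\<close>

lemma fixed_point_exists:
 assumes \<rho>: "\<rho> \<in> weights" and c: "0 \<le> c"
  and h_path: "!!z. wpath \<rho> z ==> continuous_on UNIV (\<lambda>t. h t (z t))"
  and h_lip: "!!t \<phi> \<psi>. \<phi> \<in> E ==> \<psi> \<in> E ==> norm (h t \<phi> - h t \<psi>) \<le> k t * norm (\<phi> - \<psi>)"
  and h0: "!!t. norm (h t 0) \<le> c * (k t * \<rho> t)"
 shows "\<exists>z. wpath \<rho> z \<and> tame \<rho> (\<lambda>t. h t (z t)) \<and> (\<forall>t. z t = G (\<lambda>t. h t (z t)) t)"
proof -
 note pos = weight_pos[OF \<rho>]
 note cont = weight_cont[OF \<rho>]
 define S :: "(real \<Rightarrow>\<^sub>C 'e) set" where "S = {y. \<forall>t. apply_bcontfun y t \<in> E}"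
 define H where "H y = G (\<lambda>t. h t (\<rho> t *\<^sub>R apply_bcontfun y t))" for y
 define \<Psi> where "\<Psi> y = Bcontfun (\<lambda>t. (1 / \<rho> t) *\<^sub>R H y t)" for y
 have path: "wpath \<rho> (\<lambda>t. \<rho> t *\<^sub>R apply_bcontfun y t)" if "y \<in> S" for y
  unfolding wpath_def
 proof (intro conjI allI exI[of _ "norm y"])
  show "continuous_on UNIV (\<lambda>t. \<rho> t *\<^sub>R apply_bcontfun y t)" by (intro continuous_intros cont) simp
  show "\<rho> t *\<^sub>R apply_bcontfun y t \<in> E" for t using that subspace_scale[OF subspace_E] by (simp add: S_def)
  show "norm (\<rho> t *\<^sub>R apply_bcontfun y t) \<le> norm y * \<rho> t" for t
   using mult_right_mono[OF norm_bounded[of y t], of "\<rho> t"] pos[of t] by (simp add: mult_ac)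
 qed simp
 have tame: "tame \<rho> (\<lambda>t. h t (z t))" if z: "wpath \<rho> z" for z
 proof -
  obtain B where B: "0 \<le> B" "!!t. norm (z t) \<le> B * \<rho> t" using z unfolding wpath_def by blast
  have "norm (h t (z t)) \<le> (B + c) * (k t * \<rho> t)" for t
  proof -
   have "norm (h t (z t)) \<le> norm (h t (z t) - h t 0) + norm (h t 0)" using norm_triangle_ineq[of "h t (z t) - h t 0" "h t 0"] by simp
   also have "\<dots> \<le> k t * norm (z t - 0) + c * (k t * \<rho> t)"
    by (intro add_mono h_lip h0 wpathD(2)[OF z] subspace_0[OF subspace_E])
   also have "\<dots> \<le> k t * (B * \<rho> t) + c * (k t * \<rho> t)" using B(2)[of t] k_nonneg by (intro add_right_mono mult_left_mono) auto
   finally show ?thesis by (simp add: algebra_simps)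
  qed
  then show ?thesis unfolding tame_def using h_path[OF z] B(1) c by (intro conjI exI[of _ "B + c"]) auto
 qed
 have HW: "wpath \<rho> (H y)" if "y \<in> S" for y unfolding H_def by (rule tame_G[OF \<rho> tame[OF path[OF that]]])
 have \<Psi>: "apply_bcontfun (\<Psi> y) t = (1 / \<rho> t) *\<^sub>R H y t" if y: "y \<in> S" for y t
 proof -
  obtain B where B: "!!t. norm (H y t) \<le> B * \<rho> t" using HW[OF y] unfolding wpath_def by blast
  have "(\<lambda>t. (1 / \<rho> t) *\<^sub>R H y t) \<in> bcontfun"
  proof (rule bcontfun_normI)
   show "continuous_on UNIV (\<lambda>t. (1 / \<rho> t) *\<^sub>R H y t)"
    using pos by (intro continuous_intros cont wpathD(1)[OF HW[OF y]]) (auto simp: less_imp_neq[symmetric])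
   show "norm ((1 / \<rho> t) *\<^sub>R H y t) \<le> B" for t using B[of t] pos[of t] by (simp add: divide_le_eq)
  qed
  then show ?thesis unfolding \<Psi>_def by (simp add: Bcontfun_inverse)
 qed
 have "\<exists>!y\<in>S. \<Psi> y = y"
 proof (rule Banach_fix)
  have "closed S"
  proof (rule closed_sequential_limits[THEN iffD2, rule_format])
   fix y :: "nat => real \<Rightarrow>\<^sub>C 'e" and l assume y: "(\<forall>n. y n \<in> S) \<and> y \<longlonglongrightarrow> l"
   have "apply_bcontfun l t \<in> E" for t
   proof -
    have "(\<lambda>n. apply_bcontfun (y n) t) \<longlonglongrightarrow> apply_bcontfun l t"
     unfolding tendsto_iff
    proof (intro allI impI)
     fix e :: real assume "0 < e"
     then have "\<forall>\<^sub>F n in sequentially. dist (y n) l < e" using y tendstoD by blast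
     then show "\<forall>\<^sub>F n in sequentially. dist (apply_bcontfun (y n) t) (apply_bcontfun l t) < e"
      by eventually_elim (meson dist_bounded order_le_less_trans)
    qed
    then show ?thesis by (rule closed_sequentially[OF closed_E, rotated]) (use y in \<open>simp add: S_def\<close>)
   qed
   then show "l \<in> S" by (simp add: S_def)
  qed
  then show "complete S" by (simp add: complete_eq_closed)
  have "0 \<in> S" by (simp add: S_def subspace_0[OF subspace_E])
  then show "S \<noteq> {}" by blast
  show "0 \<le> \<kappa>" "\<kappa> < 1" by (fact \<kappa>)+
  show "\<Psi> ` S \<subseteq> S" using \<Psi> wpathD(2)[OF HW] subspace_scale[OF subspace_E] by (auto simp: S_def)
  show "dist (\<Psi> y) (\<Psi> y') \<le> \<kappa> * dist y y'" if y: "y \<in> S" "y' \<in> S" for y y'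
  proof (rule dist_bound)
   fix t
   have "norm (H y t - H y' t) \<le> \<kappa> * norm (y - y') * \<rho> t"
    unfolding H_def
   proof (rule G_diff_bound[OF \<rho> tame[OF path[OF y(1)]] tame[OF path[OF y(2)]] norm_ge_zero])
    fix t
    have "norm (h t (\<rho> t *\<^sub>R apply_bcontfun y t) - h t (\<rho> t *\<^sub>R apply_bcontfun y' t)) \<le>
      k t * norm (\<rho> t *\<^sub>R apply_bcontfun y t - \<rho> t *\<^sub>R apply_bcontfun y' t)"
     by (rule h_lip[OF wpathD(2)[OF path[OF y(1)]] wpathD(2)[OF path[OF y(2)]]])
    also have "\<dots> = k t * \<rho> t * norm (apply_bcontfun (y - y') t)"
     using pos[of t] by (simp add: scaleR_diff_right[symmetric] mult.assoc)
    also have "\<dots> \<le> k t * \<rho> t * norm (y - y')" by (intro mult_left_mono norm_bounded k\<rho>_nonneg[OF \<rho>])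
    finally show "norm (h t (\<rho> t *\<^sub>R apply_bcontfun y t) - h t (\<rho> t *\<^sub>R apply_bcontfun y' t)) \<le> norm (y - y') * (k t * \<rho> t)"
     by (simp add: mult_ac)
   qed
   then have "(1 / \<rho> t) * norm (H y t - H y' t) \<le> \<kappa> * norm (y - y')" using pos[of t] by (simp add: divide_le_eq)
   moreover have "norm ((1 / \<rho> t) *\<^sub>R (H y t - H y' t)) = (1 / \<rho> t) * norm (H y t - H y' t)" using pos[of t] by simp
   ultimately show "dist (apply_bcontfun (\<Psi> y) t) (apply_bcontfun (\<Psi> y') t) \<le> \<kappa> * dist y y'"
    unfolding \<Psi>[OF y(1)] \<Psi>[OF y(2)] dist_norm scaleR_diff_right[symmetric] by linarith
  qed
 qed
 then obtain y where y: "y \<in> S" "\<Psi> y = y" by blast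
 have "\<forall>t. \<rho> t *\<^sub>R apply_bcontfun y t = H y t" using \<Psi>[OF y(1)] pos unfolding y(2) by (simp add: less_imp_neq[symmetric])
 then show ?thesis
  unfolding H_def by (intro exI[of _ "\<lambda>t. \<rho> t *\<^sub>R apply_bcontfun y t"] conjI path[OF y(1)] tame[OF path[OF y(1)]])
qed

definition fp :: "(real => real) => (real => 'e => 'f) => real => 'e" where
 "fp \<rho> h = (SOME z. wpath \<rho> z \<and> tame \<rho> (\<lambda>t. h t (z t)) \<and> (\<forall>t. z t = G (\<lambda>t. h t (z t)) t))"

definition shifted :: "(real => 'e) => real => 'e => 'f" where
 "shifted X t \<phi> = g t (X t + \<phi>)"

definition linearized :: "(real => 'e) => (real => 'e) => real => 'e => 'f" where
 "linearized y X t \<phi> = Dg t (y t) (X t + \<phi>)"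

lemma Dg_linear:
 assumes "\<phi> \<in> E"
 shows "Dg t \<phi> (u *\<^sub>R v + u' *\<^sub>R v') = u *\<^sub>R Dg t \<phi> v + u' *\<^sub>R Dg t \<phi> v'"
proof -
 interpret bounded_linear "Dg t \<phi>" using g_deriv[OF assms] by (rule has_derivative_bounded_linear)
 show ?thesis by (simp add: add scaleR)
qed

lemma Dg_diff: "\<phi> \<in> E ==> Dg t \<phi> (v - v') = Dg t \<phi> v - Dg t \<phi> v'"
 using Dg_linear[of \<phi> t 1 v "-1" v'] by simp

text \<open>
  The mean value inequality on the segment from \<open>\<phi>\<close> to \<open>\<phi> + h\<close>. It is applied to a function of a real variable since
  the bound on the derivative holds on \<open>E\<close> only, not on the ambient space.
\<close>

lemma taylor_remainder:
 assumes \<phi>: "\<phi> \<in> E" and h: "h \<in> E"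
 shows "norm (g t (\<phi> + h) - g t \<phi> - Dg t \<phi> h) \<le> \<Lambda> * k t * (min 1 (norm h) * norm h)"
proof -
 define F where "F s = g t (\<phi> + s *\<^sub>R h) - s *\<^sub>R Dg t \<phi> h" for s
 have in_E: "\<phi> + s *\<^sub>R h \<in> E" for s by (intro subspace_add[OF subspace_E] subspace_scale[OF subspace_E] \<phi> h)
 have "norm (F 1 - F 0) \<le> \<Lambda> * k t * (min 1 (norm h) * norm h) * norm (1 - 0 :: real)"
 proof (rule differentiable_bound[where S = "{0..1}" and f' = "\<lambda>s u. Dg t (\<phi> + s *\<^sub>R h) (u *\<^sub>R h) - u *\<^sub>R Dg t \<phi> h"])
  fix s :: real assume s: "s \<in> {0..1}"
  have "((\<lambda>s. g t (\<phi> + s *\<^sub>R h)) has_derivative (\<lambda>u. Dg t (\<phi> + s *\<^sub>R h) (u *\<^sub>R h))) (at s within {0..1})"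
  proof (rule has_derivative_in_compose2[where t = E and g' = "Dg t" and f = "\<lambda>s. \<phi> + s *\<^sub>R h" and f' = "\<lambda>u. u *\<^sub>R h", OF g_deriv])
   show "((\<lambda>s. \<phi> + s *\<^sub>R h) has_derivative (\<lambda>u. u *\<^sub>R h)) (at s within {0..1})"
    by (auto intro!: derivative_eq_intros)
  qed (use in_E s in auto)
  then show "(F has_derivative (\<lambda>u. Dg t (\<phi> + s *\<^sub>R h) (u *\<^sub>R h) - u *\<^sub>R Dg t \<phi> h)) (at s within {0..1})"
   unfolding F_def by (auto intro!: derivative_eq_intros)
  show "onorm (\<lambda>u. Dg t (\<phi> + s *\<^sub>R h) (u *\<^sub>R h) - u *\<^sub>R Dg t \<phi> h) \<le> \<Lambda> * k t * (min 1 (norm h) * norm h)"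
  proof (rule onorm_le)
   fix u :: real
   have "Dg t (\<phi> + s *\<^sub>R h) (u *\<^sub>R h) - u *\<^sub>R Dg t \<phi> h = u *\<^sub>R (Dg t (\<phi> + s *\<^sub>R h) h - Dg t \<phi> h)"
    using Dg_linear[OF in_E, of t s u h 0 h] by (simp add: scaleR_diff_right)
   then have "norm (Dg t (\<phi> + s *\<^sub>R h) (u *\<^sub>R h) - u *\<^sub>R Dg t \<phi> h) = \<bar>u\<bar> * norm (Dg t (\<phi> + s *\<^sub>R h) h - Dg t \<phi> h)" by simp
   also have "\<dots> \<le> \<bar>u\<bar> * (\<Lambda> * k t * (min 1 (norm (\<phi> + s *\<^sub>R h - \<phi>)) * norm h))"
    by (intro mult_left_mono Dg_lip in_E \<phi> h) auto
   also have "\<dots> \<le> \<bar>u\<bar> * (\<Lambda> * k t * (min 1 (norm h) * norm h))"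
   proof -
    have "norm (\<phi> + s *\<^sub>R h - \<phi>) \<le> norm h" using s by (simp add: mult_left_le_one_le)
    then show ?thesis using \<Lambda>_nonneg k_nonneg by (intro mult_left_mono mult_right_mono min.mono mult_nonneg_nonneg) auto
   qed
   finally show "norm (Dg t (\<phi> + s *\<^sub>R h) (u *\<^sub>R h) - u *\<^sub>R Dg t \<phi> h) \<le> \<Lambda> * k t * (min 1 (norm h) * norm h) * norm u" by (simp add: mult_ac)
  qed
 qed auto
 moreover have "F 1 - F 0 = g t (\<phi> + h) - g t \<phi> - Dg t \<phi> h" by (simp add: F_def)
 ultimately show ?thesis by simp
qed

lemma fp_shifted:
 assumes \<rho>: "\<rho> \<in> weights" and X: "wpath \<rho> X"
 shows "wpath \<rho> (fp \<rho> (shifted X))" "tame \<rho> (\<lambda>t. g t (X t + fp \<rho> (shifted X) t))"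
  "fp \<rho> (shifted X) t = G (\<lambda>t. g t (X t + fp \<rho> (shifted X) t)) t"
proof -
 obtain B where B: "0 \<le> B" "!!t. norm (X t) \<le> B * \<rho> t" using X unfolding wpath_def by blast
 have "\<exists>z. wpath \<rho> z \<and> tame \<rho> (\<lambda>t. shifted X t (z t)) \<and> (\<forall>t. z t = G (\<lambda>t. shifted X t (z t)) t)"
 proof (rule fixed_point_exists[OF \<rho> B(1)])
  fix z assume "wpath \<rho> z"
  then show "continuous_on UNIV (\<lambda>t. shifted X t (z t))"
   unfolding shifted_def using wpathD[OF wpath_add[OF X]] by (intro g_path) auto
 next
  fix t \<phi> \<psi> assume "\<phi> \<in> E" "\<psi> \<in> E"
  then show "norm (shifted X t \<phi> - shifted X t \<psi>) \<le> k t * norm (\<phi> - \<psi>)"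
   using g_lip[of "X t + \<phi>" "X t + \<psi>" t] wpathD(2)[OF X] by (simp add: shifted_def subspace_add[OF subspace_E])
 next
  fix t
  have "norm (g t (X t) - g t 0) \<le> k t * norm (X t - 0)" by (intro g_lip wpathD(2)[OF X] subspace_0[OF subspace_E])
  also have "\<dots> \<le> k t * (B * \<rho> t)" using B k_nonneg by (intro mult_left_mono) auto
  finally show "norm (shifted X t 0) \<le> B * (k t * \<rho> t)" by (simp add: shifted_def g_zero mult_ac)
 qed
 from someI_ex[OF this] show "wpath \<rho> (fp \<rho> (shifted X))" "tame \<rho> (\<lambda>t. g t (X t + fp \<rho> (shifted X) t))"
  "fp \<rho> (shifted X) t = G (\<lambda>t. g t (X t + fp \<rho> (shifted X) t)) t"
  unfolding fp_def[symmetric] unfolding shifted_def by blast+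
qed

lemma fp_linearized:
 assumes \<rho>: "\<rho> \<in> weights" and y: "wpath \<rho> y" and X: "wpath \<rho> X"
 shows "wpath \<rho> (fp \<rho> (linearized y X))" "tame \<rho> (\<lambda>t. Dg t (y t) (X t + fp \<rho> (linearized y X) t))"
  "fp \<rho> (linearized y X) t = G (\<lambda>t. Dg t (y t) (X t + fp \<rho> (linearized y X) t)) t"
proof -
 obtain B where B: "0 \<le> B" "!!t. norm (X t) \<le> B * \<rho> t" using X unfolding wpath_def by blast
 have "\<exists>z. wpath \<rho> z \<and> tame \<rho> (\<lambda>t. linearized y X t (z t)) \<and> (\<forall>t. z t = G (\<lambda>t. linearized y X t (z t)) t)"
 proof (rule fixed_point_exists[OF \<rho> B(1)])
  fix z assume "wpath \<rho> z"
  then show "continuous_on UNIV (\<lambda>t. linearized y X t (z t))"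
   unfolding linearized_def using wpathD[OF wpath_add[OF X]] by (intro Dg_path wpathD[OF y]) auto
 next
  fix t \<phi> \<psi> assume "\<phi> \<in> E" "\<psi> \<in> E"
  then show "norm (linearized y X t \<phi> - linearized y X t \<psi>) \<le> k t * norm (\<phi> - \<psi>)"
   using Dg_bound[OF wpathD(2)[OF y, of t], of "\<phi> - \<psi>" t] Dg_diff[OF wpathD(2)[OF y, of t], of t "X t + \<phi>" "X t + \<psi>"]
   by (simp add: linearized_def subspace_diff[OF subspace_E])
 next
  fix t
  have "norm (Dg t (y t) (X t)) \<le> k t * norm (X t)" by (intro Dg_bound wpathD(2)[OF X] wpathD(2)[OF y])
  also have "\<dots> \<le> k t * (B * \<rho> t)" using B k_nonneg by (intro mult_left_mono) auto
  finally show "norm (linearized y X t 0) \<le> B * (k t * \<rho> t)" by (simp add: linearized_def mult_ac)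
 qed
 from someI_ex[OF this] show "wpath \<rho> (fp \<rho> (linearized y X))" "tame \<rho> (\<lambda>t. Dg t (y t) (X t + fp \<rho> (linearized y X) t))"
  "fp \<rho> (linearized y X) t = G (\<lambda>t. Dg t (y t) (X t + fp \<rho> (linearized y X) t)) t"
  unfolding fp_def[symmetric] unfolding linearized_def by blast+
qed

lemma tame_g:
 assumes \<rho>: "\<rho> \<in> weights" and y: "wpath \<rho> y"
 shows "tame \<rho> (\<lambda>t. g t (y t))"
proof -
 obtain B where B: "0 \<le> B" "!!t. norm (y t) \<le> B * \<rho> t" using y unfolding wpath_def by blast
 have "norm (g t (y t)) \<le> B * (k t * \<rho> t)" for t
 proof -
  have "norm (g t (y t) - g t 0) \<le> k t * norm (y t - 0)" by (intro g_lip wpathD(2)[OF y] subspace_0[OF subspace_E])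
  also have "\<dots> \<le> k t * (B * \<rho> t)" using B k_nonneg by (intro mult_left_mono) auto
  finally show ?thesis by (simp add: g_zero mult_ac)
 qed
 then show ?thesis unfolding tame_def using B(1) g_path[OF wpathD[OF y]] by blast
qed

lemma fp_shifted_unique:
 assumes \<rho>: "\<rho> \<in> weights" and X: "wpath \<rho> X" and z: "wpath \<rho> z" "!!t. z t = G (\<lambda>t. g t (X t + z t)) t"
 shows "z t = fp \<rho> (shifted X) t"
proof -
 note p = fp_shifted[OF \<rho> X]
 have "norm (z t - fp \<rho> (shifted X) t) \<le> \<kappa> * 0 / (1 - \<kappa>) * \<rho> t"
 proof (rule comparison[OF \<rho> tame_g[OF \<rho> wpath_add[OF X z(1)]] p(2) z(2) p(3)])
  show "norm (g t (X t + z t) - g t (X t + fp \<rho> (shifted X) t)) \<le> k t * (norm (z t - fp \<rho> (shifted X) t) + 0 * \<rho> t)" for t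
   using g_lip[OF wpathD(2)[OF wpath_add[OF X z(1)]] wpathD(2)[OF wpath_add[OF X p(1)]], of t t t] by simp
 qed simp
 then show ?thesis by simp
qed

lemma fp_shifted_lipschitz:
 assumes \<rho>: "\<rho> \<in> weights" and X: "wpath \<rho> X" "wpath \<rho> X'" and c: "0 \<le> c" "!!t. norm (X t - X' t) \<le> c * \<rho> t"
 shows "norm (fp \<rho> (shifted X) t - fp \<rho> (shifted X') t) \<le> \<kappa> * c / (1 - \<kappa>) * \<rho> t"
proof -
 note p = fp_shifted[OF \<rho> X(1)] and p' = fp_shifted[OF \<rho> X(2)]
 show ?thesis
 proof (rule comparison[OF \<rho> p(2) p'(2) p(3) p'(3) c(1)])
  fix t
  let ?z = "fp \<rho> (shifted X) t" and ?z' = "fp \<rho> (shifted X') t"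
  have "norm (g t (X t + ?z) - g t (X' t + ?z')) \<le> k t * norm (X t + ?z - (X' t + ?z'))"
   by (rule g_lip[OF wpathD(2)[OF wpath_add[OF X(1) p(1)]] wpathD(2)[OF wpath_add[OF X(2) p'(1)]]])
  also have "\<dots> \<le> k t * (norm (?z - ?z') + c * \<rho> t)"
   using c(2)[of t] norm_triangle_ineq[of "?z - ?z'" "X t - X' t"] k_nonneg by (intro mult_left_mono) (auto simp: algebra_simps)
  finally show "norm (g t (X t + ?z) - g t (X' t + ?z')) \<le> k t * (norm (?z - ?z') + c * \<rho> t)" .
 qed
qed

end


section \<open>Differentiable dependence on a parameter\<close>

text \<open>
  A linear family of unperturbed paths \<open>X b\<close>, with values in the space of weight \<open>\<rho>\<close>. The weight \<open>\<rho> powr (1 + p)\<close> is dominated by a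
  second admissible weight \<open>\<rho>'\<close>, which leaves room for a remainder of order \<open>1 + p\<close>.
\<close>

locale weighted_family = weighted_problem E g Dg k \<Lambda> \<kappa> G weights
 for E :: "'e::{real_normed_vector, complete_space} set"
  and g :: "real => 'e => 'f::real_normed_vector" and Dg k \<Lambda> \<kappa> G weights +
 fixes W :: "'b::real_normed_vector set" and X :: "'b => real => 'e" and \<rho> \<rho>' :: "real => real" and p CX Cp :: real
 assumes subspace_W: "subspace W"
  and \<rho>: "\<rho> \<in> weights" and \<rho>': "\<rho>' \<in> weights"
  and X_cont: "b \<in> W ==> continuous_on UNIV (X b)" and X_E: "b \<in> W ==> X b t \<in> E"
  and X_bound: "b \<in> W ==> norm (X b t) \<le> CX * norm b * \<rho> t"
  and X_combine: "b \<in> W ==> c \<in> W ==> X (u *\<^sub>R b + v *\<^sub>R c) t = u *\<^sub>R X b t + v *\<^sub>R X c t"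
  and CX: "0 \<le> CX" and p: "0 < p" "p \<le> 1" and Cp: "0 \<le> Cp"
  and \<rho>_le: "\<rho> t \<le> Cp * \<rho>' t" and \<rho>_powr: "\<rho> t powr p * \<rho> t \<le> Cp * \<rho>' t"
begin

abbreviation z :: "'b => real => 'e" where "z b \<equiv> fp \<rho> (shifted (X b))"

text \<open>
  \<open>y b\<close> is the perturbed path, \<open>X c + v b c\<close> the solution of the equation linearized along it, and \<open>force b\<close>,
  \<open>dforce b c\<close> are the corresponding forcing terms.
\<close>

definition y :: "'b => real => 'e" where "y b t = X b t + z b t"

abbreviation v :: "'b => 'b => real => 'e" where "v b c \<equiv> fp \<rho> (linearized (y b) (X c))"

definition force :: "'b => real => 'f" where "force b t = g t (y b t)"

definition dforce :: "'b => 'b => real => 'f" where "dforce b c t = Dg t (y b t) (X c t + v b c t)"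

lemma X_wpath: "b \<in> W ==> wpath \<rho> (X b)"
 unfolding wpath_def using X_cont X_E X_bound CX by (meson mult_nonneg_nonneg norm_ge_zero)

lemma z_props:
 assumes "b \<in> W"
 shows "wpath \<rho> (z b)" "wpath \<rho> (y b)" "tame \<rho> (force b)" "z b t = G (force b) t"
 using fp_shifted[OF \<rho> X_wpath[OF assms]] wpath_add[OF X_wpath[OF assms]] unfolding force_def[abs_def] y_def[abs_def] by blast+

lemma v_props:
 assumes "b \<in> W" "c \<in> W"
 shows "wpath \<rho> (v b c)" "wpath \<rho> (\<lambda>t. X c t + v b c t)" "tame \<rho> (dforce b c)" "v b c t = G (dforce b c) t"
 using fp_linearized[OF \<rho> z_props(2)[OF assms(1)] X_wpath[OF assms(2)]] wpath_add[OF X_wpath[OF assms(2)]]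
 unfolding dforce_def[abs_def] by blast+

lemma X_diff: "b \<in> W ==> c \<in> W ==> X (b - c) t = X b t - X c t"
 using X_combine[of b c 1 "-1" t] by simp

definition Cy :: real where "Cy = CX / (1 - \<kappa>)"

lemma Cy: "0 \<le> Cy" "\<kappa> * (CX * n) / (1 - \<kappa>) + CX * n = Cy * n"
 using CX \<kappa> by (auto simp: Cy_def field_simps)

lemma y_lipschitz:
 assumes b: "b \<in> W" "b' \<in> W"
 shows "norm (y b t - y b' t) \<le> Cy * norm (b - b') * \<rho> t"
proof -
 have Xd: "norm (X b t - X b' t) \<le> CX * norm (b - b') * \<rho> t" for t
  using X_bound[OF subspace_diff[OF subspace_W b]] by (simp add: X_diff b)
 have 1: "norm (z b t - z b' t) \<le> \<kappa> * (CX * norm (b - b')) / (1 - \<kappa>) * \<rho> t"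
  using CX Xd by (intro fp_shifted_lipschitz \<rho> X_wpath b) auto
 have 2: "norm (y b t - y b' t) \<le> norm (X b t - X b' t) + norm (z b t - z b' t)"
  unfolding y_def by (rule norm_diff_triangle_ineq)
 have "norm (y b t - y b' t) \<le> (\<kappa> * (CX * norm (b - b')) / (1 - \<kappa>) + CX * norm (b - b')) * \<rho> t"
  using order_trans[OF 2 add_mono[OF Xd 1]] by (simp only: distrib_right add.commute)
 then show ?thesis unfolding Cy(2) .
qed

lemma G_zero: "G (\<lambda>t. 0) t = 0"
 using tame_combine(2)[OF \<rho> z_props(3) z_props(3), of 0 0 0 0 t] subspace_0[OF subspace_W] by simp

lemma variation_bound:
 assumes b: "b \<in> W" and c: "c \<in> W"
 shows "norm (X c t + v b c t) \<le> Cy * norm c * \<rho> t"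
proof -
 have t0: "tame \<rho> (\<lambda>t. 0)" using tame_combine(1)[OF \<rho> z_props(3) z_props(3), of b b 0 0] b by simp
 have 1: "norm (v b c t - 0) \<le> \<kappa> * (CX * norm c) / (1 - \<kappa>) * \<rho> t"
 proof (rule comparison[OF \<rho> v_props(3)[OF b c] t0 v_props(4)[OF b c]])
  fix t
  have "norm (dforce b c t - 0) \<le> k t * norm (X c t + v b c t)"
   unfolding dforce_def using Dg_bound[OF wpathD(2)[OF z_props(2)[OF b]] wpathD(2)[OF v_props(2)[OF b c]]] by simp
  also have "\<dots> \<le> k t * (norm (v b c t - 0) + CX * norm c * \<rho> t)"
   using X_bound[OF c, of t] norm_triangle_ineq[of "X c t" "v b c t"] k_nonneg by (intro mult_left_mono) auto
  finally show "norm (dforce b c t - 0) \<le> k t * (norm (v b c t - 0) + CX * norm c * \<rho> t)" .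
 qed (use CX G_zero in auto)
 have "norm (X c t + v b c t) \<le> (\<kappa> * (CX * norm c) / (1 - \<kappa>) + CX * norm c) * \<rho> t"
  using order_trans[OF norm_triangle_ineq add_mono[OF X_bound[OF c] 1[unfolded diff_zero]]]
  by (simp only: distrib_right add.commute)
 then show ?thesis unfolding Cy(2) .
qed

lemma variation_linear:
 assumes b: "b \<in> W" and c: "c \<in> W" "c' \<in> W"
 shows "v b (u *\<^sub>R c + u' *\<^sub>R c') t = u *\<^sub>R v b c t + u' *\<^sub>R v b c' t"
  "dforce b (u *\<^sub>R c + u' *\<^sub>R c') t = u *\<^sub>R dforce b c t + u' *\<^sub>R dforce b c' t"
proof -
 let ?d = "u *\<^sub>R c + u' *\<^sub>R c'"
 have d: "?d \<in> W" by (intro subspace_add[OF subspace_W] subspace_scale[OF subspace_W] c)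
 have lin: "u *\<^sub>R dforce b c t + u' *\<^sub>R dforce b c' t = Dg t (y b t) (X ?d t + (u *\<^sub>R v b c t + u' *\<^sub>R v b c' t))" for t
  unfolding dforce_def Dg_linear[OF wpathD(2)[OF z_props(2)[OF b]], symmetric] X_combine[OF c]
  by (simp add: algebra_simps)
 have "norm (v b ?d t - (u *\<^sub>R v b c t + u' *\<^sub>R v b c' t)) \<le> \<kappa> * 0 / (1 - \<kappa>) * \<rho> t" for t
 proof (rule comparison[OF \<rho> v_props(3)[OF b d] tame_combine(1)[OF \<rho> v_props(3)[OF b c(1)] v_props(3)[OF b c(2)]] v_props(4)[OF b d]])
  show "u *\<^sub>R v b c t + u' *\<^sub>R v b c' t = G (\<lambda>t. u *\<^sub>R dforce b c t + u' *\<^sub>R dforce b c' t) t" for t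
   unfolding tame_combine(2)[OF \<rho> v_props(3)[OF b c(1)] v_props(3)[OF b c(2)]]
   using v_props(4)[OF b c(1), of t] v_props(4)[OF b c(2), of t] by metis
  fix t
  let ?w = "u *\<^sub>R v b c t + u' *\<^sub>R v b c' t"
  have "?w \<in> E" by (intro subspace_add[OF subspace_E] subspace_scale[OF subspace_E] wpathD(2)[OF v_props(1)] b c)
  then have "v b ?d t - ?w \<in> E" by (intro subspace_diff[OF subspace_E] wpathD(2)[OF v_props(1)] b d)
  from Dg_bound[OF wpathD(2)[OF z_props(2)[OF b]] this]
  show "norm (dforce b ?d t - (u *\<^sub>R dforce b c t + u' *\<^sub>R dforce b c' t)) \<le> k t * (norm (v b ?d t - ?w) + 0 * \<rho> t)"
   unfolding lin unfolding dforce_def Dg_diff[OF wpathD(2)[OF z_props(2)[OF b]], symmetric] by simp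
 qed simp
 then have eq: "v b ?d t = u *\<^sub>R v b c t + u' *\<^sub>R v b c' t" for t by simp
 show "v b ?d t = u *\<^sub>R v b c t + u' *\<^sub>R v b c' t" by (rule eq)
 show "dforce b ?d t = u *\<^sub>R dforce b c t + u' *\<^sub>R dforce b c' t" unfolding lin unfolding dforce_def eq ..
qed

definition Ch :: real where "Ch = Cy powr p * Cy * Cp"

lemma Ch: "0 \<le> Ch" using Cy Cp by (simp add: Ch_def)

text \<open>
  Interpolation: the bounded modulus of continuity of \<open>Dg\<close> is traded for a power of the distance.
\<close>

lemma holder_step:
 assumes u: "0 \<le> u" "u \<le> Cy * m * \<rho> t" and w: "0 \<le> w" "w \<le> Cy * n * \<rho> t" and mn: "0 \<le> m" "0 \<le> n"
 shows "min 1 u * w \<le> Ch * (m powr p * n) * \<rho>' t"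
proof -
 note pos = weight_pos[OF \<rho>, of t]
 have "min 1 u \<le> u powr p" by (rule min_one_le_powr[OF u(1) p])
 also have "\<dots> \<le> (Cy * m * \<rho> t) powr p" using u p by (intro powr_mono2) auto
 also have "\<dots> = Cy powr p * m powr p * \<rho> t powr p" using Cy mn pos by (simp add: powr_mult)
 finally have "min 1 u * w \<le> (Cy powr p * m powr p * \<rho> t powr p) * (Cy * n * \<rho> t)"
  using w u(1) by (intro mult_mono) auto
 also have "\<dots> = (Cy powr p * Cy * (m powr p * n)) * (\<rho> t powr p * \<rho> t)" by (simp add: mult_ac)
 also have "\<dots> \<le> (Cy powr p * Cy * (m powr p * n)) * (Cp * \<rho>' t)" using Cy mn by (intro mult_left_mono \<rho>_powr) auto
 finally show ?thesis by (simp add: Ch_def mult_ac)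
qed

lemma tame_mono: "tame \<rho> f ==> tame \<rho>' f"
proof -
 assume "tame \<rho> f"
 then obtain c where c: "0 \<le> c" "!!t. norm (f t) \<le> c * (k t * \<rho> t)" "continuous_on UNIV f" unfolding tame_def by blast
 have "norm (f t) \<le> (c * Cp) * (k t * \<rho>' t)" for t
 proof -
  have "c * (k t * \<rho> t) \<le> c * (k t * (Cp * \<rho>' t))" using c k_nonneg by (intro mult_left_mono \<rho>_le) auto
  then show ?thesis using c(2)[of t] by (simp add: mult_ac)
 qed
 then show "tame \<rho>' f" unfolding tame_def using c Cp by (intro conjI exI[of _ "c * Cp"]) auto
qed

text \<open>
  The error \<open>z (b + c) - z b - v b c\<close> solves the linearized equation up to the Taylor remainder of \<open>g\<close>, which is
  small relative to \<open>\<rho>'\<close>.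
\<close>

lemma force_remainder:
 assumes b: "b \<in> W" and c: "c \<in> W"
 shows "norm (force (b + c) t - force b t - dforce b c t) \<le> \<Lambda> * Ch / (1 - \<kappa>) * (norm c powr p * norm c) * (k t * \<rho>' t)"
proof -
 have bc: "b + c \<in> W" by (rule subspace_add[OF subspace_W b c])
 define N where "N = \<Lambda> * Ch * (norm c powr p * norm c)"
 have N0: "0 \<le> N" using \<Lambda>_nonneg Ch by (simp add: N_def)
 let ?u = "\<lambda>t. z (b + c) t - (z b t + v b c t)"
 note yE = wpathD(2)[OF z_props(2)[OF b]] and y'E = wpathD(2)[OF z_props(2)[OF bc]] and vE = wpathD(2)[OF v_props(2)[OF b c]]
 have step: "norm (force (b + c) t - (force b t + dforce b c t)) \<le> k t * (norm (?u t) + N * \<rho>' t)" for t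
 proof -
  let ?h = "y (b + c) t - y b t"
  have hE: "?h \<in> E" by (rule subspace_diff[OF subspace_E y'E yE])
  have h: "norm ?h \<le> Cy * norm c * \<rho> t" using y_lipschitz[OF bc b, of t] by simp
  have hu: "?h - (X c t + v b c t) = ?u t"
   using X_combine[OF b c, of 1 1 t] by (simp add: y_def algebra_simps)
  have "norm (g t (y b t + ?h) - g t (y b t) - Dg t (y b t) ?h) \<le> \<Lambda> * k t * (min 1 (norm ?h) * norm ?h)"
   by (rule taylor_remainder[OF yE hE])
  also have "\<dots> \<le> \<Lambda> * k t * (Ch * (norm c powr p * norm c) * \<rho>' t)"
   using \<Lambda>_nonneg k_nonneg by (intro mult_left_mono holder_step h) auto
  finally have 1: "norm (g t (y (b + c) t) - g t (y b t) - Dg t (y b t) ?h) \<le> k t * (N * \<rho>' t)" by (simp add: N_def mult_ac)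
  have "?u t \<in> E" unfolding hu[symmetric] by (rule subspace_diff[OF subspace_E hE vE])
  from Dg_bound[OF yE this] have 2: "norm (Dg t (y b t) ?h - dforce b c t) \<le> k t * norm (?u t)"
   unfolding hu[symmetric] Dg_diff[OF yE] dforce_def .
  have "force (b + c) t - (force b t + dforce b c t) =
    (g t (y (b + c) t) - g t (y b t) - Dg t (y b t) ?h) + (Dg t (y b t) ?h - dforce b c t)"
   by (simp add: force_def)
  then have "norm (force (b + c) t - (force b t + dforce b c t)) \<le> k t * (N * \<rho>' t) + k t * norm (?u t)"
   using norm_triangle_mono[OF 1 2] by metis
  then show ?thesis by (simp add: algebra_simps)
 qed
 have T: "tame \<rho> (\<lambda>t. force b t + dforce b c t)"
  using tame_combine(1)[OF \<rho> z_props(3)[OF b] v_props(3)[OF b c], of 1 1] by simp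
 have zv: "z b t + v b c t = G (\<lambda>t. force b t + dforce b c t) t" for t
  using tame_combine(2)[OF \<rho> z_props(3)[OF b] v_props(3)[OF b c], of 1 1 t]
  by (simp add: z_props(4)[OF b, of t, symmetric] v_props(4)[OF b c, of t, symmetric])
 have "norm (?u t) \<le> \<kappa> * N / (1 - \<kappa>) * \<rho>' t" for t
  by (rule comparison[OF \<rho>' tame_mono[OF z_props(3)[OF bc]] tame_mono[OF T] z_props(4)[OF bc] zv N0 step])
 then have "norm (?u t) + N * \<rho>' t \<le> (\<kappa> * N / (1 - \<kappa>) + N) * \<rho>' t" by (simp add: distrib_right)
 also have "\<kappa> * N / (1 - \<kappa>) + N = N / (1 - \<kappa>)" using \<kappa> by (simp add: field_simps)
 finally have "k t * (norm (?u t) + N * \<rho>' t) \<le> k t * (N / (1 - \<kappa>) * \<rho>' t)" using k_nonneg by (intro mult_left_mono) auto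
 then have "norm (force (b + c) t - (force b t + dforce b c t)) \<le> k t * (N / (1 - \<kappa>) * \<rho>' t)" using step[of t] by linarith
 then show ?thesis by (simp add: N_def diff_diff_eq mult_ac)
qed

lemma dforce_holder:
 assumes b: "b \<in> W" "b' \<in> W" and c: "c \<in> W"
 shows "norm (dforce b c t - dforce b' c t) \<le> \<Lambda> * Ch / (1 - \<kappa>) * (norm (b - b') powr p * norm c) * (k t * \<rho>' t)"
proof -
 define N where "N = \<Lambda> * Ch * (norm (b - b') powr p * norm c)"
 have N0: "0 \<le> N" using \<Lambda>_nonneg Ch by (simp add: N_def)
 note yE = wpathD(2)[OF z_props(2)[OF b(1)]] and y'E = wpathD(2)[OF z_props(2)[OF b(2)]]
  and vE = wpathD(2)[OF v_props(2)[OF b(1) c]] and v'E = wpathD(2)[OF v_props(2)[OF b(2) c]]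
 have step: "norm (dforce b c t - dforce b' c t) \<le> k t * (norm (v b c t - v b' c t) + N * \<rho>' t)" for t
 proof -
  let ?w = "X c t + v b c t" and ?w' = "X c t + v b' c t"
  have "norm (Dg t (y b t) ?w - Dg t (y b' t) ?w) \<le> \<Lambda> * k t * (min 1 (norm (y b t - y b' t)) * norm ?w)"
   by (rule Dg_lip[OF yE y'E vE])
  also have "\<dots> \<le> \<Lambda> * k t * (Ch * (norm (b - b') powr p * norm c) * \<rho>' t)"
   using \<Lambda>_nonneg k_nonneg by (intro mult_left_mono holder_step y_lipschitz variation_bound b c) auto
  finally have 1: "norm (Dg t (y b t) ?w - Dg t (y b' t) ?w) \<le> k t * (N * \<rho>' t)" by (simp add: N_def mult_ac)
  have 2: "norm (Dg t (y b' t) ?w - Dg t (y b' t) ?w') \<le> k t * norm (v b c t - v b' c t)"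
   using Dg_bound[OF y'E[of t] subspace_diff[OF subspace_E vE[of t] v'E[of t]], of t] unfolding Dg_diff[OF y'E] by simp
  have "dforce b c t - dforce b' c t = (Dg t (y b t) ?w - Dg t (y b' t) ?w) + (Dg t (y b' t) ?w - Dg t (y b' t) ?w')"
   by (simp add: dforce_def)
  then have "norm (dforce b c t - dforce b' c t) \<le> k t * (N * \<rho>' t) + k t * norm (v b c t - v b' c t)"
   using norm_triangle_mono[OF 1 2] by metis
  then show ?thesis by (simp add: algebra_simps)
 qed
 have "norm (v b c t - v b' c t) \<le> \<kappa> * N / (1 - \<kappa>) * \<rho>' t" for t
  by (rule comparison[OF \<rho>' tame_mono[OF v_props(3)[OF b(1) c]] tame_mono[OF v_props(3)[OF b(2) c]]
     v_props(4)[OF b(1) c] v_props(4)[OF b(2) c] N0 step])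
 then have "norm (v b c t - v b' c t) + N * \<rho>' t \<le> (\<kappa> * N / (1 - \<kappa>) + N) * \<rho>' t" by (simp add: distrib_right)
 also have "\<kappa> * N / (1 - \<kappa>) + N = N / (1 - \<kappa>)" using \<kappa> by (simp add: field_simps)
 finally have "k t * (norm (v b c t - v b' c t) + N * \<rho>' t) \<le> k t * (N / (1 - \<kappa>) * \<rho>' t)" using k_nonneg by (intro mult_left_mono) auto
 then have "norm (dforce b c t - dforce b' c t) \<le> k t * (N / (1 - \<kappa>) * \<rho>' t)" using step[of t] by linarith
 then show ?thesis by (simp add: N_def mult_ac)
qed

lemma dforce_bound:
 assumes "b \<in> W" "c \<in> W"
 shows "norm (dforce b c t) \<le> Cy * Cp * norm c * (k t * \<rho>' t)"
proof -
 have "norm (dforce b c t) \<le> k t * norm (X c t + v b c t)"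
  unfolding dforce_def by (rule Dg_bound[OF wpathD(2)[OF z_props(2)] wpathD(2)[OF v_props(2)]]) (use assms in auto)
 also have "\<dots> \<le> k t * (Cy * norm c * (Cp * \<rho>' t))"
  using variation_bound[OF assms, of t] mult_left_mono[OF \<rho>_le[of t], of "Cy * norm c"] Cy k_nonneg by (intro mult_left_mono) auto
 finally show ?thesis by (simp add: mult_ac)
qed

text \<open>
  Any linear observation of the force that is bounded relative to \<open>\<rho>'\<close> depends on \<open>b\<close> in a \<open>C\<^sup>1\<close> way. The observation is
  the value of the solution at one time for the conjugacy, and the unstable part for its inverse.
\<close>

theorem observed_force_C1:
 fixes \<Xi> :: "(real => 'f) => 'h::real_normed_vector"
 assumes pr: "bounded_linear pr" "!!w. pr w \<in> W" "!!w. w \<in> W ==> pr w = w"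
  and A: "bounded_linear A" and f: "!!b. b \<in> W ==> f b = A b + \<Xi> (force b)"
  and \<Xi>_combine: "!!f h c1 c2. tame \<rho>' f ==> tame \<rho>' h ==> \<Xi> (\<lambda>t. c1 *\<^sub>R f t + c2 *\<^sub>R h t) = c1 *\<^sub>R \<Xi> f + c2 *\<^sub>R \<Xi> h"
  and \<Xi>_bound: "!!f c. continuous_on UNIV f ==> 0 \<le> c ==> (!!t. norm (f t) \<le> c * (k t * \<rho>' t)) ==> norm (\<Xi> f) \<le> B * c"
 shows "C1_on W W f"
proof -
 note F = tame_mono[OF z_props(3)] and dF = tame_mono[OF v_props(3)]
 have \<Xi>_diff: "\<Xi> (\<lambda>t. f t - h t) = \<Xi> f - \<Xi> h \<and> tame \<rho>' (\<lambda>t. f t - h t)" if "tame \<rho>' f" "tame \<rho>' h" for f h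
  using \<Xi>_combine[OF that, of 1 "-1"] tame_combine(1)[OF \<rho>' that, of 1 "-1"] by simp
 define Q where "Q = \<Lambda> * Ch / (1 - \<kappa>)"
 have Q0: "0 \<le> Q" using \<Lambda>_nonneg Ch \<kappa> by (simp add: Q_def)
 define S where "S = \<bar>B\<bar> * (Q + Cy * Cp)"
 have S: "B * (Q * n) \<le> S * n" "B * (Cy * Cp * n) \<le> S * n" if "0 \<le> n" for n
 proof -
  have *: "B * (q * n) \<le> S * n" if "0 \<le> q" "q \<le> Q + Cy * Cp" for q
  proof -
   have "B * (q * n) \<le> \<bar>B\<bar> * (q * n)" using that(1) \<open>0 \<le> n\<close> by (intro mult_right_mono) auto
   also have "\<dots> \<le> \<bar>B\<bar> * ((Q + Cy * Cp) * n)" using that \<open>0 \<le> n\<close> by (intro mult_left_mono mult_right_mono) auto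
   finally show ?thesis by (simp add: S_def mult_ac)
  qed
  show "B * (Q * n) \<le> S * n" "B * (Cy * Cp * n) \<le> S * n" using * Q0 Cy Cp by auto
 qed
 show ?thesis
 proof (rule C1_on_of_holder_expansion[where N = "\<lambda>b. \<Xi> (force b)" and N' = "\<lambda>b c. \<Xi> (dforce b c)" and B = S, OF subspace_W pr A f p(1)])
  fix b c assume b: "b \<in> W" and c: "c \<in> W"
  have bc: "b + c \<in> W" by (rule subspace_add[OF subspace_W b c])
  show "norm (\<Xi> (dforce b c)) \<le> S * norm c"
  proof -
   have "norm (\<Xi> (dforce b c)) \<le> B * (Cy * Cp * norm c)"
    using dF[OF b c] dforce_bound[OF b c] Cy Cp by (intro \<Xi>_bound) (auto simp: tame_def)
   then show ?thesis using S(2)[of "norm c"] by simp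
  qed
  have eq: "\<Xi> (\<lambda>t. force (b + c) t - force b t - dforce b c t) = \<Xi> (force (b + c)) - \<Xi> (force b) - \<Xi> (dforce b c)"
   and tm: "tame \<rho>' (\<lambda>t. force (b + c) t - force b t - dforce b c t)"
   using \<Xi>_diff[OF F[OF bc] F[OF b]] \<Xi>_diff[OF _ dF[OF b c], of "\<lambda>t. force (b + c) t - force b t"] by auto
  have "norm (\<Xi> (\<lambda>t. force (b + c) t - force b t - dforce b c t)) \<le> B * (Q * (norm c powr p * norm c))"
   by (intro \<Xi>_bound force_remainder[OF b c, folded Q_def] tm[unfolded tame_def, THEN conjunct1]) (simp add: Q0)
  then show "norm (\<Xi> (force (b + c)) - \<Xi> (force b) - \<Xi> (dforce b c)) \<le> S * (norm c powr p * norm c)"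
   unfolding eq using S(1)[of "norm c powr p * norm c"] by simp
 next
  fix b b' c assume b: "b \<in> W" "b' \<in> W" and c: "c \<in> W"
  note d = \<Xi>_diff[OF dF[OF b(1) c] dF[OF b(2) c]]
  have "norm (\<Xi> (\<lambda>t. dforce b c t - dforce b' c t)) \<le> B * (Q * (norm (b - b') powr p * norm c))"
   by (intro \<Xi>_bound dforce_holder[OF b c, folded Q_def] d[THEN conjunct2, unfolded tame_def, THEN conjunct1]) (simp add: Q0)
  then show "norm (\<Xi> (dforce b c) - \<Xi> (dforce b' c)) \<le> S * (norm (b - b') powr p * norm c)"
   using d S(1)[of "norm (b - b') powr p * norm c"] by simp
 next
  fix b c d u v assume b: "b \<in> W" and c: "c \<in> W" "d \<in> W"
  have "dforce b (u *\<^sub>R c + v *\<^sub>R d) = (\<lambda>t. u *\<^sub>R dforce b c t + v *\<^sub>R dforce b d t)"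
   using variation_linear(2)[OF b c] by auto
  then show "\<Xi> (dforce b (u *\<^sub>R c + v *\<^sub>R d)) = u *\<^sub>R \<Xi> (dforce b c) + v *\<^sub>R \<Xi> (dforce b d)"
   using \<Xi>_combine[OF dF[OF b c(1)] dF[OF b c(2)]] by simp
 qed auto
qed

end

lemma integral_le_increment:
 fixes F h H :: "real => real"
 assumes "u \<le> v" "F integrable_on {u..v}" and le: "!!\<sigma>. \<sigma> \<in> {u..v} ==> F \<sigma> \<le> h \<sigma>"
  and H: "!!\<sigma>. (H has_real_derivative h \<sigma>) (at \<sigma>)"
 shows "integral {u..v} F \<le> H v - H u"
proof -
 have "(h has_integral (H v - H u)) {u..v}"
  by (rule fundamental_theorem_of_calculus[OF assms(1)])
   (use H in \<open>simp add: has_real_derivative_iff_has_vector_derivative has_vector_derivative_at_within\<close>)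
 with le show ?thesis using has_integral_le[OF integrable_integral[OF assms(2)]] by blast
qed

section \<open>Weights on the whole line\<close>

text \<open>
  The hypotheses of the theorem in logarithmic time. Here \<open>x'\<close> is \<open>\<mu>' / \<mu>\<close>, and \<open>\<Lambda>\<close> is measured relative to the
  Lipschitz constant of \<open>g t\<close>.
\<close>

locale smooth_dichotomy = exponential_dichotomy r \<zeta> x P K \<alpha> \<beta> \<theta> \<nu> Kt a \<epsilon> D +
  perturbation r \<zeta> g "\<lambda>t. \<delta> * (x' t * exp (- ((\<gamma> + \<epsilon>) * \<bar>x t\<bar>)) * exp (- ((\<xi> + \<epsilon>) * \<bar>x t\<bar>)))"
 for r and \<zeta> :: "real => real => real ^ ('n::finite) ^ 'n" and x P K \<alpha> \<beta> \<theta> \<nu> Kt a \<epsilon> D g \<delta> x' \<gamma> \<xi> +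
 fixes D2g :: "real => 'n phase => 'n phase => real ^ 'n" and \<Lambda> :: real
 assumes x_deriv: "(x has_real_derivative x' t) (at t)" and x'_nonneg: "0 \<le> x' t"
  and pos: "0 < \<alpha>" "0 < \<beta>" "0 < \<epsilon>" "0 < \<delta>" "0 < Kt" "0 < D" "0 \<le> \<Lambda>" "0 \<le> a"
  and \<gamma>: "\<theta> \<le> \<gamma>" "\<nu> \<le> \<gamma>" and \<xi>: "0 < \<xi>" "a < \<beta> + \<xi> + \<epsilon>"
  and small: "D * \<delta> / \<alpha> + D * \<delta> / \<beta> \<le> 1 / 4"
  and g_bounded: "\<phi> \<in> C r ==> norm (g t \<phi>) \<le> \<delta> * (x' t * exp (- ((\<gamma> + \<epsilon>) * \<bar>x t\<bar>)))"
  and D2g_deriv: "\<phi> \<in> C r ==> (g t has_derivative D2g t \<phi>) (at \<phi> within C r)"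
  and D2g_path: "continuous_on UNIV y ==> (!!t. y t \<in> C r) ==> continuous_on UNIV w ==> (!!t. w t \<in> C r) ==>
   continuous_on UNIV (\<lambda>t. D2g t (y t) (w t))"
  and D2g_lip: "\<phi> \<in> C r ==> \<psi> \<in> C r ==> v \<in> C r ==> norm (D2g t \<phi> v - D2g t \<psi> v) \<le>
   \<Lambda> * (\<delta> * (x' t * exp (- ((\<gamma> + \<epsilon>) * \<bar>x t\<bar>)) * exp (- ((\<xi> + \<epsilon>) * \<bar>x t\<bar>)))) * (min 1 (norm (\<phi> - \<psi>)) * norm v)"
begin

definition dens :: "real => real" where "dens t = x' t * exp (- ((\<gamma> + \<epsilon>) * \<bar>x t\<bar>))"

definition k :: "real => real" where "k t = \<delta> * (dens t * exp (- ((\<xi> + \<epsilon>) * \<bar>x t\<bar>)))"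

lemma dens_nonneg: "0 \<le> dens t" using x'_nonneg by (simp add: dens_def)

lemma k_nonneg: "0 \<le> k t" using dens_nonneg pos by (simp add: k_def)

lemma k_le_dens: "k t \<le> \<delta> * dens t"
 unfolding k_def using dens_nonneg[of t] pos \<xi> by (intro mult_left_mono mult_left_le) auto

lemma x_mono: "s \<le> t ==> x s \<le> x t"
 using DERIV_nonneg_imp_nondecreasing[of s t x] x_deriv x'_nonneg by blast

lemma exp_cancel:
 assumes "c \<le> d"
 shows "exp (c * \<bar>y\<bar>) * exp (- (d * \<bar>y\<bar>)) \<le> (1::real)"
proof -
 have "c * \<bar>y\<bar> \<le> d * \<bar>y\<bar>" by (intro mult_right_mono assms) simp
 then show ?thesis by (simp add: exp_add[symmetric])
qed

text \<open>
  The nonuniformity of the kernel is absorbed by the decay of \<open>dens\<close>, as \<open>\<theta> \<le> \<gamma>\<close>; what remains is the derivative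
  of an exponential of \<open>x\<close>.
\<close>

lemma stable_integral:
 assumes f: "continuous_on UNIV f" and B: "0 \<le> B" and bd: "!!\<sigma>. \<sigma> \<le> t ==> norm (f \<sigma>) \<le> B * dens \<sigma>"
 shows "stable_adm f t (D * B / \<alpha>)"
 unfolding stable_adm_def
proof (intro allI impI)
 fix s assume st: "s \<le> t"
 define H where "H \<sigma> = D * B / \<alpha> * exp (- \<alpha> * (x t - x \<sigma>))" for \<sigma>
 have "integral {s..t} (\<lambda>\<sigma>. stable_kernel t \<sigma> * norm (f \<sigma>)) \<le> H t - H s"
 proof (rule integral_le_increment[OF st kernel_int(1)[OF f]])
  show "(H has_real_derivative D * B * x' \<sigma> * exp (- \<alpha> * (x t - x \<sigma>))) (at \<sigma>)" for \<sigma>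
   unfolding H_def using pos by (auto intro!: derivative_eq_intros x_deriv)
  fix \<sigma> assume \<sigma>: "\<sigma> \<in> {s..t}"
  have "stable_kernel t \<sigma> * norm (f \<sigma>) \<le> stable_kernel t \<sigma> * (B * dens \<sigma>)"
   using \<sigma> bd kernels_nonneg by (intro mult_left_mono) auto
  also have "\<dots> = D * B * x' \<sigma> * exp (- \<alpha> * (x t - x \<sigma>)) * (exp ((\<theta> + \<epsilon>) * \<bar>x \<sigma>\<bar>) * exp (- ((\<gamma> + \<epsilon>) * \<bar>x \<sigma>\<bar>)))"
   by (simp only: stable_kernel_def dens_def exp_add mult_ac)
  also have "\<dots> \<le> D * B * x' \<sigma> * exp (- \<alpha> * (x t - x \<sigma>)) * 1"
   using pos B x'_nonneg \<gamma> by (intro mult_left_mono exp_cancel mult_nonneg_nonneg) auto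
  finally show "stable_kernel t \<sigma> * norm (f \<sigma>) \<le> D * B * x' \<sigma> * exp (- \<alpha> * (x t - x \<sigma>))" by simp
 qed
 also have "\<dots> \<le> D * B / \<alpha>" using pos B by (simp add: H_def)
 finally show "integral {s..t} (\<lambda>\<sigma>. stable_kernel t \<sigma> * norm (f \<sigma>)) \<le> D * B / \<alpha>" .
qed

lemma unstable_integral:
 assumes f: "continuous_on UNIV f" and B: "0 \<le> B1" "0 \<le> B2" and b: "b < \<beta>"
  and bd: "!!\<sigma>. t \<le> \<sigma> ==> norm (f \<sigma>) \<le> dens \<sigma> * (B1 + B2 * exp (b * x \<sigma>))"
 shows "unstable_adm f t (D * (B1 / \<beta> + B2 * exp (b * x t) / (\<beta> - b)))"
 unfolding unstable_adm_def
proof (intro allI impI)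
 fix u assume tu: "t \<le> u"
 define E where "E \<sigma> = exp (\<beta> * (x t - x \<sigma>))" for \<sigma>
 define F where "F \<sigma> = exp (\<beta> * x t - (\<beta> - b) * x \<sigma>)" for \<sigma>
 define H where "H \<sigma> = - (D * (B1 / \<beta> * E \<sigma> + B2 / (\<beta> - b) * F \<sigma>))" for \<sigma>
 have F: "F \<sigma> = E \<sigma> * exp (b * x \<sigma>)" for \<sigma> by (simp add: F_def E_def exp_add[symmetric] algebra_simps)
 have "integral {t..u} (\<lambda>\<sigma>. unstable_kernel t \<sigma> * norm (f \<sigma>)) \<le> H u - H t"
 proof (rule integral_le_increment[OF tu kernel_int(2)[OF f]])
  have dE: "(E has_real_derivative - \<beta> * (x' \<sigma> * E \<sigma>)) (at \<sigma>)" for \<sigma>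
   unfolding E_def by (auto intro!: derivative_eq_intros x_deriv)
  have dF: "(F has_real_derivative - (\<beta> - b) * (x' \<sigma> * F \<sigma>)) (at \<sigma>)" for \<sigma>
   unfolding F_def by (auto intro!: derivative_eq_intros x_deriv simp: algebra_simps)
  have "(H has_real_derivative - (D * (B1 / \<beta> * (- \<beta> * (x' \<sigma> * E \<sigma>)) + B2 / (\<beta> - b) * (- (\<beta> - b) * (x' \<sigma> * F \<sigma>))))) (at \<sigma>)" for \<sigma>
   unfolding H_def by (intro DERIV_minus DERIV_cmult DERIV_add dE dF)
  moreover have "B1 / \<beta> * (- \<beta> * u) = - (B1 * u)" "B2 / (\<beta> - b) * (- (\<beta> - b) * u) = - (B2 * u)" for u
   using pos b by (simp_all add: field_simps)
  ultimately show "(H has_real_derivative D * (B1 * (x' \<sigma> * E \<sigma>) + B2 * (x' \<sigma> * F \<sigma>))) (at \<sigma>)" for \<sigma>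
   by (simp only: minus_add_distrib mult_minus_right minus_minus distrib_left)
  fix \<sigma> assume \<sigma>: "\<sigma> \<in> {t..u}"
  have "unstable_kernel t \<sigma> * norm (f \<sigma>) \<le> unstable_kernel t \<sigma> * (dens \<sigma> * (B1 + B2 * exp (b * x \<sigma>)))"
   using \<sigma> bd kernels_nonneg by (intro mult_left_mono) auto
  also have "\<dots> = D * x' \<sigma> * E \<sigma> * (B1 + B2 * exp (b * x \<sigma>)) * (exp ((\<nu> + \<epsilon>) * \<bar>x \<sigma>\<bar>) * exp (- ((\<gamma> + \<epsilon>) * \<bar>x \<sigma>\<bar>)))"
   by (simp add: unstable_kernel_def dens_def exp_add E_def)
  also have "\<dots> \<le> D * x' \<sigma> * E \<sigma> * (B1 + B2 * exp (b * x \<sigma>)) * 1"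
   using pos B x'_nonneg \<gamma> by (intro mult_left_mono exp_cancel mult_nonneg_nonneg) (auto simp: E_def)
  finally show "unstable_kernel t \<sigma> * norm (f \<sigma>) \<le> D * (B1 * (x' \<sigma> * E \<sigma>) + B2 * (x' \<sigma> * F \<sigma>))"
   by (simp add: F algebra_simps)
 qed
 also have "\<dots> \<le> - H t"
  using pos B b by (simp add: H_def E_def F_def)
 also have "\<dots> = D * (B1 / \<beta> + B2 * exp (b * x t) / (\<beta> - b))"
  by (simp add: H_def E_def F_def algebra_simps)
 finally show "integral {t..u} (\<lambda>\<sigma>. unstable_kernel t \<sigma> * norm (f \<sigma>)) \<le> D * (B1 / \<beta> + B2 * exp (b * x t) / (\<beta> - b))" .
qed

text \<open>
  The case of a force bounded by \<open>\<delta> * dens\<close>, which holds along every path.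
\<close>

lemma bounded_force:
 assumes f: "continuous_on UNIV f" and bd: "!!\<sigma>. norm (f \<sigma>) \<le> \<delta> * dens \<sigma>"
 shows "adm f" "norm (bsol f t) \<le> 1 / 4"
proof -
 have S: "stable_adm f t (D * \<delta> / \<alpha>)" for t using pos bd by (intro stable_integral f) auto
 have U: "unstable_adm f t (D * (\<delta> / \<beta> + 0 * exp (0 * x t) / (\<beta> - 0)))" for t
  using pos bd by (intro unstable_integral f) (auto simp: mult_ac)
 show "adm f" unfolding adm_def using f S U by blast
 have "norm (bsol f t) \<le> norm (stable_sol f t) + norm (unstable_sol f t)" unfolding bsol_def by (rule norm_triangle_ineq4)
 moreover have "norm (unstable_sol f t) \<le> D * \<delta> / \<beta>" using unstable_sol_lim(2)[OF f U, of t] by simp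
 ultimately show "norm (bsol f t) \<le> 1 / 4"
  using stable_sol_lim(2)[OF f S, of t] small by linarith
qed

text \<open>
  \<open>b\<close> is the growth exponent of the weight after multiplication with the extra decay of the Lipschitz
  constant; it has to be smaller than the rate \<open>\<beta>\<close> of the unstable kernel.
\<close>

definition good_weight :: "real => real => bool" where
 "good_weight e i \<longleftrightarrow> 0 < i \<and> (\<exists>b<\<beta>. (\<forall>y. exp (- ((\<xi> + \<epsilon>) * \<bar>y\<bar>)) * exp (e * y) \<le> exp (b * y)) \<and>
   (\<forall>y. D * (\<delta> * i * exp (b * y) / (\<beta> - b)) \<le> (1 + i * exp (e * y)) / 4))"

text \<open>
  Since \<open>b < e\<close>, the function \<open>i * exp (b * y)\<close> is small relative to \<open>i * exp (e * y)\<close> for large \<open>y\<close> and relative to \<open>1\<close>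
  otherwise, if \<open>i\<close> is small; \<open>Y\<close> separates the two ranges.
\<close>

lemma good_weight_exists:
 assumes e: "0 < e" "e < \<beta> + \<xi> + \<epsilon>"
 shows "\<exists>i. good_weight e i"
proof -
 define b where "b = max (min \<beta> e / 2) (e - (\<xi> + \<epsilon>))"
 have b: "0 < b" "b < \<beta>" "b < e" "e - (\<xi> + \<epsilon>) \<le> b" "b \<le> e + (\<xi> + \<epsilon>)"
  using e pos \<xi> by (auto simp: b_def max_def min_def)
 \<comment> \<open>\<open>q\<close> is the factor by which \<open>i * exp (b * y)\<close> has to be smaller than the weight.\<close>
 define q where "q = (\<beta> - b) / (4 * D * \<delta>)"
 have q: "0 < q" using b pos by (simp add: q_def)
 define Y where "Y = - ln q / (e - b)"
 have qY: "exp (- ((e - b) * Y)) = q" using b q by (simp add: Y_def)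
 define i where "i = q * exp (- (b * Y))"
 have i: "0 < i" using q by (simp add: i_def)
 have bound: "i * exp (b * y) \<le> q * (1 + i * exp (e * y))" for y
 proof (cases "y \<le> Y")
  case True
  have "i * exp (b * y) \<le> i * exp (b * Y)" using True b i by (intro mult_left_mono) auto
  also have "\<dots> = q" by (simp add: i_def exp_minus)
  also have "\<dots> \<le> q * (1 + i * exp (e * y))" using q i by simp
  finally show ?thesis .
 next
  case False
  have "exp (b * y) = exp (e * y) * exp (- ((e - b) * y))" by (simp add: exp_add[symmetric] algebra_simps)
  also have "\<dots> \<le> exp (e * y) * q" unfolding qY[symmetric] using False b by (intro mult_left_mono) auto
  finally have "i * exp (b * y) \<le> i * (exp (e * y) * q)" using i by (intro mult_left_mono) auto
  also have "\<dots> \<le> q * (1 + i * exp (e * y))" using q i by (simp add: algebra_simps)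
  finally show ?thesis .
 qed
 have "D * (\<delta> * i * exp (b * y) / (\<beta> - b)) \<le> (1 + i * exp (e * y)) / 4" for y
 proof -
  have "D * \<delta> / (\<beta> - b) * (i * exp (b * y)) \<le> D * \<delta> / (\<beta> - b) * (q * (1 + i * exp (e * y)))"
   using pos b by (intro mult_left_mono bound) auto
  also have "\<dots> = (1 + i * exp (e * y)) / 4" using pos b by (simp add: q_def)
  finally show ?thesis by simp
 qed
 moreover have "exp (- ((\<xi> + \<epsilon>) * \<bar>y\<bar>)) * exp (e * y) \<le> exp (b * y)" for y
 proof (cases "0 \<le> y")
  case True
  have "(e - (\<xi> + \<epsilon>)) * y \<le> b * y" using b True by (intro mult_right_mono) auto
  then show ?thesis using True by (simp add: exp_add[symmetric] algebra_simps)
 next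
  case False
  have "(e + (\<xi> + \<epsilon>)) * y \<le> b * y" using b False by (intro mult_right_mono_neg) auto
  then show ?thesis using False by (simp add: exp_add[symmetric] algebra_simps)
 qed
 ultimately show ?thesis unfolding good_weight_def using i b(2) by blast
qed

definition line_weights :: "(real => real) set" where
 "line_weights = {\<rho>. \<exists>e>0. \<exists>i. good_weight e i \<and> \<rho> = (\<lambda>t. 1 + i * exp (e * x t))}"

text \<open>
  The stable integral is harmless as the weight increases. The constants add up to \<open>1 / 4\<close> from the constant
  part of the weight and \<open>1 / 4\<close> from the growing part.
\<close>

lemma bsol_weighted:
 assumes \<rho>: "\<rho> \<in> line_weights" and f: "continuous_on UNIV f" and c: "0 \<le> c" and bd: "!!t. norm (f t) \<le> c * (k t * \<rho> t)"
 shows "adm f" "norm (bsol f t) \<le> 1 / 2 * c * \<rho> t"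
proof -
 obtain e i where e: "0 < e" "good_weight e i" and \<rho>: "\<rho> = (\<lambda>t. 1 + i * exp (e * x t))" using \<rho> unfolding line_weights_def by blast
 obtain b where b: "b < \<beta>" "0 < i" and b1: "!!y. exp (- ((\<xi> + \<epsilon>) * \<bar>y\<bar>)) * exp (e * y) \<le> exp (b * y)"
  and b2: "!!y. D * (\<delta> * i * exp (b * y) / (\<beta> - b)) \<le> (1 + i * exp (e * y)) / 4"
  using e(2) unfolding good_weight_def by blast
 have \<rho>1: "1 \<le> \<rho> t" for t using b by (simp add: \<rho>)
 have \<rho>_mono: "\<rho> s \<le> \<rho> t" if "s \<le> t" for s t using x_mono[OF that] b e by (simp add: \<rho>)
 have S: "stable_adm f t (D * (c * \<delta> * \<rho> t) / \<alpha>)" for t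
 proof (rule stable_integral[OF f])
  show "0 \<le> c * \<delta> * \<rho> t" using c pos \<rho>1[of t] by simp
  fix \<sigma> assume \<sigma>: "\<sigma> \<le> t"
  have "c * (k \<sigma> * \<rho> \<sigma>) \<le> c * ((\<delta> * dens \<sigma>) * \<rho> t)"
   using c k_le_dens k_nonneg \<rho>_mono[OF \<sigma>] \<rho>1[of \<sigma>] dens_nonneg[of \<sigma>] pos by (intro mult_left_mono mult_mono) auto
  then show "norm (f \<sigma>) \<le> c * \<delta> * \<rho> t * dens \<sigma>" using bd[of \<sigma>] by (simp add: mult_ac)
 qed
 have U: "unstable_adm f t (D * (c * \<delta> / \<beta> + c * \<delta> * i * exp (b * x t) / (\<beta> - b)))" for t
 proof (rule unstable_integral[OF f])
  show "0 \<le> c * \<delta>" "0 \<le> c * \<delta> * i" "b < \<beta>" using c pos b by auto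
  fix \<sigma> :: real
  have "exp (- ((\<xi> + \<epsilon>) * \<bar>x \<sigma>\<bar>)) * \<rho> \<sigma> = exp (- ((\<xi> + \<epsilon>) * \<bar>x \<sigma>\<bar>)) + i * (exp (- ((\<xi> + \<epsilon>) * \<bar>x \<sigma>\<bar>)) * exp (e * x \<sigma>))"
   by (simp add: \<rho> algebra_simps)
  also have "\<dots> \<le> 1 + i * exp (b * x \<sigma>)" using b1 b pos \<xi> by (intro add_mono mult_left_mono) auto
  finally have "(c * \<delta> * dens \<sigma>) * (exp (- ((\<xi> + \<epsilon>) * \<bar>x \<sigma>\<bar>)) * \<rho> \<sigma>) \<le> (c * \<delta> * dens \<sigma>) * (1 + i * exp (b * x \<sigma>))"
   using c pos dens_nonneg[of \<sigma>] by (intro mult_left_mono) auto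
  then show "norm (f \<sigma>) \<le> dens \<sigma> * (c * \<delta> + c * \<delta> * i * exp (b * x \<sigma>))" using bd[of \<sigma>] by (simp add: k_def algebra_simps)
 qed
 show "adm f" unfolding adm_def using f S U by blast
 have "norm (bsol f t) \<le> norm (stable_sol f t) + norm (unstable_sol f t)" unfolding bsol_def by (rule norm_triangle_ineq4)
 also have "\<dots> \<le> D * (c * \<delta> * \<rho> t) / \<alpha> + D * (c * \<delta> / \<beta> + c * \<delta> * i * exp (b * x t) / (\<beta> - b))"
  by (intro add_mono stable_sol_lim(2)[OF f S] unstable_sol_lim(2)[OF f U])
 also have "\<dots> = c * (D * \<delta> / \<alpha> * \<rho> t + D * \<delta> / \<beta> + D * (\<delta> * i * exp (b * x t) / (\<beta> - b)))"
  by (simp add: algebra_simps)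
 also have "\<dots> \<le> c * (D * \<delta> / \<alpha> * \<rho> t + D * \<delta> / \<beta> * \<rho> t + \<rho> t / 4)"
 proof (intro mult_left_mono[OF _ c] add_mono order_refl)
  show "D * \<delta> / \<beta> \<le> D * \<delta> / \<beta> * \<rho> t" using mult_left_mono[OF \<rho>1[of t], of "D * \<delta> / \<beta>"] pos by simp
  show "D * (\<delta> * i * exp (b * x t) / (\<beta> - b)) \<le> \<rho> t / 4" unfolding \<rho> by (rule b2)
 qed
 also have "\<dots> = c * ((D * \<delta> / \<alpha> + D * \<delta> / \<beta>) * \<rho> t + \<rho> t / 4)" by (simp add: algebra_simps)
 also have "\<dots> \<le> c * (1 / 4 * \<rho> t + \<rho> t / 4)"
  using c small \<rho>1[of t] by (intro mult_left_mono add_right_mono mult_right_mono) auto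
 finally show "norm (bsol f t) \<le> 1 / 2 * c * \<rho> t" by simp
qed

lemma D2g_bound:
 assumes \<phi>: "\<phi> \<in> C r" and v: "v \<in> C r"
 shows "norm (D2g t \<phi> v) \<le> k t * norm v"
proof (cases "v = 0")
 case True
 interpret bounded_linear "D2g t \<phi>" using D2g_deriv[OF \<phi>] by (rule has_derivative_bounded_linear)
 show ?thesis using True by (simp add: zero)
next
 case False
 interpret bounded_linear "D2g t \<phi>" using D2g_deriv[OF \<phi>] by (rule has_derivative_bounded_linear)
 have nv: "0 < norm v" using False by simp
 have "norm (D2g t \<phi> v) \<le> k t * norm v + e" if e: "0 < e" for e
 proof -
  have "0 < e / norm v" using e nv by simp
  then obtain d where d: "0 < d" "!!y. y \<in> C r ==> norm (y - \<phi>) < d ==>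
    norm (g t y - g t \<phi> - D2g t \<phi> (y - \<phi>)) \<le> e / norm v * norm (y - \<phi>)"
   using D2g_deriv[OF \<phi>, of t] unfolding has_derivative_within_alt by blast
  define s where "s = d / (2 * norm v)"
  have s: "0 < s" using d nv by (simp add: s_def)
  have yC: "\<phi> + s *\<^sub>R v \<in> C r" by (intro C_add C_scale \<phi> v)
  have "norm (s *\<^sub>R v) < d" using d nv by (simp add: s_def)
  then have "norm (g t (\<phi> + s *\<^sub>R v) - g t \<phi> - s *\<^sub>R D2g t \<phi> v) \<le> e / norm v * norm (s *\<^sub>R v)"
   using d(2)[OF yC] by (simp add: scaleR)
  also have "\<dots> = s * e" using s nv by simp
  finally have 1: "norm (g t (\<phi> + s *\<^sub>R v) - g t \<phi> - s *\<^sub>R D2g t \<phi> v) \<le> s * e" .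
  have 2: "norm (g t (\<phi> + s *\<^sub>R v) - g t \<phi>) \<le> k t * (s * norm v)"
   using g_lip[OF yC \<phi>, of t] s by (simp add: k_def dens_def)
  have "norm (s *\<^sub>R D2g t \<phi> v) \<le> norm (g t (\<phi> + s *\<^sub>R v) - g t \<phi>) + norm (g t (\<phi> + s *\<^sub>R v) - g t \<phi> - s *\<^sub>R D2g t \<phi> v)"
   using norm_triangle_ineq4[of "g t (\<phi> + s *\<^sub>R v) - g t \<phi>" "g t (\<phi> + s *\<^sub>R v) - g t \<phi> - s *\<^sub>R D2g t \<phi> v"] by simp
  then have "s * norm (D2g t \<phi> v) \<le> s * (k t * norm v + e)" using 1 2 s by (simp add: algebra_simps)
  then show ?thesis using s by simp
 qed
 then show ?thesis by (rule field_le_epsilon)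
qed

lemma problem_data:
 "subspace (C r :: 'n phase set)" "closed (C r :: 'n phase set)"
 "continuous_on UNIV y ==> (!!t. y t \<in> C r) ==> continuous_on UNIV (\<lambda>t. g t (y t))"
 "\<phi> \<in> C r ==> \<psi> \<in> C r ==> norm (g t \<phi> - g t \<psi>) \<le> k t * norm (\<phi> - \<psi>)"
 "\<phi> \<in> C r ==> \<psi> \<in> C r ==> v \<in> C r ==> norm (D2g t \<phi> v - D2g t \<psi> v) \<le> \<Lambda> * k t * (min 1 (norm (\<phi> - \<psi>)) * norm v)"
 using subspace_C closed_C g_path_continuous[of UNIV y] g_lip[of \<phi> \<psi> t] D2g_lip[of \<phi> \<psi> v t] by (auto simp: k_def dens_def)

lemma line_problem: "weighted_problem (C r) g D2g k \<Lambda> (1/2) bsol line_weights"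
proof (rule weighted_problem.intro, goal_cases)
 case (14 \<rho>) then show ?case by (auto simp: line_weights_def intro!: continuous_intros x_cont)
next
 case (15 \<rho> t) then show ?case by (auto simp: line_weights_def good_weight_def intro!: add_pos_pos)
next
 case (16 \<rho> f c)
 then show ?case using bsol_weighted[OF 16] bsol_continuous admD(7) by blast
next
 case (17 \<rho> f h c c1 c2 t)
 then show ?case using bsol_combine[OF bsol_weighted(1)[OF 17(1,2,4,5)] bsol_weighted(1)[OF 17(1,3,4,6)]] by blast
qed (use problem_data g_zero D2g_path D2g_deriv D2g_bound k_nonneg pos in auto)

sublocale line: weighted_problem "C r" g D2g k \<Lambda> "1/2" bsol line_weights by (rule line_problem)

text \<open>
  The exponents \<open>a \<le> e0 \<le> e1 = e0 * (1 + p)\<close> are placed in the interval from \<open>a\<close> to \<open>\<beta> + \<xi> + \<epsilon>\<close>.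
\<close>

definition gap :: real where "gap = \<beta> + \<xi> + \<epsilon> - a"
definition p :: real where "p = gap / (4 * (a + gap))"
definition e0 :: real where "e0 = a + gap / 4"
definition e1 :: real where "e1 = e0 * (1 + p)"

lemma exponents: "0 < p" "p \<le> 1" "0 < e0" "a \<le> e0" "e0 \<le> e1" "0 < e1" "e1 < \<beta> + \<xi> + \<epsilon>" "e0 < \<beta> + \<xi> + \<epsilon>"
proof -
 have gap: "0 < gap" using \<xi> by (simp add: gap_def)
 show p: "0 < p" "p \<le> 1" using gap pos by (auto simp: p_def field_simps)
 show e0: "0 < e0" "a \<le> e0" using gap pos by (auto simp: e0_def)
 have "e1 = e0 + e0 * p" by (simp add: e1_def algebra_simps)
 then show "e0 \<le> e1" "0 < e1" using e0 mult_pos_pos[OF e0(1) p(1)] by linarith+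
 have "p * e0 \<le> p * (a + gap)" using p gap by (intro mult_left_mono) (auto simp: e0_def)
 also have "\<dots> = gap / 4"
 proof -
  have "a + gap \<noteq> 0" using gap pos by simp
  from nonzero_mult_divide_mult_cancel_right[OF this, of gap 4] show ?thesis
   by (simp only: p_def times_divide_eq_left)
 qed
 finally have "e1 \<le> e0 + gap / 4" by (simp add: e1_def algebra_simps)
 then have "e1 < a + gap" using gap by (simp add: e0_def)
 then show "e1 < \<beta> + \<xi> + \<epsilon>" by (simp add: gap_def)
 then show "e0 < \<beta> + \<xi> + \<epsilon>" using \<open>e0 \<le> e1\<close> by simp
qed

definition \<iota> :: "real => real" where "\<iota> e = (SOME i. good_weight e i)"

definition \<rho> :: "real => real => real" where "\<rho> e t = 1 + \<iota> e * exp (e * x t)"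

lemma \<iota>: "good_weight e0 (\<iota> e0)" "good_weight e1 (\<iota> e1)" "0 < \<iota> e0" "0 < \<iota> e1"
 unfolding \<iota>_def using good_weight_exists exponents by (metis someI good_weight_def)+

lemma \<rho>: "\<rho> e0 \<in> line_weights" "\<rho> e1 \<in> line_weights" "1 \<le> \<rho> e0 t"
proof -
 have "\<rho> e \<in> line_weights" if "0 < e" "good_weight e (\<iota> e)" for e
  unfolding line_weights_def using that by (intro CollectI exI[of _ e] exI[of _ "\<iota> e"] conjI) (auto simp: \<rho>_def)
 then show "\<rho> e0 \<in> line_weights" "\<rho> e1 \<in> line_weights" using \<iota> exponents by blast+
 show "1 \<le> \<rho> e0 t" using \<iota> by (simp add: \<rho>_def)
qed

lemma \<rho>_powr: "\<rho> e0 t powr p * \<rho> e0 t \<le> 4 * (1 + \<iota> e0 powr (1 + p) / \<iota> e1) * \<rho> e1 t"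
proof -
 define u where "u = \<iota> e0 * exp (e0 * x t)"
 have u: "0 < u" "\<rho> e0 t = 1 + u" using \<iota> by (auto simp: u_def \<rho>_def)
 have up: "u powr (1 + p) = \<iota> e0 powr (1 + p) * exp (e1 * x t)"
  using \<iota> by (simp add: u_def powr_mult exp_powr_real e1_def mult_ac)
 \<comment> \<open>\<open>1 + u \<le> 2 * max 1 u\<close>, and a power of a maximum is at most the sum of the powers.\<close>
 have "\<rho> e0 t powr p * \<rho> e0 t = (1 + u) powr (1 + p)" using u by (simp add: powr_add)
 also have "\<dots> \<le> (2 * max 1 u) powr (1 + p)" using u exponents by (intro powr_mono2) auto
 also have "\<dots> = 2 powr (1 + p) * max 1 u powr (1 + p)" by (simp add: powr_mult)
 also have "\<dots> \<le> 2 powr 2 * (1 + u powr (1 + p))"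
  using exponents u by (intro mult_mono powr_mono) (auto simp: max_def)
 also have "\<dots> = 4 * (1 + \<iota> e0 powr (1 + p) / \<iota> e1 * (\<iota> e1 * exp (e1 * x t)))" using \<iota> by (simp add: up)
 also have "\<dots> \<le> 4 * ((1 + \<iota> e0 powr (1 + p) / \<iota> e1) * \<rho> e1 t)"
 proof -
  define A B where "A = \<iota> e0 powr (1 + p) / \<iota> e1" and "B = \<iota> e1 * exp (e1 * x t)"
  have "0 \<le> A" "0 \<le> B" using \<iota> by (auto simp: A_def B_def)
  then have "1 + A * B \<le> (1 + A) * (1 + B)" by (simp add: algebra_simps)
  then show ?thesis by (simp add: A_def B_def \<rho>_def)
 qed
 finally show ?thesis by (simp only: mult.assoc)
qed

lemma \<rho>_le_powr: "\<rho> e0 t \<le> \<rho> e0 t powr p * \<rho> e0 t"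
 using \<rho>(3)[of t] exponents ge_one_powr_ge_zero[of "\<rho> e0 t" p] by (simp add: mult_le_cancel_right1)

text \<open>
  Forwards the orbit grows at most with exponent \<open>a \<le> e0\<close>, backwards it stays bounded.
\<close>

lemma orb_weighted: "\<exists>CX\<ge>0. \<forall>b\<in>UU s. \<forall>t. norm (orb t s b) \<le> CX * norm b * \<rho> e0 t"
proof -
 define A B where "A = Kt * exp (- a * x s + \<epsilon> * \<bar>x s\<bar>) * (1 + 1 / \<iota> e0)" and "B = K * exp (\<nu> * \<bar>x s\<bar>)"
 have AB: "0 \<le> A" "0 \<le> B" using pos signs \<iota> by (auto simp: A_def B_def)
 have "norm (orb t s b) \<le> (A + B) * norm b * \<rho> e0 t" if b: "b \<in> UU s" for b t
 proof (cases "s \<le> t")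
  case True
  have "exp (a * x t) \<le> 1 + exp (e0 * x t)"
  proof (cases "0 \<le> x t")
   case True
   then have "a * x t \<le> e0 * x t" using exponents by (intro mult_right_mono) auto
   then have "exp (a * x t) \<le> exp (e0 * x t)" by simp
   then show ?thesis by linarith
  next
   case False
   then have "exp (a * x t) \<le> 1" using pos by (simp add: mult_nonneg_nonpos)
   then show ?thesis using exp_gt_zero[of "e0 * x t"] by linarith
  qed
  also have "\<dots> \<le> (1 + 1 / \<iota> e0) * \<rho> e0 t" using \<iota> by (simp add: \<rho>_def algebra_simps)
  finally have e: "exp (a * x t) \<le> (1 + 1 / \<iota> e0) * \<rho> e0 t" .
  have "norm (orb t s b) \<le> Kt * exp (a * (x t - x s) + \<epsilon> * \<bar>x s\<bar>) * norm b"
   using TT_growth[OF True UU_C[OF b]] by (simp add: orb_forward[OF True] UU_C[OF b])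
  also have "\<dots> = (Kt * exp (- a * x s + \<epsilon> * \<bar>x s\<bar>) * norm b) * exp (a * x t)" by (simp add: exp_add[symmetric] algebra_simps)
  also have "\<dots> \<le> (Kt * exp (- a * x s + \<epsilon> * \<bar>x s\<bar>) * norm b) * ((1 + 1 / \<iota> e0) * \<rho> e0 t)"
   using pos by (intro mult_left_mono e) auto
  also have "\<dots> = A * norm b * \<rho> e0 t" by (simp add: A_def)
  also have "\<dots> \<le> (A + B) * norm b * \<rho> e0 t" using AB \<rho>(3)[of t] by (intro mult_right_mono) auto
  finally show ?thesis .
 next
  case False
  have "norm (orb t s b) \<le> K * exp (\<beta> * (x t - x s) + \<nu> * \<bar>x s\<bar>) * norm b" using orb_bound[OF _ b] False by simp
  also have "\<dots> \<le> B * norm b" unfolding B_def using signs pos x_mono[of t s] False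
   by (intro mult_right_mono mult_left_mono) (auto simp: mult_nonneg_nonpos)
  also have "\<dots> = B * norm b * 1" by simp
  also have "\<dots> \<le> (A + B) * norm b * \<rho> e0 t" using AB \<rho>(3)[of t] by (intro mult_mono) auto
  finally show ?thesis .
 qed
 then show ?thesis using AB by (intro exI[of _ "A + B"]) auto
qed

lemma subspace_UU: "subspace (UU s)"
 unfolding subspace_def using UU_0 UU_add UU_scale by blast

lemma line_family: "\<exists>CX Cp. weighted_family (C r) g D2g k \<Lambda> (1/2) bsol line_weights (UU s) (\<lambda>b t. orb t s b) (\<rho> e0) (\<rho> e1) p CX Cp"
proof -
 obtain CX where CX: "0 \<le> CX" "!!b t. b \<in> UU s ==> norm (orb t s b) \<le> CX * norm b * \<rho> e0 t" using orb_weighted by blast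
 define Cp where "Cp = 4 * (1 + \<iota> e0 powr (1 + p) / \<iota> e1)"
 have Cp: "0 \<le> Cp" using \<iota> by (simp add: Cp_def)
 have "weighted_family (C r) g D2g k \<Lambda> (1/2) bsol line_weights (UU s) (\<lambda>b t. orb t s b) (\<rho> e0) (\<rho> e1) p CX Cp"
  by (intro weighted_family.intro line_problem weighted_family_axioms.intro;
    rule subspace_UU \<rho>(1) \<rho>(2) orb_continuous UU_C[OF orb_UU] CX orb_combine exponents(1) exponents(2) Cp
     order_trans[OF \<rho>_le_powr \<rho>_powr, folded Cp_def] \<rho>_powr[folded Cp_def]; assumption?)
 then show ?thesis by blast
qed

end

context smooth_dichotomy
begin

section \<open>The conjugacy\<close>

abbreviation ZZ :: "real => 'n phase => real => 'n phase" where
 "ZZ s b \<equiv> line.fp (\<rho> e0) (line.shifted (\<lambda>\<tau>. orb \<tau> s b))"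

definition YY :: "real => 'n phase => real => 'n phase" where "YY s b t = orb t s b + ZZ s b t"

definition FF :: "real => 'n phase => real => real ^ 'n" where "FF s b t = g t (YY s b t)"

lemma orb_wpath: "b \<in> UU s ==> line.wpath (\<rho> e0) (\<lambda>\<tau>. orb \<tau> s b)"
proof -
 assume b: "b \<in> UU s"
 obtain CX where CX: "0 \<le> CX" "!!t. norm (orb t s b) \<le> CX * norm b * \<rho> e0 t" using orb_weighted[of s] b by blast
 show ?thesis
  unfolding line.wpath_def using orb_continuous[OF b] UU_C[OF orb_UU[OF b]] CX
  by (intro conjI exI[of _ "CX * norm b"]) auto
qed

lemma perturbed_orbit:
 assumes b: "b \<in> UU s"
 shows "line.wpath (\<rho> e0) (ZZ s b)" "line.wpath (\<rho> e0) (YY s b)" "ZZ s b t \<in> C r" "YY s b t \<in> C r"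
  "continuous_on UNIV (FF s b)" "adm (FF s b)" "ZZ s b t = bsol (FF s b) t" "norm (ZZ s b t) \<le> 1 / 4"
  "u \<le> t ==> YY s b t = W t u (YY s b u) (FF s b)"
proof -
 note fp = line.fp_shifted[OF \<rho>(1) orb_wpath[OF b]]
 show z: "line.wpath (\<rho> e0) (ZZ s b)" by (rule fp(1))
 show y: "line.wpath (\<rho> e0) (YY s b)" using line.wpath_add[OF orb_wpath[OF b] z] by (simp only: YY_def[abs_def])
 show "ZZ s b t \<in> C r" "YY s b t \<in> C r" using line.wpathD(2)[OF z] line.wpathD(2)[OF y] by blast+
 have "line.tame (\<rho> e0) (FF s b)" using fp(2) by (simp only: FF_def[abs_def] YY_def)
 then show fc: "continuous_on UNIV (FF s b)" by (simp add: line.tame_def)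
 have "norm (FF s b \<sigma>) \<le> \<delta> * dens \<sigma>" for \<sigma>
  unfolding FF_def using g_bounded[OF line.wpathD(2)[OF y]] by (simp add: dens_def)
 note bf = bounded_force[OF fc this]
 show adm: "adm (FF s b)" by (rule bf(1))
 have zb: "ZZ s b t = bsol (FF s b) t" for t using fp(3)[of t] by (simp only: FF_def[abs_def] YY_def)
 show "ZZ s b t = bsol (FF s b) t" by (rule zb)
 show "norm (ZZ s b t) \<le> 1 / 4" unfolding zb by (rule bf(2))
 assume ut: "u \<le> t"
 note ff = forcing_continuous[OF fc]
 have "W t u (YY s b u) (FF s b) = TT t u (orb u s b) + (TT t u (bsol (FF s b) u) + W t u 0 (FF s b))"
  unfolding W_split[OF ff, of t u "YY s b u"] unfolding YY_def zb by (simp add: TT_add)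
 also have "TT t u (bsol (FF s b) u) + W t u 0 (FF s b) = bsol (FF s b) t"
  using bsol_mild[OF adm ut] W_split[OF ff, of t u "bsol (FF s b) u"] by simp
 also have "TT t u (orb u s b) = orb t s b" by (rule orb_evolves[OF b ut])
 finally show "YY s b t = W t u (YY s b u) (FF s b)" by (simp add: YY_def zb)
qed

text \<open>
  All points of an orbit define the same fixed point problem. The conjugacy relation is a consequence.
\<close>

lemma ZZ_along_orbit: "b \<in> UU s ==> ZZ t (orb t s b) = ZZ s b"
 by (simp add: orb_cocycle)

definition eta :: "real \<times> 'n phase => 'n phase" where
 "eta = restrict (\<lambda>(s, b). ZZ s b s) (Sigma UNIV UU)"

lemma eta: "b \<in> UU s ==> eta (s, b) = ZZ s b s"
 by (simp add: eta_def)

lemma eta_conjugates: "conjugates r \<zeta> g P (\<lambda>t b. b + eta (t, b))"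
 unfolding conjugates_def
proof (intro allI impI ballI)
 fix t s b assume st: "s \<le> t" and b: "b \<in> UU s"
 have T: "T r \<zeta> t s b = orb t s b" using T_eq[OF UU_C[OF b] st] orb_forward[OF st UU_C[OF b]] by simp
 have h: "orb t s b + eta (t, orb t s b) = YY s b t" by (simp add: eta orb_UU[OF b] ZZ_along_orbit[OF b] YY_def)
 have "b + eta (s, b) = YY s b s" by (simp add: eta b YY_def orb_self)
 moreover have "R r \<zeta> g t s (YY s b s) = YY s b t"
  by (rule R_unique[OF perturbed_orbit(4)[OF b] forcing_continuous[OF perturbed_orbit(5)[OF b]] _ perturbed_orbit(9)[OF b] st])
   (simp_all add: FF_def)
 ultimately show "T r \<zeta> t s b + eta (t, T r \<zeta> t s b) = R r \<zeta> g t s (b + eta (s, b))" using T h by simp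
qed

lemma x_continuous_comp: "continuous_on A f ==> continuous_on A (\<lambda>w. x (f w))"
 by (rule continuous_on_compose2[OF x_cont]) auto

text \<open>
  A nearby point \<open>(s, b)\<close> is transported to the base time \<open>s'\<close> along its orbit, which reduces continuity to the
  Lipschitz dependence on the orbit and to continuity in time along one fixed orbit.
\<close>

lemma eta_continuous: "continuous_on (Sigma UNIV UU) eta"
 unfolding continuous_on_def
proof
 fix w assume "w \<in> Sigma UNIV UU"
 then obtain s' b' where w: "w = (s', b')" and b': "b' \<in> UU s'" by blast
 obtain CX where CX: "0 \<le> CX" "!!b t. b \<in> UU s' ==> norm (orb t s' b) \<le> CX * norm b * \<rho> e0 t" using orb_weighted by blast
 \<comment> \<open>\<open>N\<close> bounds the transport along orbits to time \<open>s'\<close>, from later and from earlier times, and is continuous.\<close>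
 define N where "N s = K * exp (\<beta> * \<bar>x s' - x s\<bar> + \<nu> * \<bar>x s\<bar>) + Kt * exp (a * \<bar>x s' - x s\<bar> + \<epsilon> * \<bar>x s\<bar>)" for s
 define H where "H w = CX * (N (fst w) * norm (snd w - orb (fst w) s' b')) * \<rho> e0 (fst w) + norm (ZZ s' b' (fst w) - ZZ s' b' s')" for w
 have transport: "norm (orb s' s c) \<le> N s * norm c" if c: "c \<in> UU s" for s c
 proof (cases "s \<le> s'")
  case True
  have "norm (orb s' s c) \<le> Kt * exp (a * (x s' - x s) + \<epsilon> * \<bar>x s\<bar>) * norm c"
   using TT_growth[OF True UU_C[OF c]] by (simp add: orb_forward[OF True] UU_C[OF c])
  also have "\<dots> \<le> N s * norm c" using x_mono[OF True] signs by (intro mult_right_mono) (auto simp: N_def)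
  finally show ?thesis .
 next
  case False
  have "norm (orb s' s c) \<le> K * exp (\<beta> * (x s' - x s) + \<nu> * \<bar>x s\<bar>) * norm c" using orb_bound[OF _ c] False by simp
  also have "\<dots> \<le> K * exp (\<beta> * \<bar>x s' - x s\<bar> + \<nu> * \<bar>x s\<bar>) * norm c"
   using signs pos by (intro mult_right_mono mult_left_mono) auto
  also have "\<dots> \<le> N s * norm c" using signs by (intro mult_right_mono) (auto simp: N_def)
  finally show ?thesis .
 qed
 have bound: "norm (eta w' - eta w) \<le> H w'" if "w' \<in> Sigma UNIV UU" for w'
 proof -
  obtain s b where w': "w' = (s, b)" and b: "b \<in> UU s" using \<open>w' \<in> Sigma UNIV UU\<close> by blast
  let ?b = "orb s' s b"
  have bU: "?b \<in> UU s'" by (rule orb_UU[OF b])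
  have "?b - b' = orb s' s (b - orb s s' b')"
   by (simp add: orb_diff b orb_UU[OF b'] orb_cocycle[OF b'] orb_self[OF b'])
  then have n: "norm (?b - b') \<le> N s * norm (b - orb s s' b')" using transport[OF UU_diff[OF b orb_UU[OF b']]] by simp
  have "norm (ZZ s' ?b s - ZZ s' b' s) \<le> 1/2 * (CX * norm (?b - b')) / (1 - 1/2) * \<rho> e0 s"
  proof (rule line.fp_shifted_lipschitz[OF \<rho>(1) orb_wpath[OF bU] orb_wpath[OF b']])
   show "norm (orb t s' ?b - orb t s' b') \<le> CX * norm (?b - b') * \<rho> e0 t" for t
    using CX(2)[OF UU_diff[OF bU b']] by (simp add: orb_diff[OF bU b'])
  qed (use CX in simp)
  also have "\<dots> = CX * norm (?b - b') * \<rho> e0 s" by simp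
  also have "\<dots> \<le> CX * (N s * norm (b - orb s s' b')) * \<rho> e0 s"
   using CX(1) n \<rho>(3)[of s] by (intro mult_right_mono mult_left_mono) auto
  finally have "norm (ZZ s b s - ZZ s' b' s) \<le> CX * (N s * norm (b - orb s s' b')) * \<rho> e0 s"
   unfolding ZZ_along_orbit[OF b] .
  moreover have "norm (ZZ s b s - ZZ s' b' s') \<le> norm (ZZ s b s - ZZ s' b' s) + norm (ZZ s' b' s - ZZ s' b' s')"
   using norm_triangle_ineq[of "ZZ s b s - ZZ s' b' s" "ZZ s' b' s - ZZ s' b' s'"] by simp
  ultimately show ?thesis by (simp add: H_def w w' eta b b')
 qed
 have "continuous_on UNIV H"
 proof -
  have o: "continuous_on UNIV (\<lambda>w::real \<times> 'n phase. orb (fst w) s' b')"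
   by (rule continuous_on_compose2[OF orb_continuous[OF b']]) (auto intro: continuous_intros)
  have z: "continuous_on UNIV (\<lambda>w::real \<times> 'n phase. ZZ s' b' (fst w))"
   by (rule continuous_on_compose2[OF line.wpathD(1)[OF perturbed_orbit(1)[OF b']]]) (auto intro: continuous_intros)
  have \<rho>c: "continuous_on UNIV (\<lambda>w::real \<times> 'n phase. \<rho> e0 (fst w))"
   unfolding \<rho>_def by (intro continuous_intros x_continuous_comp)
  show ?thesis unfolding H_def[abs_def] N_def by (intro continuous_intros x_continuous_comp o z \<rho>c)
 qed
 then have "isCont H w" using continuous_on_eq_continuous_at[OF open_UNIV, of H] by blast
 then have "(H \<longlongrightarrow> H w) (at w within Sigma UNIV UU)" unfolding isCont_def by (rule tendsto_within_subset) simp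
 moreover have "H w = 0" unfolding H_def w fst_conv snd_conv orb_self[OF b'] by simp
 ultimately have H0: "(H \<longlongrightarrow> 0) (at w within Sigma UNIV UU)" by simp
 have "\<forall>\<^sub>F w' in at w within Sigma UNIV UU. norm (eta w' - eta w) \<le> H w'"
  unfolding eventually_at_filter using bound by (intro always_eventually allI impI)
 from Lim_null_comparison[OF this H0] show "(eta \<longlongrightarrow> eta w) (at w within Sigma UNIV UU)" by (rule Lim_null[THEN iffD2])
qed

lemma eta_M: "eta \<in> M r P"
 unfolding M_def
proof (intro CollectI conjI eta_continuous)
 show "eta \<in> Sigma UNIV UU \<rightarrow>\<^sub>E C r" unfolding eta_def using perturbed_orbit(3) by auto
 show "bounded (eta ` Sigma UNIV UU)" unfolding bounded_iff using perturbed_orbit(8) by (intro exI[of _ "1/4"]) (auto simp: eta)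
qed

text \<open>A full orbit of the perturbed equation is pieced together from solutions on half-lines.\<close>

lemma R_orbit_mild:
 assumes R: "!!u t. u \<le> t ==> y t = R r \<zeta> g t u (y u)" and C: "!!t. y t \<in> C r"
 shows "continuous_on UNIV y" "u \<le> t ==> y t = W t u (y u) (\<lambda>v. g v (y v))"
proof -
 have piece: "\<exists>Y. continuous_on UNIV Y \<and> (\<forall>t. Y t \<in> C r) \<and> (\<forall>t\<ge>u. Y t = y t) \<and> (\<forall>t\<ge>u. Y t = W t u (y u) (\<lambda>v. g v (Y v)))" for u
  using R_mild[OF C, of u u] R[of u] by metis
 have "isCont y t" for t
 proof -
  obtain Y where Y: "continuous_on UNIV Y" "!!w. t - 1 \<le> w ==> Y w = y w" using piece[of "t - 1"] by blast
  have "continuous_on {t - 1<..} y"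
   by (rule continuous_on_eq[OF continuous_on_subset[OF Y(1)]]) (use Y(2) in auto)
  then show ?thesis using continuous_on_eq_continuous_at[OF open_greaterThan, of "t - 1" y] by simp
 qed
 then show y: "continuous_on UNIV y" by (simp add: continuous_on_eq_continuous_at)
 assume ut: "u \<le> t"
 obtain Y where Y: "continuous_on UNIV Y" "!!t. Y t \<in> C r" "!!t. u \<le> t ==> Y t = y t"
  "Y t = W t u (y u) (\<lambda>v. g v (Y v))" using piece[of u] ut by blast
 have "W t u (y u) (\<lambda>v. g v (Y v)) = W t u (y u) (\<lambda>v. g v (y v))"
  by (rule W_forcing_cong[OF forcing_continuous[OF g_path_continuous[OF Y(1,2)]] forcing_continuous[OF g_path_continuous[OF y C]]])
   (simp add: Y(3))
 then show "y t = W t u (y u) (\<lambda>v. g v (y v))" using Y(3)[OF ut] Y(4) by simp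
qed

text \<open>
  A conjugacy carries full orbits to full orbits, so its displacement along an orbit is a bounded solution of
  the forced equation, hence the fixed point.
\<close>

lemma eta_unique:
 assumes \<eta>: "\<eta> \<in> M r P" and conj: "conjugates r \<zeta> g P (\<lambda>t b. b + \<eta> (t, b))"
 shows "\<eta> = eta"
proof
 fix w
 have ext: "\<eta> \<in> Sigma UNIV UU \<rightarrow>\<^sub>E C r" and bdd: "bounded (\<eta> ` Sigma UNIV UU)" using \<eta> by (auto simp: M_def)
 show "\<eta> w = eta w"
 proof (cases "w \<in> Sigma UNIV UU")
  case False
  then show ?thesis using PiE_arb[OF ext False] by (simp only: eta_def restrict_apply if_False)
 next
  case True
  then obtain s b where w: "w = (s, b)" and b: "b \<in> UU s" by blast
  obtain B where B: "!!t c. c \<in> UU t ==> norm (\<eta> (t, c)) \<le> B" using bdd unfolding bounded_iff by fastforce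
  define z where "z t = \<eta> (t, orb t s b)" for t
  define y where "y t = orb t s b + z t" for t
  note oU = orb_UU[OF b] and oC = UU_C[OF orb_UU[OF b]]
  have zC: "z t \<in> C r" for t unfolding z_def using ext oU by auto
  have yC: "y t \<in> C r" for t unfolding y_def by (rule C_add[OF oC zC])
  have R: "y t = R r \<zeta> g t u (y u)" if ut: "u \<le> t" for u t
  proof -
   have "T r \<zeta> t u (orb u s b) = orb t s b" using T_eq[OF oC ut] orb_evolves[OF b ut] by simp
   then show ?thesis using conj ut oU[of u] unfolding conjugates_def y_def z_def by metis
  qed
  define f where "f v = g v (y v)" for v
  have mild: "y t = W t u (y u) f" if "u \<le> t" for u t
   unfolding f_def[abs_def] by (rule R_orbit_mild(2)) (use R yC that in blast)+
  have "continuous_on UNIV y" by (rule R_orbit_mild(1)) (use R yC in blast)+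
  then have fc: "continuous_on UNIV f" unfolding f_def[abs_def] by (rule g_path_continuous[OF _ yC])
  note ff = forcing_continuous[OF fc]
  have "norm (f \<sigma>) \<le> \<delta> * dens \<sigma>" for \<sigma> unfolding f_def using g_bounded[OF yC] by (simp add: dens_def)
  note bf = bounded_force[OF fc this]
  have zmild: "z t = W t u (z u) f" if ut: "u \<le> t" for u t
  proof -
   have "z t = y t - orb t s b" by (simp add: y_def)
   also have "\<dots> = W t u (y u) f - orb t s b" by (simp only: mild[OF ut])
   also have "\<dots> = TT t u (y u) - TT t u (orb u s b) + W t u 0 f"
    unfolding W_split[OF ff, of t u "y u"] orb_evolves[OF b ut] by simp
   also have "TT t u (y u) - TT t u (orb u s b) = TT t u (z u)" unfolding TT_diff[symmetric] y_def by simp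
   finally show ?thesis using W_split[OF ff, of t u "z u"] by simp
  qed
  have zB: "norm (z t) \<le> B" for t unfolding z_def by (rule B[OF oU])
  have zb: "z t = bsol f t" for t by (rule bsol_unique[OF bf(1) zmild zC zB bf(2)])
  have B0: "0 \<le> B" using zB[of 0] norm_ge_zero[of "z 0"] by linarith
  have zw: "line.wpath (\<rho> e0) z"
   unfolding line.wpath_def
  proof (intro conjI allI exI[of _ B])
   show "continuous_on UNIV z" by (rule mild_continuous[OF ff zmild])
   show "norm (z t) \<le> B * \<rho> e0 t" for t using zB[of t] mult_left_mono[OF \<rho>(3)[of t] B0] by simp
  qed (use zC B0 in auto)
  have "(\<lambda>t. g t (orb t s b + z t)) = f" by (simp only: f_def[abs_def] y_def)
  then have "z s = ZZ s b s"
   by (intro line.fp_shifted_unique[OF \<rho>(1) orb_wpath[OF b] zw]) (simp only: zb[symmetric])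
  then show ?thesis by (simp add: w z_def eta b orb_self)
 qed
qed

section \<open>The equation on a half-line and the left inverse\<close>

text \<open>
  Forced solutions of the initial value problem at \<open>t0\<close>. Paths on \<open>[t0, \<infinity>)\<close> are extended by constants so that the
  abstract theorem for paths on the line applies.
\<close>

definition half_G :: "real => (real => real ^ 'n) => real => 'n phase" where
 "half_G t0 f t = W (max t t0) t0 0 f"

definition m1 :: real where "m1 = 2 * Kt * \<delta> / (\<xi> + \<epsilon>)"

text \<open>
  The second factor increases with \<open>t\<close> towards \<open>1\<close>. Its logarithmic derivative is twice the constant of the growth
  estimate, so that forward integration is a contraction with constant \<open>1 / 2\<close> whatever the size of \<open>\<delta>\<close>.
\<close>

definition half_weight :: "real => real => real => real" where
 "half_weight t0 e t = exp (e * x (max t t0)) * exp (- (m1 * exp (- ((\<xi> + \<epsilon>) * x (max t t0)))))"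

definition half_weights :: "real => (real => real) set" where
 "half_weights t0 = {\<rho>. \<exists>e\<ge>a. \<rho> = half_weight t0 e}"

lemma half_weight_pos: "0 < half_weight t0 e t"
 by (simp add: half_weight_def)

lemma half_weight_continuous: "continuous_on UNIV (half_weight t0 e)"
 unfolding half_weight_def[abs_def] by (intro continuous_intros x_continuous_comp)

lemma half_bound:
 assumes t: "t0 \<le> t" and f: "continuous_on UNIV f" and e: "a \<le> e" and c: "0 \<le> c"
  and bd: "!!\<sigma>. t0 \<le> \<sigma> ==> norm (f \<sigma>) \<le> c * (k \<sigma> * half_weight t0 e \<sigma>)"
 shows "norm (W t t0 0 f) \<le> 1 / 2 * c * half_weight t0 e t"
proof (cases "t = t0")
 case True
 then show ?thesis using c half_weight_pos[of t0 e t] by (simp add: W_zero_time[OF forcing_continuous[OF f]])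
next
 case False
 let ?c = "\<xi> + \<epsilon>"
 have c1: "0 < ?c" using \<xi> pos by simp
 define Z where "Z \<sigma> = exp (- (m1 * exp (- (?c * x \<sigma>))))" for \<sigma>
 define A where "A = Kt * c * \<delta> * exp (e * x t)"
 have A0: "0 \<le> A" using pos c by (simp add: A_def)
 define H where "H \<sigma> = c / 2 * exp (e * x t) * Z \<sigma>" for \<sigma>
 have "norm (W t t0 0 f) \<le> integral {t0..t} (\<lambda>\<sigma>. growth_kernel t \<sigma> * norm (f \<sigma>))"
  using forced_growth_bound[OF _ f order_refl, of t0 t] False t W_restrict[OF f, of t t0] by simp
 also have "\<dots> \<le> H t - H t0"
 proof (rule integral_le_increment[OF t])
  show "(\<lambda>\<sigma>. growth_kernel t \<sigma> * norm (f \<sigma>)) integrable_on {t0..t}"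
   by (intro integrable_continuous_real continuous_intros kernels_continuous continuous_on_subset[OF f]) simp
  \<comment> \<open>By the choice of \<open>m1\<close>, differentiating \<open>Z\<close> produces the factor \<open>2 * Kt * \<delta>\<close>.\<close>
  have dZ: "(Z has_real_derivative x' \<sigma> * (m1 * ?c) * exp (- (?c * x \<sigma>)) * Z \<sigma>) (at \<sigma>)" for \<sigma>
   unfolding Z_def by (auto intro!: derivative_eq_intros x_deriv simp: algebra_simps)
  have "(H has_real_derivative c / 2 * exp (e * x t) * (x' \<sigma> * (m1 * ?c) * exp (- (?c * x \<sigma>)) * Z \<sigma>)) (at \<sigma>)" for \<sigma>
   unfolding H_def by (intro DERIV_cmult dZ)
  moreover have m1: "m1 * ?c = 2 * Kt * \<delta>" using c1 by (simp add: m1_def)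
  have "c / 2 * exp (e * x t) * (x' \<sigma> * (m1 * ?c) * exp (- (?c * x \<sigma>)) * Z \<sigma>) = A * x' \<sigma> * Z \<sigma> * exp (- (?c * x \<sigma>))" for \<sigma>
   unfolding m1 A_def by simp
  ultimately show "(H has_real_derivative A * x' \<sigma> * Z \<sigma> * exp (- (?c * x \<sigma>))) (at \<sigma>)" for \<sigma>
   by (simp only:)
  fix \<sigma> assume \<sigma>: "\<sigma> \<in> {t0..t}"
  have Z0: "0 \<le> Z \<sigma>" by (simp add: Z_def)
  have "(e - a) * x \<sigma> \<le> (e - a) * x t" using e x_mono[of \<sigma> t] \<sigma> by (intro mult_left_mono) auto
  then have 1: "exp (a * (x t - x \<sigma>)) * exp (e * x \<sigma>) \<le> exp (e * x t)"
   by (simp add: exp_add[symmetric] algebra_simps)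
  have 2: "exp (\<epsilon> * \<bar>x \<sigma>\<bar>) * exp (- ((\<gamma> + \<epsilon>) * \<bar>x \<sigma>\<bar>)) \<le> 1" using \<gamma> signs by (intro exp_cancel) auto
  have 3: "exp (- (?c * \<bar>x \<sigma>\<bar>)) \<le> exp (- (?c * x \<sigma>))" using c1 by simp
  have hw: "half_weight t0 e \<sigma> = exp (e * x \<sigma>) * Z \<sigma>" using \<sigma> by (simp add: half_weight_def Z_def)
  have "growth_kernel t \<sigma> * norm (f \<sigma>) \<le> growth_kernel t \<sigma> * (c * (k \<sigma> * half_weight t0 e \<sigma>))"
   using \<sigma> bd kernels_nonneg by (intro mult_left_mono) auto
  also have "\<dots> = (Kt * c * \<delta> * x' \<sigma> * Z \<sigma>) * ((exp (a * (x t - x \<sigma>)) * exp (e * x \<sigma>)) *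
    ((exp (\<epsilon> * \<bar>x \<sigma>\<bar>) * exp (- ((\<gamma> + \<epsilon>) * \<bar>x \<sigma>\<bar>))) * exp (- (?c * \<bar>x \<sigma>\<bar>))))"
   unfolding hw by (simp only: growth_kernel_def k_def dens_def exp_add mult_ac)
  also have "\<dots> \<le> (Kt * c * \<delta> * x' \<sigma> * Z \<sigma>) * (exp (e * x t) * (1 * exp (- (?c * x \<sigma>))))"
   using pos c x'_nonneg Z0 by (intro mult_left_mono mult_mono 1 2 3 mult_nonneg_nonneg) auto
  also have "\<dots> = A * x' \<sigma> * Z \<sigma> * exp (- (?c * x \<sigma>))" by (simp add: A_def mult_ac)
  finally show "growth_kernel t \<sigma> * norm (f \<sigma>) \<le> A * x' \<sigma> * Z \<sigma> * exp (- (?c * x \<sigma>))" .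
 qed
 also have "\<dots> \<le> H t" using c by (simp add: H_def Z_def)
 also have "\<dots> = 1 / 2 * c * half_weight t0 e t" using t by (simp add: H_def Z_def half_weight_def)
 finally show ?thesis .
qed

lemma half_problem: "weighted_problem (C r) g D2g k \<Lambda> (1/2) (half_G t0) (half_weights t0)"
proof (rule weighted_problem.intro, goal_cases)
 case (14 \<rho>) then show ?case by (auto simp: half_weights_def half_weight_continuous)
next
 case (15 \<rho> t) then show ?case by (auto simp: half_weights_def half_weight_pos)
next
 case (16 \<rho> f c)
 then obtain e where e: "a \<le> e" "\<rho> = half_weight t0 e" unfolding half_weights_def by blast
 note ff = forcing_continuous[OF 16(2)]
 have "continuous_on UNIV (half_G t0 f)"
  unfolding half_G_def[abs_def] by (rule continuous_on_compose2[OF W_continuous[OF ff]]) (auto intro!: continuous_intros)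
 moreover have "norm (half_G t0 f t) \<le> 1 / 2 * c * \<rho> t" for t
 proof -
  have "norm (W (max t t0) t0 0 f) \<le> 1 / 2 * c * half_weight t0 e (max t t0)"
   using half_bound[OF _ 16(2) e(1) 16(3), of t0 "max t t0"] 16(4) unfolding e(2) by simp
  then show ?thesis by (simp add: half_G_def e(2) half_weight_def)
 qed
 ultimately show ?case using W_C[OF ff] by (simp add: half_G_def)
next
 case (17 \<rho> f h c c1 c2 t)
 then show ?case unfolding half_G_def by (intro W_forced_combine forcing_continuous)
qed (use problem_data g_zero D2g_path D2g_deriv D2g_bound k_nonneg pos in auto)

lemma half_dominates:
 assumes t: "t0 \<le> t"
 shows "exp (e * x t) \<le> exp (m1 * exp (- ((\<xi> + \<epsilon>) * x t0))) * half_weight t0 e t"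
proof -
 have "m1 * exp (- ((\<xi> + \<epsilon>) * x t)) \<le> m1 * exp (- ((\<xi> + \<epsilon>) * x t0))"
  using x_mono[OF t] pos \<xi> by (intro mult_left_mono) (auto simp: m1_def)
 then have "1 \<le> exp (m1 * exp (- ((\<xi> + \<epsilon>) * x t0))) * exp (- (m1 * exp (- ((\<xi> + \<epsilon>) * x t))))"
  by (simp add: exp_add[symmetric])
 from mult_left_mono[OF this, of "exp (e * x t)"] show ?thesis using t by (simp add: half_weight_def mult_ac)
qed

lemma half_family:
 "\<exists>CX Cp. weighted_family (C r) g D2g k \<Lambda> (1/2) (half_G t0) (half_weights t0) (C r) (\<lambda>\<phi> t. TT (max t t0) t0 \<phi>)
   (half_weight t0 e0) (half_weight t0 e1) p CX Cp"
proof -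
 define E where "E = exp (m1 * exp (- ((\<xi> + \<epsilon>) * x t0)))"
 define CX where "CX = Kt * exp (- e0 * x t0 + \<epsilon> * \<bar>x t0\<bar>) * E"
 define Cp where "Cp = 1 + exp ((e0 - e1) * x t0)"
 have CX: "0 \<le> CX" and Cp: "0 \<le> Cp" using pos by (auto simp: CX_def E_def Cp_def intro: add_nonneg_nonneg)
 have bound: "norm (TT (max t t0) t0 \<phi>) \<le> CX * norm \<phi> * half_weight t0 e0 t" if \<phi>: "\<phi> \<in> C r" for \<phi> t
 proof -
  define u where "u = max t t0"
  have u: "t0 \<le> u" and hw: "half_weight t0 e0 u = half_weight t0 e0 t" by (auto simp: u_def half_weight_def)
  have "norm (TT u t0 \<phi>) \<le> Kt * exp (a * (x u - x t0) + \<epsilon> * \<bar>x t0\<bar>) * norm \<phi>" by (rule TT_growth[OF u \<phi>])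
  also have "\<dots> \<le> Kt * exp (e0 * (x u - x t0) + \<epsilon> * \<bar>x t0\<bar>) * norm \<phi>"
  proof -
   have "a * (x u - x t0) \<le> e0 * (x u - x t0)" using x_mono[OF u] exponents by (intro mult_right_mono) auto
   then show ?thesis using pos by (intro mult_right_mono mult_left_mono) auto
  qed
  also have "\<dots> = (Kt * exp (- e0 * x t0 + \<epsilon> * \<bar>x t0\<bar>) * norm \<phi>) * exp (e0 * x u)"
   by (simp add: exp_add[symmetric] algebra_simps)
  also have "\<dots> \<le> (Kt * exp (- e0 * x t0 + \<epsilon> * \<bar>x t0\<bar>) * norm \<phi>) * (E * half_weight t0 e0 u)"
   unfolding E_def using pos by (intro mult_left_mono half_dominates u) auto
  finally show ?thesis unfolding hw by (simp add: CX_def u_def mult_ac)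
 qed
 have le: "half_weight t0 e0 t \<le> Cp * half_weight t0 e1 t" for t
 proof -
  define u where "u = max t t0"
  define Z where "Z = exp (- (m1 * exp (- ((\<xi> + \<epsilon>) * x u))))"
  have "(e0 - e1) * x u \<le> (e0 - e1) * x t0" using exponents x_mono[of t0 u] by (intro mult_left_mono_neg) (auto simp: u_def)
  then have "exp (e0 * x u) \<le> exp ((e0 - e1) * x t0) * exp (e1 * x u)" by (simp add: exp_add[symmetric] algebra_simps)
  also have "\<dots> \<le> Cp * exp (e1 * x u)" by (simp add: Cp_def)
  finally have "exp (e0 * x u) * Z \<le> Cp * exp (e1 * x u) * Z" by (intro mult_right_mono) (auto simp: Z_def)
  then show ?thesis by (simp add: half_weight_def u_def Z_def)
 qed
 have powr: "half_weight t0 e0 t powr p * half_weight t0 e0 t \<le> Cp * half_weight t0 e1 t" for t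
 proof -
  define u where "u = max t t0"
  define q where "q = m1 * exp (- ((\<xi> + \<epsilon>) * x u))"
  have q: "0 \<le> q" using pos \<xi> by (simp add: q_def m1_def)
  have h: "half_weight t0 e t = exp (e * x u - q)" for e by (simp add: half_weight_def u_def q_def exp_add[symmetric])
  have "half_weight t0 e0 t powr p * half_weight t0 e0 t = exp ((e0 * x u - q) * p + (e0 * x u - q))"
   unfolding h by (simp add: exp_powr_real exp_add)
  also have "(e0 * x u - q) * p + (e0 * x u - q) = e1 * x u - q - q * p" by (simp add: e1_def algebra_simps)
  also have "exp (e1 * x u - q - q * p) \<le> exp (e1 * x u - q)" using q exponents by simp
  also have "\<dots> \<le> Cp * half_weight t0 e1 t" unfolding h by (simp add: Cp_def)
  finally show ?thesis .
 qed
 have W: "half_weight t0 e0 \<in> half_weights t0" "half_weight t0 e1 \<in> half_weights t0"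
  using exponents order_trans[OF exponents(4,5)] unfolding half_weights_def by blast+
 have cont: "continuous_on UNIV (\<lambda>t. TT (max t t0) t0 \<phi>)" for \<phi>
  by (rule continuous_on_compose2[OF W_continuous[OF forcing_0]]) (auto intro!: continuous_intros)
 have comb: "TT (max t t0) t0 (u *\<^sub>R b + v *\<^sub>R c) = u *\<^sub>R TT (max t t0) t0 b + v *\<^sub>R TT (max t t0) t0 c" for t u v b c
  by (rule TT_combine)
 have "weighted_family (C r) g D2g k \<Lambda> (1/2) (half_G t0) (half_weights t0) (C r) (\<lambda>\<phi> t. TT (max t t0) t0 \<phi>)
   (half_weight t0 e0) (half_weight t0 e1) p CX Cp"
  by (intro weighted_family.intro half_problem weighted_family_axioms.intro;
    rule subspace_C W cont TT_C bound comb CX exponents(1) exponents(2) Cp le powr; assumption?)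
 then show ?thesis by blast
qed

lemma bounded_linear_QQ: "bounded_linear (\<lambda>\<phi>. QQ s (retr \<phi>))"
proof -
 interpret retr: bounded_linear retr by (rule bounded_linear_retr)
 obtain B where B: "!!\<phi>. norm (retr \<phi>) \<le> norm \<phi> * B" using retr.bounded by blast
 show ?thesis
 proof (rule bounded_linear_intro)
  show "QQ s (retr (\<phi> + \<psi>)) = QQ s (retr \<phi>) + QQ s (retr \<psi>)" for \<phi> \<psi> by (simp add: retr.add QQ_add retr_C)
  show "QQ s (retr (c *\<^sub>R \<phi>)) = c *\<^sub>R QQ s (retr \<phi>)" for c \<phi>
   using QQ_combine[OF retr_C retr_C, of s c \<phi> 0 \<phi>] by (simp add: retr.scaleR)
  fix \<phi>
  have "norm (QQ s (retr \<phi>)) \<le> K * exp (\<nu> * \<bar>x s\<bar>) * norm (retr \<phi>)" by (rule QQ_norm[OF retr_C])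
  also have "\<dots> \<le> K * exp (\<nu> * \<bar>x s\<bar>) * (norm \<phi> * B)" using signs by (intro mult_left_mono B) auto
  finally show "norm (QQ s (retr \<phi>)) \<le> norm \<phi> * (K * exp (\<nu> * \<bar>x s\<bar>) * B)" by (simp add: mult_ac)
 qed
qed

text \<open>
  Forces of size \<open>k\<close> times the weight with exponent \<open>e1\<close> grow with exponent \<open>e1 - (\<xi> + \<epsilon>) < \<beta>\<close>, so the unstable
  kernel integrates them.
\<close>

lemma half_unstable:
 assumes f: "continuous_on UNIV f" and c: "0 \<le> c" and bd: "!!\<sigma>. norm (f \<sigma>) \<le> c * (k \<sigma> * half_weight t0 e1 \<sigma>)"
 shows "unstable_adm f t0 (D * \<delta> * exp ((e1 - (\<xi> + \<epsilon>)) * x t0) / (\<beta> - (e1 - (\<xi> + \<epsilon>))) * c)"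
proof -
 let ?b = "e1 - (\<xi> + \<epsilon>)"
 have "unstable_adm f t0 (D * (0 / \<beta> + c * \<delta> * exp (?b * x t0) / (\<beta> - ?b)))"
 proof (rule unstable_integral[OF f])
  show "?b < \<beta>" "0 \<le> c * \<delta>" "(0::real) \<le> 0" using exponents c pos by auto
  fix \<sigma> assume \<sigma>: "t0 \<le> \<sigma>"
  have c1: "0 < \<xi> + \<epsilon>" using pos \<xi> by simp
  have "half_weight t0 e1 \<sigma> \<le> exp (e1 * x \<sigma>)"
   using \<sigma> pos c1 by (simp add: half_weight_def m1_def mult_le_cancel_left1)
  moreover have "exp (- ((\<xi> + \<epsilon>) * \<bar>x \<sigma>\<bar>)) \<le> exp (- ((\<xi> + \<epsilon>) * x \<sigma>))" using c1 by simp
  ultimately have "exp (- ((\<xi> + \<epsilon>) * \<bar>x \<sigma>\<bar>)) * half_weight t0 e1 \<sigma> \<le> exp (- ((\<xi> + \<epsilon>) * x \<sigma>)) * exp (e1 * x \<sigma>)"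
   using half_weight_pos[of t0 e1 \<sigma>] by (intro mult_mono) auto
  also have "\<dots> = exp (?b * x \<sigma>)" by (simp add: exp_add[symmetric] algebra_simps)
  finally have "(c * \<delta> * dens \<sigma>) * (exp (- ((\<xi> + \<epsilon>) * \<bar>x \<sigma>\<bar>)) * half_weight t0 e1 \<sigma>) \<le> (c * \<delta> * dens \<sigma>) * exp (?b * x \<sigma>)"
   using c pos dens_nonneg[of \<sigma>] by (intro mult_left_mono) auto
  then show "norm (f \<sigma>) \<le> dens \<sigma> * (0 + c * \<delta> * exp (?b * x \<sigma>))" using bd[of \<sigma>] by (simp add: k_def mult_ac)
 qed
 then show ?thesis by (simp add: mult_ac)
qed

text \<open>
  The unstable part of the fixed point at \<open>t0\<close> is recovered from the forward solution alone; subtracting it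
  leaves \<open>b\<close>.
\<close>

lemma smooth_left_inverse:
 "\<exists>h. C1_on (C r) (C r) h \<and> h ` C r \<subseteq> UU t0 \<and> (\<forall>b\<in>UU t0. h (b + ZZ t0 b t0) = b)"
proof -
 obtain CX Cp where fam: "weighted_family (C r) g D2g k \<Lambda> (1/2) (half_G t0) (half_weights t0) (C r) (\<lambda>\<phi> t. TT (max t t0) t0 \<phi>)
   (half_weight t0 e0) (half_weight t0 e1) p CX Cp" using half_family by blast
 interpret half: weighted_family "C r" g D2g k \<Lambda> "1/2" "half_G t0" "half_weights t0" "C r" "\<lambda>\<phi> t. TT (max t t0) t0 \<phi>"
  "half_weight t0 e0" "half_weight t0 e1" p CX Cp by (rule fam)
 define h where "h \<phi> = QQ t0 \<phi> + unstable_sol (half.force \<phi>) t0" for \<phi>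
 have tameU: "\<exists>B. unstable_adm f t0 B" if "half.tame (half_weight t0 e1) f" for f
  using that half_unstable[of f _ t0] unfolding half.tame_def by blast
 have "C1_on (C r) (C r) h"
 proof (rule half.observed_force_C1[OF bounded_linear_retr retr_C retr_id bounded_linear_QQ[of t0], where \<Xi> = "\<lambda>f. unstable_sol f t0"])
  show "h \<phi> = QQ t0 (retr \<phi>) + unstable_sol (half.force \<phi>) t0" if "\<phi> \<in> C r" for \<phi> by (simp add: h_def retr_id that)
  show "unstable_sol (\<lambda>t. c1 *\<^sub>R f t + c2 *\<^sub>R f' t) t0 = c1 *\<^sub>R unstable_sol f t0 + c2 *\<^sub>R unstable_sol f' t0"
   if "half.tame (half_weight t0 e1) f" "half.tame (half_weight t0 e1) f'" for f f' c1 c2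
  proof -
   note tame = that
   obtain B1 where "unstable_adm f t0 B1" using tameU[OF tame(1)] by blast
   moreover obtain B2 where "unstable_adm f' t0 B2" using tameU[OF tame(2)] by blast
   ultimately show ?thesis using tame by (intro unstable_sol_combine) (auto simp: half.tame_def)
  qed
  show "norm (unstable_sol f t0) \<le> D * \<delta> * exp ((e1 - (\<xi> + \<epsilon>)) * x t0) / (\<beta> - (e1 - (\<xi> + \<epsilon>))) * c"
   if "continuous_on UNIV f" "0 \<le> c" "!!t. norm (f t) \<le> c * (k t * half_weight t0 e1 t)" for f c
   by (rule unstable_sol_lim(2)[OF that(1) half_unstable[OF that]])
 qed
 moreover have "h ` C r \<subseteq> UU t0"
 proof
  fix u assume "u \<in> h ` C r"
  then obtain \<phi> where \<phi>: "\<phi> \<in> C r" "u = h \<phi>" by blast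
  have t: "half.tame (half_weight t0 e1) (half.force \<phi>)" by (rule half.tame_mono[OF half.z_props(3)[OF \<phi>(1)]])
  then obtain B where B: "unstable_adm (half.force \<phi>) t0 B" using tameU by blast
  have "continuous_on UNIV (half.force \<phi>)" using t by (simp add: half.tame_def)
  from unstable_sol_lim(3)[OF this B] show "u \<in> UU t0" unfolding \<phi>(2) h_def by (intro UU_add QQ_in_UU \<phi>(1))
 qed
 moreover have "h (b + ZZ t0 b t0) = b" if b: "b \<in> UU t0" for b
 proof -
  note orbit = perturbed_orbit[OF b]
  let ?f = "FF t0 b" and ?\<phi> = "YY t0 b t0"
  note ff = forcing_continuous[OF orbit(5)]
  have \<phi>C: "?\<phi> \<in> C r" by (rule orbit(4))
  have forward: "YY t0 b (max t t0) = TT (max t t0) t0 ?\<phi> + half_G t0 ?f t" for t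
   using orbit(9)[of t0 "max t t0"] W_split[OF ff, of "max t t0" t0 ?\<phi>] by (simp add: half_G_def)
  have Xw: "half.wpath (half_weight t0 e0) (\<lambda>t. TT (max t t0) t0 ?\<phi>)" by (rule half.X_wpath[OF \<phi>C])
  have Yw: "half.wpath (half_weight t0 e0) (\<lambda>t. YY t0 b (max t t0))"
  proof -
   obtain B where B: "0 \<le> B" "!!t. norm (YY t0 b t) \<le> B * \<rho> e0 t" using orbit(2) unfolding line.wpath_def by blast
   define E where "E = (exp (- e0 * x t0) + \<iota> e0) * exp (m1 * exp (- ((\<xi> + \<epsilon>) * x t0)))"
   have E: "\<rho> e0 u \<le> E * half_weight t0 e0 u" if u: "t0 \<le> u" for u
   proof -
    have "0 \<le> e0 * (x u - x t0)" using exponents x_mono[OF u] by simp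
    then have "1 \<le> exp (- e0 * x t0) * exp (e0 * x u)" by (simp add: exp_add[symmetric] algebra_simps)
    then have "\<rho> e0 u \<le> (exp (- e0 * x t0) + \<iota> e0) * exp (e0 * x u)" by (simp add: \<rho>_def distrib_right)
    also have "\<dots> \<le> (exp (- e0 * x t0) + \<iota> e0) * (exp (m1 * exp (- ((\<xi> + \<epsilon>) * x t0))) * half_weight t0 e0 u)"
     using \<iota> by (intro mult_left_mono half_dominates u) (auto intro: add_nonneg_nonneg less_imp_le)
    finally show ?thesis by (simp add: E_def mult.assoc)
   qed
   have "norm (YY t0 b (max t t0)) \<le> (B * E) * half_weight t0 e0 t" for t
   proof -
    have "norm (YY t0 b (max t t0)) \<le> B * \<rho> e0 (max t t0)" by (rule B(2))
    also have "\<dots> \<le> B * (E * half_weight t0 e0 (max t t0))" using B(1) by (intro mult_left_mono E) auto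
    finally show ?thesis by (simp add: half_weight_def mult_ac)
   qed
   moreover have "0 \<le> B * E" using B(1) \<iota> by (auto simp: E_def intro!: mult_nonneg_nonneg add_nonneg_nonneg)
   moreover have "continuous_on UNIV (\<lambda>t. YY t0 b (max t t0))"
    by (rule continuous_on_compose2[OF line.wpathD(1)[OF orbit(2)]]) (auto intro!: continuous_intros)
   ultimately show ?thesis unfolding half.wpath_def using orbit(4) by blast
  qed
  have G_eq: "half_G t0 ?f = (\<lambda>t. 1 *\<^sub>R YY t0 b (max t t0) + (-1) *\<^sub>R TT (max t t0) t0 ?\<phi>)" using forward by auto
  have Gw: "half.wpath (half_weight t0 e0) (half_G t0 ?f)" unfolding G_eq by (rule half.wpath_combine[OF Yw Xw])
  \<comment> \<open>The force along the path that is frozen before \<open>t0\<close>; from \<open>t0\<close> on it is the force along the full orbit.\<close>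
  define f' where "f' t = g t (YY t0 b (max t t0))" for t
  have f'c: "continuous_on UNIV f'" unfolding f'_def[abs_def] using half.wpathD[OF Yw] by (intro g_path_continuous) auto
  have ff': "f' t = ?f t" if "t0 \<le> t" for t using that by (simp add: f'_def FF_def)
  have "half_G t0 ?f t = half_G t0 f' t" for t
   unfolding half_G_def by (rule W_forcing_cong[OF ff forcing_continuous[OF f'c]]) (simp add: ff')
  moreover have "(\<lambda>t. g t (TT (max t t0) t0 ?\<phi> + half_G t0 ?f t)) = f'" by (simp only: f'_def[abs_def] forward)
  ultimately have "half_G t0 ?f t = half.z ?\<phi> t" for t
   by (intro half.fp_shifted_unique[OF half.\<rho> Xw Gw]) (simp only:)
  then have "half.force ?\<phi> = f'" by (simp add: fun_eq_iff half.force_def half.y_def f'_def forward)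
  moreover have "unstable_sol f' t0 = unstable_sol ?f t0" by (rule unstable_sol_cong[OF f'c orbit(5) ff'])
  moreover have "QQ t0 (ZZ t0 b t0) = - unstable_sol ?f t0" using QQ_bsol[OF orbit(6), of t0] orbit(7)[of t0] by simp
  moreover have "?\<phi> = b + ZZ t0 b t0" by (simp add: YY_def orb_self[OF b])
  ultimately show ?thesis using orbit(3) by (simp add: h_def QQ_add UU_C[OF b] QQ_UU[OF b])
 qed
 ultimately show ?thesis by blast
qed

section \<open>The conjugacy is a diffeomorphism\<close>

lemma eta_C1: "C1_on (UU t) (UU t) (\<lambda>b. b + eta (t, b))"
proof -
 obtain CX Cp where fam: "weighted_family (C r) g D2g k \<Lambda> (1/2) bsol line_weights (UU t) (\<lambda>b \<tau>. orb \<tau> t b) (\<rho> e0) (\<rho> e1) p CX Cp"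
  using line_family by blast
 interpret fam: weighted_family "C r" g D2g k \<Lambda> "1/2" bsol line_weights "UU t" "\<lambda>b \<tau>. orb \<tau> t b" "\<rho> e0" "\<rho> e1" p CX Cp by (rule fam)
 show ?thesis
 proof (rule fam.observed_force_C1[where pr = "\<lambda>\<phi>. QQ t (retr \<phi>)" and A = "\<lambda>b. b" and \<Xi> = "\<lambda>f. bsol f t", OF bounded_linear_QQ])
  show "QQ t (retr \<phi>) \<in> UU t" for \<phi> by (rule QQ_in_UU[OF retr_C])
  show "QQ t (retr b) = b" if "b \<in> UU t" for b using that by (simp add: retr_id UU_C QQ_UU)
  show "bounded_linear (\<lambda>b::'n phase. b)" by (rule bounded_linear_ident)
  show "b + eta (t, b) = b + bsol (fam.force b) t" if "b \<in> UU t" for b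
   using fam.z_props(4)[OF that, of t] by (simp add: eta that)
  show "bsol (\<lambda>t. c1 *\<^sub>R f t + c2 *\<^sub>R h t) t = c1 *\<^sub>R bsol f t + c2 *\<^sub>R bsol h t"
   if "line.tame (\<rho> e1) f" "line.tame (\<rho> e1) h" for f h c1 c2
   by (rule line.tame_combine(2)[OF \<rho>(2) that])
  show "norm (bsol f t) \<le> \<rho> e1 t / 2 * c"
   if "continuous_on UNIV f" "0 \<le> c" "!!t. norm (f t) \<le> c * (k t * \<rho> e1 t)" for f c
   using bsol_weighted(2)[OF \<rho>(2) that, of t] by (simp add: mult_ac)
 qed
qed

lemma eta_diffeo: "C1_diffeo_onto_image (C r) (UU t) (\<lambda>b. b + eta (t, b))"
proof -
 obtain h where h: "C1_on (C r) (C r) h" "h ` C r \<subseteq> UU t" "!!b. b \<in> UU t ==> h (b + eta (t, b)) = b"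
  using smooth_left_inverse[of t] by (auto simp: eta)
 have inj: "inj_on (\<lambda>b. b + eta (t, b)) (UU t)" by (rule inj_on_inverseI[where g = h]) (rule h(3))
 have img: "(\<lambda>b. b + eta (t, b)) ` UU t \<subseteq> C r" using perturbed_orbit(3) by (auto simp: eta UU_C intro!: C_add)
 show ?thesis
  unfolding C1_diffeo_onto_image_def
 proof (intro conjI img inj eta_C1 ballI)
  fix y assume y: "y \<in> (\<lambda>b. b + eta (t, b)) ` UU t"
  show "\<exists>V k. openin (top_of_set (C r)) V \<and> y \<in> V \<and> k ` V \<subseteq> UU t \<and> C1_on (C r) V k \<and>
    (\<forall>z\<in>V \<inter> (\<lambda>b. b + eta (t, b)) ` UU t. k z = the_inv_into (UU t) (\<lambda>b. b + eta (t, b)) z)"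
  proof (intro exI conjI ballI)
   show "y \<in> C r" using y img by blast
   fix z assume "z \<in> C r \<inter> (\<lambda>b. b + eta (t, b)) ` UU t"
   then obtain b where b: "b \<in> UU t" "z = b + eta (t, b)" by blast
   show "h z = the_inv_into (UU t) (\<lambda>b. b + eta (t, b)) z"
    unfolding b(2) h(3)[OF b(1)] by (rule the_inv_into_f_f[OF inj b(1), symmetric])
  qed (use h in auto)
 qed
qed

theorem smooth_conjugacy:
 "(\<exists>!\<eta>. \<eta> \<in> M r P \<and> conjugates r \<zeta> g P (\<lambda>t b. b + \<eta> (t, b))) \<and>
  (\<forall>\<eta>. \<eta> \<in> M r P \<and> conjugates r \<zeta> g P (\<lambda>t b. b + \<eta> (t, b)) -->
   (\<forall>t. C1_diffeo_onto_image (C r) (U r P t) (\<lambda>b. b + \<eta> (t, b))))"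
proof (intro conjI ex1I[of _ eta] eta_M eta_conjugates allI impI)
 fix \<eta> t assume "\<eta> \<in> M r P \<and> conjugates r \<zeta> g P (\<lambda>t b. b + \<eta> (t, b))"
 then show "\<eta> = eta" using eta_unique by blast
 then show "C1_diffeo_onto_image (C r) (U r P t) (\<lambda>b. b + \<eta> (t, b))" using eta_diffeo by simp
qed

end

section \<open>Growth rates in logarithmic time\<close>

text \<open>
  The operator norm controls the change of the operator uniformly on bounded sets, and the operator at the limit
  is continuous.
\<close>

lemma continuous_on_operator_path:
 fixes f' :: "'a::real_normed_vector => 'b::real_normed_vector => 'c::real_normed_vector" and p :: "real => 'a"
 assumes bl: "!!x. x \<in> V ==> bounded_linear (f' x)"
  and op: "!!x e. x \<in> V ==> 0 < e ==> \<exists>d>0. \<forall>y\<in>V. dist y x < d --> (\<forall>v\<in>E. norm (f' y v - f' x v) \<le> e * norm v)"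
  and p: "continuous_on UNIV p" "!!t. p t \<in> V" and q: "continuous_on UNIV q" "!!t. q t \<in> E"
 shows "continuous_on UNIV (\<lambda>t. f' (p t) (q t))"
proof -
 have "isCont (\<lambda>t. f' (p t) (q t)) t0" for t0
 proof -
  have pt: "(p \<longlongrightarrow> p t0) (at t0)" and qt: "(q \<longlongrightarrow> q t0) (at t0)"
   using p(1) q(1) by (auto simp: continuous_on_def)
  interpret bounded_linear "f' (p t0)" by (rule bl[OF p(2)])
  have 1: "((\<lambda>t. f' (p t0) (q t)) \<longlongrightarrow> f' (p t0) (q t0)) (at t0)" by (rule tendsto[OF qt])
  have 2: "((\<lambda>t. f' (p t) (q t) - f' (p t0) (q t)) \<longlongrightarrow> 0) (at t0)"
  proof (rule tendstoI)
   fix e :: real assume e: "0 < e"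
   define B where "B = norm (q t0) + 1"
   have B: "0 < B" by (simp add: B_def add_nonneg_pos)
   obtain d where d: "0 < d" "!!y v. y \<in> V ==> dist y (p t0) < d ==> v \<in> E ==> norm (f' y v - f' (p t0) v) \<le> e / (2 * B) * norm v"
    using op[OF p(2)[of t0], of "e / (2 * B)"] e B by auto
   have "\<forall>\<^sub>F t in at t0. dist (p t) (p t0) < d" by (rule tendstoD[OF pt d(1)])
   moreover have "\<forall>\<^sub>F t in at t0. dist (q t) (q t0) < 1" by (rule tendstoD[OF qt]) simp
   ultimately show "\<forall>\<^sub>F t in at t0. dist (f' (p t) (q t) - f' (p t0) (q t)) 0 < e"
   proof eventually_elim
    case (elim t)
    have "norm (q t) \<le> norm (q t0) + norm (q t - q t0)" using norm_triangle_ineq[of "q t0" "q t - q t0"] by simp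
    then have "norm (q t) < B" using elim(2) by (simp add: B_def dist_norm)
    then have "e / (2 * B) * norm (q t) \<le> e / (2 * B) * B" using e B by (intro mult_left_mono) auto
    also have "\<dots> < e" using e B by simp
    finally show ?case using d(2)[OF p(2) elim(1) q(2), of t] by simp
   qed
  qed
  show ?thesis unfolding isCont_def using tendsto_add[OF 1 2] by simp
 qed
 then show ?thesis by (simp add: continuous_on_eq_continuous_at)
qed

text \<open>
  Both sides are the derivative of \<open>s \<mapsto> g t (\<phi> + s *\<^sub>R v)\<close> at \<open>0\<close>.
\<close>

lemma partial_derivative_eq:
 fixes g :: "real => 'a::real_normed_vector => 'b::real_normed_vector"
 assumes f': "((\<lambda>(t, \<phi>). g t \<phi>) has_derivative f') (at (t, \<phi>) within UNIV \<times> E)"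
  and d: "(g t has_derivative d) (at \<phi> within E)" and E: "subspace E" "\<phi> \<in> E" "v \<in> E"
 shows "f' (0, v) = d v"
proof -
 have line: "\<phi> + s *\<^sub>R v \<in> E" for s by (intro subspace_add[OF E(1)] subspace_scale[OF E(1)] E(2,3))
 have c1: "((\<lambda>s. \<phi> + s *\<^sub>R v) has_derivative (\<lambda>u. u *\<^sub>R v)) (at (0::real))" by (auto intro!: derivative_eq_intros)
 have c2: "((\<lambda>s. (t, \<phi> + s *\<^sub>R v)) has_derivative (\<lambda>u. (0, u *\<^sub>R v))) (at (0::real))"
  by (intro has_derivative_Pair has_derivative_const c1)
 have "((\<lambda>s. g t (\<phi> + s *\<^sub>R v)) has_derivative (\<lambda>u. d (u *\<^sub>R v))) (at 0)"
  by (rule has_derivative_in_compose[OF c1]) (rule has_derivative_subset[where s = E], use d line in auto)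
 moreover have "((\<lambda>s. (\<lambda>(t, \<phi>). g t \<phi>) (t, \<phi> + s *\<^sub>R v)) has_derivative (\<lambda>u. f' (0, u *\<^sub>R v))) (at 0)"
  by (rule has_derivative_in_compose[OF c2]) (rule has_derivative_subset[where s = "UNIV \<times> E"], use f' line in auto)
 ultimately have "(\<lambda>u::real. d (u *\<^sub>R v)) = (\<lambda>u. f' (0, u *\<^sub>R v))"
  by (intro has_derivative_unique) auto
 from fun_cong[OF this, of 1] show ?thesis by simp
qed

locale growth_function =
 fixes \<mu> :: "real => real"
 assumes differentiable_growth: "differentiable_growth_rate \<mu>"
begin

definition x :: "real => real" where "x t = ln (\<mu> t)"
definition x' :: "real => real" where "x' t = deriv \<mu> t / \<mu> t"

lemma rate: "strict_mono \<mu>" "0 < \<mu> t" "\<mu> 0 = 1" "filterlim \<mu> at_top at_top" "(\<mu> \<longlongrightarrow> 0) at_bot" "\<mu> differentiable (at t)"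
 using differentiable_growth by (auto simp: differentiable_growth_rate_def growth_rate_def)

lemma deriv: "(\<mu> has_real_derivative deriv \<mu> t) (at t)"
 using rate(6) by (simp add: DERIV_deriv_iff_real_differentiable)

lemma x_deriv: "(x has_real_derivative x' t) (at t)"
 unfolding x_def[abs_def] x'_def using rate(2)[of t] by (auto intro!: derivative_eq_intros deriv)

lemma x_cont: "continuous_on UNIV x"
 using x_deriv by (meson DERIV_isCont continuous_at_imp_continuous_on)

lemma x'_nonneg: "0 \<le> x' t"
proof -
 have "mono_on UNIV \<mu>" using rate(1) by (simp add: strict_mono_mono)
 then have "0 \<le> deriv \<mu> t"
  by (rule mono_on_imp_deriv_nonneg) (use deriv in auto)
 then show ?thesis using rate(2)[of t] by (simp add: x'_def)
qed

lemma x_top: "filterlim x at_top at_top"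
 unfolding x_def[abs_def] by (rule filterlim_compose[OF ln_at_top rate(4)])

lemma x_bot: "filterlim x at_bot at_bot"
 unfolding x_def[abs_def]
 by (rule filterlim_compose[OF ln_at_0], unfold filterlim_at) (simp add: rate(2,5) less_imp_neq[OF rate(2), symmetric])

lemma abs_x: "sgn t * x t = \<bar>x t\<bar>"
proof -
 have "0 < x t" if "0 < t" using strict_monoD[OF rate(1) that] by (simp add: x_def rate(3))
 moreover have "x t < 0" if "t < 0" using strict_monoD[OF rate(1) that] rate(2)[of t] by (simp add: x_def rate(3))
 moreover have "x 0 = 0" by (simp add: x_def rate(3))
 ultimately show ?thesis by (cases t "0::real" rule: linorder_cases) auto
qed

lemma powr_eq:
 "(\<mu> t / \<mu> s) powr c = exp (c * (x t - x s))" "\<mu> s powr (sgn s * c) = exp (c * \<bar>x s\<bar>)"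
 "\<mu> s powr (- sgn s * c) = exp (- (c * \<bar>x s\<bar>))"
 "deriv \<mu> t * \<mu> t powr (- sgn t * c - 1) = x' t * exp (- (c * \<bar>x t\<bar>))"
 "deriv \<mu> t * \<mu> t powr (- sgn t * c - 2 * sgn t * d - 1) = x' t * exp (- (c * \<bar>x t\<bar>)) * exp (- (2 * d * \<bar>x t\<bar>))"
proof -
 note pos = rate(2)
 show "(\<mu> t / \<mu> s) powr c = exp (c * (x t - x s))" using pos[of t] pos[of s] by (simp add: powr_def x_def ln_div)
 have 2: "\<mu> s powr (sgn s * c) = exp (c * \<bar>x s\<bar>)" for s c
  unfolding abs_x[symmetric] using pos[of s] by (simp add: powr_def x_def mult_ac)
 show "\<mu> s powr (sgn s * c) = exp (c * \<bar>x s\<bar>)" by (rule 2)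
 have 3: "\<mu> s powr (- sgn s * c) = exp (- (c * \<bar>x s\<bar>))" for s c using 2[of s "- c"] by simp
 show "\<mu> s powr (- sgn s * c) = exp (- (c * \<bar>x s\<bar>))" by (rule 3)
 have m: "\<mu> t powr (u - 1) = \<mu> t powr u / \<mu> t" for u using pos[of t] by (simp add: powr_diff)
 show "deriv \<mu> t * \<mu> t powr (- sgn t * c - 1) = x' t * exp (- (c * \<bar>x t\<bar>))"
  unfolding m 3 by (simp add: x'_def)
 have "\<mu> t powr (- sgn t * c - 2 * sgn t * d) = \<mu> t powr (- sgn t * c) * \<mu> t powr (- sgn t * (2 * d))"
  unfolding powr_add[symmetric] by (simp add: algebra_simps)
 then show "deriv \<mu> t * \<mu> t powr (- sgn t * c - 2 * sgn t * d - 1) = x' t * exp (- (c * \<bar>x t\<bar>)) * exp (- (2 * d * \<bar>x t\<bar>))"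
  unfolding m 3 by (simp add: x'_def)
qed

lemma x'_absolutely_integrable: "x' absolutely_integrable_on {u..v}"
proof (cases "u \<le> v")
 case True
 have "(x' has_integral x v - x u) {u..v}"
  by (rule fundamental_theorem_of_calculus[OF True])
   (use x_deriv in \<open>simp add: has_real_derivative_iff_has_vector_derivative has_vector_derivative_at_within\<close>)
 then show ?thesis using x'_nonneg by (intro nonnegative_absolutely_integrable_1) auto
qed simp

lemma rate_density: "0 \<le> \<delta> ==> rate (\<lambda>t. \<delta> * (x' t * exp (- (c * \<bar>x t\<bar>)) * exp (- (d * \<bar>x t\<bar>))))"
proof
 assume \<delta>: "0 \<le> \<delta>"
 show "0 \<le> \<delta> * (x' t * exp (- (c * \<bar>x t\<bar>)) * exp (- (d * \<bar>x t\<bar>)))" for t using \<delta> x'_nonneg by simp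
 fix u v
 define h where "h t = \<delta> * exp (- (c * \<bar>x t\<bar>)) * exp (- (d * \<bar>x t\<bar>))" for t
 have hc: "continuous_on {u..v} h" unfolding h_def by (intro continuous_intros continuous_on_subset[OF x_cont]) auto
 have "h \<in> borel_measurable (lebesgue_on {u..v})" by (rule continuous_imp_measurable_on_sets_lebesgue[OF hc]) simp
 moreover have "bounded (h ` {u..v})" by (rule compact_imp_bounded[OF compact_continuous_image[OF hc]]) simp
 ultimately have "(\<lambda>t. h t * x' t) absolutely_integrable_on {u..v}"
  by (intro absolutely_integrable_bounded_measurable_product_real x'_absolutely_integrable) auto
 then show "(\<lambda>t. \<delta> * (x' t * exp (- (c * \<bar>x t\<bar>)) * exp (- (d * \<bar>x t\<bar>)))) absolutely_integrable_on {u..v}"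
  by (simp add: h_def mult_ac)
qed

end

section \<open>The conjugacy theorem\<close>

theorem theorem2:
  fixes r q :: real
    and \<zeta> :: "real \<Rightarrow> real \<Rightarrow> real ^ ('n::finite) ^ 'n"
    and g :: "real \<Rightarrow> 'n phase \<Rightarrow> real ^ 'n"
    and D2g :: "real \<Rightarrow> 'n phase \<Rightarrow> 'n phase \<Rightarrow> real ^ 'n"
    and \<mu> :: "real \<Rightarrow> real"
    and P :: "real \<Rightarrow> 'n phase \<Rightarrow> 'n phase"
    and K \<alpha> \<beta> \<theta> \<nu> N Kt a \<epsilon> D \<delta> \<gamma> \<Lambda> \<xi> :: real
  assumes "q > 0" and "r > 0"
    and "delay_kernel r \<zeta>"
    and "K \<ge> 1" "\<alpha> > 0" "\<beta> > 0" "\<theta> \<ge> 0" "\<nu> \<ge> 0" "\<alpha> > \<theta>" "\<beta> > \<nu>"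
    and "differentiable_growth_rate \<mu>"
    and "N > 1" "\<forall>s. \<mu> (s + r) / \<mu> s \<le> N"
    and "dichotomy r \<zeta> \<mu> P UNIV K \<alpha> \<beta> \<theta> \<nu>"
    and "Kt \<ge> 1" "a \<ge> 0" "\<epsilon> > 0"
    and "bounded_growth r \<zeta> \<mu> Kt a \<epsilon>"
    and "\<theta> \<ge> \<epsilon> + \<nu>" "\<alpha> > \<theta> + \<epsilon>" "\<beta> > \<nu> + \<epsilon>"
    and "D > 0" "extended_bounds r \<zeta> \<mu> P D \<alpha> \<beta> \<theta> \<nu> \<epsilon>"
    and "continuous_on (UNIV \<times> C r) (\<lambda>(t, \<phi>). g t \<phi>)"
    and "\<forall>t. g t 0 = 0"
    and "\<forall>t. \<exists>B. B-lipschitz_on (C r) (g t)"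
    and "C1_on (UNIV \<times> C r) (UNIV \<times> C r) (\<lambda>(t, \<phi>). g t \<phi>)"
    and "\<forall>t. \<forall>\<phi>\<in>C r. (g t has_derivative D2g t \<phi>) (at \<phi> within C r)"
    and "\<forall>t. \<forall>v\<in>C r. D2g t 0 v = 0"
    and "\<delta> > 0" "\<gamma> > max \<theta> \<nu>" "\<Lambda> > 0"
    and "max (\<nu> + \<epsilon>) (\<bar>a - \<beta>\<bar> + \<epsilon>) < \<xi>" "\<xi> < (\<alpha> + \<beta>) / 2"
    and "\<forall>t. \<forall>\<phi>\<in>C r. \<forall>\<psi>\<in>C r.
           norm (g t \<phi> - g t \<psi>) \<le>
             \<delta> * min 1 (norm (\<phi> - \<psi>) * \<mu> t powr (- sgn t * (\<xi> + \<epsilon>))) *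
             deriv \<mu> t * \<mu> t powr (- sgn t * (\<gamma> + \<epsilon>) - 1)"
    and "\<forall>t. \<forall>\<phi>\<in>C r. \<forall>\<psi>\<in>C r. \<forall>v\<in>C r.
           norm (D2g t \<phi> v - D2g t \<psi> v) \<le>
             \<Lambda> * min 1 (norm (\<phi> - \<psi>) * \<mu> t powr (- sgn t * (\<xi> + \<epsilon>))) *
             deriv \<mu> t * \<mu> t powr (- sgn t * (\<gamma> + \<epsilon>) - 2 * sgn t * \<xi> - 1) * norm v"
    and "\<delta> \<le> q * \<alpha> * \<beta> / (D * (\<alpha> + \<beta>) * (1 + q)\<^sup>2)"
    and "\<Lambda> \<le> q\<^sup>2 * (\<alpha> + \<beta> - 2 * \<xi>) * ((\<xi> - \<epsilon>)\<^sup>2 - (a - \<beta>)\<^sup>2) /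
              (D * (D * ((\<xi> - \<epsilon>)\<^sup>2 - (a - \<beta>)\<^sup>2) + 4 * \<xi> * Kt * (\<alpha> + \<beta> - 2 * \<xi>)) * (1 + q) ^ 3)"
  shows "(\<exists>!\<eta>. \<eta> \<in> M r P \<and> conjugates r \<zeta> g P (\<lambda>t b. b + \<eta> (t, b))) \<and>
         (\<forall>\<eta>. \<eta> \<in> M r P \<and> conjugates r \<zeta> g P (\<lambda>t b. b + \<eta> (t, b)) \<longrightarrow>
            (\<forall>t. C1_diffeo_onto_image (C r) (U r P t) (\<lambda>b. b + \<eta> (t, b))))"
proof -
 note hyps = assms
 have \<delta>: "0 < \<delta>" and \<Lambda>: "0 < \<Lambda>" and D: "0 < D" and \<epsilon>: "0 < \<epsilon>" by fact+
 interpret kernel r \<zeta> by (unfold_locales; fact)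
 interpret growth_function \<mu> by (unfold_locales; fact)
 have \<xi>: "0 < \<xi>" "a < \<beta> + \<xi> + \<epsilon>" "\<epsilon> < \<xi>"
  using \<open>max (\<nu> + \<epsilon>) (\<bar>a - \<beta>\<bar> + \<epsilon>) < \<xi>\<close> \<epsilon> by auto
 have \<gamma>: "\<theta> \<le> \<gamma>" "\<nu> \<le> \<gamma>" using assms by auto
 define d where "d t = x' t * exp (- ((\<gamma> + \<epsilon>) * \<bar>x t\<bar>))" for t
 define e where "e t = exp (- ((\<xi> + \<epsilon>) * \<bar>x t\<bar>))" for t
 have d0: "0 \<le> d t" for t using x'_nonneg by (simp add: d_def)
 have e: "0 < e t" "e t \<le> 1" for t using \<xi> \<epsilon> by (auto simp: e_def)
 have glip: "norm (g t \<phi> - g t \<psi>) \<le> \<delta> * min 1 (norm (\<phi> - \<psi>) * e t) * d t" if "\<phi> \<in> C r" "\<psi> \<in> C r" for t \<phi> \<psi>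
 proof -
  have "norm (g t \<phi> - g t \<psi>) \<le> \<delta> * min 1 (norm (\<phi> - \<psi>) * \<mu> t powr (- sgn t * (\<xi> + \<epsilon>))) *
    deriv \<mu> t * \<mu> t powr (- sgn t * (\<gamma> + \<epsilon>) - 1)" using hyps that by blast
  then show ?thesis unfolding mult.assoc powr_eq d_def e_def .
 qed
 have Dlip: "norm (D2g t \<phi> v - D2g t \<psi> v) \<le> \<Lambda> * min 1 (norm (\<phi> - \<psi>) * e t) * (d t * exp (- (2 * \<xi> * \<bar>x t\<bar>))) * norm v"
  if "\<phi> \<in> C r" "\<psi> \<in> C r" "v \<in> C r" for t \<phi> \<psi> v
 proof -
  have "norm (D2g t \<phi> v - D2g t \<psi> v) \<le> \<Lambda> * min 1 (norm (\<phi> - \<psi>) * \<mu> t powr (- sgn t * (\<xi> + \<epsilon>))) *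
    deriv \<mu> t * \<mu> t powr (- sgn t * (\<gamma> + \<epsilon>) - 2 * sgn t * \<xi> - 1) * norm v" using hyps that by blast
  also have "\<dots> = \<Lambda> * min 1 (norm (\<phi> - \<psi>) * \<mu> t powr (- sgn t * (\<xi> + \<epsilon>))) *
    (deriv \<mu> t * \<mu> t powr (- sgn t * (\<gamma> + \<epsilon>) - 2 * sgn t * \<xi> - 1)) * norm v" by (simp only: mult.assoc)
  finally show ?thesis unfolding powr_eq d_def e_def .
 qed
 have g_lip: "norm (g t \<phi> - g t \<psi>) \<le> \<delta> * (d t * e t) * norm (\<phi> - \<psi>)" if "\<phi> \<in> C r" "\<psi> \<in> C r" for t \<phi> \<psi>
 proof -
  have "\<delta> * min 1 (norm (\<phi> - \<psi>) * e t) * d t \<le> \<delta> * (norm (\<phi> - \<psi>) * e t) * d t"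
   using \<delta> d0 by (intro mult_right_mono mult_left_mono) auto
  then show ?thesis using glip[OF that, of t] by (simp add: mult_ac)
 qed
 have g_bounded: "norm (g t \<phi>) \<le> \<delta> * d t" if "\<phi> \<in> C r" for t \<phi>
 proof -
  have "\<delta> * min 1 (norm (\<phi> - 0) * e t) * d t \<le> \<delta> * 1 * d t"
   using \<delta> d0 by (intro mult_right_mono mult_left_mono) auto
  moreover have "g t 0 = 0" using hyps by blast
  ultimately show ?thesis using glip[OF that C_0, of t] by simp
 qed
 have D2g_lip: "norm (D2g t \<phi> v - D2g t \<psi> v) \<le> \<Lambda> / \<delta> * (\<delta> * (d t * e t)) * (min 1 (norm (\<phi> - \<psi>)) * norm v)"
  if "\<phi> \<in> C r" "\<psi> \<in> C r" "v \<in> C r" for t \<phi> \<psi> v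
 proof -
  have "(\<xi> + \<epsilon>) * \<bar>x t\<bar> \<le> 2 * \<xi> * \<bar>x t\<bar>" using \<xi> by (intro mult_right_mono) auto
  then have "exp (- (2 * \<xi> * \<bar>x t\<bar>)) \<le> e t" by (simp add: e_def)
  moreover have "min 1 (norm (\<phi> - \<psi>) * e t) \<le> min 1 (norm (\<phi> - \<psi>))"
   using e[of t] mult_left_mono[OF e(2)[of t] norm_ge_zero[of "\<phi> - \<psi>"]] by (intro min.mono) auto
  moreover have "0 \<le> min 1 (norm (\<phi> - \<psi>) * e t)" using e[of t] by simp
  ultimately have "\<Lambda> * min 1 (norm (\<phi> - \<psi>) * e t) * (d t * exp (- (2 * \<xi> * \<bar>x t\<bar>))) * norm v \<le>
    \<Lambda> * min 1 (norm (\<phi> - \<psi>)) * (d t * e t) * norm v"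
   using \<Lambda> d0[of t] e(1)[of t] by (intro mult_mono mult_nonneg_nonneg) auto
  also have "\<dots> = \<Lambda> / \<delta> * (\<delta> * (d t * e t)) * (min 1 (norm (\<phi> - \<psi>)) * norm v)" using \<delta> by (simp add: mult_ac)
  finally show ?thesis using Dlip[OF that, of t] by linarith
 qed
 have D2g_deriv: "(g t has_derivative D2g t \<phi>) (at \<phi> within C r)" if "\<phi> \<in> C r" for t \<phi> using hyps that by blast
 have D2g_path: "continuous_on UNIV (\<lambda>t. D2g t (y t) (w t))"
  if "continuous_on UNIV y" "!!t. y t \<in> C r" "continuous_on UNIV w" "!!t. w t \<in> C r" for y w
 proof -
  obtain f' where f': "!!z. z \<in> UNIV \<times> C r ==> ((\<lambda>(t, \<phi>). g t \<phi>) has_derivative f' z) (at z within UNIV \<times> C r)"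
   and f'c: "!!z e. z \<in> UNIV \<times> C r ==> 0 < e ==> \<exists>d>0. \<forall>y\<in>UNIV \<times> C r. dist y z < d -->
    (\<forall>v\<in>UNIV \<times> C r. norm (f' y v - f' z v) \<le> e * norm v)"
   using \<open>C1_on (UNIV \<times> C r) (UNIV \<times> C r) (\<lambda>(t, \<phi>). g t \<phi>)\<close> unfolding C1_on_def by blast
  have "continuous_on UNIV (\<lambda>t. f' (t, y t) (0, w t))"
   by (rule continuous_on_operator_path[OF has_derivative_bounded_linear[OF f'] f'c]) (use that in \<open>auto intro!: continuous_intros\<close>)
  moreover have "f' (t, y t) (0, w t) = D2g t (y t) (w t)" for t
   by (rule partial_derivative_eq[OF f' D2g_deriv subspace_C]) (use that in auto)
  ultimately show ?thesis by simp
 qed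
 \<comment> \<open>\<open>q / (1 + q)\<^sup>2\<close> is largest at \<open>q = 1\<close>.\<close>
 have small: "D * \<delta> / \<alpha> + D * \<delta> / \<beta> \<le> 1 / 4"
 proof -
  have p: "0 < \<alpha>" "0 < \<beta>" "0 < q" by fact+
  have "D * \<delta> / \<alpha> + D * \<delta> / \<beta> = D * (\<alpha> + \<beta>) / (\<alpha> * \<beta>) * \<delta>" using p by (simp add: field_simps)
  also have "\<dots> \<le> D * (\<alpha> + \<beta>) / (\<alpha> * \<beta>) * (q * \<alpha> * \<beta> / (D * (\<alpha> + \<beta>) * (1 + q)\<^sup>2))"
   using p D hyps by (intro mult_left_mono) auto
  also have "\<dots> = q / (1 + q)\<^sup>2"
  proof -
   have "D * (\<alpha> + \<beta>) \<noteq> 0" "\<alpha> * \<beta> \<noteq> 0" "(1 + q)\<^sup>2 \<noteq> 0" using p D by auto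
   then show ?thesis by (simp add: divide_simps)
  qed
  also have "\<dots> \<le> 1 / 4"
   using p sum_squares_bound[of 1 q] by (simp add: divide_simps power2_eq_square algebra_simps)
  finally show ?thesis .
 qed
 note dichotomy = \<open>dichotomy r \<zeta> \<mu> P UNIV K \<alpha> \<beta> \<theta> \<nu>\<close>[unfolded dichotomy_def powr_eq mult.assoc mult_exp_exp]
  and growth = \<open>bounded_growth r \<zeta> \<mu> Kt a \<epsilon>\<close>[unfolded bounded_growth_def powr_eq mult.assoc mult_exp_exp]
  and extended = \<open>extended_bounds r \<zeta> \<mu> P D \<alpha> \<beta> \<theta> \<nu> \<epsilon>\<close>[unfolded extended_bounds_def powr_eq mult.assoc mult_exp_exp]
 have P: "bounded_projection_on (C r) (P s)" for s
  using \<open>dichotomy r \<zeta> \<mu> P UNIV K \<alpha> \<beta> \<theta> \<nu>\<close> by (simp add: dichotomy_def)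
 have P_T: "T r \<zeta> t s (P s \<phi>) = P t (T r \<zeta> t s \<phi>)" if "s \<le> t" "\<phi> \<in> C r" for s t \<phi>
  using \<open>dichotomy r \<zeta> \<mu> P UNIV K \<alpha> \<beta> \<theta> \<nu>\<close> that by (simp add: dichotomy_def)
 have T_bij: "bij_betw (T r \<zeta> t s) (U r P s) (U r P t)" if "s \<le> t" for s t using dichotomy that by blast
 have P_bound: "norm (T r \<zeta> t s (P s \<phi>)) \<le> K * exp (- \<alpha> * (x t - x s) + \<theta> * \<bar>x s\<bar>) * norm \<phi>"
  if "s \<le> t" "\<phi> \<in> C r" for s t \<phi> using dichotomy that unfolding mult.assoc by blast
 have Q_bound: "norm (Tbar r \<zeta> P t s (Q P s \<phi>)) \<le> K * exp (\<beta> * (x t - x s) + \<nu> * \<bar>x s\<bar>) * norm \<phi>"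
  if "t \<le> s" "\<phi> \<in> C r" for s t \<phi> using dichotomy that unfolding mult.assoc by blast
 have T0_growth: "sup_norm r (T0 r \<zeta> t s \<psi>) \<le> Kt * exp (a * (x t - x s) + \<epsilon> * \<bar>x s\<bar>) * sup_norm r \<psi>"
  if "s \<le> t" "\<psi> \<in> C0 r" for s t \<psi> using growth that unfolding mult.assoc by blast
 have P0_bound: "sup_norm r (T0 r \<zeta> t s (P0 r \<zeta> P s v)) \<le> D * exp (- \<alpha> * (x t - x s) + (\<theta> + \<epsilon>) * \<bar>x s\<bar>) * norm v"
  if "s \<le> t" for s t v using extended that unfolding mult.assoc by blast
 have Q0_bound: "norm (Tbar r \<zeta> P t s (Q0 r \<zeta> P s v)) \<le> D * exp (\<beta> * (x t - x s) + (\<nu> + \<epsilon>) * \<bar>x s\<bar>) * norm v"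
  if "t \<le> s" for s t v using extended that unfolding mult.assoc by blast
 have rate: "rate (\<lambda>t. \<delta> * (x' t * exp (- ((\<gamma> + \<epsilon>) * \<bar>x t\<bar>)) * exp (- ((\<xi> + \<epsilon>) * \<bar>x t\<bar>))))"
  using \<delta> by (intro rate_density) simp
 have signs: "0 \<le> K" "0 \<le> Kt" "0 \<le> D" "0 < Kt" "0 \<le> \<Lambda> / \<delta>" using hyps \<delta> \<Lambda> by auto
 have zero: "g t 0 = 0" for t using hyps by blast
 have "smooth_dichotomy r \<zeta> x P K \<alpha> \<beta> \<theta> \<nu> Kt a \<epsilon> D g \<delta> x' \<gamma> \<xi> D2g (\<Lambda> / \<delta>)"
  by (intro smooth_dichotomy.intro exponential_dichotomy.intro exponential_dichotomy_axioms.intro perturbation.intro perturbation_axioms.intro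
     smooth_dichotomy_axioms.intro kernel_axioms x_cont x_top x_bot signs P rate zero small \<xi>(1,2) \<gamma> x_deriv x'_nonneg
     hyps(5,6,7,8,9,10,16,24) \<delta> D \<epsilon>;
    rule P_T T_bij P_bound Q_bound T0_growth P0_bound Q0_bound g_lip[unfolded d_def e_def] g_bounded[unfolded d_def]
     D2g_deriv D2g_path D2g_lip[unfolded d_def e_def]; assumption)
 then show ?thesis by (rule smooth_dichotomy.smooth_conjugacy)
qed

end
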